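(* Let $k$ be a field, $H$ a Hopf algebra over $k$, and $\alpha:H\times H\to k$ a normalized convolution-invertible two-cocycle. Suppose that the algebra $S(t_H)_{\Theta}$ is integral over its subalgebra $\mathcal B_H^{\alpha}$. Then for any field extension $K$ of $k$ and any algebra morphism $\lambda:\mathcal B_H^{\alpha}\to K$, the $H$-comodule $K$-algebra $K\otimes_{\mathcal B_H^{\alpha}}\mathcal A_H^{\alpha}$ (with $K$ regarded as a $\mathcal B_H^{\alpha}$-module via $\lambda$) is a $K$-form of ${}^{\alpha}H$.
   Context: All algebras are associative unital $k$-algebras; unadorned tensor products are over $k$; $\Delta$, $\varepsilon$ are the comultiplication and counit of $H$, with Sweedler notation. An $H$-comodule algebra is an algebra with a right $H$-coaction that is an algebra morphism; morphisms are algebra morphisms that are comodule maps. Cocycles and twisted algebras: let $R$ be a commutative algebra. A two-cocycle with values in $R$ is a bilinear map $\alpha:H\times H\to R$ with $\sum\alpha(x_{(1)},y_{(1)})\alpha(x_{(2)}y_{(2)},z)=\sum\alpha(y_{(1)},z_{(1)})\alpha(x,y_{(2)}z_{(2)})$ for all $x,y,z\in H$; it is normalized if $\alpha(x,1)=\alpha(1,x)=\varepsilon(x)1$, and convolution-invertible if it is invertible for convolution in $\operatorname{Hom}(H\otimes H,R)$. The twisted algebra $R\otimes{}^{\alpha}H$ is $R\otimes H$ with product $(b\otimes x)\cdot_\alpha(c\otimes y)=\sum bc\,\alpha(x_{(1)},y_{(1)})\otimes x_{(2)}y_{(2)}$ and coaction $\mathrm{id}_R\otimes\Delta$. For $R=k$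 write ${}^{\alpha}H=k\otimes{}^{\alpha}H$. Forms: for a field extension $K$ of $k$ and a normalized convolution-invertible two-cocycle $\beta:H\times H\to K$, the $H$-comodule algebra $K\otimes{}^{\beta}H$ is a $K$-form of ${}^{\alpha}H$ if there are a field extension $L$ of $K$ and an $L$-linear isomorphism of $H$-comodule algebras $L\otimes_K(K\otimes{}^{\beta}H)\cong L\otimes_k{}^{\alpha}H$. An $H$-comodule $K$-algebra that is $K$-linearly isomorphic, as an $H$-comodule algebra, to such a $K\otimes{}^{\beta}H$ is also called a $K$-form. Universal cocycle: let $t_H$ be a copy of the vector space $H$ (with identity map $h\mapsto t_h$), $S(t_H)$ its symmetric algebra, $K_H$ the field of fractions of $S(t_H)$. Let $t^{-1}:H\to K_H$, $h\mapsto t_h^{-1}$, be the unique linear map with $\sum t_{h_{(1)}}t^{-1}_{h_{(2)}}=\sum t^{-1}_{h_{(1)}}t_{h_{(2)}}=\varepsilon(h)1$ for all $h\in H$ (it exists; note that $t^{-1}_h$ is in general not $1/t_h$). $S(t_H)_{\Theta}$ is the subalgebra of $K_H$ generated by all $t_h$ and $t_h^{-1}$, $h\in H$. Define $\sigma:H\times H\to S(t_H)_{\Theta}$ by $\sigma(x,y)=\sum t_{x_{(1)}}t_{y_{(1)}}\alpha(x_{(2)},y_{(2)})t^{-1}_{x_{(3)}y_{(3)}}$; it is a convolution-invertible two-cocycle with convolution inverse $\sigma^{-1}(x,y)=\sum t_{x_{(1)}y_{(1)}}\alpha^{-1}(x_{(2)},y_{(2)})t^{-1}_{x_{(3)}}t^{-1}_{y_{(3)}}$.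 $\mathcal B_H^{\alpha}\subset S(t_H)_{\Theta}$ is the subalgebra generated by all values of $\sigma$ and $\sigma^{-1}$, and $\mathcal A_H^{\alpha}=\mathcal B_H^{\alpha}\otimes{}^{\sigma}H$ is the corresponding twisted algebra, which is associative with unit $t_1^{-1}\otimes1$ and is an $H$-comodule $\mathcal B_H^{\alpha}$-algebra. *)

theory Defs
  imports "HOL-Algebra.Algebra"
begin

section \<open>Modules, algebras and tensor products\<close>

definition assoc_algebra :: "('r, 'm) ring_scheme \<Rightarrow> ('r, 'a, 'n) module_scheme \<Rightarrow> bool" where
  "assoc_algebra R A \<longleftrightarrow>
     Module.module R A \<and> ring A \<and>
     (\<forall>r\<in>carrier R. \<forall>x\<in>carrier A. \<forall>y\<in>carrier A.
        (r \<odot>\<^bsub>A\<^esub> x) \<otimes>\<^bsub>A\<^esub> y = r \<odot>\<^bsub>A\<^esub> (x \<otimes>\<^bsub>A\<^esub> y) \<and>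
        x \<otimes>\<^bsub>A\<^esub> (r \<odot>\<^bsub>A\<^esub> y) = r \<odot>\<^bsub>A\<^esub> (x \<otimes>\<^bsub>A\<^esub> y))"

definition linear_map ::
    "('r, 'm) ring_scheme \<Rightarrow> ('r, 'a, 'n) module_scheme \<Rightarrow> ('r, 'b, 'o) module_scheme
      \<Rightarrow> ('a \<Rightarrow> 'b) \<Rightarrow> bool" where
  "linear_map R M N f \<longleftrightarrow>
     f \<in> carrier M \<rightarrow> carrier N \<and>
     (\<forall>x\<in>carrier M. \<forall>y\<in>carrier M. f (x \<oplus>\<^bsub>M\<^esub> y) = f x \<oplus>\<^bsub>N\<^esub> f y) \<and>
     (\<forall>r\<in>carrier R. \<forall>x\<in>carrier M. f (r \<odot>\<^bsub>M\<^esub> x) = r \<odot>\<^bsub>N\<^esub> f x)"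

definition bilinear_map ::
    "('r, 'm) ring_scheme \<Rightarrow> ('r, 'a, 'n) module_scheme \<Rightarrow> ('r, 'b, 'o) module_scheme
      \<Rightarrow> ('r, 'c, 'p) module_scheme \<Rightarrow> ('a \<Rightarrow> 'b \<Rightarrow> 'c) \<Rightarrow> bool" where
  "bilinear_map R M N P f \<longleftrightarrow>
     (\<forall>x\<in>carrier M. linear_map R N P (f x)) \<and>
     (\<forall>y\<in>carrier N. linear_map R M P (\<lambda>x. f x y))"

text \<open>A ring \<open>S\<close> as an algebra over \<open>R\<close> along a ring morphism \<open>\<phi>: R \<rightarrow> S\<close>, and
  restriction of scalars of an \<open>S\<close>-algebra along \<open>\<phi>\<close>.\<close>

definition as_algebra :: "('r \<Rightarrow> 's) \<Rightarrow> ('s, 'm) ring_scheme \<Rightarrow> ('r, 's) module" where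
  "as_algebra \<phi> S =
     \<lparr>carrier = carrier S, monoid.mult = monoid.mult S, one = one S,
      ring.zero = ring.zero S, add = add S,
      smult = (\<lambda>r x. \<phi> r \<otimes>\<^bsub>S\<^esub> x)\<rparr>"

definition restrict_scalars ::
    "('r \<Rightarrow> 's) \<Rightarrow> ('s, 'a, 'm) module_scheme \<Rightarrow> ('r, 'a) module" where
  "restrict_scalars \<phi> M =
     \<lparr>carrier = carrier M, monoid.mult = monoid.mult M, one = one M,
      ring.zero = ring.zero M, add = add M,
      smult = (\<lambda>r x. \<phi> r \<odot>\<^bsub>M\<^esub> x)\<rparr>"

text \<open>
  The tensor product \<open>M \<otimes>\<^sub>R N\<close> is the free abelian group on \<open>M \<times> N\<close> modulo the
  subgroup generated by the usual relations; its elements are therefore cosets of formal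
  integer combinations of pairs.  A map out of such a quotient is given by its values
  \<open>f a b\<close> on generators and is evaluated on an arbitrary representative of the coset; it is
  only ever used for \<open>f\<close> respecting the relations, when the representative is immaterial.
\<close>

type_synonym ('a, 'b) tensor = "(('a \<times> 'b) \<Rightarrow>\<^sub>0 int) set"

definition lift2 ::
    "('g, 'm) ring_scheme \<Rightarrow> ('a \<Rightarrow> 'b \<Rightarrow> 'g) \<Rightarrow> ('a, 'b) tensor \<Rightarrow> 'g" where
  "lift2 G f T =
     (let p = (SOME p. p \<in> T)
      in finsum G (\<lambda>(a, b). [Poly_Mapping.lookup p (a, b)] \<cdot>\<^bsub>G\<^esub> f a b) (Poly_Mapping.keys p))"

definition tensor_rels ::
    "('r, 'x) ring_scheme \<Rightarrow> ('r, 'a, 'm) module_scheme \<Rightarrow> ('r, 'b, 'n) module_scheme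
      \<Rightarrow> ('a, 'b) tensor" where
  "tensor_rels R M N =
     generate (free_Abelian_group (carrier M \<times> carrier N))
       ({frag_of (x \<oplus>\<^bsub>M\<^esub> x', y) - frag_of (x, y) - frag_of (x', y) | x x' y.
           x \<in> carrier M \<and> x' \<in> carrier M \<and> y \<in> carrier N} \<union>
        {frag_of (x, y \<oplus>\<^bsub>N\<^esub> y') - frag_of (x, y) - frag_of (x, y') | x y y'.
           x \<in> carrier M \<and> y \<in> carrier N \<and> y' \<in> carrier N} \<union>
        {frag_of (r \<odot>\<^bsub>M\<^esub> x, y) - frag_of (x, r \<odot>\<^bsub>N\<^esub> y) | r x y.
           r \<in> carrier R \<and> x \<in> carrier M \<and> y \<in> carrier N})"

definition pure_tensor ::
    "('r, 'x) ring_scheme \<Rightarrow> ('r, 'a, 'm) module_scheme \<Rightarrow> ('r, 'b, 'n) module_scheme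
      \<Rightarrow> 'a \<Rightarrow> 'b \<Rightarrow> ('a, 'b) tensor" where
  "pure_tensor R M N x y =
     tensor_rels R M N #>\<^bsub>free_Abelian_group (carrier M \<times> carrier N)\<^esub> frag_of (x, y)"

text \<open>Auxiliary: only the additive structure of this record is meaningful.\<close>

definition tensor_space ::
    "('r, 'x) ring_scheme \<Rightarrow> ('r, 'a, 'm) module_scheme \<Rightarrow> ('r, 'b, 'n) module_scheme
      \<Rightarrow> ('a, 'b) tensor ring" where
  "tensor_space R M N =
     (let Q = free_Abelian_group (carrier M \<times> carrier N) Mod tensor_rels R M N
      in \<lparr>carrier = carrier Q, monoid.mult = undefined, one = undefined,
          ring.zero = one Q, add = monoid.mult Q\<rparr>)"

text \<open>The tensor product of two \<open>R\<close>-algebras, with \<open>(a \<otimes> b)(a' \<otimes> b') = aa' \<otimes> bb'\<close>.\<close>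

definition tensor ::
    "('r, 'x) ring_scheme \<Rightarrow> ('r, 'a, 'm) module_scheme \<Rightarrow> ('r, 'b, 'n) module_scheme
      \<Rightarrow> ('r, ('a, 'b) tensor) module" where
  "tensor R M N =
     (let V = tensor_space R M N; \<tau> = pure_tensor R M N
      in \<lparr>carrier = carrier V,
          monoid.mult = (\<lambda>T U. lift2 V (\<lambda>a b. lift2 V (\<lambda>a' b'. \<tau> (a \<otimes>\<^bsub>M\<^esub> a') (b \<otimes>\<^bsub>N\<^esub> b')) U) T),
          one = \<tau> \<one>\<^bsub>M\<^esub> \<one>\<^bsub>N\<^esub>,
          ring.zero = ring.zero V,
          add = add V,
          smult = (\<lambda>r. lift2 V (\<lambda>a b. \<tau> (r \<odot>\<^bsub>M\<^esub> a) b))\<rparr>)"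


section \<open>Hopf algebras\<close>

record ('k, 'h) hopf = "('k, 'h) module" +
  comult :: "'h \<Rightarrow> ('h, 'h) tensor"
  counit :: "'h \<Rightarrow> 'k"

text \<open>Sweedler sums: \<open>sweedler G H f x\<close> is \<open>\<Sum> f(x\<^sub>(\<^sub>1\<^sub>), x\<^sub>(\<^sub>2\<^sub>))\<close>, and similarly
  for three factors, the values of \<open>f\<close> being added in \<open>G\<close>.\<close>

definition sweedler ::
    "('g, 'm) ring_scheme \<Rightarrow> ('k, 'h, 'n) hopf_scheme \<Rightarrow> ('h \<Rightarrow> 'h \<Rightarrow> 'g) \<Rightarrow> 'h \<Rightarrow> 'g" where
  "sweedler G H f x = lift2 G f (comult H x)"

definition sweedler3 ::
    "('g, 'm) ring_scheme \<Rightarrow> ('k, 'h, 'n) hopf_scheme \<Rightarrow> ('h \<Rightarrow> 'h \<Rightarrow> 'h \<Rightarrow> 'g) \<Rightarrow> 'h \<Rightarrow> 'g" where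
  "sweedler3 G H f x = sweedler G H (\<lambda>x1 x'. sweedler G H (\<lambda>x2 x3. f x1 x2 x3) x') x"

definition hopf_algebra :: "('k, 'm) ring_scheme \<Rightarrow> ('k, 'h, 'n) hopf_scheme \<Rightarrow> bool" where
  "hopf_algebra k H \<longleftrightarrow>
     (let HH = tensor k H H; HHH = tensor k HH H in
     assoc_algebra k H \<and>
     linear_map k H HH (comult H) \<and> comult H \<in> ring_hom H HH \<and>
     linear_map k H (as_algebra id k) (counit H) \<and> counit H \<in> ring_hom H k \<and>
     (\<forall>x\<in>carrier H.
        sweedler HHH H (\<lambda>x1 x2. pure_tensor k HH H (comult H x1) x2) x =
        sweedler3 HHH H (\<lambda>x1 x2 x3. pure_tensor k HH H (pure_tensor k H H x1 x2) x3) x) \<and>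
     (\<forall>x\<in>carrier H.
        sweedler H H (\<lambda>x1 x2. counit H x1 \<odot>\<^bsub>H\<^esub> x2) x = x \<and>
        sweedler H H (\<lambda>x1 x2. counit H x2 \<odot>\<^bsub>H\<^esub> x1) x = x) \<and>
     (\<exists>S. linear_map k H H S \<and>
        (\<forall>x\<in>carrier H.
           sweedler H H (\<lambda>x1 x2. S x1 \<otimes>\<^bsub>H\<^esub> x2) x = counit H x \<odot>\<^bsub>H\<^esub> \<one>\<^bsub>H\<^esub> \<and>
           sweedler H H (\<lambda>x1 x2. x1 \<otimes>\<^bsub>H\<^esub> S x2) x = counit H x \<odot>\<^bsub>H\<^esub> \<one>\<^bsub>H\<^esub>)))"


section \<open>Two-cocycles, twisted algebras and comodule algebras\<close>

text \<open>Throughout, a commutative \<open>k\<close>-algebra is a commutative ring \<open>R\<close> together with its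
  structure morphism \<open>\<rho>: k \<rightarrow> R\<close>.\<close>

definition two_cocycle ::
    "('k, 'm) ring_scheme \<Rightarrow> ('k, 'h, 'n) hopf_scheme \<Rightarrow> ('r, 'o) ring_scheme \<Rightarrow> ('k \<Rightarrow> 'r)
      \<Rightarrow> ('h \<Rightarrow> 'h \<Rightarrow> 'r) \<Rightarrow> bool" where
  "two_cocycle k H R \<rho> \<alpha> \<longleftrightarrow>
     bilinear_map k H H (as_algebra \<rho> R) \<alpha> \<and>
     (\<forall>x\<in>carrier H. \<forall>y\<in>carrier H. \<forall>z\<in>carrier H.
        sweedler R H (\<lambda>x1 x2. sweedler R H (\<lambda>y1 y2.
          \<alpha> x1 y1 \<otimes>\<^bsub>R\<^esub> \<alpha> (x2 \<otimes>\<^bsub>H\<^esub> y2) z) y) x =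
        sweedler R H (\<lambda>y1 y2. sweedler R H (\<lambda>z1 z2.
          \<alpha> y1 z1 \<otimes>\<^bsub>R\<^esub> \<alpha> x (y2 \<otimes>\<^bsub>H\<^esub> z2)) z) y)"

definition normalized ::
    "('k, 'h, 'n) hopf_scheme \<Rightarrow> ('k \<Rightarrow> 'r) \<Rightarrow> ('h \<Rightarrow> 'h \<Rightarrow> 'r) \<Rightarrow> bool" where
  "normalized H \<rho> \<alpha> \<longleftrightarrow>
     (\<forall>x\<in>carrier H. \<alpha> x \<one>\<^bsub>H\<^esub> = \<rho> (counit H x) \<and> \<alpha> \<one>\<^bsub>H\<^esub> x = \<rho> (counit H x))"

definition conv2 ::
    "('k, 'h, 'n) hopf_scheme \<Rightarrow> ('r, 'o) ring_scheme
      \<Rightarrow> ('h \<Rightarrow> 'h \<Rightarrow> 'r) \<Rightarrow> ('h \<Rightarrow> 'h \<Rightarrow> 'r) \<Rightarrow> 'h \<Rightarrow> 'h \<Rightarrow> 'r" where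
  "conv2 H R \<alpha> \<beta> x y =
     sweedler R H (\<lambda>x1 x2. sweedler R H (\<lambda>y1 y2. \<alpha> x1 y1 \<otimes>\<^bsub>R\<^esub> \<beta> x2 y2) y) x"

definition conv2_inverse ::
    "('k, 'm) ring_scheme \<Rightarrow> ('k, 'h, 'n) hopf_scheme \<Rightarrow> ('r, 'o) ring_scheme \<Rightarrow> ('k \<Rightarrow> 'r)
      \<Rightarrow> ('h \<Rightarrow> 'h \<Rightarrow> 'r) \<Rightarrow> ('h \<Rightarrow> 'h \<Rightarrow> 'r) \<Rightarrow> bool" where
  "conv2_inverse k H R \<rho> \<alpha> \<alpha>' \<longleftrightarrow>
     bilinear_map k H H (as_algebra \<rho> R) \<alpha>' \<and>
     (\<forall>x\<in>carrier H. \<forall>y\<in>carrier H.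
        conv2 H R \<alpha> \<alpha>' x y = \<rho> (counit H x \<otimes>\<^bsub>k\<^esub> counit H y) \<and>
        conv2 H R \<alpha>' \<alpha> x y = \<rho> (counit H x \<otimes>\<^bsub>k\<^esub> counit H y))"

definition normalized_invertible_cocycle ::
    "('k, 'm) ring_scheme \<Rightarrow> ('k, 'h, 'n) hopf_scheme \<Rightarrow> ('r, 'o) ring_scheme \<Rightarrow> ('k \<Rightarrow> 'r)
      \<Rightarrow> ('h \<Rightarrow> 'h \<Rightarrow> 'r) \<Rightarrow> bool" where
  "normalized_invertible_cocycle k H R \<rho> \<alpha> \<longleftrightarrow>
     two_cocycle k H R \<rho> \<alpha> \<and> normalized H \<rho> \<alpha> \<and> (\<exists>\<alpha>'. conv2_inverse k H R \<rho> \<alpha> \<alpha>')"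

text \<open>A comodule algebra \<open>A\<close> over \<open>R\<close> carries a coaction \<open>A \<rightarrow> A \<otimes>\<^sub>k H\<close>; its codomain
  is formed with the \<open>k\<close>-module structure obtained from \<open>\<rho>: k \<rightarrow> R\<close>.\<close>

record ('r, 'a, 'h) comod_alg = "('r, 'a) module" +
  coact :: "'a \<Rightarrow> ('a, 'h) tensor"

definition with_coact ::
    "('r, 'a) module \<Rightarrow> ('a \<Rightarrow> ('a, 'h) tensor) \<Rightarrow> ('r, 'a, 'h) comod_alg" where
  "with_coact A \<delta> =
     \<lparr>carrier = carrier A, monoid.mult = monoid.mult A, one = one A,
      ring.zero = ring.zero A, add = add A,
      smult = smult A, coact = \<delta>\<rparr>"

text \<open>The twisted algebra \<open>R \<otimes>\<^sup>\<alpha> H\<close>.  Its unit is \<open>u \<otimes> 1\<close>, where \<open>u = \<alpha>(1,1)\<^sup>-\<^sup>1\<close>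
  has to be supplied: \<open>u = 1\<close> if \<open>\<alpha>\<close> is normalized, \<open>u = t\<^sub>1\<^sup>-\<^sup>1\<close> for the universal
  cocycle.\<close>

definition twisted_algebra ::
    "('k, 'm) ring_scheme \<Rightarrow> ('k, 'h, 'n) hopf_scheme \<Rightarrow> ('r, 'o) ring_scheme \<Rightarrow> ('k \<Rightarrow> 'r)
      \<Rightarrow> ('h \<Rightarrow> 'h \<Rightarrow> 'r) \<Rightarrow> 'r \<Rightarrow> ('r, ('r, 'h) tensor) module" where
  "twisted_algebra k H R \<rho> \<alpha> u =
     (let V = tensor k (as_algebra \<rho> R) H; \<tau> = pure_tensor k (as_algebra \<rho> R) H
      in \<lparr>carrier = carrier V,
          monoid.mult = (\<lambda>T U. lift2 V (\<lambda>b x. lift2 V (\<lambda>c y.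
            sweedler V H (\<lambda>x1 x2. sweedler V H (\<lambda>y1 y2.
              \<tau> (b \<otimes>\<^bsub>R\<^esub> c \<otimes>\<^bsub>R\<^esub> \<alpha> x1 y1) (x2 \<otimes>\<^bsub>H\<^esub> y2)) y) x) U) T),
          one = \<tau> u \<one>\<^bsub>H\<^esub>,
          ring.zero = ring.zero V,
          add = add V,
          smult = (\<lambda>r. lift2 V (\<lambda>b x. \<tau> (r \<otimes>\<^bsub>R\<^esub> b) x))\<rparr>)"

definition twisted ::
    "('k, 'm) ring_scheme \<Rightarrow> ('k, 'h, 'n) hopf_scheme \<Rightarrow> ('r, 'o) ring_scheme \<Rightarrow> ('k \<Rightarrow> 'r)
      \<Rightarrow> ('h \<Rightarrow> 'h \<Rightarrow> 'r) \<Rightarrow> 'r \<Rightarrow> ('r, ('r, 'h) tensor, 'h) comod_alg" where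
  "twisted k H R \<rho> \<alpha> u =
     (let A = twisted_algebra k H R \<rho> \<alpha> u; Ak = restrict_scalars \<rho> A; W = tensor k Ak H
      in with_coact A
           (lift2 W (\<lambda>b x. sweedler W H (\<lambda>x1 x2.
              pure_tensor k Ak H (pure_tensor k (as_algebra \<rho> R) H b x1) x2) x)))"

text \<open>The comodule algebra \<open>S \<otimes>\<^sub>R A\<close> over \<open>S\<close>, for a comodule algebra \<open>A\<close> over \<open>R\<close>
  and a morphism \<open>\<phi>: R \<rightarrow> S\<close>.\<close>

definition base_change_algebra ::
    "('r, 'm) ring_scheme \<Rightarrow> ('s, 'n) ring_scheme \<Rightarrow> ('r \<Rightarrow> 's) \<Rightarrow> ('r, 'a, 'o) module_scheme
      \<Rightarrow> ('s, ('s, 'a) tensor) module" where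
  "base_change_algebra R S \<phi> A =
     (let V = tensor R (as_algebra \<phi> S) A
      in \<lparr>carrier = carrier V, monoid.mult = monoid.mult V, one = one V,
          ring.zero = ring.zero V, add = add V,
          smult = (\<lambda>s. lift2 V (\<lambda>s' a. pure_tensor R (as_algebra \<phi> S) A (s \<otimes>\<^bsub>S\<^esub> s') a))\<rparr>)"

definition base_change ::
    "('k, 'l) ring_scheme \<Rightarrow> ('k, 'h, 'n) hopf_scheme \<Rightarrow> ('r, 'm) ring_scheme \<Rightarrow> ('k \<Rightarrow> 'r)
      \<Rightarrow> ('s, 'o) ring_scheme \<Rightarrow> ('r \<Rightarrow> 's) \<Rightarrow> ('r, 'a, 'h) comod_alg
      \<Rightarrow> ('s, ('s, 'a) tensor, 'h) comod_alg" where
  "base_change k H R \<rho> S \<phi> A =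
     (let C = base_change_algebra R S \<phi> A; Ck = restrict_scalars (\<phi> \<circ> \<rho>) C; W = tensor k Ck H
      in with_coact C
           (lift2 W (\<lambda>s a. lift2 W (\<lambda>a0 a1.
              pure_tensor k Ck H (pure_tensor R (as_algebra \<phi> S) A s a0) a1) (coact A a))))"

text \<open>\<open>R\<close>-linear isomorphisms of comodule algebras; the last clause is
  \<open>\<delta>\<^sub>B \<circ> f = (f \<otimes> id) \<circ> \<delta>\<^sub>A\<close>.\<close>

definition comod_alg_iso ::
    "('k, 'm) ring_scheme \<Rightarrow> ('k, 'h, 'n) hopf_scheme \<Rightarrow> ('r, 'o) ring_scheme \<Rightarrow> ('k \<Rightarrow> 'r)
      \<Rightarrow> ('r, 'a, 'h) comod_alg \<Rightarrow> ('r, 'b, 'h) comod_alg \<Rightarrow> ('a \<Rightarrow> 'b) \<Rightarrow> bool" where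
  "comod_alg_iso k H R \<rho> A B f \<longleftrightarrow>
     (let Bk = restrict_scalars \<rho> B in
     f \<in> ring_iso A B \<and> linear_map R A B f \<and>
     (\<forall>a\<in>carrier A.
        coact B (f a) =
        lift2 (tensor k Bk H) (\<lambda>a0 a1. pure_tensor k Bk H (f a0) a1) (coact A a)))"


section \<open>Forms\<close>

definition field_extension ::
    "('k, 'm) ring_scheme \<Rightarrow> ('l, 'n) ring_scheme \<Rightarrow> ('k \<Rightarrow> 'l) \<Rightarrow> bool" where
  "field_extension k L i \<longleftrightarrow> field k \<and> field L \<and> i \<in> ring_hom k L"

text \<open>
  The extension \<open>L\<close> is sought among fields with elements in the type \<open>('l \<times> 'h) list\<close>.
  This is no restriction: given an isomorphism over some \<open>L\<close>, the matrix coefficients of it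
  and of its inverse, with respect to a basis of \<open>H\<close>, generate a subfield of \<open>L\<close> over
  \<open>K\<close> over which the isomorphism is already defined, and this subfield has cardinality
  at most \<open>max(|K|, |H|, \<aleph>\<^sub>0)\<close>.
\<close>

definition twisted_is_form ::
    "('k, 'm) ring_scheme \<Rightarrow> ('k, 'h, 'n) hopf_scheme \<Rightarrow> ('h \<Rightarrow> 'h \<Rightarrow> 'k)
      \<Rightarrow> ('l, 'o) ring_scheme \<Rightarrow> ('k \<Rightarrow> 'l) \<Rightarrow> ('h \<Rightarrow> 'h \<Rightarrow> 'l) \<Rightarrow> bool" where
  "twisted_is_form k H \<alpha> K i \<beta> \<longleftrightarrow>
     (\<exists>(L :: ('l \<times> 'h) list ring) j f.
        field_extension K L j \<and>
        comod_alg_iso k H L (j \<circ> i)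
          (base_change k H K i L j (twisted k H K i \<beta> \<one>\<^bsub>K\<^esub>))
          (base_change k H k id L (j \<circ> i) (twisted k H k id \<alpha> \<one>\<^bsub>k\<^esub>))
          f)"

definition is_form ::
    "('k, 'm) ring_scheme \<Rightarrow> ('k, 'h, 'n) hopf_scheme \<Rightarrow> ('h \<Rightarrow> 'h \<Rightarrow> 'k)
      \<Rightarrow> ('l, 'o) ring_scheme \<Rightarrow> ('k \<Rightarrow> 'l) \<Rightarrow> ('l, 'a, 'h) comod_alg \<Rightarrow> bool" where
  "is_form k H \<alpha> K i A \<longleftrightarrow>
     (\<exists>\<beta> f. normalized_invertible_cocycle k H K i \<beta> \<and>
        twisted_is_form k H \<alpha> K i \<beta> \<and>
        comod_alg_iso k H K i A (twisted k H K i \<beta> \<one>\<^bsub>K\<^esub>) f)"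


section \<open>The symmetric algebra and its field of fractions\<close>

text \<open>
  The symmetric algebra of a \<open>k\<close>-module \<open>V\<close>: the abelian group generated by symbols
  \<open>(c, {#v\<^sub>1, \<dots>, v\<^sub>n#})\<close>, standing for the monomial \<open>c v\<^sub>1 \<dots> v\<^sub>n\<close>, modulo additivity in
  \<open>c\<close> and multilinearity in \<open>v\<^sub>1, \<dots>, v\<^sub>n\<close>.
\<close>

definition sym_gens :: "('k, 'm) ring_scheme \<Rightarrow> ('k, 'v, 'n) module_scheme \<Rightarrow> ('k \<times> 'v multiset) set" where
  "sym_gens k V = carrier k \<times> {M. set_mset M \<subseteq> carrier V}"

definition sym_rels ::
    "('k, 'm) ring_scheme \<Rightarrow> ('k, 'v, 'n) module_scheme \<Rightarrow> ('k, 'v multiset) tensor" where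
  "sym_rels k V =
     generate (free_Abelian_group (sym_gens k V))
       ({frag_of (c \<oplus>\<^bsub>k\<^esub> d, M) - frag_of (c, M) - frag_of (d, M) | c d M.
           c \<in> carrier k \<and> d \<in> carrier k \<and> set_mset M \<subseteq> carrier V} \<union>
        {frag_of (c, add_mset (v \<oplus>\<^bsub>V\<^esub> w) M) - frag_of (c, add_mset v M) - frag_of (c, add_mset w M)
           | c v w M.
           c \<in> carrier k \<and> v \<in> carrier V \<and> w \<in> carrier V \<and> set_mset M \<subseteq> carrier V} \<union>
        {frag_of (c, add_mset (d \<odot>\<^bsub>V\<^esub> v) M) - frag_of (c \<otimes>\<^bsub>k\<^esub> d, add_mset v M) | c d v M.
           c \<in> carrier k \<and> d \<in> carrier k \<and> v \<in> carrier V \<and> set_mset M \<subseteq> carrier V})"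

definition sym_monomial ::
    "('k, 'm) ring_scheme \<Rightarrow> ('k, 'v, 'n) module_scheme \<Rightarrow> 'k \<Rightarrow> 'v multiset
      \<Rightarrow> ('k, 'v multiset) tensor" where
  "sym_monomial k V c M = sym_rels k V #>\<^bsub>free_Abelian_group (sym_gens k V)\<^esub> frag_of (c, M)"

text \<open>Auxiliary: only the additive structure of this record is meaningful.\<close>

definition sym_space ::
    "('k, 'm) ring_scheme \<Rightarrow> ('k, 'v, 'n) module_scheme \<Rightarrow> ('k, 'v multiset) tensor ring" where
  "sym_space k V =
     (let Q = free_Abelian_group (sym_gens k V) Mod sym_rels k V
      in \<lparr>carrier = carrier Q, monoid.mult = undefined, one = undefined,
          ring.zero = one Q, add = monoid.mult Q\<rparr>)"

definition symmetric_algebra ::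
    "('k, 'm) ring_scheme \<Rightarrow> ('k, 'v, 'n) module_scheme
      \<Rightarrow> ('k, ('k, 'v multiset) tensor) module" where
  "symmetric_algebra k V =
     (let W = sym_space k V; \<mu> = sym_monomial k V
      in \<lparr>carrier = carrier W,
          monoid.mult = (\<lambda>T U. lift2 W (\<lambda>c M. lift2 W (\<lambda>d N. \<mu> (c \<otimes>\<^bsub>k\<^esub> d) (M + N)) U) T),
          one = \<mu> \<one>\<^bsub>k\<^esub> {#},
          ring.zero = ring.zero W,
          add = add W,
          smult = (\<lambda>r. lift2 W (\<lambda>c M. \<mu> (r \<otimes>\<^bsub>k\<^esub> c) M))\<rparr>)"

definition fraction_field :: "('s, 'm) ring_scheme \<Rightarrow> ('q, 'n) ring_scheme \<Rightarrow> ('s \<Rightarrow> 'q) \<Rightarrow> bool" where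
  "fraction_field S Q \<iota> \<longleftrightarrow>
     field Q \<and> \<iota> \<in> ring_hom S Q \<and> inj_on \<iota> (carrier S) \<and>
     (\<forall>q\<in>carrier Q. \<exists>a\<in>carrier S. \<exists>b\<in>carrier S.
        b \<noteq> \<zero>\<^bsub>S\<^esub> \<and> q = \<iota> a \<otimes>\<^bsub>Q\<^esub> inv\<^bsub>Q\<^esub> (\<iota> b))"


section \<open>The universal cocycle\<close>

text \<open>Here \<open>Q\<close> is \<open>K\<^sub>H\<close> and \<open>\<iota>\<close> is the inclusion of \<open>S(t\<^sub>H)\<close> into it.  The map
  \<open>h \<mapsto> t\<^sub>h\<^sup>-\<^sup>1\<close> is a convolution inverse, hence determined on \<open>carrier H\<close> by
  \<open>is_t_inverse\<close> below.\<close>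

definition t_scalar ::
    "('k, 'm) ring_scheme \<Rightarrow> ('k, 'h, 'n) hopf_scheme \<Rightarrow> (('k, 'h multiset) tensor \<Rightarrow> 'q) \<Rightarrow> 'k \<Rightarrow> 'q" where
  "t_scalar k H \<iota> c = \<iota> (sym_monomial k H c {#})"

definition t_gen ::
    "('k, 'm) ring_scheme \<Rightarrow> ('k, 'h, 'n) hopf_scheme \<Rightarrow> (('k, 'h multiset) tensor \<Rightarrow> 'q) \<Rightarrow> 'h \<Rightarrow> 'q" where
  "t_gen k H \<iota> h = \<iota> (sym_monomial k H \<one>\<^bsub>k\<^esub> {#h#})"

definition is_t_inverse ::
    "('k, 'm) ring_scheme \<Rightarrow> ('k, 'h, 'n) hopf_scheme \<Rightarrow> ('q, 'o) ring_scheme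
      \<Rightarrow> (('k, 'h multiset) tensor \<Rightarrow> 'q) \<Rightarrow> ('h \<Rightarrow> 'q) \<Rightarrow> bool" where
  "is_t_inverse k H Q \<iota> tinv \<longleftrightarrow>
     linear_map k H (as_algebra (t_scalar k H \<iota>) Q) tinv \<and>
     (\<forall>h\<in>carrier H.
        sweedler Q H (\<lambda>h1 h2. t_gen k H \<iota> h1 \<otimes>\<^bsub>Q\<^esub> tinv h2) h = t_scalar k H \<iota> (counit H h) \<and>
        sweedler Q H (\<lambda>h1 h2. tinv h1 \<otimes>\<^bsub>Q\<^esub> t_gen k H \<iota> h2) h = t_scalar k H \<iota> (counit H h))"

definition generated_subalgebra ::
    "('k, 'm) ring_scheme \<Rightarrow> ('q, 'o) ring_scheme \<Rightarrow> ('k \<Rightarrow> 'q) \<Rightarrow> 'q set \<Rightarrow> 'q set" where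
  "generated_subalgebra k Q s Y = generate_ring Q (s ` carrier k \<union> Y)"

definition S_Theta ::
    "('k, 'm) ring_scheme \<Rightarrow> ('k, 'h, 'n) hopf_scheme \<Rightarrow> ('q, 'o) ring_scheme
      \<Rightarrow> (('k, 'h multiset) tensor \<Rightarrow> 'q) \<Rightarrow> ('h \<Rightarrow> 'q) \<Rightarrow> 'q set" where
  "S_Theta k H Q \<iota> tinv =
     generated_subalgebra k Q (t_scalar k H \<iota>) (t_gen k H \<iota> ` carrier H \<union> tinv ` carrier H)"

definition sigma ::
    "('k, 'm) ring_scheme \<Rightarrow> ('k, 'h, 'n) hopf_scheme \<Rightarrow> ('h \<Rightarrow> 'h \<Rightarrow> 'k) \<Rightarrow> ('q, 'o) ring_scheme
      \<Rightarrow> (('k, 'h multiset) tensor \<Rightarrow> 'q) \<Rightarrow> ('h \<Rightarrow> 'q) \<Rightarrow> 'h \<Rightarrow> 'h \<Rightarrow> 'q" where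
  "sigma k H \<alpha> Q \<iota> tinv x y =
     sweedler3 Q H (\<lambda>x1 x2 x3. sweedler3 Q H (\<lambda>y1 y2 y3.
       t_gen k H \<iota> x1 \<otimes>\<^bsub>Q\<^esub> t_gen k H \<iota> y1 \<otimes>\<^bsub>Q\<^esub> t_scalar k H \<iota> (\<alpha> x2 y2)
         \<otimes>\<^bsub>Q\<^esub> tinv (x3 \<otimes>\<^bsub>H\<^esub> y3)) y) x"

text \<open>The argument \<open>\<alpha>'\<close> stands for the convolution inverse of \<open>\<alpha>\<close>.\<close>

definition sigma_inv ::
    "('k, 'm) ring_scheme \<Rightarrow> ('k, 'h, 'n) hopf_scheme \<Rightarrow> ('h \<Rightarrow> 'h \<Rightarrow> 'k) \<Rightarrow> ('q, 'o) ring_scheme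
      \<Rightarrow> (('k, 'h multiset) tensor \<Rightarrow> 'q) \<Rightarrow> ('h \<Rightarrow> 'q) \<Rightarrow> 'h \<Rightarrow> 'h \<Rightarrow> 'q" where
  "sigma_inv k H \<alpha>' Q \<iota> tinv x y =
     sweedler3 Q H (\<lambda>x1 x2 x3. sweedler3 Q H (\<lambda>y1 y2 y3.
       t_gen k H \<iota> (x1 \<otimes>\<^bsub>H\<^esub> y1) \<otimes>\<^bsub>Q\<^esub> t_scalar k H \<iota> (\<alpha>' x2 y2)
         \<otimes>\<^bsub>Q\<^esub> tinv x3 \<otimes>\<^bsub>Q\<^esub> tinv y3) y) x"

definition B_alg ::
    "('k, 'm) ring_scheme \<Rightarrow> ('k, 'h, 'n) hopf_scheme \<Rightarrow> ('h \<Rightarrow> 'h \<Rightarrow> 'k) \<Rightarrow> ('q, 'o) ring_scheme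
      \<Rightarrow> (('k, 'h multiset) tensor \<Rightarrow> 'q) \<Rightarrow> ('h \<Rightarrow> 'q) \<Rightarrow> ('q, 'o) ring_scheme" where
  "B_alg k H \<alpha> Q \<iota> tinv =
     (let \<alpha>' = (SOME \<alpha>'. conv2_inverse k H k id \<alpha> \<alpha>')
      in Q\<lparr>carrier := generated_subalgebra k Q (t_scalar k H \<iota>)
             ((\<lambda>(x, y). sigma k H \<alpha> Q \<iota> tinv x y) ` (carrier H \<times> carrier H) \<union>
              (\<lambda>(x, y). sigma_inv k H \<alpha>' Q \<iota> tinv x y) ` (carrier H \<times> carrier H))\<rparr>)"

definition A_alg ::
    "('k, 'm) ring_scheme \<Rightarrow> ('k, 'h, 'n) hopf_scheme \<Rightarrow> ('h \<Rightarrow> 'h \<Rightarrow> 'k) \<Rightarrow> ('q, 'o) ring_scheme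
      \<Rightarrow> (('k, 'h multiset) tensor \<Rightarrow> 'q) \<Rightarrow> ('h \<Rightarrow> 'q) \<Rightarrow> ('q, ('q, 'h) tensor, 'h) comod_alg" where
  "A_alg k H \<alpha> Q \<iota> tinv =
     twisted k H (B_alg k H \<alpha> Q \<iota> tinv) (t_scalar k H \<iota>) (sigma k H \<alpha> Q \<iota> tinv) (tinv \<one>\<^bsub>H\<^esub>)"

text \<open>Polynomials are coefficient lists with the leading coefficient first.\<close>

definition integral_over :: "('q, 'm) ring_scheme \<Rightarrow> 'q set \<Rightarrow> 'q \<Rightarrow> bool" where
  "integral_over Q B x \<longleftrightarrow>
     (\<exists>p. polynomial\<^bsub>Q\<^esub> B p \<and> p \<noteq> [] \<and> lead_coeff p = \<one>\<^bsub>Q\<^esub> \<and> ring.eval Q p x = \<zero>\<^bsub>Q\<^esub>)"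

end

theory Submission
  imports Defs
begin

text \<open>The map \<open>t\<close> is convolution-invertible with values in \<open>S(t\<^sub>H)\<^sub>\<Theta>\<close> and gauges \<open>\<alpha>\<close>
  into \<open>\<sigma>\<close>.  Integrality allows us to extend \<open>\<lambda>\<close> from \<open>B\<close> to \<open>S(t\<^sub>H)\<^sub>\<Theta>\<close>, with values
  in an algebraic closure \<open>L\<close> of \<open>K\<close>.  Over \<open>L\<close> the cocycle \<open>\<lambda> \<circ> \<sigma>\<close> is therefore the gauge
  transform of \<open>\<alpha>\<close> by \<open>\<lambda> \<circ> t\<close>, and gauge equivalent cocycles have isomorphic twisted
  algebras.  Since \<open>t\<^sub>1 = \<sigma>(1, 1)\<close> and its inverse lie in \<open>B\<close>, rescaling by \<open>\<lambda>(t\<^sub>1)\<^sup>-\<^sup>1\<close>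
  makes \<open>\<lambda> \<circ> \<sigma>\<close> a normalized cocycle over \<open>K\<close>.\<close>

section \<open>Additive maps out of quotients of free abelian groups\<close>

text \<open>The relation between \<sigma> and \<alpha> that does the work is
  \<open>\<sigma>(x1, y1) t(x2 y2) = t(x1) t(y1) \<alpha>(x2, y2)\<close>: it makes the linear map
  \<open>b \<otimes> x \<mapsto> \<Sum> b t(x1) \<otimes> x2\<close> multiplicative. Such identities
  are noncommutative, as H need not be cocommutative: factors may change places only if they depend
  on different arguments. They are therefore verified as words in the algebras of linear maps from
  H, H \<otimes> H and H \<otimes> H \<otimes> H to L, where Sweedler sums disappear. Two mismatches
  of domains shape the rest. The formula for \<sigma> holds in \<open>K\<^sub>H\<close>, but the
  extension of \<open>lam\<close> lives on a subring; the formula is pulled back to that subring and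
  then pushed to L. The normalized cocycle has values in K, but its gauge exists only over L; its
  properties are proved over L and pulled back along the injection of K. Integrality acts through
  lying-over: without it, a relation satisfied by an element of \<open>K\<^sub>H\<close> could
  reduce to a nonzero constant over K, and no root could be assigned to that element.\<close>

definition fragsum :: "('g, 'm) ring_scheme \<Rightarrow> ('x \<Rightarrow> 'g) \<Rightarrow> ('x \<Rightarrow>\<^sub>0 int) \<Rightarrow> 'g" where
  "fragsum G f p =
     finsum G (\<lambda>x. add_pow G (Poly_Mapping.lookup p x) (f x)) (Poly_Mapping.keys p)"

text \<open>Additivity determines a map on a tensor product from its values on pure tensors, since
  these generate it as a group; scalars enter only through the relators.\<close>

definition addhom :: "('a, 'm) ring_scheme \<Rightarrow> ('b, 'n) ring_scheme \<Rightarrow> ('a \<Rightarrow> 'b) \<Rightarrow> bool" where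
  "addhom G G' h \<longleftrightarrow>
     h \<in> carrier G \<rightarrow> carrier G' \<and>
     (\<forall>x\<in>carrier G. \<forall>y\<in>carrier G. h (x \<oplus>\<^bsub>G\<^esub> y) = h x \<oplus>\<^bsub>G'\<^esub> h y)"

text \<open>Records built on one abelian group occur with different products, scalar actions and
  coactions. Whatever is evaluated through \<open>lift2\<close> sees only the additive part, and
  this relation moves results between such records.\<close>

definition same_add :: "('a, 'm) ring_scheme \<Rightarrow> ('a, 'n) ring_scheme \<Rightarrow> bool" where
  "same_add G G' \<longleftrightarrow> carrier G = carrier G' \<and> add G = add G' \<and> \<zero>\<^bsub>G\<^esub> = \<zero>\<^bsub>G'\<^esub>"

lemma abelian_group_cong_add:
  assumes "same_add G G'" shows "abelian_group G \<longleftrightarrow> abelian_group G'"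
  using assms
  by (simp add: same_add_def abelian_group_def abelian_group_axioms_def abelian_monoid_def
      comm_group_def comm_monoid_def comm_monoid_axioms_def group_def group_axioms_def
      monoid_def Units_def)

lemma fragsum_cong_add:
  assumes "same_add G G'" shows "fragsum G = fragsum G'"
proof -
  have "add_pow G n x = add_pow G' n x" for n :: int and x
    using assms by (simp add: same_add_def add_pow_def int_pow_def2 nat_pow_def m_inv_def)
  then show ?thesis
    using assms
    by (intro ext) (simp add: same_add_def fragsum_def finsum_def finprod_def comp_def)
qed

context abelian_group begin

lemma minus_eq_zeroD: "x \<in> carrier G \<Longrightarrow> y \<in> carrier G \<Longrightarrow> x \<ominus> y = \<zero> \<Longrightarrow> x = y"
  using minus_equality[of x "\<ominus> y"] by (simp add: minus_eq)

lemma add_minus_cancel: "x \<in> carrier G \<Longrightarrow> y \<in> carrier G \<Longrightarrow> (x \<ominus> y) \<oplus> y = x"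
  by (simp add: minus_eq a_assoc l_neg)

lemma add_minus_cancel': "x \<in> carrier G \<Longrightarrow> y \<in> carrier G \<Longrightarrow> (x \<oplus> y) \<ominus> y = x"
  by (simp add: minus_eq a_assoc r_neg)

end

lemma addhom_cong_add:
  "same_add G G' \<Longrightarrow> same_add E E' \<Longrightarrow> addhom G E = addhom G' E'"
  by (intro ext) (simp add: addhom_def same_add_def)

lemma addhom_closed: "addhom G G' h \<Longrightarrow> x \<in> carrier G \<Longrightarrow> h x \<in> carrier G'"
  by (auto simp: addhom_def)

lemma addhom_add:
  "addhom G G' h \<Longrightarrow> x \<in> carrier G \<Longrightarrow> y \<in> carrier G \<Longrightarrow> h (x \<oplus>\<^bsub>G\<^esub> y) = h x \<oplus>\<^bsub>G'\<^esub> h y"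
  by (auto simp: addhom_def)

lemma addhomI:
  "(\<And>x. x \<in> carrier G \<Longrightarrow> h x \<in> carrier G') \<Longrightarrow>
   (\<And>x y. x \<in> carrier G \<Longrightarrow> y \<in> carrier G \<Longrightarrow> h (x \<oplus>\<^bsub>G\<^esub> y) = h x \<oplus>\<^bsub>G'\<^esub> h y) \<Longrightarrow> addhom G G' h"
  by (auto simp: addhom_def)

lemma addhom_comp:
  "addhom G G' h \<Longrightarrow> addhom G' G'' h' \<Longrightarrow> addhom G G'' (\<lambda>x. h' (h x))"
  by (auto simp: addhom_def Pi_iff)

lemma addhom_group_hom:
  assumes "abelian_group G" "abelian_group G'" "addhom G G' h"
  shows "group_hom (add_monoid G) (add_monoid G') h"
  using assms by (auto simp: group_hom_def group_hom_axioms_def hom_def addhom_def abelian_group.a_group)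

lemma addhom_zero:
  assumes "abelian_group G" "abelian_group G'" "addhom G G' h"
  shows "h \<zero>\<^bsub>G\<^esub> = \<zero>\<^bsub>G'\<^esub>"
  using group_hom.hom_one[OF addhom_group_hom[OF assms]] by simp

lemma addhom_minus:
  assumes "abelian_group G" "abelian_group G'" "addhom G G' h" "x \<in> carrier G"
  shows "h (\<ominus>\<^bsub>G\<^esub> x) = \<ominus>\<^bsub>G'\<^esub> h x"
  using group_hom.hom_inv[OF addhom_group_hom[OF assms(1-3)]] assms(4) by (simp add: a_inv_def)

lemma addhom_finsum:
  assumes G: "abelian_group G" and G': "abelian_group G'" and h: "addhom G G' h"
    and f: "f \<in> A \<rightarrow> carrier G"
  shows "h (finsum G f A) = finsum G' (\<lambda>x. h (f x)) A"
proof -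
  interpret G: abelian_group G by fact
  interpret G': abelian_group G' by fact
  show ?thesis
    using f
  proof (induction A rule: infinite_finite_induct)
    case (insert x A)
    then have "h (finsum G f (insert x A)) = h (f x \<oplus>\<^bsub>G\<^esub> finsum G f A)"
      by (subst G.finsum_insert) auto
    also have "\<dots> = h (f x) \<oplus>\<^bsub>G'\<^esub> finsum G' (\<lambda>x. h (f x)) A"
      using insert by (subst addhom_add[OF h]) auto
    also have "\<dots> = finsum G' (\<lambda>x. h (f x)) (insert x A)"
      using insert h by (subst G'.finsum_insert) (auto simp: addhom_def)
    finally show ?case .
  qed (auto simp: addhom_zero[OF G G' h] G.finsum_infinite G'.finsum_infinite)
qed

lemma addhom_fragsum:
  assumes G: "abelian_group G" and G': "abelian_group G'" and h: "addhom G G' h"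
    and f: "f \<in> S \<rightarrow> carrier G" and p: "Poly_Mapping.keys p \<subseteq> S"
  shows "h (fragsum G f p) = fragsum G' (\<lambda>x. h (f x)) p"
proof -
  interpret G: abelian_group G by fact
  interpret G': abelian_group G' by fact
  have pw: "h (add_pow G n x) = add_pow G' n (h x)" if "x \<in> carrier G" for x and n :: int
    using group_hom.hom_int_pow[OF addhom_group_hom[OF G G' h]] that by (simp add: add_pow_def)
  show ?thesis
    unfolding fragsum_def using f p
    by (subst addhom_finsum[OF G G' h])
      (auto intro!: G'.finsum_cong' simp: pw addhom_closed[OF h] subset_iff Pi_iff)
qed

text \<open>Indices outside the support have coefficient 0. A common index set is what makes the
  sums over \<open>p\<close>, \<open>q\<close> and \<open>p + q\<close> comparable.\<close>

lemma fragsum_superset: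
  assumes "abelian_group G" "f \<in> A \<rightarrow> carrier G" "finite A" "Poly_Mapping.keys p \<subseteq> A"
  shows "fragsum G f p = finsum G (\<lambda>x. add_pow G (Poly_Mapping.lookup p x) (f x)) A"
proof -
  interpret abelian_group G by fact
  show ?thesis
    unfolding fragsum_def using assms(2-)
    by (intro add.finprod_mono_neutral_cong_left)
      (auto simp: not_in_keys_iff_lookup_eq_zero add_pow_def[of G "0::int"])
qed

lemma fragsum_closed:
  assumes "abelian_group G" "f \<in> S \<rightarrow> carrier G" "Poly_Mapping.keys p \<subseteq> S"
  shows "fragsum G f p \<in> carrier G"
proof -
  interpret abelian_group G by fact
  show ?thesis
    unfolding fragsum_def using assms by (auto intro!: finsum_closed simp: Pi_iff subset_iff)
qed

lemma fragsum_add: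
  assumes "abelian_group G" "f \<in> S \<rightarrow> carrier G" "Poly_Mapping.keys p \<subseteq> S" "Poly_Mapping.keys q \<subseteq> S"
  shows "fragsum G f (p + q) = fragsum G f p \<oplus>\<^bsub>G\<^esub> fragsum G f q"
proof -
  interpret abelian_group G by fact
  define A where "A = Poly_Mapping.keys p \<union> Poly_Mapping.keys q"
  have A: "finite A" "f \<in> A \<rightarrow> carrier G" using assms by (auto simp: A_def Pi_iff)
  have "fragsum G f (p + q) = finsum G (\<lambda>x. add_pow G (Poly_Mapping.lookup (p + q) x) (f x)) A"
    using Poly_Mapping.keys_add[of p q] by (intro fragsum_superset A assms) (auto simp: A_def)
  also have "\<dots> = finsum G (\<lambda>x. add_pow G (Poly_Mapping.lookup p x) (f x) \<oplus>\<^bsub>G\<^esub> add_pow G (Poly_Mapping.lookup q x) (f x)) A"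
    using A by (intro finsum_cong') (auto simp: lookup_add add.int_pow_mult Pi_iff)
  also have "\<dots> = fragsum G f p \<oplus>\<^bsub>G\<^esub> fragsum G f q"
    using A fragsum_superset[OF assms(1) A(2,1), of p] fragsum_superset[OF assms(1) A(2,1), of q]
    by (subst finsum_addf) (auto simp: A_def Pi_iff)
  finally show ?thesis .
qed

lemma fragsum_of:
  assumes "abelian_group G" "f x \<in> carrier G"
  shows "fragsum G f (frag_of x) = f x"
proof -
  interpret abelian_group G by fact
  show ?thesis using assms(2) by (simp add: fragsum_def finsum_insert)
qed

lemma fragsum_diff:
  assumes G: "abelian_group G" and f: "f \<in> S \<rightarrow> carrier G"
    and "Poly_Mapping.keys p \<subseteq> S" "Poly_Mapping.keys q \<subseteq> S"
  shows "fragsum G f (p - q) = fragsum G f p \<ominus>\<^bsub>G\<^esub> fragsum G f q"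
proof -
  interpret abelian_group G by fact
  have k: "Poly_Mapping.keys (p - q) \<subseteq> S" using Poly_Mapping.keys_diff[of p q] assms by auto
  have "fragsum G f p = fragsum G f (p - q) \<oplus>\<^bsub>G\<^esub> fragsum G f q"
    using fragsum_add[OF G f k assms(4)] by simp
  then show ?thesis
    using fragsum_closed[OF G f k] fragsum_closed[OF G f assms(4)]
    by (simp add: minus_eq a_assoc r_neg)
qed

lemma fragsum_addf:
  assumes "abelian_group G" "f \<in> S \<rightarrow> carrier G" "g \<in> S \<rightarrow> carrier G" "Poly_Mapping.keys p \<subseteq> S"
  shows "fragsum G (\<lambda>x. f x \<oplus>\<^bsub>G\<^esub> g x) p = fragsum G f p \<oplus>\<^bsub>G\<^esub> fragsum G g p"
proof -
  interpret abelian_group G by fact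
  have "fragsum G (\<lambda>x. f x \<oplus>\<^bsub>G\<^esub> g x) p = finsum G (\<lambda>x. add_pow G (Poly_Mapping.lookup p x) (f x)
      \<oplus>\<^bsub>G\<^esub> add_pow G (Poly_Mapping.lookup p x) (g x)) (Poly_Mapping.keys p)"
    unfolding fragsum_def using assms
    by (intro finsum_cong') (auto simp: add.int_pow_distrib Pi_iff subset_iff)
  also have "\<dots> = fragsum G f p \<oplus>\<^bsub>G\<^esub> fragsum G g p"
    unfolding fragsum_def using assms by (subst finsum_addf) (auto simp: Pi_iff subset_iff)
  finally show ?thesis .
qed

lemma fragsum_cong:
  assumes "abelian_group G" "g \<in> S \<rightarrow> carrier G" "Poly_Mapping.keys p \<subseteq> S" "\<And>x. x \<in> S \<Longrightarrow> f x = g x"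
  shows "fragsum G f p = fragsum G g p"
proof -
  interpret abelian_group G by fact
  show ?thesis
    unfolding fragsum_def using assms by (intro finsum_cong') (auto simp: Pi_iff subset_iff)
qed

text \<open>Fubini for formal integer combinations, by induction on \<open>p\<close> as an element
  of a free abelian group. It is what permits Sweedler sums over different arguments to be
  interchanged.\<close>

lemma fragsum_swap:
  assumes G: "abelian_group G" and p: "Poly_Mapping.keys p \<subseteq> S" and q: "Poly_Mapping.keys q \<subseteq> S'"
    and f: "\<And>x y. x \<in> S \<Longrightarrow> y \<in> S' \<Longrightarrow> f x y \<in> carrier G"
  shows "fragsum G (\<lambda>x. fragsum G (f x) q) p = fragsum G (\<lambda>y. fragsum G (\<lambda>x. f x y) p) q"
proof -
  interpret abelian_group G by fact
  have f1: "(\<lambda>x. f x y) \<in> S \<rightarrow> carrier G" if "y \<in> S'" for y using f that by auto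
  have f2: "(\<lambda>x. fragsum G (f x) q) \<in> S \<rightarrow> carrier G"
    using fragsum_closed[OF G _ q] f by (auto simp: Pi_iff)
  have cl: "(\<lambda>y. fragsum G (\<lambda>x. f x y) p) \<in> S' \<rightarrow> carrier G"
    if "Poly_Mapping.keys p \<subseteq> S" for p
    using fragsum_closed[OF G f1 that] by (auto simp: Pi_iff)
  show ?thesis
    using p
  proof (rule free_Abelian_group_induct)
    have "fragsum G (\<lambda>y. fragsum G (\<lambda>x. f x y) 0) q = \<zero>\<^bsub>G\<^esub>"
      by (simp add: fragsum_def finsum_zero)
    then show "fragsum G (\<lambda>x. fragsum G (f x) q) 0 = fragsum G (\<lambda>y. fragsum G (\<lambda>x. f x y) 0) q"
      by (simp add: fragsum_def)
  next
    fix a assume a: "a \<in> S"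
    have "fragsum G (\<lambda>y. fragsum G (\<lambda>x. f x y) (frag_of a)) q = fragsum G (f a) q"
      using a f by (intro fragsum_cong[OF G _ q] fragsum_of[OF G]) auto
    then show "fragsum G (\<lambda>x. fragsum G (f x) q) (frag_of a)
        = fragsum G (\<lambda>y. fragsum G (\<lambda>x. f x y) (frag_of a)) q"
      using f2 a by (subst fragsum_of[OF G]) (auto simp: Pi_iff)
  next
    fix u v assume uv: "Poly_Mapping.keys u \<subseteq> S" "Poly_Mapping.keys v \<subseteq> S"
      and IH: "fragsum G (\<lambda>x. fragsum G (f x) q) u = fragsum G (\<lambda>y. fragsum G (\<lambda>x. f x y) u) q"
        "fragsum G (\<lambda>x. fragsum G (f x) q) v = fragsum G (\<lambda>y. fragsum G (\<lambda>x. f x y) v) q"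
    have d: "Poly_Mapping.keys (u - v) \<subseteq> S" using uv keys_diff[of u v] by auto
    have "fragsum G (\<lambda>y. fragsum G (\<lambda>x. f x y) u) q
        = fragsum G (\<lambda>y. fragsum G (\<lambda>x. f x y) (u - v) \<oplus>\<^bsub>G\<^esub> fragsum G (\<lambda>x. f x y) v) q"
      using uv d cl
      by (intro fragsum_cong[OF G _ q]) (auto simp: Pi_iff simp flip: fragsum_add[OF G f1 d uv(2)])
    also have "\<dots> = fragsum G (\<lambda>y. fragsum G (\<lambda>x. f x y) (u - v)) q
        \<oplus>\<^bsub>G\<^esub> fragsum G (\<lambda>y. fragsum G (\<lambda>x. f x y) v) q"
      using uv d by (intro fragsum_addf[OF G _ _ q] cl)
    finally show "fragsum G (\<lambda>x. fragsum G (f x) q) (u - v)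
        = fragsum G (\<lambda>y. fragsum G (\<lambda>x. f x y) (u - v)) q"
      using fragsum_diff[OF G f2 uv] IH add_minus_cancel' fragsum_closed[OF G cl q] d uv by simp
  qed
qed

lemma fragsum_hom:
  assumes "abelian_group G" "f \<in> S \<rightarrow> carrier G"
  shows "group_hom (free_Abelian_group S) (add_monoid G) (fragsum G f)"
  using assms fragsum_add[OF assms] fragsum_closed[OF assms]
  by (auto simp: group_hom_def group_hom_axioms_def hom_def abelian_group.a_group)

text \<open>Shaped so that \<open>tensor_space\<close> and \<open>sym_space\<close> unfold to
  instances of it; one universal property then serves tensor products and the symmetric algebra. As
  there, the multiplicative fields are placeholders.\<close>

definition qspace :: "'x set \<Rightarrow> ('x \<Rightarrow>\<^sub>0 int) set \<Rightarrow> ('x \<Rightarrow>\<^sub>0 int) set ring" where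
  "qspace S Rl =
     (let Q = free_Abelian_group S Mod generate (free_Abelian_group S) Rl
      in \<lparr>carrier = carrier Q, monoid.mult = undefined, one = undefined,
          ring.zero = one Q, add = monoid.mult Q\<rparr>)"

definition qgen :: "'x set \<Rightarrow> ('x \<Rightarrow>\<^sub>0 int) set \<Rightarrow> 'x \<Rightarrow> ('x \<Rightarrow>\<^sub>0 int) set" where
  "qgen S Rl x = generate (free_Abelian_group S) Rl #>\<^bsub>free_Abelian_group S\<^esub> frag_of x"

section \<open>Universal property of a free abelian group modulo relators\<close>

locale frag_quotient =
  fixes S :: "'x set" and Rl :: "('x \<Rightarrow>\<^sub>0 int) set"
  assumes rels: "Rl \<subseteq> carrier (free_Abelian_group S)"
begin

abbreviation "F \<equiv> free_Abelian_group S"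
abbreviation "N \<equiv> generate F Rl"
abbreviation "V \<equiv> qspace S Rl"

lemma N_subgroup: "subgroup N F"
  by (intro group.generate_is_subgroup rels) simp

lemma N_normal: "N \<lhd> F"
  using comm_group.normal_iff_subgroup[OF abelian_free_Abelian_group] N_subgroup by blast

lemma V_abelian: "abelian_group V"
proof -
  interpret Q: comm_group "F Mod N"
    using comm_group.abelian_FactGroup[OF abelian_free_Abelian_group N_subgroup] .
  have eq: "carrier V = carrier (F Mod N)" "add V = monoid.mult (F Mod N)" "\<zero>\<^bsub>V\<^esub> = \<one>\<^bsub>F Mod N\<^esub>"
    by (simp_all add: qspace_def Let_def)
  show ?thesis
    by (rule abelian_groupI; unfold eq)
      (fact Q.m_closed Q.m_assoc Q.m_comm Q.one_closed Q.l_one Q.l_inv_ex)+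
qed

lemma carrier_V: "carrier V = (\<lambda>p. N #>\<^bsub>F\<^esub> p) ` carrier F"
  by (auto simp: qspace_def Let_def FactGroup_def RCOSETS_def)

lemma add_V: "x \<in> carrier F \<Longrightarrow> y \<in> carrier F \<Longrightarrow>
    (N #>\<^bsub>F\<^esub> x) \<oplus>\<^bsub>V\<^esub> (N #>\<^bsub>F\<^esub> y) = N #>\<^bsub>F\<^esub> (x + y)"
  using normal.rcos_sum[OF N_normal] by (simp add: qspace_def Let_def FactGroup_def)

lemma coset_hom: "group_hom F (add_monoid V) (\<lambda>p. N #>\<^bsub>F\<^esub> p)"
proof -
  have "group (add_monoid V)" using abelian_group.a_group[OF V_abelian] .
  moreover have "(\<lambda>p. N #>\<^bsub>F\<^esub> p) \<in> hom F (add_monoid V)"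
    by (rule homI) (auto simp: carrier_V add_V)
  ultimately show ?thesis by (simp add: group_hom_def group_hom_axioms_def)
qed

lemma qgen_closed: "x \<in> S \<Longrightarrow> qgen S Rl x \<in> carrier V"
  by (auto simp: qgen_def carrier_V)

lemma coset_zero: "r \<in> Rl \<Longrightarrow> N #>\<^bsub>F\<^esub> r = \<zero>\<^bsub>V\<^esub>"
proof -
  assume "r \<in> Rl"
  then have "r \<in> N" by (rule generate.incl)
  then have "N #>\<^bsub>F\<^esub> r = N" using subgroup.rcos_const[OF N_subgroup] by simp
  then show ?thesis by (simp add: qspace_def Let_def FactGroup_def)
qed

lemma coset_diff:
  assumes "x \<in> carrier F" "y \<in> carrier F"
  shows "N #>\<^bsub>F\<^esub> (x - y) = (N #>\<^bsub>F\<^esub> x) \<ominus>\<^bsub>V\<^esub> (N #>\<^bsub>F\<^esub> y)"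
proof -
  interpret V: abelian_group V by (rule V_abelian)
  have "x - y \<in> carrier F" using assms keys_diff[of x y] by auto
  then have "N #>\<^bsub>F\<^esub> x = (N #>\<^bsub>F\<^esub> (x - y)) \<oplus>\<^bsub>V\<^esub> (N #>\<^bsub>F\<^esub> y)"
    using assms by (subst add_V) auto
  moreover have "N #>\<^bsub>F\<^esub> (x - y) \<in> carrier V" "N #>\<^bsub>F\<^esub> y \<in> carrier V"
    using assms \<open>x - y \<in> carrier F\<close> by (auto simp: carrier_V simp del: carrier_free_Abelian_group_iff)
  ultimately show ?thesis by (simp add: V.minus_eq V.a_assoc V.r_neg)
qed

lemma qgen_eq:
  assumes "frag_of u - frag_of v \<in> Rl" "u \<in> S" "v \<in> S"
  shows "qgen S Rl u = qgen S Rl v"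
proof -
  interpret V: abelian_group V by (rule V_abelian)
  have "qgen S Rl u \<ominus>\<^bsub>V\<^esub> qgen S Rl v = \<zero>\<^bsub>V\<^esub>"
    using coset_zero[OF assms(1)] assms(2,3) coset_diff[of "frag_of u" "frag_of v"]
    by (simp add: qgen_def)
  then show ?thesis using V.minus_eq_zeroD qgen_closed assms by blast
qed

lemma qgen_add:
  assumes "frag_of u - frag_of v - frag_of w \<in> Rl" "u \<in> S" "v \<in> S" "w \<in> S"
  shows "qgen S Rl u = qgen S Rl v \<oplus>\<^bsub>V\<^esub> qgen S Rl w"
proof -
  interpret V: abelian_group V by (rule V_abelian)
  have "frag_of u - frag_of v \<in> carrier F" using assms keys_diff[of "frag_of u" "frag_of v"] by auto
  then have "(qgen S Rl u \<ominus>\<^bsub>V\<^esub> qgen S Rl v) \<ominus>\<^bsub>V\<^esub> qgen S Rl w = \<zero>\<^bsub>V\<^esub>"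
    using coset_zero[OF assms(1)] assms(2-) coset_diff[of "frag_of u" "frag_of v"]
      coset_diff[of "frag_of u - frag_of v" "frag_of w"]
    by (simp add: qgen_def)
  then have "qgen S Rl u \<ominus>\<^bsub>V\<^esub> qgen S Rl v = qgen S Rl w"
    using V.minus_eq_zeroD qgen_closed assms by auto
  then show ?thesis using qgen_closed assms V.add_minus_cancel[of "qgen S Rl u" "qgen S Rl v"]
    by (simp add: V.a_comm)
qed

lemma qspace_induct [consumes 1, case_names zero gen diff]:
  assumes "T \<in> carrier V"
    and "P \<zero>\<^bsub>V\<^esub>" "\<And>x. x \<in> S \<Longrightarrow> P (qgen S Rl x)"
    and "\<And>x y. x \<in> carrier V \<Longrightarrow> y \<in> carrier V \<Longrightarrow> P x \<Longrightarrow> P y \<Longrightarrow> P (x \<ominus>\<^bsub>V\<^esub> y)"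
  shows "P T"
proof -
  obtain p where p: "Poly_Mapping.keys p \<subseteq> S" "T = N #>\<^bsub>F\<^esub> p" using assms(1) by (auto simp: carrier_V)
  have "P (N #>\<^bsub>F\<^esub> p)" using p(1)
  proof (rule free_Abelian_group_induct)
    show "P (N #>\<^bsub>F\<^esub> 0)" using group_hom.hom_one[OF coset_hom] assms(2) by simp
    show "P (N #>\<^bsub>F\<^esub> (x - y))"
      if "Poly_Mapping.keys x \<subseteq> S" "Poly_Mapping.keys y \<subseteq> S" "P (N #>\<^bsub>F\<^esub> x)" "P (N #>\<^bsub>F\<^esub> y)" for x y
      using that coset_diff[of x y] assms(4) by (auto simp: carrier_V)
    show "P (N #>\<^bsub>F\<^esub> frag_of a)" if "a \<in> S" for a using assms(3)[OF that] by (simp add: qgen_def)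
  qed
  with p show ?thesis by simp
qed

lemma hom_ext:
  assumes "abelian_group G" "addhom V G h" "addhom V G h'"
    "\<And>x. x \<in> S \<Longrightarrow> h (qgen S Rl x) = h' (qgen S Rl x)" "T \<in> carrier V"
  shows "h T = h' T"
proof -
  interpret V: abelian_group V by (rule V_abelian)
  interpret G: abelian_group G by fact
  show ?thesis
    using assms(5)
  proof (induction T rule: qspace_induct)
    case (diff x y)
    then show ?case
      using assms(2,3) addhom_minus[OF V_abelian assms(1) assms(2)] addhom_minus[OF V_abelian assms(1) assms(3)]
      by (simp add: V.minus_eq addhom_add addhom_closed)
  qed (use assms addhom_zero[OF V_abelian assms(1,2)] addhom_zero[OF V_abelian assms(1,3)] in auto)
qed

text \<open>The kernel of the induced map is a subgroup containing the relators, hence it contains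
  the subgroup that they generate.\<close>

lemma fragsum_kills:
  assumes "abelian_group G" "f \<in> S \<rightarrow> carrier G" "\<And>r. r \<in> Rl \<Longrightarrow> fragsum G f r = \<zero>\<^bsub>G\<^esub>" "n \<in> N"
  shows "fragsum G f n = \<zero>\<^bsub>G\<^esub>"
proof -
  interpret h: group_hom F "add_monoid G" "fragsum G f" by (rule fragsum_hom[OF assms(1,2)])
  have "N \<subseteq> kernel F (add_monoid G) (fragsum G f)"
    using rels assms(3)
    by (intro h.G.generate_subgroup_incl h.subgroup_kernel) (auto simp: kernel_def simp del: carrier_free_Abelian_group_iff)
  with assms(4) show ?thesis by (auto simp: kernel_def)
qed

text \<open>The representative picked by \<open>SOME\<close> differs from \<open>p\<close> by an
  element of \<open>N\<close>, which is killed. This settles the well-definedness of maps out of the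
  quotient.\<close>

lemma fragsum_some:
  assumes G: "abelian_group G" and f: "f \<in> S \<rightarrow> carrier G"
    and z: "\<And>r. r \<in> Rl \<Longrightarrow> fragsum G f r = \<zero>\<^bsub>G\<^esub>"
    and p: "p \<in> carrier F"
  shows "fragsum G f (SOME q. q \<in> N #>\<^bsub>F\<^esub> p) = fragsum G f p"
proof -
  interpret G: abelian_group G by fact
  have "p \<in> N #>\<^bsub>F\<^esub> p" using group.rcos_self[OF group_free_Abelian_group p N_subgroup] .
  then have "(SOME q. q \<in> N #>\<^bsub>F\<^esub> p) \<in> N #>\<^bsub>F\<^esub> p" by (rule someI)
  then obtain n where n: "n \<in> N" "(SOME q. q \<in> N #>\<^bsub>F\<^esub> p) = n + p"
    by (auto simp: r_coset_def)
  have "n \<in> carrier F" using n(1) subgroup.subset[OF N_subgroup] by blast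
  then show ?thesis
    using n p fragsum_add[OF G f, of n p] fragsum_kills[OF G f z n(1)] fragsum_closed[OF G f, of p]
    by simp
qed

text \<open>Supplies the support condition for the representative that \<open>lift2\<close> happens
  to pick. It gives summation rules even for integrands that do not respect the relations, as long
  as both sides evaluate the same coset.\<close>

lemma some_in_carrier:
  assumes "T \<in> carrier V" shows "(SOME q. q \<in> T) \<in> carrier F"
proof -
  obtain p where p: "p \<in> carrier F" "T = N #>\<^bsub>F\<^esub> p" using assms by (auto simp: carrier_V)
  have "p \<in> T" using group.rcos_self[OF group_free_Abelian_group p(1) N_subgroup] p by simp
  then have "(SOME q. q \<in> T) \<in> T" by (rule someI)
  moreover have "T \<subseteq> carrier F"
    using p subgroup.subset[OF N_subgroup] monoid.r_coset_subset_G[OF group.is_monoid[OF group_free_Abelian_group]] by blast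
  ultimately show ?thesis by blast
qed

lemma lift_hom:
  assumes G: "abelian_group G" and f: "f \<in> S \<rightarrow> carrier G"
    and z: "\<And>r. r \<in> Rl \<Longrightarrow> fragsum G f r = \<zero>\<^bsub>G\<^esub>"
  shows "addhom V G (\<lambda>T. fragsum G f (SOME q. q \<in> T))"
    and "x \<in> S \<Longrightarrow> fragsum G f (SOME q. q \<in> qgen S Rl x) = f x"
proof -
  show "addhom V G (\<lambda>T. fragsum G f (SOME q. q \<in> T))"
  proof (rule addhomI)
    fix T assume "T \<in> carrier V"
    then obtain p where p: "p \<in> carrier F" "T = N #>\<^bsub>F\<^esub> p" by (auto simp: carrier_V)
    then show "fragsum G f (SOME q. q \<in> T) \<in> carrier G"
      using fragsum_some[OF G f z p(1)] fragsum_closed[OF G f] by simp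
    fix U assume "U \<in> carrier V"
    then obtain q where q: "q \<in> carrier F" "U = N #>\<^bsub>F\<^esub> q" by (auto simp: carrier_V)
    have pq: "p + q \<in> carrier F" using p q keys_add[of p q] by auto
    show "fragsum G f (SOME q. q \<in> T \<oplus>\<^bsub>V\<^esub> U) =
       fragsum G f (SOME q. q \<in> T) \<oplus>\<^bsub>G\<^esub> fragsum G f (SOME q. q \<in> U)"
      using p q pq fragsum_add[OF G f] by (simp only: add_V fragsum_some[OF G f z]) simp
  qed
  show "fragsum G f (SOME q. q \<in> qgen S Rl x) = f x" if "x \<in> S"
    unfolding qgen_def using that f by (subst fragsum_some[OF G f z]) (auto simp: fragsum_of[OF G] Pi_iff)
qed

end

lemma lift2_fragsum: "lift2 G f T = fragsum G (\<lambda>(a, b). f a b) (SOME p. p \<in> T)"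
proof -
  have "(\<lambda>(a, b). add_pow G (Poly_Mapping.lookup p (a, b)) (f a b)) =
      (\<lambda>x. add_pow G (Poly_Mapping.lookup p x) (case x of (a, b) \<Rightarrow> f a b))" for p
    by auto
  then show ?thesis unfolding lift2_def fragsum_def Let_def by (rule arg_cong)
qed

lemma lift2_cong_add: "same_add G G' \<Longrightarrow> lift2 G = lift2 G'"
  by (intro ext) (simp add: lift2_fragsum fragsum_cong_add)

section \<open>Tensor products\<close>

text \<open>Just enough structure for the relators to be combinations of pairs from the carriers.
  Twisted algebras with restricted scalars have it before any module axiom is verified for
  them.\<close>

definition premodule :: "('r, 'x) ring_scheme \<Rightarrow> ('r, 'a, 'm) module_scheme \<Rightarrow> bool" where
  "premodule R M \<longleftrightarrow>
     abelian_group M \<and> (\<forall>r\<in>carrier R. \<forall>x\<in>carrier M. r \<odot>\<^bsub>M\<^esub> x \<in> carrier M)"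

text \<open>The maps that factor through the tensor product. The target is a mere abelian group, so
  one notion covers bilinear maps over \<open>R\<close> as well as maps into spaces with another
  scalar action.\<close>

definition balanced ::
    "('r, 'x) ring_scheme \<Rightarrow> ('r, 'a, 'm) module_scheme \<Rightarrow> ('r, 'b, 'n) module_scheme
      \<Rightarrow> ('g, 'o) ring_scheme \<Rightarrow> ('a \<Rightarrow> 'b \<Rightarrow> 'g) \<Rightarrow> bool" where
  "balanced R M N G f \<longleftrightarrow>
     (\<forall>x\<in>carrier M. addhom N G (f x)) \<and>
     (\<forall>y\<in>carrier N. addhom M G (\<lambda>x. f x y)) \<and>
     (\<forall>r\<in>carrier R. \<forall>x\<in>carrier M. \<forall>y\<in>carrier N. f (r \<odot>\<^bsub>M\<^esub> x) y = f x (r \<odot>\<^bsub>N\<^esub> y))"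

lemma balancedI:
  assumes "\<And>x y. x \<in> carrier M \<Longrightarrow> y \<in> carrier N \<Longrightarrow> f x y \<in> carrier G"
    "\<And>x x' y. x \<in> carrier M \<Longrightarrow> x' \<in> carrier M \<Longrightarrow> y \<in> carrier N \<Longrightarrow>
       f (x \<oplus>\<^bsub>M\<^esub> x') y = f x y \<oplus>\<^bsub>G\<^esub> f x' y"
    "\<And>x y y'. x \<in> carrier M \<Longrightarrow> y \<in> carrier N \<Longrightarrow> y' \<in> carrier N \<Longrightarrow>
       f x (y \<oplus>\<^bsub>N\<^esub> y') = f x y \<oplus>\<^bsub>G\<^esub> f x y'"
    "\<And>r x y. r \<in> carrier R \<Longrightarrow> x \<in> carrier M \<Longrightarrow> y \<in> carrier N \<Longrightarrow>
       f (r \<odot>\<^bsub>M\<^esub> x) y = f x (r \<odot>\<^bsub>N\<^esub> y)"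
  shows "balanced R M N G f"
  using assms by (auto simp: balanced_def addhom_def)

lemma balancedD:
  assumes "balanced R M N G f"
  shows "x \<in> carrier M \<Longrightarrow> y \<in> carrier N \<Longrightarrow> f x y \<in> carrier G"
    "x \<in> carrier M \<Longrightarrow> x' \<in> carrier M \<Longrightarrow> y \<in> carrier N \<Longrightarrow>
       f (x \<oplus>\<^bsub>M\<^esub> x') y = f x y \<oplus>\<^bsub>G\<^esub> f x' y"
    "x \<in> carrier M \<Longrightarrow> y \<in> carrier N \<Longrightarrow> y' \<in> carrier N \<Longrightarrow>
       f x (y \<oplus>\<^bsub>N\<^esub> y') = f x y \<oplus>\<^bsub>G\<^esub> f x y'"
    "r \<in> carrier R \<Longrightarrow> x \<in> carrier M \<Longrightarrow> y \<in> carrier N \<Longrightarrow>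
       f (r \<odot>\<^bsub>M\<^esub> x) y = f x (r \<odot>\<^bsub>N\<^esub> y)"
  using assms by (auto simp: balanced_def addhom_def Pi_iff)

text \<open>Lean substitutes for the locales \<open>abelian_group\<close>, \<open>ring\<close> and \<open>module\<close>, whose
  interpretations carry thousands of facts, too many for the iterated convolution algebras below.\<close>

locale plain_group =
  fixes G :: "('a, 'm) ring_scheme"
  assumes abelian_group_axioms: "abelian_group G"
begin

lemma closed [intro, simp]:
  "x \<in> carrier G \<Longrightarrow> y \<in> carrier G \<Longrightarrow> x \<oplus>\<^bsub>G\<^esub> y \<in> carrier G" "\<zero>\<^bsub>G\<^esub> \<in> carrier G"
  "x \<in> carrier G \<Longrightarrow> \<ominus>\<^bsub>G\<^esub> x \<in> carrier G"
  using abelian_group_axioms abelian_group.a_inv_closed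
  by (auto intro: abelian_monoid.a_closed abelian_monoid.zero_closed abelian_group.axioms)

lemma zero [simp]:
  "x \<in> carrier G \<Longrightarrow> \<zero>\<^bsub>G\<^esub> \<oplus>\<^bsub>G\<^esub> x = x" "x \<in> carrier G \<Longrightarrow> x \<oplus>\<^bsub>G\<^esub> \<zero>\<^bsub>G\<^esub> = x"
  using abelian_group.axioms(1)[OF abelian_group_axioms]
  by (auto simp: abelian_monoid.l_zero abelian_monoid.r_zero)

lemmas a_closed = closed(1)
lemmas a_assoc = abelian_monoid.a_assoc[OF abelian_group.axioms(1)[OF abelian_group_axioms]]
lemmas a_comm = abelian_monoid.a_comm[OF abelian_group.axioms(1)[OF abelian_group_axioms]]
lemmas a_lcomm = abelian_monoid.a_lcomm[OF abelian_group.axioms(1)[OF abelian_group_axioms]]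
lemmas a_ac = a_assoc a_comm a_lcomm
lemmas l_neg = abelian_group.l_neg[OF abelian_group_axioms]

end

locale plain_ring = plain_group A for A :: "('a, 'm) ring_scheme" +
  assumes ring_axioms: "ring A"
begin

lemma mult_closed [intro, simp]:
  "x \<in> carrier A \<Longrightarrow> y \<in> carrier A \<Longrightarrow> x \<otimes>\<^bsub>A\<^esub> y \<in> carrier A" "\<one>\<^bsub>A\<^esub> \<in> carrier A"
  using ring.ring_simprules(5,6)[OF ring_axioms] by auto

lemma unit [simp]:
  "x \<in> carrier A \<Longrightarrow> \<one>\<^bsub>A\<^esub> \<otimes>\<^bsub>A\<^esub> x = x" "x \<in> carrier A \<Longrightarrow> x \<otimes>\<^bsub>A\<^esub> \<one>\<^bsub>A\<^esub> = x"
  "x \<in> carrier A \<Longrightarrow> \<zero>\<^bsub>A\<^esub> \<otimes>\<^bsub>A\<^esub> x = \<zero>\<^bsub>A\<^esub>" "x \<in> carrier A \<Longrightarrow> x \<otimes>\<^bsub>A\<^esub> \<zero>\<^bsub>A\<^esub> = \<zero>\<^bsub>A\<^esub>"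
  using monoid.l_one[OF ring.is_monoid[OF ring_axioms]] monoid.r_one[OF ring.is_monoid[OF ring_axioms]]
    ring.ring_simprules(24,25)[OF ring_axioms]
  by auto

lemmas m_closed = mult_closed(1)
lemmas one_closed = mult_closed(2)
lemmas m_assoc = monoid.m_assoc[OF ring.is_monoid[OF ring_axioms]]
lemmas l_distr = ring.ring_simprules(13)[OF ring_axioms]
lemmas r_distr = ring.ring_simprules(23)[OF ring_axioms]

end

locale tensor_product =
  fixes R :: "('r, 'x) ring_scheme" and M :: "('r, 'a, 'm) module_scheme"
    and N :: "('r, 'b, 'n) module_scheme"
  assumes M: "premodule R M" and N: "premodule R N"
begin

abbreviation "gens \<equiv> carrier M \<times> carrier N"

definition "relators =
       {frag_of (x \<oplus>\<^bsub>M\<^esub> x', y) - frag_of (x, y) - frag_of (x', y) | x x' y.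
           x \<in> carrier M \<and> x' \<in> carrier M \<and> y \<in> carrier N} \<union>
        {frag_of (x, y \<oplus>\<^bsub>N\<^esub> y') - frag_of (x, y) - frag_of (x, y') | x y y'.
           x \<in> carrier M \<and> y \<in> carrier N \<and> y' \<in> carrier N} \<union>
        {frag_of (r \<odot>\<^bsub>M\<^esub> x, y) - frag_of (x, r \<odot>\<^bsub>N\<^esub> y) | r x y.
           r \<in> carrier R \<and> x \<in> carrier M \<and> y \<in> carrier N}"

sublocale M: plain_group M by (rule plain_group.intro) (use M in \<open>simp add: premodule_def\<close>)
sublocale N: plain_group N by (rule plain_group.intro) (use N in \<open>simp add: premodule_def\<close>)

lemma smult_closed_M: "r \<in> carrier R \<Longrightarrow> x \<in> carrier M \<Longrightarrow> r \<odot>\<^bsub>M\<^esub> x \<in> carrier M"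
  using M by (simp add: premodule_def)

lemma smult_closed_N: "r \<in> carrier R \<Longrightarrow> x \<in> carrier N \<Longrightarrow> r \<odot>\<^bsub>N\<^esub> x \<in> carrier N"
  using N by (simp add: premodule_def)

sublocale frag: frag_quotient gens relators
proof
  have d: "p - q \<in> carrier (free_Abelian_group gens)"
    if "p \<in> carrier (free_Abelian_group gens)" "q \<in> carrier (free_Abelian_group gens)"
    for p q :: "('a \<times> 'b) \<Rightarrow>\<^sub>0 int"
    using that Poly_Mapping.keys_diff[of p q] by auto
  show "relators \<subseteq> carrier (free_Abelian_group gens)"
    unfolding relators_def
    by (auto intro!: d simp: smult_closed_M smult_closed_N simp del: carrier_free_Abelian_group_iff)
qed

lemma tensor_space_qspace: "tensor_space R M N = qspace gens relators"
  by (simp add: tensor_space_def qspace_def tensor_rels_def relators_def)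

lemma pure_qgen: "pure_tensor R M N x y = qgen gens relators (x, y)"
  by (simp add: pure_tensor_def qgen_def tensor_rels_def relators_def)

lemma same_add_tensor: "same_add (tensor R M N) (qspace gens relators)"
  by (simp add: same_add_def tensor_def Let_def tensor_space_qspace)

lemma carrier_tensor: "carrier (tensor R M N) = carrier (qspace gens relators)"
  and add_tensor: "add (tensor R M N) = add (qspace gens relators)"
  and zero_tensor: "\<zero>\<^bsub>tensor R M N\<^esub> = \<zero>\<^bsub>qspace gens relators\<^esub>"
  by (simp_all add: tensor_def Let_def tensor_space_qspace)

lemma tensor_abelian: "abelian_group (tensor R M N)"
  using frag.V_abelian abelian_group_cong_add[OF same_add_tensor] by simp

lemma pure_closed: "x \<in> carrier M \<Longrightarrow> y \<in> carrier N \<Longrightarrow> pure_tensor R M N x y \<in> carrier (tensor R M N)"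
  by (simp add: pure_qgen carrier_tensor frag.qgen_closed)

lemma pure_balanced: "balanced R M N (tensor R M N) (pure_tensor R M N)"
proof (rule balancedI)
  show "pure_tensor R M N (x \<oplus>\<^bsub>M\<^esub> x') y =
      pure_tensor R M N x y \<oplus>\<^bsub>tensor R M N\<^esub> pure_tensor R M N x' y"
    if "x \<in> carrier M" "x' \<in> carrier M" "y \<in> carrier N" for x x' y
    unfolding pure_qgen add_tensor by (rule frag.qgen_add) (use that in \<open>auto simp: relators_def\<close>)
  show "pure_tensor R M N x (y \<oplus>\<^bsub>N\<^esub> y') =
      pure_tensor R M N x y \<oplus>\<^bsub>tensor R M N\<^esub> pure_tensor R M N x y'"
    if "x \<in> carrier M" "y \<in> carrier N" "y' \<in> carrier N" for x y y'
    unfolding pure_qgen add_tensor by (rule frag.qgen_add) (use that in \<open>auto simp: relators_def\<close>)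
  show "pure_tensor R M N (r \<odot>\<^bsub>M\<^esub> x) y = pure_tensor R M N x (r \<odot>\<^bsub>N\<^esub> y)"
    if "r \<in> carrier R" "x \<in> carrier M" "y \<in> carrier N" for r x y
    unfolding pure_qgen
    by (rule frag.qgen_eq) (use that smult_closed_M smult_closed_N in \<open>auto simp: relators_def\<close>)
qed (rule pure_closed)

text \<open>Universal property of the tensor product: balancedness sends each of the three kinds of
  relators to zero.\<close>

lemma lift2_hom:
  assumes G: "abelian_group G" and f: "balanced R M N G f"
  shows "addhom (tensor R M N) G (lift2 G f)"
    and "x \<in> carrier M \<Longrightarrow> y \<in> carrier N \<Longrightarrow> lift2 G f (pure_tensor R M N x y) = f x y"
proof -
  interpret G: abelian_group G by fact
  let ?f = "\<lambda>(a, b). f a b"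
  have f': "?f \<in> gens \<rightarrow> carrier G" using balancedD(1)[OF f] by auto
  have of: "fragsum G ?f (frag_of (a, b)) = f a b" if "a \<in> carrier M" "b \<in> carrier N" for a b
    using that balancedD(1)[OF f] by (simp add: fragsum_of[OF G])
  have d: "fragsum G ?f (frag_of u - frag_of v) = ?f u \<ominus>\<^bsub>G\<^esub> ?f v" if "u \<in> gens" "v \<in> gens" for u v
    using that by (subst fragsum_diff[OF G f']) (auto simp: of)
  have d3: "fragsum G ?f (frag_of u - frag_of v - frag_of w) = (?f u \<ominus>\<^bsub>G\<^esub> ?f v) \<ominus>\<^bsub>G\<^esub> ?f w"
    if "u \<in> gens" "v \<in> gens" "w \<in> gens" for u v w
    using that keys_diff[of "frag_of u" "frag_of v"]
    by (subst fragsum_diff[OF G f']) (auto simp: of d)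
  have z: "(a \<oplus>\<^bsub>G\<^esub> b \<ominus>\<^bsub>G\<^esub> a) \<ominus>\<^bsub>G\<^esub> b = \<zero>\<^bsub>G\<^esub>" if "a \<in> carrier G" "b \<in> carrier G" for a b
    using that G.add_minus_cancel'[of b a] by (simp add: G.a_comm) (simp add: G.minus_eq G.r_neg)
  have kill: "fragsum G ?f r = \<zero>\<^bsub>G\<^esub>" if "r \<in> relators" for r
    using that unfolding relators_def
  proof (elim UnE CollectE exE conjE; hypsubst)
    show "fragsum G ?f (frag_of (x \<oplus>\<^bsub>M\<^esub> x', y) - frag_of (x, y) - frag_of (x', y)) = \<zero>\<^bsub>G\<^esub>"
      if "x \<in> carrier M" "x' \<in> carrier M" "y \<in> carrier N" for x x' y
      using that by (subst d3) (simp_all add: balancedD(1,2)[OF f] z)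
    show "fragsum G ?f (frag_of (x, y \<oplus>\<^bsub>N\<^esub> y') - frag_of (x, y) - frag_of (x, y')) = \<zero>\<^bsub>G\<^esub>"
      if "x \<in> carrier M" "y \<in> carrier N" "y' \<in> carrier N" for x y y'
      using that by (subst d3) (simp_all add: balancedD(1,3)[OF f] z)
    show "fragsum G ?f (frag_of (r \<odot>\<^bsub>M\<^esub> x, y) - frag_of (x, r \<odot>\<^bsub>N\<^esub> y)) = \<zero>\<^bsub>G\<^esub>"
      if "r \<in> carrier R" "x \<in> carrier M" "y \<in> carrier N" for r x y
      using that smult_closed_M smult_closed_N
      by (subst d) (simp_all add: balancedD(1,4)[OF f] G.minus_eq G.r_neg)
  qed
  show "addhom (tensor R M N) G (lift2 G f)"
    using frag.lift_hom(1)[OF G f' kill] addhom_cong_add[OF same_add_tensor, of G G]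
    by (simp add: lift2_fragsum[abs_def] same_add_def)
  show "lift2 G f (pure_tensor R M N x y) = f x y" if "x \<in> carrier M" "y \<in> carrier N"
    using frag.lift_hom(2)[OF G f' kill, of "(x, y)"] that by (simp add: lift2_fragsum pure_qgen)
qed

lemma tensor_ext:
  assumes "abelian_group G" "addhom (tensor R M N) G h" "addhom (tensor R M N) G h'"
    "\<And>x y. x \<in> carrier M \<Longrightarrow> y \<in> carrier N \<Longrightarrow>
       h (pure_tensor R M N x y) = h' (pure_tensor R M N x y)" "T \<in> carrier (tensor R M N)"
  shows "h T = h' T"
  using frag.hom_ext[OF assms(1), of h h' T] assms(2-)
    addhom_cong_add[OF same_add_tensor, of G G]
  by (auto simp: pure_qgen carrier_tensor same_add_def)

text \<open>The product and the action in the definition of \<open>tensor\<close> are lifted into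
  the auxiliary additive record. Its addition is that of the final record, so the two lifts
  coincide.\<close>

lemma lift2_tensor_space: "lift2 (tensor R M N) = lift2 (tensor_space R M N)"
  by (rule lift2_cong_add) (simp add: same_add_def tensor_def Let_def)

lemma tensor_smult:
  "r \<odot>\<^bsub>tensor R M N\<^esub> T = lift2 (tensor R M N) (\<lambda>a b. pure_tensor R M N (r \<odot>\<^bsub>M\<^esub> a) b) T"
  unfolding lift2_tensor_space by (simp add: tensor_def Let_def)

lemma tensor_mult:
  "T \<otimes>\<^bsub>tensor R M N\<^esub> U = lift2 (tensor R M N) (\<lambda>a b. lift2 (tensor R M N)
     (\<lambda>a' b'. pure_tensor R M N (a \<otimes>\<^bsub>M\<^esub> a') (b \<otimes>\<^bsub>N\<^esub> b')) U) T"
  unfolding lift2_tensor_space by (simp add: tensor_def Let_def)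

lemma tensor_one: "\<one>\<^bsub>tensor R M N\<^esub> = pure_tensor R M N \<one>\<^bsub>M\<^esub> \<one>\<^bsub>N\<^esub>"
  by (simp add: tensor_def Let_def)

lemma lift2_add:
  assumes "abelian_group G" "balanced R M N G f" "balanced R M N G g" "T \<in> carrier (tensor R M N)"
  shows "lift2 G (\<lambda>x y. f x y \<oplus>\<^bsub>G\<^esub> g x y) T = lift2 G f T \<oplus>\<^bsub>G\<^esub> lift2 G g T"
proof -
  have s: "Poly_Mapping.keys (SOME q. q \<in> T) \<subseteq> carrier M \<times> carrier N"
    using frag.some_in_carrier assms(4) by (simp add: carrier_tensor)
  have "(\<lambda>(a, b). f a b \<oplus>\<^bsub>G\<^esub> g a b) = (\<lambda>x. (\<lambda>(a, b). f a b) x \<oplus>\<^bsub>G\<^esub> (\<lambda>(a, b). g a b) x)"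
    by auto
  then show ?thesis
    unfolding lift2_fragsum using balancedD(1)[OF assms(2)] balancedD(1)[OF assms(3)]
    by (simp only:) (intro fragsum_addf[OF assms(1) _ _ s]; auto)
qed

text \<open>Both sides sum over the same chosen representative of \<open>T\<close>, whose support
  lies in the carriers; hence agreement of the integrands there is enough.\<close>

lemma lift2_cong:
  assumes "abelian_group G" "T \<in> carrier (tensor R M N)"
    "\<And>a b. a \<in> carrier M \<Longrightarrow> b \<in> carrier N \<Longrightarrow> g a b \<in> carrier G"
    "\<And>a b. a \<in> carrier M \<Longrightarrow> b \<in> carrier N \<Longrightarrow> f a b = g a b"
  shows "lift2 G f T = lift2 G g T"
proof -
  have s: "Poly_Mapping.keys (SOME q. q \<in> T) \<subseteq> carrier M \<times> carrier N"
    using frag.some_in_carrier assms(2) by (simp add: carrier_tensor)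
  show ?thesis
    unfolding lift2_fragsum using assms(3,4) by (intro fragsum_cong[OF assms(1) _ s]) auto
qed

lemma lift2_closed:
  assumes "abelian_group G" "T \<in> carrier (tensor R M N)"
    "\<And>a b. a \<in> carrier M \<Longrightarrow> b \<in> carrier N \<Longrightarrow> f a b \<in> carrier G"
  shows "lift2 G f T \<in> carrier G"
proof -
  have s: "Poly_Mapping.keys (SOME q. q \<in> T) \<subseteq> carrier M \<times> carrier N"
    using frag.some_in_carrier assms(2) by (simp add: carrier_tensor)
  show ?thesis
    unfolding lift2_fragsum using assms(3) by (intro fragsum_closed[OF assms(1) _ s]) auto
qed

lemma hom_lift2:
  assumes "abelian_group G" "abelian_group G'" "addhom G G' h" "T \<in> carrier (tensor R M N)"
    "\<And>a b. a \<in> carrier M \<Longrightarrow> b \<in> carrier N \<Longrightarrow> f a b \<in> carrier G"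
  shows "h (lift2 G f T) = lift2 G' (\<lambda>a b. h (f a b)) T"
proof -
  have s: "Poly_Mapping.keys (SOME q. q \<in> T) \<subseteq> carrier M \<times> carrier N"
    using frag.some_in_carrier assms(4) by (simp add: carrier_tensor)
  have e: "(\<lambda>x. h (case x of (a, b) \<Rightarrow> f a b)) = (\<lambda>(a, b). h (f a b))" by auto
  show ?thesis
    unfolding lift2_fragsum e[symmetric] using assms(5)
    by (intro addhom_fragsum[OF assms(1-3) _ s]) auto
qed

end

section \<open>Sweedler sums\<close>

lemma linear_mapI:
  assumes "\<And>x. x \<in> carrier M \<Longrightarrow> f x \<in> carrier N"
    "\<And>x y. x \<in> carrier M \<Longrightarrow> y \<in> carrier M \<Longrightarrow> f (x \<oplus>\<^bsub>M\<^esub> y) = f x \<oplus>\<^bsub>N\<^esub> f y"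
    "\<And>r x. r \<in> carrier R \<Longrightarrow> x \<in> carrier M \<Longrightarrow> f (r \<odot>\<^bsub>M\<^esub> x) = r \<odot>\<^bsub>N\<^esub> f x"
  shows "linear_map R M N f"
  using assms by (auto simp: linear_map_def)

lemma linear_mapD:
  assumes "linear_map R M N f"
  shows "x \<in> carrier M \<Longrightarrow> f x \<in> carrier N"
    "x \<in> carrier M \<Longrightarrow> y \<in> carrier M \<Longrightarrow> f (x \<oplus>\<^bsub>M\<^esub> y) = f x \<oplus>\<^bsub>N\<^esub> f y"
    "r \<in> carrier R \<Longrightarrow> x \<in> carrier M \<Longrightarrow> f (r \<odot>\<^bsub>M\<^esub> x) = r \<odot>\<^bsub>N\<^esub> f x"
  using assms by (auto simp: linear_map_def)

lemma linear_map_addhom: "linear_map R M N f \<Longrightarrow> addhom M N f"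
  by (auto simp: linear_map_def addhom_def)

lemma linear_map_comp:
  "linear_map R M N f \<Longrightarrow> linear_map R N P g \<Longrightarrow> linear_map R M P (\<lambda>x. g (f x))"
  by (auto simp: linear_map_def Pi_iff)

lemma premoduleI: "module R M \<Longrightarrow> premodule R M"
  by (simp add: premodule_def module.smult_closed module.axioms)

definition alg_hom ::
    "('r, 'm) ring_scheme \<Rightarrow> ('r, 'a, 'n) module_scheme \<Rightarrow> ('r, 'b, 'o) module_scheme
      \<Rightarrow> ('a \<Rightarrow> 'b) \<Rightarrow> bool" where
  "alg_hom R A B f \<longleftrightarrow> linear_map R A B f \<and> f \<in> ring_hom A B"

lemma alg_homD:
  assumes "alg_hom R A B f"
  shows "linear_map R A B f"
    "x \<in> carrier A \<Longrightarrow> f x \<in> carrier B"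
    "x \<in> carrier A \<Longrightarrow> y \<in> carrier A \<Longrightarrow> f (x \<oplus>\<^bsub>A\<^esub> y) = f x \<oplus>\<^bsub>B\<^esub> f y"
    "x \<in> carrier A \<Longrightarrow> y \<in> carrier A \<Longrightarrow> f (x \<otimes>\<^bsub>A\<^esub> y) = f x \<otimes>\<^bsub>B\<^esub> f y"
    "r \<in> carrier R \<Longrightarrow> x \<in> carrier A \<Longrightarrow> f (r \<odot>\<^bsub>A\<^esub> x) = r \<odot>\<^bsub>B\<^esub> f x"
    "f \<one>\<^bsub>A\<^esub> = \<one>\<^bsub>B\<^esub>"
  using assms by (auto simp: alg_hom_def linear_map_def ring_hom_def)

lemma alg_hom_comp:
  "alg_hom R A B f \<Longrightarrow> alg_hom R B C g \<Longrightarrow> alg_hom R A C (\<lambda>x. g (f x))"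
  by (auto simp: alg_hom_def linear_map_def ring_hom_def Pi_iff)

locale algebra_over =
  fixes R :: "('r, 'm) ring_scheme" and A :: "('r, 'a, 'n) module_scheme"
  assumes assoc_algebra: "assoc_algebra R A"
begin

lemma module_axioms: "module R A" and ring_A: "ring A"
  using assoc_algebra by (simp_all add: assoc_algebra_def)

lemma scalars: "cring R"
  by (rule module.axioms(1)[OF module_axioms])

sublocale plain_group A
  by (rule plain_group.intro) (rule module.axioms(2)[OF module_axioms])

sublocale A: plain_ring A
  by (intro plain_ring.intro plain_ring_axioms.intro plain_group_axioms ring_A)

lemmas smult_closed [intro, simp] = module.smult_closed[OF module_axioms]
lemmas smult_null [simp] = module.smult_l_null[OF module_axioms] module.smult_r_null[OF module_axioms]
lemmas smult_one [simp] = module.smult_one[OF module_axioms]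
lemmas smult_l_distr = module.smult_l_distr[OF module_axioms]
lemmas smult_r_distr = module.smult_r_distr[OF module_axioms]
lemmas smult_assoc1 = module.smult_assoc1[OF module_axioms]
lemmas smult_l_minus = module.smult_l_minus[OF module_axioms]

lemma smult_mult:
  "r \<in> carrier R \<Longrightarrow> x \<in> carrier A \<Longrightarrow> y \<in> carrier A \<Longrightarrow>
     (r \<odot>\<^bsub>A\<^esub> x) \<otimes>\<^bsub>A\<^esub> y = r \<odot>\<^bsub>A\<^esub> (x \<otimes>\<^bsub>A\<^esub> y)"
  "r \<in> carrier R \<Longrightarrow> x \<in> carrier A \<Longrightarrow> y \<in> carrier A \<Longrightarrow>
     x \<otimes>\<^bsub>A\<^esub> (r \<odot>\<^bsub>A\<^esub> y) = r \<odot>\<^bsub>A\<^esub> (x \<otimes>\<^bsub>A\<^esub> y)"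
  using assoc_algebra by (auto simp: assoc_algebra_def)

lemma addhom_mult_left: "a \<in> carrier A \<Longrightarrow> addhom A A (\<lambda>x. a \<otimes>\<^bsub>A\<^esub> x)"
  by (rule addhomI) (auto simp: A.r_distr)

lemma addhom_mult_right: "a \<in> carrier A \<Longrightarrow> addhom A A (\<lambda>x. x \<otimes>\<^bsub>A\<^esub> a)"
  by (rule addhomI) (auto simp: A.l_distr)

lemma addhom_smult: "r \<in> carrier R \<Longrightarrow> addhom A A (\<lambda>x. r \<odot>\<^bsub>A\<^esub> x)"
  by (rule addhomI) (auto simp: smult_r_distr)

lemma balanced_mult:
  assumes f: "linear_map R M A f" and g: "linear_map R N A g"
  shows "balanced R M N A (\<lambda>x y. f x \<otimes>\<^bsub>A\<^esub> g y)"
  by (rule balancedI)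
    (auto simp: linear_mapD[OF f] linear_mapD[OF g] A.l_distr A.r_distr smult_mult)

end

locale hopf =
  fixes k :: "('k, 'm) ring_scheme" and H :: "('k, 'h, 'n) hopf_scheme"
  assumes cring_k: "cring k" and hopf: "hopf_algebra k H"
begin

lemma assoc_H: "assoc_algebra k H"
  using hopf by (simp add: hopf_algebra_def Let_def)

sublocale k: cring k by (rule cring_k)
sublocale H: algebra_over k H by unfold_locales (rule assoc_H)

abbreviation "HH \<equiv> tensor k H H"
abbreviation "\<epsilon> \<equiv> counit H"
abbreviation "\<Delta> \<equiv> comult H"
abbreviation "sw G \<equiv> sweedler G H"

lemma premodule_H: "premodule k H"
  by (rule premoduleI) (rule H.module_axioms)

sublocale HH: tensor_product k H H
  by unfold_locales (rule premodule_H)+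

lemma comult_linear: "linear_map k H HH \<Delta>"
  and comult_hom: "\<Delta> \<in> ring_hom H HH"
  and counit_linear: "linear_map k H (as_algebra id k) \<epsilon>"
  and counit_hom: "\<epsilon> \<in> ring_hom H k"
  using hopf by (simp_all add: hopf_algebra_def Let_def)

lemma counit_closed [simp]: "x \<in> carrier H \<Longrightarrow> \<epsilon> x \<in> carrier k"
  using counit_hom by (auto simp: ring_hom_def)

lemma counit_simps:
  "x \<in> carrier H \<Longrightarrow> y \<in> carrier H \<Longrightarrow> \<epsilon> (x \<oplus>\<^bsub>H\<^esub> y) = \<epsilon> x \<oplus>\<^bsub>k\<^esub> \<epsilon> y"
  "x \<in> carrier H \<Longrightarrow> y \<in> carrier H \<Longrightarrow> \<epsilon> (x \<otimes>\<^bsub>H\<^esub> y) = \<epsilon> x \<otimes>\<^bsub>k\<^esub> \<epsilon> y"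
  "r \<in> carrier k \<Longrightarrow> x \<in> carrier H \<Longrightarrow> \<epsilon> (r \<odot>\<^bsub>H\<^esub> x) = r \<otimes>\<^bsub>k\<^esub> \<epsilon> x"
  "\<epsilon> \<one>\<^bsub>H\<^esub> = \<one>\<^bsub>k\<^esub>"
  using counit_hom counit_linear by (auto simp: ring_hom_def linear_map_def as_algebra_def)

lemma comult_closed: "x \<in> carrier H \<Longrightarrow> \<Delta> x \<in> carrier HH"
  using linear_mapD(1)[OF comult_linear] .

text \<open>A Sweedler sum runs over one fixed finite representative of \<open>\<Delta> x\<close>.
  Since its support is known, such sums can be compared, added and interchanged termwise;
  bilinearity of the integrand matters only when \<open>x\<close> itself is rewritten.\<close>

lemma comult_rep: "x \<in> carrier H \<Longrightarrow> Poly_Mapping.keys (SOME p. p \<in> \<Delta> x) \<subseteq> carrier H \<times> carrier H"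
  using HH.frag.some_in_carrier comult_closed by (simp add: HH.carrier_tensor)

lemma sweedler_fragsum: "sw G f x = fragsum G (\<lambda>(a, b). f a b) (SOME p. p \<in> \<Delta> x)"
  by (simp add: sweedler_def lift2_fragsum)

lemma sweedler_closed:
  assumes "abelian_group G" "x \<in> carrier H"
    "\<And>a b. a \<in> carrier H \<Longrightarrow> b \<in> carrier H \<Longrightarrow> f a b \<in> carrier G"
  shows "sw G f x \<in> carrier G"
  unfolding sweedler_fragsum using assms(3)
  by (intro fragsum_closed[OF assms(1) _ comult_rep[OF assms(2)]]) auto

lemma sweedler_hom:
  assumes "abelian_group G" "abelian_group G'" "addhom G G' h" "x \<in> carrier H"
    "\<And>a b. a \<in> carrier H \<Longrightarrow> b \<in> carrier H \<Longrightarrow> f a b \<in> carrier G"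
  shows "h (sw G f x) = sw G' (\<lambda>a b. h (f a b)) x"
proof -
  have "h (sw G f x) = fragsum G' (\<lambda>x. h (case x of (a, b) \<Rightarrow> f a b)) (SOME p. p \<in> \<Delta> x)"
    unfolding sweedler_fragsum using assms(5)
    by (intro addhom_fragsum[OF assms(1-3) _ comult_rep[OF assms(4)]]) auto
  moreover have "(\<lambda>x. h (case x of (a, b) \<Rightarrow> f a b)) = (\<lambda>(a, b). h (f a b))" by auto
  ultimately show ?thesis by (simp add: sweedler_fragsum)
qed

lemma sweedler_cong:
  assumes "abelian_group G" "x \<in> carrier H"
    "\<And>a b. a \<in> carrier H \<Longrightarrow> b \<in> carrier H \<Longrightarrow> g a b \<in> carrier G"
    "\<And>a b. a \<in> carrier H \<Longrightarrow> b \<in> carrier H \<Longrightarrow> f a b = g a b"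
  shows "sw G f x = sw G g x"
  unfolding sweedler_fragsum using assms(3,4)
  by (intro fragsum_cong[OF assms(1) _ comult_rep[OF assms(2)]]) auto

lemma sweedler_cong_add: "same_add G G' \<Longrightarrow> sw G = sw G'"
  by (intro ext) (simp add: sweedler_fragsum fragsum_cong_add)

lemma sweedler_add:
  assumes "abelian_group G" "x \<in> carrier H"
    "\<And>a b. a \<in> carrier H \<Longrightarrow> b \<in> carrier H \<Longrightarrow> f a b \<in> carrier G"
    "\<And>a b. a \<in> carrier H \<Longrightarrow> b \<in> carrier H \<Longrightarrow> g a b \<in> carrier G"
  shows "sw G (\<lambda>a b. f a b \<oplus>\<^bsub>G\<^esub> g a b) x = sw G f x \<oplus>\<^bsub>G\<^esub> sw G g x"
proof -
  have "(\<lambda>(a, b). f a b \<oplus>\<^bsub>G\<^esub> g a b) = (\<lambda>x. (\<lambda>(a, b). f a b) x \<oplus>\<^bsub>G\<^esub> (\<lambda>(a, b). g a b) x)"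
    by auto
  then show ?thesis
    unfolding sweedler_fragsum using assms(3,4)
    by (simp only:) (intro fragsum_addf[OF assms(1) _ _ comult_rep[OF assms(2)]]; auto)
qed

lemma sweedler_swap:
  assumes "abelian_group G" "x \<in> carrier H" "y \<in> carrier H"
    "\<And>a b c d. a \<in> carrier H \<Longrightarrow> b \<in> carrier H \<Longrightarrow> c \<in> carrier H \<Longrightarrow> d \<in> carrier H \<Longrightarrow>
       f a b c d \<in> carrier G"
  shows "sw G (\<lambda>a b. sw G (\<lambda>c d. f a b c d) y) x = sw G (\<lambda>c d. sw G (\<lambda>a b. f a b c d) x) y"
proof -
  show ?thesis
    unfolding sweedler_fragsum split_def using assms(4)
    by (intro fragsum_swap[OF assms(1) comult_rep[OF assms(2)] comult_rep[OF assms(3)]]) auto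
qed

lemma sweedler_addhom:
  assumes "abelian_group G" "balanced k H H G f"
  shows "addhom H G (sw G f)"
  unfolding sweedler_def
  by (rule addhom_comp[OF linear_map_addhom[OF comult_linear] HH.lift2_hom(1)[OF assms]])

text \<open>Additivity of \<open>lift2 G f\<close> carries it inside the sum over the representative
  of \<open>T\<close>, whatever the family \<open>g\<close> is.\<close>

lemma lift2_lift2:
  assumes "abelian_group G" "balanced k H H G f" "T \<in> carrier HH"
    "\<And>a b. a \<in> carrier H \<Longrightarrow> b \<in> carrier H \<Longrightarrow> g a b \<in> carrier HH"
  shows "lift2 G f (lift2 HH g T) = lift2 G (\<lambda>a b. lift2 G f (g a b)) T"
proof -
  have s: "Poly_Mapping.keys (SOME q. q \<in> T) \<subseteq> carrier H \<times> carrier H"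
    using HH.frag.some_in_carrier assms(3) by (simp add: HH.carrier_tensor)
  have e: "(\<lambda>x. lift2 G f (case x of (a, b) \<Rightarrow> g a b)) = (\<lambda>(a, b). lift2 G f (g a b))" by auto
  show ?thesis
    unfolding lift2_fragsum[of HH] lift2_fragsum[of G _ T] e[symmetric] using assms(4)
    by (intro addhom_fragsum[OF HH.tensor_abelian assms(1) HH.lift2_hom(1)[OF assms(1,2)] _ s]) auto
qed

text \<open>The chosen representative of the coproduct of a multiple of \<open>x\<close> is
  unrelated to that of \<open>\<Delta> x\<close>. Linearity of \<open>\<Delta>\<close> identifies
  only the cosets, so balancedness of \<open>f\<close> is essential here.\<close>

lemma sweedler_smult:
  assumes "abelian_group G" "balanced k H H G f" "r \<in> carrier k" "x \<in> carrier H"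
  shows "sw G f (r \<odot>\<^bsub>H\<^esub> x) = sw G (\<lambda>a b. f (r \<odot>\<^bsub>H\<^esub> a) b) x"
proof -
  have "\<Delta> (r \<odot>\<^bsub>H\<^esub> x) = lift2 HH (\<lambda>a b. pure_tensor k H H (r \<odot>\<^bsub>H\<^esub> a) b) (\<Delta> x)"
    using linear_mapD(3)[OF comult_linear assms(3,4)] by (simp add: HH.tensor_smult)
  then have "sw G f (r \<odot>\<^bsub>H\<^esub> x)
      = lift2 G (\<lambda>a b. lift2 G f (pure_tensor k H H (r \<odot>\<^bsub>H\<^esub> a) b)) (\<Delta> x)"
    using assms by (simp add: sweedler_def lift2_lift2 comult_closed HH.pure_closed)
  also have "\<dots> = sw G (\<lambda>a b. f (r \<odot>\<^bsub>H\<^esub> a) b) x"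
    unfolding sweedler_def[symmetric] using assms balancedD(1)[OF assms(2)]
    by (intro sweedler_cong) (auto simp: HH.lift2_hom(2)[OF assms(1,2)])
  finally show ?thesis .
qed

text \<open>Multiplicativity of \<open>\<Delta>\<close> in summed form: the product in
  \<open>HH\<close> unfolds to a double lift, through which the map induced by \<open>f\<close> is
  moved.\<close>

lemma sweedler_mult:
  assumes "abelian_group G" "balanced k H H G f" "x \<in> carrier H" "y \<in> carrier H"
  shows "sw G f (x \<otimes>\<^bsub>H\<^esub> y)
    = sw G (\<lambda>a b. sw G (\<lambda>c d. f (a \<otimes>\<^bsub>H\<^esub> c) (b \<otimes>\<^bsub>H\<^esub> d)) y) x"
proof -
  let ?\<tau> = "pure_tensor k H H"
  have "\<Delta> (x \<otimes>\<^bsub>H\<^esub> y) = \<Delta> x \<otimes>\<^bsub>HH\<^esub> \<Delta> y"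
    using comult_hom assms by (auto simp: ring_hom_def)
  also have "\<dots> = sw HH (\<lambda>a b. sw HH (\<lambda>c d. ?\<tau> (a \<otimes>\<^bsub>H\<^esub> c) (b \<otimes>\<^bsub>H\<^esub> d)) y) x"
    by (simp add: HH.tensor_mult sweedler_def)
  finally have "sw G f (x \<otimes>\<^bsub>H\<^esub> y)
      = lift2 G f (sw HH (\<lambda>a b. sw HH (\<lambda>c d. ?\<tau> (a \<otimes>\<^bsub>H\<^esub> c) (b \<otimes>\<^bsub>H\<^esub> d)) y) x)"
    by (simp add: sweedler_def)
  also have "\<dots> = sw G (\<lambda>a b. lift2 G f (sw HH (\<lambda>c d. ?\<tau> (a \<otimes>\<^bsub>H\<^esub> c) (b \<otimes>\<^bsub>H\<^esub> d)) y)) x"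
    using assms HH.tensor_abelian HH.lift2_hom(1)[OF assms(1,2)]
    by (intro sweedler_hom) (auto intro!: sweedler_closed HH.pure_closed)
  also have "\<dots> = sw G (\<lambda>a b. sw G (\<lambda>c d. f (a \<otimes>\<^bsub>H\<^esub> c) (b \<otimes>\<^bsub>H\<^esub> d)) y) x"
  proof (intro sweedler_cong assms)
    fix a b assume ab: "a \<in> carrier H" "b \<in> carrier H"
    show "sw G (\<lambda>c d. f (a \<otimes>\<^bsub>H\<^esub> c) (b \<otimes>\<^bsub>H\<^esub> d)) y \<in> carrier G"
      using assms ab balancedD(1)[OF assms(2)] by (auto intro!: sweedler_closed)
    have "lift2 G f (sw HH (\<lambda>c d. ?\<tau> (a \<otimes>\<^bsub>H\<^esub> c) (b \<otimes>\<^bsub>H\<^esub> d)) y)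
        = sw G (\<lambda>c d. lift2 G f (?\<tau> (a \<otimes>\<^bsub>H\<^esub> c) (b \<otimes>\<^bsub>H\<^esub> d))) y"
      using assms HH.tensor_abelian HH.lift2_hom(1)[OF assms(1,2)] ab
      by (intro sweedler_hom) (auto intro!: HH.pure_closed)
    also have "\<dots> = sw G (\<lambda>c d. f (a \<otimes>\<^bsub>H\<^esub> c) (b \<otimes>\<^bsub>H\<^esub> d)) y"
      using assms ab balancedD(1)[OF assms(2)]
      by (intro sweedler_cong) (auto simp: HH.lift2_hom(2)[OF assms(1,2)])
    finally show "lift2 G f (sw HH (\<lambda>c d. ?\<tau> (a \<otimes>\<^bsub>H\<^esub> c) (b \<otimes>\<^bsub>H\<^esub> d)) y)
        = sw G (\<lambda>c d. f (a \<otimes>\<^bsub>H\<^esub> c) (b \<otimes>\<^bsub>H\<^esub> d)) y" .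
  qed
  finally show ?thesis .
qed

lemma sweedler_one:
  assumes "abelian_group G" "balanced k H H G f"
  shows "sw G f \<one>\<^bsub>H\<^esub> = f \<one>\<^bsub>H\<^esub> \<one>\<^bsub>H\<^esub>"
proof -
  have "\<Delta> \<one>\<^bsub>H\<^esub> = pure_tensor k H H \<one>\<^bsub>H\<^esub> \<one>\<^bsub>H\<^esub>"
    using comult_hom by (simp add: ring_hom_def HH.tensor_one)
  then show ?thesis using HH.lift2_hom(2)[OF assms] by (simp add: sweedler_def)
qed

text \<open>The two counit axioms, transported along the linear map \<open>g\<close>.\<close>

lemma sweedler_counit:
  assumes g: "linear_map k H M g" and M: "module k M" and x: "x \<in> carrier H"
  shows "sw M (\<lambda>a b. \<epsilon> a \<odot>\<^bsub>M\<^esub> g b) x = g x" "sw M (\<lambda>a b. \<epsilon> b \<odot>\<^bsub>M\<^esub> g a) x = g x"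
proof -
  interpret M: module k M by fact
  have "sw H (\<lambda>a b. \<epsilon> a \<odot>\<^bsub>H\<^esub> b) x = x" "sw H (\<lambda>a b. \<epsilon> b \<odot>\<^bsub>H\<^esub> a) x = x"
    using hopf x unfolding hopf_algebra_def Let_def by blast+
  moreover have "g (sw H (\<lambda>a b. \<epsilon> a \<odot>\<^bsub>H\<^esub> b) x) = sw M (\<lambda>a b. g (\<epsilon> a \<odot>\<^bsub>H\<^esub> b)) x"
    using x by (intro sweedler_hom linear_map_addhom[OF g]) (auto intro: M.abelian_group_axioms H.abelian_group_axioms)
  moreover have "g (sw H (\<lambda>a b. \<epsilon> b \<odot>\<^bsub>H\<^esub> a) x) = sw M (\<lambda>a b. g (\<epsilon> b \<odot>\<^bsub>H\<^esub> a)) x"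
    using x by (intro sweedler_hom linear_map_addhom[OF g]) (auto intro: M.abelian_group_axioms H.abelian_group_axioms)
  moreover have "sw M (\<lambda>a b. g (\<epsilon> a \<odot>\<^bsub>H\<^esub> b)) x = sw M (\<lambda>a b. \<epsilon> a \<odot>\<^bsub>M\<^esub> g b) x"
    using x by (intro sweedler_cong M.abelian_group_axioms) (auto simp: linear_mapD[OF g])
  moreover have "sw M (\<lambda>a b. g (\<epsilon> b \<odot>\<^bsub>H\<^esub> a)) x = sw M (\<lambda>a b. \<epsilon> b \<odot>\<^bsub>M\<^esub> g a) x"
    using x by (intro sweedler_cong M.abelian_group_axioms) (auto simp: linear_mapD[OF g])
  ultimately show "sw M (\<lambda>a b. \<epsilon> a \<odot>\<^bsub>M\<^esub> g b) x = g x" "sw M (\<lambda>a b. \<epsilon> b \<odot>\<^bsub>M\<^esub> g a) x = g x"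
    by simp_all
qed

end

section \<open>The threefold tensor product and coassociativity for trilinear maps\<close>

context hopf begin

abbreviation "HHH \<equiv> tensor k HH H"

lemma lift2_lift2_smult:
  assumes "abelian_group G" "balanced k H H G f" "r \<in> carrier k" "T \<in> carrier HH"
  shows "lift2 G f (r \<odot>\<^bsub>HH\<^esub> T) = lift2 G (\<lambda>a b. f (r \<odot>\<^bsub>H\<^esub> a) b) T"
  unfolding HH.tensor_smult using assms balancedD(1)[OF assms(2)]
  by (subst lift2_lift2[OF assms(1,2)])
    (auto intro!: HH.lift2_cong[OF assms(1)] HH.pure_closed simp: HH.lift2_hom(2)[OF assms(1,2)])

lemma premodule_HH: "premodule k HH"
  unfolding premodule_def
  by (auto simp: HH.tensor_abelian HH.tensor_smult intro!: HH.lift2_closed HH.pure_closed)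

sublocale HHH: tensor_product k HH H
  by unfold_locales (rule premodule_HH premodule_H)+

text \<open>Balancedness in each pair of neighbouring arguments, which is what a map out of
  \<open>(H \<otimes> H) \<otimes> H\<close> requires of its curried form.\<close>

definition trilinear :: "('g, 'o) ring_scheme \<Rightarrow> ('h \<Rightarrow> 'h \<Rightarrow> 'h \<Rightarrow> 'g) \<Rightarrow> bool" where
  "trilinear G f \<longleftrightarrow>
     (\<forall>z\<in>carrier H. balanced k H H G (\<lambda>x y. f x y z)) \<and>
     (\<forall>x\<in>carrier H. balanced k H H G (\<lambda>y z. f x y z))"

text \<open>The coassociativity axiom is an equation in \<open>HHH\<close>. A trilinear
  \<open>f\<close> induces an additive map on \<open>HHH\<close>, and applying it to the two sides
  produces the two nestings.\<close>

lemma coassoc: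
  assumes G: "abelian_group G" and f: "trilinear G f" and x: "x \<in> carrier H"
  shows "sw G (\<lambda>a b. sw G (\<lambda>c d. f c d b) a) x = sw G (\<lambda>a b. sw G (\<lambda>c d. f a c d) b) x"
proof -
  interpret G: abelian_group G by fact
  \<comment> \<open>\<open>F\<close> lifts \<open>f\<close> in its first two arguments, so that it
    can be paired with the last one over \<open>HHH\<close>.\<close>
  define F where "F T z = lift2 G (\<lambda>x y. f x y z) T" for T z
  have f1: "balanced k H H G (\<lambda>x y. f x y z)" if "z \<in> carrier H" for z
    using f that by (simp add: trilinear_def)
  have f2: "balanced k H H G (\<lambda>y z. f x y z)" if "x \<in> carrier H" for x
    using f that by (simp add: trilinear_def)
  have F: "balanced k HH H G F"
  proof (rule balancedI)
    show "F T z \<in> carrier G" if "T \<in> carrier HH" "z \<in> carrier H" for T z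
      unfolding F_def using that addhom_closed[OF HH.lift2_hom(1)[OF G f1]] by blast
    show "F (T \<oplus>\<^bsub>HH\<^esub> T') z = F T z \<oplus>\<^bsub>G\<^esub> F T' z"
      if "T \<in> carrier HH" "T' \<in> carrier HH" "z \<in> carrier H" for T T' z
      unfolding F_def using that addhom_add[OF HH.lift2_hom(1)[OF G f1]] by blast
    show "F T (z \<oplus>\<^bsub>H\<^esub> z') = F T z \<oplus>\<^bsub>G\<^esub> F T z'"
      if "T \<in> carrier HH" "z \<in> carrier H" "z' \<in> carrier H" for T z z'
      unfolding F_def using that balancedD(1,3)[OF f2] G
      by (subst HH.lift2_add[OF G f1 f1, symmetric])
        (auto intro!: HH.lift2_cong[OF G] G.a_closed)
    show "F (r \<odot>\<^bsub>HH\<^esub> T) z = F T (r \<odot>\<^bsub>H\<^esub> z)"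
      if "r \<in> carrier k" "T \<in> carrier HH" "z \<in> carrier H" for r T z
      unfolding F_def using that balancedD(1,4)[OF f2] balancedD(1,4)[OF f1]
      by (subst lift2_lift2_smult[OF G f1]) (auto intro!: HH.lift2_cong[OF G])
  qed
  let ?\<tau> = "pure_tensor k H H" and ?\<tau>' = "pure_tensor k HH H"
  note FL = HHH.lift2_hom[OF G F]
  have co: "sw HHH (\<lambda>x1 x2. ?\<tau>' (\<Delta> x1) x2) x = sw HHH (\<lambda>x1 x'. sw HHH (\<lambda>x2 x3. ?\<tau>' (?\<tau> x1 x2) x3) x') x"
    using hopf x unfolding hopf_algebra_def Let_def sweedler3_def by blast
  have "lift2 G F (sw HHH (\<lambda>x1 x2. ?\<tau>' (\<Delta> x1) x2) x) = sw G (\<lambda>x1 x2. lift2 G F (?\<tau>' (\<Delta> x1) x2)) x"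
    using x by (intro sweedler_hom[OF HHH.tensor_abelian G FL(1)] HHH.pure_closed comult_closed)
  also have "\<dots> = sw G (\<lambda>a b. sw G (\<lambda>c d. f c d b) a) x"
    using x FL(2) balancedD(1)[OF f2] comult_closed
    by (intro sweedler_cong[OF G]) (auto simp: F_def sweedler_def[symmetric] intro!: sweedler_closed[OF G])
  finally have l: "lift2 G F (sw HHH (\<lambda>x1 x2. ?\<tau>' (\<Delta> x1) x2) x) = sw G (\<lambda>a b. sw G (\<lambda>c d. f c d b) a) x" .
  have "lift2 G F (sw HHH (\<lambda>x1 x'. sw HHH (\<lambda>x2 x3. ?\<tau>' (?\<tau> x1 x2) x3) x') x)
      = sw G (\<lambda>x1 x'. lift2 G F (sw HHH (\<lambda>x2 x3. ?\<tau>' (?\<tau> x1 x2) x3) x')) x"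
    using x
    by (intro sweedler_hom[OF HHH.tensor_abelian G FL(1)] sweedler_closed[OF HHH.tensor_abelian]
        HHH.pure_closed HH.pure_closed)
  also have "\<dots> = sw G (\<lambda>a b. sw G (\<lambda>c d. f a c d) b) x"
  proof (intro sweedler_cong[OF G x])
    fix a b assume ab: "a \<in> carrier H" "b \<in> carrier H"
    show "sw G (\<lambda>c d. f a c d) b \<in> carrier G"
      using ab balancedD(1)[OF f2] by (intro sweedler_closed[OF G])
    have "lift2 G F (sw HHH (\<lambda>x2 x3. ?\<tau>' (?\<tau> a x2) x3) b)
      = sw G (\<lambda>x2 x3. lift2 G F (?\<tau>' (?\<tau> a x2) x3)) b"
      using ab by (intro sweedler_hom[OF HHH.tensor_abelian G FL(1)] HHH.pure_closed HH.pure_closed)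
    also have "\<dots> = sw G (\<lambda>c d. f a c d) b"
      using ab FL(2) balancedD(1)[OF f2]
      by (intro sweedler_cong[OF G]) (auto simp: F_def HH.pure_closed HH.lift2_hom(2)[OF G f1])
    finally show "lift2 G F (sw HHH (\<lambda>x2 x3. ?\<tau>' (?\<tau> a x2) x3) b) = sw G (\<lambda>c d. f a c d) b" .
  qed
  finally show ?thesis using l co by simp
qed

section \<open>Convolution algebras\<close>

text \<open>\<open>conv A\<close> is \<open>Hom(H, A)\<close>, represented by functions that are extensional on \<open>carrier H\<close>.
  \<open>Hom(H\<^sup>\<otimes>\<^sup>n, A)\<close> is obtained in curried form by iterating \<open>conv\<close>; identities between
  Sweedler sums in several arguments thus become identities in an associative algebra.\<close>

definition conv :: "('k, 'a, 'o) module_scheme \<Rightarrow> ('k, 'h \<Rightarrow> 'a) module" where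
  "conv A =
     \<lparr>carrier = {f \<in> extensional (carrier H). linear_map k H A f},
      monoid.mult = (\<lambda>f g. \<lambda>x\<in>carrier H. sw A (\<lambda>a b. f a \<otimes>\<^bsub>A\<^esub> g b) x),
      one = (\<lambda>x\<in>carrier H. \<epsilon> x \<odot>\<^bsub>A\<^esub> \<one>\<^bsub>A\<^esub>),
      ring.zero = (\<lambda>x\<in>carrier H. \<zero>\<^bsub>A\<^esub>),
      add = (\<lambda>f g. \<lambda>x\<in>carrier H. f x \<oplus>\<^bsub>A\<^esub> g x),
      smult = (\<lambda>r f. \<lambda>x\<in>carrier H. r \<odot>\<^bsub>A\<^esub> f x)\<rparr>"

lemma conv_carrierD:
  assumes "f \<in> carrier (conv A)"
  shows "f \<in> extensional (carrier H)" "linear_map k H A f" "x \<in> carrier H \<Longrightarrow> f x \<in> carrier A"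
  using assms by (auto simp: conv_def linear_map_def)

lemma conv_eqI:
  assumes "f \<in> carrier (conv A)" "g \<in> carrier (conv A)" "\<And>x. x \<in> carrier H \<Longrightarrow> f x = g x"
  shows "f = g"
  using assms by (intro extensionalityI[of f "carrier H" g]) (auto simp: conv_def)

lemma conv_apply:
  assumes "x \<in> carrier H"
  shows "(f \<otimes>\<^bsub>conv A\<^esub> g) x = sw A (\<lambda>a b. f a \<otimes>\<^bsub>A\<^esub> g b) x"
    "\<one>\<^bsub>conv A\<^esub> x = \<epsilon> x \<odot>\<^bsub>A\<^esub> \<one>\<^bsub>A\<^esub>"
    "\<zero>\<^bsub>conv A\<^esub> x = \<zero>\<^bsub>A\<^esub>"
    "(f \<oplus>\<^bsub>conv A\<^esub> g) x = f x \<oplus>\<^bsub>A\<^esub> g x"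
    "(r \<odot>\<^bsub>conv A\<^esub> f) x = r \<odot>\<^bsub>A\<^esub> f x"
  using assms by (simp_all add: conv_def)

lemma conv_restrict: "linear_map k H A f \<Longrightarrow> restrict f (carrier H) \<in> carrier (conv A)"
  by (auto simp: conv_def linear_map_def)

end

locale hopf_conv = hopf k H + A: algebra_over k A
  for k :: "('k, 'm) ring_scheme" and H :: "('k, 'h, 'n) hopf_scheme"
    and A :: "('k, 'a, 'o) module_scheme"
begin

lemma sweedler_linear:
  assumes "balanced k H H A f" "\<And>r a b. r \<in> carrier k \<Longrightarrow> a \<in> carrier H \<Longrightarrow> b \<in> carrier H \<Longrightarrow>
    f (r \<odot>\<^bsub>H\<^esub> a) b = r \<odot>\<^bsub>A\<^esub> f a b"
  shows "linear_map k H A (sw A f)"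
proof (rule linear_mapI)
  show "sw A f (x \<oplus>\<^bsub>H\<^esub> y) = sw A f x \<oplus>\<^bsub>A\<^esub> sw A f y" if "x \<in> carrier H" "y \<in> carrier H" for x y
    using addhom_add[OF sweedler_addhom[OF A.abelian_group_axioms assms(1)] that] .
  show "sw A f (r \<odot>\<^bsub>H\<^esub> x) = r \<odot>\<^bsub>A\<^esub> sw A f x" if rx: "r \<in> carrier k" "x \<in> carrier H" for r x
  proof -
    have "sw A f (r \<odot>\<^bsub>H\<^esub> x) = sw A (\<lambda>a b. f (r \<odot>\<^bsub>H\<^esub> a) b) x"
      by (rule sweedler_smult[OF A.abelian_group_axioms assms(1) rx])
    also have "\<dots> = sw A (\<lambda>a b. r \<odot>\<^bsub>A\<^esub> f a b) x"
      using rx assms(2) balancedD(1)[OF assms(1)]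
      by (intro sweedler_cong[OF A.abelian_group_axioms]) auto
    also have "\<dots> = r \<odot>\<^bsub>A\<^esub> sw A f x"
      using rx balancedD(1)[OF assms(1)]
      by (intro sweedler_hom[symmetric] A.abelian_group_axioms A.addhom_smult)
    finally show ?thesis .
  qed
qed (use balancedD(1)[OF assms(1)] in \<open>auto intro!: sweedler_closed A.abelian_group_axioms\<close>)

lemma conv_closed:
  assumes f: "f \<in> carrier (conv A)" and g: "g \<in> carrier (conv A)"
  shows "f \<otimes>\<^bsub>conv A\<^esub> g \<in> carrier (conv A)"
proof -
  note f = conv_carrierD[OF f] and g = conv_carrierD[OF g]
  have "linear_map k H A (sw A (\<lambda>a b. f a \<otimes>\<^bsub>A\<^esub> g b))"
    using f(3) g(3)
    by (intro sweedler_linear A.balanced_mult f g) (simp add: linear_mapD[OF f(2)] A.smult_mult)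
  then have "restrict (sw A (\<lambda>a b. f a \<otimes>\<^bsub>A\<^esub> g b)) (carrier H) \<in> carrier (conv A)"
    by (rule conv_restrict)
  then show ?thesis by (simp add: conv_def)
qed

lemma counit_smult_linear:
  "a \<in> carrier A \<Longrightarrow> linear_map k H A (\<lambda>x. \<epsilon> x \<odot>\<^bsub>A\<^esub> a)"
  by (rule linear_mapI) (auto simp: counit_simps A.smult_l_distr A.smult_assoc1)

lemma conv_one_closed: "\<one>\<^bsub>conv A\<^esub> \<in> carrier (conv A)"
  using conv_restrict[OF counit_smult_linear[OF A.A.one_closed]] by (simp add: conv_def)

lemma conv_add_closed:
  assumes f: "f \<in> carrier (conv A)" and g: "g \<in> carrier (conv A)"
  shows "f \<oplus>\<^bsub>conv A\<^esub> g \<in> carrier (conv A)"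
proof -
  note f = conv_carrierD[OF f] and g = conv_carrierD[OF g]
  have "linear_map k H A (\<lambda>x. f x \<oplus>\<^bsub>A\<^esub> g x)"
    by (rule linear_mapI)
      (auto simp: f(3) g(3) linear_mapD[OF f(2)] linear_mapD[OF g(2)] A.smult_r_distr A.a_ac)
  from conv_restrict[OF this] show ?thesis by (simp add: conv_def)
qed

lemma conv_smult_closed:
  assumes r: "r \<in> carrier k" and f: "f \<in> carrier (conv A)"
  shows "r \<odot>\<^bsub>conv A\<^esub> f \<in> carrier (conv A)"
proof -
  note f = conv_carrierD[OF f]
  have "linear_map k H A (\<lambda>x. r \<odot>\<^bsub>A\<^esub> f x)"
    using r by (intro linear_mapI)
      (auto simp: f(3) linear_mapD[OF f(2)] A.smult_r_distr k.m_comm simp flip: A.smult_assoc1)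
  from conv_restrict[OF this] show ?thesis by (simp add: conv_def)
qed

lemma conv_zero_closed: "\<zero>\<^bsub>conv A\<^esub> \<in> carrier (conv A)"
proof -
  have "linear_map k H A (\<lambda>x. \<zero>\<^bsub>A\<^esub>)" by (rule linear_mapI) auto
  from conv_restrict[OF this] show ?thesis by (simp add: conv_def)
qed

lemma trilinear_mult:
  assumes "linear_map k H A f" "linear_map k H A g" "linear_map k H A h"
  shows "trilinear A (\<lambda>a b c. f a \<otimes>\<^bsub>A\<^esub> g b \<otimes>\<^bsub>A\<^esub> h c)"
  unfolding trilinear_def
proof (intro conjI ballI)
  note l = linear_mapD[OF assms(1)] linear_mapD[OF assms(2)] linear_mapD[OF assms(3)]
  show "balanced k H H A (\<lambda>x y. f x \<otimes>\<^bsub>A\<^esub> g y \<otimes>\<^bsub>A\<^esub> h z)" if "z \<in> carrier H" for z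
    using that by (intro balancedI) (auto simp: l A.A.l_distr A.A.r_distr A.smult_mult)
  show "balanced k H H A (\<lambda>y z. f x \<otimes>\<^bsub>A\<^esub> g y \<otimes>\<^bsub>A\<^esub> h z)" if "x \<in> carrier H" for x
    using that by (intro balancedI) (auto simp: l A.A.l_distr A.A.r_distr A.smult_mult)
qed

text \<open>Associativity of \<open>A\<close> combined with coassociativity of \<open>H\<close>; the
  latter applies because a product of linear maps in separate arguments is trilinear.\<close>

lemma conv_assoc:
  assumes f: "f \<in> carrier (conv A)" and g: "g \<in> carrier (conv A)" and h: "h \<in> carrier (conv A)"
  shows "(f \<otimes>\<^bsub>conv A\<^esub> g) \<otimes>\<^bsub>conv A\<^esub> h = f \<otimes>\<^bsub>conv A\<^esub> (g \<otimes>\<^bsub>conv A\<^esub> h)"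
proof (rule conv_eqI[of _ A])
  note cl = conv_carrierD(3)[OF f] conv_carrierD(3)[OF g] conv_carrierD(3)[OF h]
  fix x assume x: "x \<in> carrier H"
  have "((f \<otimes>\<^bsub>conv A\<^esub> g) \<otimes>\<^bsub>conv A\<^esub> h) x
      = sw A (\<lambda>a b. sw A (\<lambda>c d. f c \<otimes>\<^bsub>A\<^esub> g d) a \<otimes>\<^bsub>A\<^esub> h b) x"
    using x cl by (auto simp: conv_apply intro!: sweedler_cong sweedler_closed A.abelian_group_axioms)
  also have "\<dots> = sw A (\<lambda>a b. sw A (\<lambda>c d. f c \<otimes>\<^bsub>A\<^esub> g d \<otimes>\<^bsub>A\<^esub> h b) a) x"
    using x cl
    by (intro sweedler_cong sweedler_hom[OF _ _ A.addhom_mult_right] sweedler_closed A.abelian_group_axioms)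
      auto
  also have "\<dots> = sw A (\<lambda>a b. sw A (\<lambda>c d. f a \<otimes>\<^bsub>A\<^esub> g c \<otimes>\<^bsub>A\<^esub> h d) b) x"
    using x f g h by (intro coassoc A.abelian_group_axioms trilinear_mult) (auto dest: conv_carrierD)
  also have "\<dots> = sw A (\<lambda>a b. sw A (\<lambda>c d. f a \<otimes>\<^bsub>A\<^esub> (g c \<otimes>\<^bsub>A\<^esub> h d)) b) x"
    using x cl by (intro sweedler_cong sweedler_closed A.abelian_group_axioms) (auto simp: A.A.m_assoc)
  also have "\<dots> = sw A (\<lambda>a b. f a \<otimes>\<^bsub>A\<^esub> sw A (\<lambda>c d. g c \<otimes>\<^bsub>A\<^esub> h d) b) x"
    using x cl
    by (intro sweedler_cong sweedler_hom[OF _ _ A.addhom_mult_left, symmetric] A.abelian_group_axioms)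
      (auto intro!: sweedler_closed A.abelian_group_axioms)
  also have "\<dots> = (f \<otimes>\<^bsub>conv A\<^esub> (g \<otimes>\<^bsub>conv A\<^esub> h)) x"
    using x cl
    by (auto simp: conv_apply intro!: sweedler_cong sweedler_closed A.A.m_closed A.abelian_group_axioms)
  finally show "((f \<otimes>\<^bsub>conv A\<^esub> g) \<otimes>\<^bsub>conv A\<^esub> h) x = (f \<otimes>\<^bsub>conv A\<^esub> (g \<otimes>\<^bsub>conv A\<^esub> h)) x" .
qed (intro conv_closed f g h)+

text \<open>A counit times a constant collapses the Sweedler sum. Both the unit laws and the
  treatment of dummy arguments by \<open>conv_unit\<close> rest on this.\<close>

lemma conv_counit_mult:
  assumes a: "a \<in> carrier A" and g: "g \<in> carrier (conv A)" and x: "x \<in> carrier H"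
  shows "sw A (\<lambda>c b. (\<epsilon> c \<odot>\<^bsub>A\<^esub> a) \<otimes>\<^bsub>A\<^esub> g b) x = a \<otimes>\<^bsub>A\<^esub> g x"
    and "sw A (\<lambda>c b. g c \<otimes>\<^bsub>A\<^esub> (\<epsilon> b \<odot>\<^bsub>A\<^esub> a)) x = g x \<otimes>\<^bsub>A\<^esub> a"
proof -
  note g = conv_carrierD[OF g]
  have "linear_map k H A (\<lambda>x. a \<otimes>\<^bsub>A\<^esub> g x)" "linear_map k H A (\<lambda>x. g x \<otimes>\<^bsub>A\<^esub> a)"
    using a g(3) by (auto intro!: linear_mapI simp: linear_mapD[OF g(2)] A.A.r_distr A.A.l_distr A.smult_mult)
  note * = sweedler_counit(1)[OF this(1) A.module_axioms x] sweedler_counit(2)[OF this(2) A.module_axioms x]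
  show "sw A (\<lambda>c b. (\<epsilon> c \<odot>\<^bsub>A\<^esub> a) \<otimes>\<^bsub>A\<^esub> g b) x = a \<otimes>\<^bsub>A\<^esub> g x"
    unfolding *(1)[symmetric] using a g(3) x
    by (intro sweedler_cong A.abelian_group_axioms) (auto simp: A.smult_mult)
  show "sw A (\<lambda>c b. g c \<otimes>\<^bsub>A\<^esub> (\<epsilon> b \<odot>\<^bsub>A\<^esub> a)) x = g x \<otimes>\<^bsub>A\<^esub> a"
    unfolding *(2)[symmetric] using a g(3) x
    by (intro sweedler_cong A.abelian_group_axioms) (auto simp: A.smult_mult)
qed

lemma conv_one_mult:
  assumes g: "g \<in> carrier (conv A)"
  shows "\<one>\<^bsub>conv A\<^esub> \<otimes>\<^bsub>conv A\<^esub> g = g" "g \<otimes>\<^bsub>conv A\<^esub> \<one>\<^bsub>conv A\<^esub> = g"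
proof -
  note cl = conv_carrierD(3)[OF g]
  show "\<one>\<^bsub>conv A\<^esub> \<otimes>\<^bsub>conv A\<^esub> g = g"
  proof (rule conv_eqI[of _ A])
    fix x assume x: "x \<in> carrier H"
    have "(\<one>\<^bsub>conv A\<^esub> \<otimes>\<^bsub>conv A\<^esub> g) x = sw A (\<lambda>c b. (\<epsilon> c \<odot>\<^bsub>A\<^esub> \<one>\<^bsub>A\<^esub>) \<otimes>\<^bsub>A\<^esub> g b) x"
      using x cl by (auto simp: conv_apply intro!: sweedler_cong A.abelian_group_axioms)
    then show "(\<one>\<^bsub>conv A\<^esub> \<otimes>\<^bsub>conv A\<^esub> g) x = g x" using conv_counit_mult(1)[OF _ g x] cl[OF x] by simp
  qed (intro conv_closed conv_one_closed g)+
  show "g \<otimes>\<^bsub>conv A\<^esub> \<one>\<^bsub>conv A\<^esub> = g"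
  proof (rule conv_eqI[of _ A])
    fix x assume x: "x \<in> carrier H"
    have "(g \<otimes>\<^bsub>conv A\<^esub> \<one>\<^bsub>conv A\<^esub>) x = sw A (\<lambda>c b. g c \<otimes>\<^bsub>A\<^esub> (\<epsilon> b \<odot>\<^bsub>A\<^esub> \<one>\<^bsub>A\<^esub>)) x"
      using x cl by (auto simp: conv_apply intro!: sweedler_cong A.abelian_group_axioms)
    then show "(g \<otimes>\<^bsub>conv A\<^esub> \<one>\<^bsub>conv A\<^esub>) x = g x" using conv_counit_mult(2)[OF _ g x] cl[OF x] by simp
  qed (intro conv_closed conv_one_closed g)+
qed

lemma conv_distr:
  assumes f: "f \<in> carrier (conv A)" and g: "g \<in> carrier (conv A)" and h: "h \<in> carrier (conv A)"
  shows "(f \<oplus>\<^bsub>conv A\<^esub> g) \<otimes>\<^bsub>conv A\<^esub> h = (f \<otimes>\<^bsub>conv A\<^esub> h) \<oplus>\<^bsub>conv A\<^esub> (g \<otimes>\<^bsub>conv A\<^esub> h)"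
    "h \<otimes>\<^bsub>conv A\<^esub> (f \<oplus>\<^bsub>conv A\<^esub> g) = (h \<otimes>\<^bsub>conv A\<^esub> f) \<oplus>\<^bsub>conv A\<^esub> (h \<otimes>\<^bsub>conv A\<^esub> g)"
proof -
  note cl = conv_carrierD(3)[OF f] conv_carrierD(3)[OF g] conv_carrierD(3)[OF h]
  show "(f \<oplus>\<^bsub>conv A\<^esub> g) \<otimes>\<^bsub>conv A\<^esub> h = (f \<otimes>\<^bsub>conv A\<^esub> h) \<oplus>\<^bsub>conv A\<^esub> (g \<otimes>\<^bsub>conv A\<^esub> h)"
  proof (rule conv_eqI[of _ A])
    fix x assume x: "x \<in> carrier H"
    show "((f \<oplus>\<^bsub>conv A\<^esub> g) \<otimes>\<^bsub>conv A\<^esub> h) x = ((f \<otimes>\<^bsub>conv A\<^esub> h) \<oplus>\<^bsub>conv A\<^esub> (g \<otimes>\<^bsub>conv A\<^esub> h)) x"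
      unfolding conv_apply[OF x] using x cl
      by (subst sweedler_add[symmetric])
        (auto simp: conv_apply A.A.l_distr intro!: sweedler_cong A.abelian_group_axioms)
  qed (intro conv_closed conv_add_closed f g h)+
  show "h \<otimes>\<^bsub>conv A\<^esub> (f \<oplus>\<^bsub>conv A\<^esub> g) = (h \<otimes>\<^bsub>conv A\<^esub> f) \<oplus>\<^bsub>conv A\<^esub> (h \<otimes>\<^bsub>conv A\<^esub> g)"
  proof (rule conv_eqI[of _ A])
    fix x assume x: "x \<in> carrier H"
    show "(h \<otimes>\<^bsub>conv A\<^esub> (f \<oplus>\<^bsub>conv A\<^esub> g)) x = ((h \<otimes>\<^bsub>conv A\<^esub> f) \<oplus>\<^bsub>conv A\<^esub> (h \<otimes>\<^bsub>conv A\<^esub> g)) x"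
      unfolding conv_apply[OF x] using x cl
      by (subst sweedler_add[symmetric])
        (auto simp: conv_apply A.A.r_distr intro!: sweedler_cong A.abelian_group_axioms)
  qed (intro conv_closed conv_add_closed f g h)+
qed

lemma conv_smult_mult:
  assumes r: "r \<in> carrier k" and f: "f \<in> carrier (conv A)" and g: "g \<in> carrier (conv A)"
  shows "(r \<odot>\<^bsub>conv A\<^esub> f) \<otimes>\<^bsub>conv A\<^esub> g = r \<odot>\<^bsub>conv A\<^esub> (f \<otimes>\<^bsub>conv A\<^esub> g)"
    "f \<otimes>\<^bsub>conv A\<^esub> (r \<odot>\<^bsub>conv A\<^esub> g) = r \<odot>\<^bsub>conv A\<^esub> (f \<otimes>\<^bsub>conv A\<^esub> g)"
proof -
  note cl = conv_carrierD(3)[OF f] conv_carrierD(3)[OF g]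
  have e: "sw A (\<lambda>a b. r \<odot>\<^bsub>A\<^esub> (f a \<otimes>\<^bsub>A\<^esub> g b)) x = r \<odot>\<^bsub>A\<^esub> sw A (\<lambda>a b. f a \<otimes>\<^bsub>A\<^esub> g b) x"
    if "x \<in> carrier H" for x
    using that cl by (intro sweedler_hom[OF _ _ A.addhom_smult[OF r], symmetric] A.abelian_group_axioms) auto
  have "((r \<odot>\<^bsub>conv A\<^esub> f) \<otimes>\<^bsub>conv A\<^esub> g) x = (r \<odot>\<^bsub>conv A\<^esub> (f \<otimes>\<^bsub>conv A\<^esub> g)) x"
    "(f \<otimes>\<^bsub>conv A\<^esub> (r \<odot>\<^bsub>conv A\<^esub> g)) x = (r \<odot>\<^bsub>conv A\<^esub> (f \<otimes>\<^bsub>conv A\<^esub> g)) x"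
    if x: "x \<in> carrier H" for x
    unfolding conv_apply[OF x] e[OF x, symmetric] using x cl r
    by (auto simp: conv_apply A.smult_mult intro!: sweedler_cong A.abelian_group_axioms)
  then show "(r \<odot>\<^bsub>conv A\<^esub> f) \<otimes>\<^bsub>conv A\<^esub> g = r \<odot>\<^bsub>conv A\<^esub> (f \<otimes>\<^bsub>conv A\<^esub> g)"
    "f \<otimes>\<^bsub>conv A\<^esub> (r \<odot>\<^bsub>conv A\<^esub> g) = r \<odot>\<^bsub>conv A\<^esub> (f \<otimes>\<^bsub>conv A\<^esub> g)"
    by (intro conv_eqI[of _ A] conv_closed conv_smult_closed r f g; simp)+
qed

text \<open>The result is again an algebra over \<open>k\<close>, hence a legitimate target for
  another \<open>conv\<close>; this is what permits the iteration. Convolution is not commutative in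
  general, even if \<open>A\<close> is.\<close>

lemma conv_algebra: "assoc_algebra k (conv A)"
proof -
  note cl = conv_carrierD(3)
  have ab: "abelian_group (conv A)"
  proof (rule abelian_groupI)
    show "\<exists>g\<in>carrier (conv A). g \<oplus>\<^bsub>conv A\<^esub> f = \<zero>\<^bsub>conv A\<^esub>" if f: "f \<in> carrier (conv A)" for f
    proof
      let ?g = "(\<ominus>\<^bsub>k\<^esub> \<one>\<^bsub>k\<^esub>) \<odot>\<^bsub>conv A\<^esub> f"
      show g: "?g \<in> carrier (conv A)" using f by (intro conv_smult_closed) auto
      show "?g \<oplus>\<^bsub>conv A\<^esub> f = \<zero>\<^bsub>conv A\<^esub>"
        by (rule conv_eqI[of _ A])
          (auto simp: conv_apply cl[OF f] A.smult_l_minus A.l_neg intro!: conv_add_closed conv_zero_closed g f)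
    qed
    show "f \<oplus>\<^bsub>conv A\<^esub> g \<oplus>\<^bsub>conv A\<^esub> h = f \<oplus>\<^bsub>conv A\<^esub> (g \<oplus>\<^bsub>conv A\<^esub> h)"
      if "f \<in> carrier (conv A)" "g \<in> carrier (conv A)" "h \<in> carrier (conv A)" for f g h
      using that by (intro conv_eqI[of _ A]) (auto simp: conv_apply cl A.a_assoc intro!: conv_add_closed)
    show "f \<oplus>\<^bsub>conv A\<^esub> g = g \<oplus>\<^bsub>conv A\<^esub> f"
      if "f \<in> carrier (conv A)" "g \<in> carrier (conv A)" for f g
      using that by (intro conv_eqI[of _ A]) (auto simp: conv_apply cl A.a_comm intro!: conv_add_closed)
    show "\<zero>\<^bsub>conv A\<^esub> \<oplus>\<^bsub>conv A\<^esub> f = f" if "f \<in> carrier (conv A)" for f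
      using that by (intro conv_eqI[of _ A])
        (auto simp: conv_apply cl intro!: conv_add_closed conv_zero_closed)
  qed (intro conv_add_closed conv_zero_closed; assumption)+
  have "ring (conv A)"
    using conv_one_mult conv_assoc conv_distr
    by (intro ringI ab monoidI conv_closed conv_one_closed) auto
  moreover have "module k (conv A)"
  proof (intro moduleI cring_k ab conv_smult_closed)
    show "(r \<oplus>\<^bsub>k\<^esub> s) \<odot>\<^bsub>conv A\<^esub> f = r \<odot>\<^bsub>conv A\<^esub> f \<oplus>\<^bsub>conv A\<^esub> s \<odot>\<^bsub>conv A\<^esub> f"
      if "r \<in> carrier k" "s \<in> carrier k" "f \<in> carrier (conv A)" for r s f
      using that by (intro conv_eqI[of _ A])
        (auto simp: conv_apply cl A.smult_l_distr intro!: conv_add_closed conv_smult_closed)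
    show "r \<odot>\<^bsub>conv A\<^esub> (f \<oplus>\<^bsub>conv A\<^esub> g) = r \<odot>\<^bsub>conv A\<^esub> f \<oplus>\<^bsub>conv A\<^esub> r \<odot>\<^bsub>conv A\<^esub> g"
      if "r \<in> carrier k" "f \<in> carrier (conv A)" "g \<in> carrier (conv A)" for r f g
      using that by (intro conv_eqI[of _ A])
        (auto simp: conv_apply cl A.smult_r_distr intro!: conv_add_closed conv_smult_closed)
    show "(r \<otimes>\<^bsub>k\<^esub> s) \<odot>\<^bsub>conv A\<^esub> f = r \<odot>\<^bsub>conv A\<^esub> (s \<odot>\<^bsub>conv A\<^esub> f)"
      if "r \<in> carrier k" "s \<in> carrier k" "f \<in> carrier (conv A)" for r s f
      using that by (intro conv_eqI[of _ A])
        (auto simp: conv_apply cl A.smult_assoc1 intro!: conv_smult_closed)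
    show "\<one>\<^bsub>k\<^esub> \<odot>\<^bsub>conv A\<^esub> f = f" if "f \<in> carrier (conv A)" for f
      using that by (intro conv_eqI[of _ A]) (auto simp: conv_apply cl intro!: conv_smult_closed)
  qed
  ultimately show ?thesis by (auto simp: assoc_algebra_def conv_smult_mult)
qed

sublocale conv: algebra_over k "conv A"
  by unfold_locales (rule conv_algebra)

end

section \<open>Functoriality of convolution algebras, and pullbacks along coalgebra
  morphisms\<close>

context hopf begin

lemma hopf_convI: "assoc_algebra k A \<Longrightarrow> hopf_conv k H A"
  by (intro hopf_conv.intro hopf_axioms algebra_over.intro)

definition conv_map :: "('a \<Rightarrow> 'b) \<Rightarrow> ('h \<Rightarrow> 'a) \<Rightarrow> 'h \<Rightarrow> 'b" where
  "conv_map \<phi> f = (\<lambda>x\<in>carrier H. \<phi> (f x))"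

text \<open>Pullback along the counit: it adds a first argument on which nothing depends.\<close>

definition conv_unit :: "('k, 'a, 'o) module_scheme \<Rightarrow> 'a \<Rightarrow> 'h \<Rightarrow> 'a" where
  "conv_unit A a = (\<lambda>x\<in>carrier H. \<epsilon> x \<odot>\<^bsub>A\<^esub> a)"

text \<open>Precomposition with the multiplication of \<open>H\<close>, which is a coalgebra
  morphism from \<open>H \<otimes> H\<close> to \<open>H\<close>.\<close>

definition conv_pull :: "('h \<Rightarrow> 'a) \<Rightarrow> 'h \<Rightarrow> 'h \<Rightarrow> 'a" where
  "conv_pull f = (\<lambda>x\<in>carrier H. \<lambda>y\<in>carrier H. f (x \<otimes>\<^bsub>H\<^esub> y))"

lemma conv_map_apply: "x \<in> carrier H \<Longrightarrow> conv_map \<phi> f x = \<phi> (f x)"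
  and conv_unit_apply: "x \<in> carrier H \<Longrightarrow> conv_unit A a x = \<epsilon> x \<odot>\<^bsub>A\<^esub> a"
  and conv_pull_apply: "x \<in> carrier H \<Longrightarrow> y \<in> carrier H \<Longrightarrow> conv_pull f x y = f (x \<otimes>\<^bsub>H\<^esub> y)"
  by (simp_all add: conv_map_def conv_unit_def conv_pull_def)

lemma conv_eval_addhom: "y \<in> carrier H \<Longrightarrow> addhom (conv A) A (\<lambda>f. f y)"
  by (rule addhomI) (auto simp: conv_apply dest: conv_carrierD)

lemma conv_map_hom:
  assumes A: "assoc_algebra k A" and B: "assoc_algebra k B" and \<phi>: "alg_hom k A B \<phi>"
  shows "alg_hom k (conv A) (conv B) (conv_map \<phi>)"
proof -
  interpret A: hopf_conv k H A using A by (rule hopf_convI)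
  interpret B: hopf_conv k H B using B by (rule hopf_convI)
  note \<phi>' = alg_homD[OF \<phi>]
  have cl: "conv_map \<phi> f \<in> carrier (conv B)" if "f \<in> carrier (conv A)" for f
    using conv_restrict[OF linear_map_comp[OF conv_carrierD(2)[OF that] \<phi>'(1)]]
    by (simp add: conv_map_def)
  have "conv_map \<phi> (f \<otimes>\<^bsub>conv A\<^esub> g) = conv_map \<phi> f \<otimes>\<^bsub>conv B\<^esub> conv_map \<phi> g"
    if fg: "f \<in> carrier (conv A)" "g \<in> carrier (conv A)" for f g
  proof (rule conv_eqI[of _ B])
    fix x assume x: "x \<in> carrier H"
    have "\<phi> (sw A (\<lambda>a b. f a \<otimes>\<^bsub>A\<^esub> g b) x) = sw B (\<lambda>a b. \<phi> (f a \<otimes>\<^bsub>A\<^esub> g b)) x"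
      using x fg
      by (intro sweedler_hom linear_map_addhom[OF \<phi>'(1)] A.A.abelian_group_axioms B.A.abelian_group_axioms)
        (auto dest: conv_carrierD)
    also have "\<dots> = sw B (\<lambda>a b. conv_map \<phi> f a \<otimes>\<^bsub>B\<^esub> conv_map \<phi> g b) x"
      using x fg by (intro sweedler_cong B.A.abelian_group_axioms)
        (auto simp: conv_map_apply \<phi>' conv_carrierD(3))
    finally show "conv_map \<phi> (f \<otimes>\<^bsub>conv A\<^esub> g) x = (conv_map \<phi> f \<otimes>\<^bsub>conv B\<^esub> conv_map \<phi> g) x"
      using x by (simp add: conv_map_apply conv_apply)
  qed (intro cl A.conv_closed B.conv_closed fg)+
  moreover have "conv_map \<phi> \<one>\<^bsub>conv A\<^esub> = \<one>\<^bsub>conv B\<^esub>"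
    by (rule conv_eqI[of _ B])
      (auto simp: conv_map_apply conv_apply \<phi>' intro!: cl A.conv_one_closed B.conv_one_closed)
  moreover have "conv_map \<phi> (f \<oplus>\<^bsub>conv A\<^esub> g) = conv_map \<phi> f \<oplus>\<^bsub>conv B\<^esub> conv_map \<phi> g"
    if "f \<in> carrier (conv A)" "g \<in> carrier (conv A)" for f g
    using that by (intro conv_eqI[of _ B])
      (auto simp: conv_map_apply conv_apply \<phi>' conv_carrierD(3) intro!: cl A.conv_add_closed B.conv_add_closed)
  moreover have "conv_map \<phi> (r \<odot>\<^bsub>conv A\<^esub> f) = r \<odot>\<^bsub>conv B\<^esub> conv_map \<phi> f"
    if "r \<in> carrier k" "f \<in> carrier (conv A)" for r f
    using that by (intro conv_eqI[of _ B])
      (auto simp: conv_map_apply conv_apply \<phi>' conv_carrierD(3) intro!: cl A.conv_smult_closed B.conv_smult_closed)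
  ultimately show ?thesis by (auto simp: alg_hom_def linear_map_def ring_hom_def cl)
qed

text \<open>Evaluation at \<open>y\<close> is additive, so it passes through the outer sum and
  exposes the inner convolution. Thus the iterated \<open>conv\<close> is convolution on
  \<open>H \<otimes> H\<close>.\<close>

lemma conv_eval_mult:
  assumes A: "assoc_algebra k A" and F: "F \<in> carrier (conv (conv A))" and G: "G \<in> carrier (conv (conv A))"
    and x: "x \<in> carrier H" and y: "y \<in> carrier H"
  shows "(F \<otimes>\<^bsub>conv (conv A)\<^esub> G) x y = sw A (\<lambda>a b. sw A (\<lambda>c d. F a c \<otimes>\<^bsub>A\<^esub> G b d) y) x"
proof -
  interpret A: hopf_conv k H A using A by (rule hopf_convI)
  have "(F \<otimes>\<^bsub>conv (conv A)\<^esub> G) x y = (sw (conv A) (\<lambda>a b. F a \<otimes>\<^bsub>conv A\<^esub> G b) x) y"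
    using x by (simp add: conv_apply)
  also have "\<dots> = sw A (\<lambda>a b. (F a \<otimes>\<^bsub>conv A\<^esub> G b) y) x"
    using x y F G
    by (intro sweedler_hom[of "conv A" A "\<lambda>f. f y"] conv_eval_addhom A.A.abelian_group_axioms
        A.conv.abelian_group_axioms A.conv_closed) (auto dest: conv_carrierD)
  also have "\<dots> = sw A (\<lambda>a b. sw A (\<lambda>c d. F a c \<otimes>\<^bsub>A\<^esub> G b d) y) x"
    using y by (simp add: conv_apply)
  finally show ?thesis .
qed

end

context hopf_conv begin

lemma conv_unit_closed: "a \<in> carrier A \<Longrightarrow> conv_unit A a \<in> carrier (conv A)"
  unfolding conv_unit_def by (rule conv_restrict[OF counit_smult_linear])

lemma conv_unit_mult:
  assumes a: "a \<in> carrier A" and g: "g \<in> carrier (conv A)" and x: "x \<in> carrier H"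
  shows "(conv_unit A a \<otimes>\<^bsub>conv A\<^esub> g) x = a \<otimes>\<^bsub>A\<^esub> g x"
    and "(g \<otimes>\<^bsub>conv A\<^esub> conv_unit A a) x = g x \<otimes>\<^bsub>A\<^esub> a"
proof -
  have "(conv_unit A a \<otimes>\<^bsub>conv A\<^esub> g) x = sw A (\<lambda>c b. (\<epsilon> c \<odot>\<^bsub>A\<^esub> a) \<otimes>\<^bsub>A\<^esub> g b) x"
    unfolding conv_apply[OF x] using a g x
    by (intro sweedler_cong A.abelian_group_axioms) (auto simp: conv_unit_apply dest: conv_carrierD)
  then show "(conv_unit A a \<otimes>\<^bsub>conv A\<^esub> g) x = a \<otimes>\<^bsub>A\<^esub> g x" by (simp add: conv_counit_mult[OF a g x])
  have "(g \<otimes>\<^bsub>conv A\<^esub> conv_unit A a) x = sw A (\<lambda>c b. g c \<otimes>\<^bsub>A\<^esub> (\<epsilon> b \<odot>\<^bsub>A\<^esub> a)) x"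
    unfolding conv_apply[OF x] using a g x
    by (intro sweedler_cong A.abelian_group_axioms) (auto simp: conv_unit_apply dest: conv_carrierD)
  then show "(g \<otimes>\<^bsub>conv A\<^esub> conv_unit A a) x = g x \<otimes>\<^bsub>A\<^esub> a" by (simp add: conv_counit_mult[OF a g x])
qed

text \<open>A factor that does not depend on the argument meets the values of \<open>g\<close> only
  through the product of \<open>A\<close>. This is the source of all commutations in the otherwise
  noncommutative convolution algebras.\<close>

lemma conv_unit_commute:
  assumes "a \<in> carrier A" "g \<in> carrier (conv A)"
    "\<And>x. x \<in> carrier H \<Longrightarrow> a \<otimes>\<^bsub>A\<^esub> g x = g x \<otimes>\<^bsub>A\<^esub> a"
  shows "conv_unit A a \<otimes>\<^bsub>conv A\<^esub> g = g \<otimes>\<^bsub>conv A\<^esub> conv_unit A a"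
  using assms by (intro conv_eqI[of _ A] conv_closed conv_unit_closed) (auto simp: conv_unit_mult)

lemma conv_unit_hom: "alg_hom k A (conv A) (conv_unit A)"
proof -
  have "conv_unit A (a \<otimes>\<^bsub>A\<^esub> b) = conv_unit A a \<otimes>\<^bsub>conv A\<^esub> conv_unit A b"
    if "a \<in> carrier A" "b \<in> carrier A" for a b
    using that by (intro conv_eqI[of _ A] conv_closed conv_unit_closed)
      (auto simp: conv_unit_mult conv_unit_closed conv_unit_apply A.smult_mult)
  moreover have "conv_unit A (a \<oplus>\<^bsub>A\<^esub> b) = conv_unit A a \<oplus>\<^bsub>conv A\<^esub> conv_unit A b"
    if "a \<in> carrier A" "b \<in> carrier A" for a b
    using that by (intro conv_eqI[of _ A] conv_add_closed conv_unit_closed)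
      (auto simp: conv_apply conv_unit_apply A.smult_r_distr)
  moreover have "conv_unit A (r \<odot>\<^bsub>A\<^esub> a) = r \<odot>\<^bsub>conv A\<^esub> conv_unit A a"
    if "r \<in> carrier k" "a \<in> carrier A" for r a
    using that by (intro conv_eqI[of _ A] conv_smult_closed conv_unit_closed)
      (auto simp: conv_apply conv_unit_apply k.m_comm simp flip: A.smult_assoc1)
  moreover have "conv_unit A \<one>\<^bsub>A\<^esub> = \<one>\<^bsub>conv A\<^esub>"
    by (intro conv_eqI[of _ A] conv_one_closed conv_unit_closed)
      (auto simp: conv_apply conv_unit_apply)
  ultimately show ?thesis by (auto simp: alg_hom_def linear_map_def ring_hom_def conv_unit_closed)
qed

lemma conv_pull_closed:
  assumes "f \<in> carrier (conv A)"
  shows "conv_pull f \<in> carrier (conv (conv A))"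
proof -
  note f = conv_carrierD[OF assms]
  have 1: "(\<lambda>y\<in>carrier H. f (x \<otimes>\<^bsub>H\<^esub> y)) \<in> carrier (conv A)" if "x \<in> carrier H" for x
    using that by (intro conv_restrict linear_mapI)
      (auto simp: f(3) linear_mapD[OF f(2)] H.A.r_distr H.smult_mult)
  have "linear_map k H (conv A) (\<lambda>x. \<lambda>y\<in>carrier H. f (x \<otimes>\<^bsub>H\<^esub> y))"
  proof (rule linear_mapI)
    show "(\<lambda>y\<in>carrier H. f ((x \<oplus>\<^bsub>H\<^esub> x') \<otimes>\<^bsub>H\<^esub> y)) =
        (\<lambda>y\<in>carrier H. f (x \<otimes>\<^bsub>H\<^esub> y)) \<oplus>\<^bsub>conv A\<^esub> (\<lambda>y\<in>carrier H. f (x' \<otimes>\<^bsub>H\<^esub> y))"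
      if "x \<in> carrier H" "x' \<in> carrier H" for x x'
      using that by (intro conv_eqI[of _ A] conv_add_closed 1)
        (auto simp: conv_apply linear_mapD[OF f(2)] H.A.l_distr)
    show "(\<lambda>y\<in>carrier H. f ((r \<odot>\<^bsub>H\<^esub> x) \<otimes>\<^bsub>H\<^esub> y)) = r \<odot>\<^bsub>conv A\<^esub> (\<lambda>y\<in>carrier H. f (x \<otimes>\<^bsub>H\<^esub> y))"
      if "r \<in> carrier k" "x \<in> carrier H" for r x
      using that by (intro conv_eqI[of _ A] conv_smult_closed 1)
        (auto simp: conv_apply linear_mapD[OF f(2)] H.smult_mult)
  qed (rule 1)
  from conv_restrict[OF this] show ?thesis by (simp add: conv_pull_def)
qed

text \<open>Here the bialgebra axiom \<open>\<Delta>(xy) = \<Delta>(x)\<Delta>(y)\<close> enters,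
  and multiplicativity of the counit for the unit element.\<close>

lemma conv_pull_hom: "alg_hom k (conv A) (conv (conv A)) conv_pull"
proof -
  interpret c2: hopf_conv k H "conv A" by (rule hopf_convI[OF conv_algebra])
  have eqI: "F = G" if "F \<in> carrier (conv (conv A))" "G \<in> carrier (conv (conv A))"
    "\<And>x y. x \<in> carrier H \<Longrightarrow> y \<in> carrier H \<Longrightarrow> F x y = G x y" for F G
    using that by (intro conv_eqI[of F "conv A" G] conv_eqI[of "F _" A "G _"]) (auto dest: conv_carrierD)
  have "conv_pull (f \<otimes>\<^bsub>conv A\<^esub> g) = conv_pull f \<otimes>\<^bsub>conv (conv A)\<^esub> conv_pull g"
    if fg: "f \<in> carrier (conv A)" "g \<in> carrier (conv A)" for f g
  proof (intro eqI conv_pull_closed conv_closed c2.conv_closed fg)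
    fix x y assume xy: "x \<in> carrier H" "y \<in> carrier H"
    note f = conv_carrierD[OF fg(1)] and g = conv_carrierD[OF fg(2)]
    have "conv_pull (f \<otimes>\<^bsub>conv A\<^esub> g) x y
        = sw A (\<lambda>a b. sw A (\<lambda>c d. f (a \<otimes>\<^bsub>H\<^esub> c) \<otimes>\<^bsub>A\<^esub> g (b \<otimes>\<^bsub>H\<^esub> d)) y) x"
      using xy sweedler_mult[OF A.abelian_group_axioms A.balanced_mult[OF f(2) g(2)] xy]
      by (simp add: conv_pull_apply conv_apply)
    also have "\<dots> = sw A (\<lambda>a b. sw A (\<lambda>c d. conv_pull f a c \<otimes>\<^bsub>A\<^esub> conv_pull g b d) y) x"
      using xy f(3) g(3)
      by (intro sweedler_cong sweedler_closed A.abelian_group_axioms) (auto simp: conv_pull_apply)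
    also have "\<dots> = (conv_pull f \<otimes>\<^bsub>conv (conv A)\<^esub> conv_pull g) x y"
      using xy fg by (simp add: conv_eval_mult[OF A.assoc_algebra] conv_pull_closed)
    finally show "conv_pull (f \<otimes>\<^bsub>conv A\<^esub> g) x y = (conv_pull f \<otimes>\<^bsub>conv (conv A)\<^esub> conv_pull g) x y" .
  qed
  moreover have "conv_pull (f \<oplus>\<^bsub>conv A\<^esub> g) = conv_pull f \<oplus>\<^bsub>conv (conv A)\<^esub> conv_pull g"
    if "f \<in> carrier (conv A)" "g \<in> carrier (conv A)" for f g
    using that by (intro eqI conv_pull_closed conv_add_closed c2.conv_add_closed)
      (auto simp: conv_pull_apply conv_apply)
  moreover have "conv_pull (r \<odot>\<^bsub>conv A\<^esub> f) = r \<odot>\<^bsub>conv (conv A)\<^esub> conv_pull f"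
    if "r \<in> carrier k" "f \<in> carrier (conv A)" for r f
    using that by (intro eqI conv_pull_closed conv_smult_closed c2.conv_smult_closed)
      (auto simp: conv_pull_apply conv_apply)
  moreover have "conv_pull \<one>\<^bsub>conv A\<^esub> = \<one>\<^bsub>conv (conv A)\<^esub>"
    by (intro eqI conv_pull_closed conv_one_closed c2.conv_one_closed)
      (auto simp: conv_pull_apply conv_apply counit_simps A.smult_assoc1)
  ultimately show ?thesis by (auto simp: alg_hom_def linear_map_def ring_hom_def conv_pull_closed)
qed

end

section \<open>Gauge transformations of two-cocycles\<close>

locale hopf_values = hopf k H + L: cring L
  for k :: "('k, 'm) ring_scheme" and H :: "('k, 'h, 'n) hopf_scheme"
    and L :: "('l, 'o) ring_scheme" +
  fixes \<rho> :: "'k \<Rightarrow> 'l"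
  assumes \<rho>_hom: "\<rho> \<in> ring_hom k L"
begin

abbreviation "A0 \<equiv> as_algebra \<rho> L"

lemma A0_simps [simp]:
  "carrier A0 = carrier L" "x \<otimes>\<^bsub>A0\<^esub> y = x \<otimes>\<^bsub>L\<^esub> y" "x \<oplus>\<^bsub>A0\<^esub> y = x \<oplus>\<^bsub>L\<^esub> y"
  "\<one>\<^bsub>A0\<^esub> = \<one>\<^bsub>L\<^esub>" "\<zero>\<^bsub>A0\<^esub> = \<zero>\<^bsub>L\<^esub>" "r \<odot>\<^bsub>A0\<^esub> x = \<rho> r \<otimes>\<^bsub>L\<^esub> x"
  by (simp_all add: as_algebra_def)

lemma same_add_A0: "same_add A0 L"
  by (simp add: same_add_def as_algebra_def)

lemma \<rho>_simps [simp]: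
  "r \<in> carrier k \<Longrightarrow> \<rho> r \<in> carrier L"
  "r \<in> carrier k \<Longrightarrow> s \<in> carrier k \<Longrightarrow> \<rho> (r \<otimes>\<^bsub>k\<^esub> s) = \<rho> r \<otimes>\<^bsub>L\<^esub> \<rho> s"
  "r \<in> carrier k \<Longrightarrow> s \<in> carrier k \<Longrightarrow> \<rho> (r \<oplus>\<^bsub>k\<^esub> s) = \<rho> r \<oplus>\<^bsub>L\<^esub> \<rho> s"
  "\<rho> \<one>\<^bsub>k\<^esub> = \<one>\<^bsub>L\<^esub>"
  using \<rho>_hom by (auto simp: ring_hom_def)

lemma A0_algebra: "assoc_algebra k A0"
proof -
  have "abelian_group A0"
    using abelian_group_cong_add[OF same_add_A0] L.abelian_group_axioms by simp
  moreover from this have "ring A0"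
    by (intro ringI monoidI) (auto simp: L.m_assoc L.l_distr L.r_distr)
  moreover have "module k A0"
    using \<open>abelian_group A0\<close>
    by (intro moduleI cring_k) (auto simp: L.l_distr L.r_distr L.m_assoc)
  ultimately show ?thesis by (auto simp: assoc_algebra_def L.m_ac)
qed

sublocale A0: hopf_conv k H A0 by (rule hopf_convI[OF A0_algebra])

abbreviation "A1 \<equiv> conv A0"
abbreviation "A2 \<equiv> conv A1"
abbreviation "A3 \<equiv> conv A2"

sublocale A1: hopf_conv k H A1 by (rule hopf_convI[OF A0.conv_algebra])
sublocale A2: hopf_conv k H A2 by (rule hopf_convI[OF A1.conv_algebra])

lemma A2_eqI:
  assumes "F \<in> carrier A2" "G \<in> carrier A2"
    "\<And>x y. x \<in> carrier H \<Longrightarrow> y \<in> carrier H \<Longrightarrow> F x y = G x y"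
  shows "F = G"
  using assms by (intro conv_eqI[of F A1 G] conv_eqI[of "F _" A0 "G _"]) (auto dest: conv_carrierD)

lemma A3_eqI:
  assumes "F \<in> carrier A3" "G \<in> carrier A3"
    "\<And>x y z. x \<in> carrier H \<Longrightarrow> y \<in> carrier H \<Longrightarrow> z \<in> carrier H \<Longrightarrow> F x y z = G x y z"
  shows "F = G"
  using assms by (intro conv_eqI[of F A2 G] A2_eqI[of "F _" "G _"]) (auto dest: conv_carrierD)

lemma A2_closed: "F \<in> carrier A2 \<Longrightarrow> x \<in> carrier H \<Longrightarrow> y \<in> carrier H \<Longrightarrow> F x y \<in> carrier L"
  using conv_carrierD(3)[of F A1 x] conv_carrierD(3)[of "F x" A0 y] by simp

lemma A1_closed: "F \<in> carrier A1 \<Longrightarrow> x \<in> carrier H \<Longrightarrow> F x \<in> carrier L"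
  using conv_carrierD(3)[of F A0 x] by simp

text \<open>Pullbacks along coalgebra maps between tensor powers of \<open>H\<close>, as algebra morphisms between
  the convolution algebras \<open>Hom(H\<^sup>\<otimes>\<^sup>n, L)\<close>: \<open>leg1 T\<close> is \<open>T \<otimes> \<epsilon>\<close>, \<open>leg2 T\<close> is \<open>\<epsilon> \<otimes> T\<close>,
  and \<open>conv_pull T\<close> is \<open>T(xy)\<close>.\<close>

definition "leg1 = conv_map (conv_unit A0)"
definition "leg2 = conv_unit A1"
text \<open>The four pullbacks from two to three arguments in the cocycle identity:
  \<open>\<alpha>(x, y)\<epsilon>(z)\<close>, \<open>\<epsilon>(x)\<alpha>(y, z)\<close>,
  \<open>\<alpha>(xy, z)\<close> and \<open>\<alpha>(x, yz)\<close>, in the order of the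
  definitions.\<close>

definition "d12 = conv_map (conv_map (conv_unit A0))"
definition "d23 = conv_unit A2"
definition "dm12 = (conv_pull :: ('h \<Rightarrow> 'h \<Rightarrow> 'l) \<Rightarrow> 'h \<Rightarrow> 'h \<Rightarrow> 'h \<Rightarrow> 'l)"
definition "dm23 = conv_map (conv_pull :: ('h \<Rightarrow> 'l) \<Rightarrow> 'h \<Rightarrow> 'h \<Rightarrow> 'l)"

lemma leg1_hom: "alg_hom k A1 A2 leg1"
  unfolding leg1_def by (intro conv_map_hom A0.conv_unit_hom A0_algebra A0.conv_algebra)
lemma leg2_hom: "alg_hom k A1 A2 leg2"
  unfolding leg2_def by (rule A1.conv_unit_hom)
lemma pull_hom: "alg_hom k A1 A2 conv_pull"
  by (rule A0.conv_pull_hom)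
lemma d12_hom: "alg_hom k A2 A3 d12"
  unfolding d12_def by (intro conv_map_hom A0.conv_unit_hom A0_algebra A0.conv_algebra A1.conv_algebra)
lemma d23_hom: "alg_hom k A2 A3 d23"
  unfolding d23_def by (rule A2.conv_unit_hom)
lemma dm12_hom: "alg_hom k A2 A3 dm12"
  unfolding dm12_def by (rule A1.conv_pull_hom)
lemma dm23_hom: "alg_hom k A2 A3 dm23"
  unfolding dm23_def by (intro conv_map_hom A0.conv_pull_hom A0.conv_algebra A1.conv_algebra)

lemmas homs = leg1_hom leg2_hom pull_hom d12_hom d23_hom dm12_hom dm23_hom

lemma legs_closed [simp]:
  "T \<in> carrier A1 \<Longrightarrow> leg1 T \<in> carrier A2"
  "T \<in> carrier A1 \<Longrightarrow> leg2 T \<in> carrier A2"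
  "T \<in> carrier A1 \<Longrightarrow> conv_pull T \<in> carrier A2"
  "\<alpha> \<in> carrier A2 \<Longrightarrow> d12 \<alpha> \<in> carrier A3"
  "\<alpha> \<in> carrier A2 \<Longrightarrow> d23 \<alpha> \<in> carrier A3"
  "\<alpha> \<in> carrier A2 \<Longrightarrow> dm12 \<alpha> \<in> carrier A3"
  "\<alpha> \<in> carrier A2 \<Longrightarrow> dm23 \<alpha> \<in> carrier A3"
  using homs[THEN alg_homD(2)] by auto

lemma legs_apply:
  assumes "x \<in> carrier H" "y \<in> carrier H"
  shows "leg1 T x y = \<rho> (\<epsilon> y) \<otimes>\<^bsub>L\<^esub> T x" "leg2 T x y = \<rho> (\<epsilon> x) \<otimes>\<^bsub>L\<^esub> T y"
    "conv_pull T x y = T (x \<otimes>\<^bsub>H\<^esub> y)"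
  using assms
  by (simp_all add: leg1_def leg2_def conv_map_apply conv_unit_apply conv_pull_apply conv_apply)

lemma d_apply:
  assumes "x \<in> carrier H" "y \<in> carrier H" "z \<in> carrier H"
  shows "d12 \<alpha> x y z = \<rho> (\<epsilon> z) \<otimes>\<^bsub>L\<^esub> \<alpha> x y" "d23 \<alpha> x y z = \<rho> (\<epsilon> x) \<otimes>\<^bsub>L\<^esub> \<alpha> y z"
    "dm12 \<alpha> x y z = \<alpha> (x \<otimes>\<^bsub>H\<^esub> y) z" "dm23 \<alpha> x y z = \<alpha> x (y \<otimes>\<^bsub>H\<^esub> z)"
  using assms
  by (simp_all add: d12_def d23_def dm12_def dm23_def conv_map_apply conv_unit_apply conv_pull_apply conv_apply)

text \<open>In Sweedler notation \<open>T(x1) T(y1) \<alpha>(x2, y2) S(x3 y3)\<close>: the shape of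
  the universal cocycle, with \<open>T = t\<close> and \<open>S\<close> its convolution inverse. The
  bracketing fits the expansion of a triple product in \<open>A2_mult3\<close>.\<close>

definition "gauge T \<alpha> S = leg1 T \<otimes>\<^bsub>A2\<^esub> leg2 T \<otimes>\<^bsub>A2\<^esub> (\<alpha> \<otimes>\<^bsub>A2\<^esub> conv_pull S)"

definition "cocycle \<alpha> \<longleftrightarrow> d12 \<alpha> \<otimes>\<^bsub>A3\<^esub> dm12 \<alpha> = d23 \<alpha> \<otimes>\<^bsub>A3\<^esub> dm23 \<alpha>"

text \<open>In each line both sides pull \<open>T\<close> back along the same map from three
  arguments to one: a single argument, a product of two neighbours, or the triple product, where
  associativity of \<open>H\<close> is used.\<close>

lemma simplicial_identities:
  assumes T: "T \<in> carrier A1"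
  shows "dm12 (leg2 T) = d23 (leg2 T)" "d23 (leg1 T) = d12 (leg2 T)" "dm23 (leg1 T) = d12 (leg1 T)"
    "d12 (conv_pull T) = dm12 (leg1 T)" "d23 (conv_pull T) = dm23 (leg2 T)"
    "dm12 (conv_pull T) = dm23 (conv_pull T)"
  using T by (auto intro!: A3_eqI simp: d_apply legs_apply A1_closed counit_simps L.m_ac H.A.m_assoc)

lemma A1_commute_unit:
  assumes "T \<in> carrier A1" "a \<in> carrier L"
  shows "T \<otimes>\<^bsub>A1\<^esub> conv_unit A0 a = conv_unit A0 a \<otimes>\<^bsub>A1\<^esub> T"
  using assms by (intro A0.conv_unit_commute[symmetric]) (auto simp: A1_closed L.m_comm)

text \<open>\<open>d23 (leg2 T)\<close> depends on the third argument only and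
  \<open>d12 \<alpha>\<close> on the first two. Factors in disjoint arguments commute because
  \<open>L\<close> is commutative.\<close>

lemma commute_d12:
  assumes T: "T \<in> carrier A1" and \<alpha>: "\<alpha> \<in> carrier A2"
  shows "d23 (leg2 T) \<otimes>\<^bsub>A3\<^esub> d12 \<alpha> = d12 \<alpha> \<otimes>\<^bsub>A3\<^esub> d23 (leg2 T)"
  unfolding d23_def
proof (rule A2.conv_unit_commute)
  fix x assume x: "x \<in> carrier H"
  have d: "d12 \<alpha> x = conv_map (conv_unit A0) (\<alpha> x)" using x by (simp add: d12_def conv_map_apply)
  have a: "\<alpha> x \<in> carrier A1" using \<alpha> x by (auto dest: conv_carrierD)
  show "leg2 T \<otimes>\<^bsub>A2\<^esub> d12 \<alpha> x = d12 \<alpha> x \<otimes>\<^bsub>A2\<^esub> leg2 T"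
    unfolding leg2_def d
  proof (rule A1.conv_unit_commute[OF T])
    show "conv_map (conv_unit A0) (\<alpha> x) \<in> carrier A2"
      using legs_closed(1)[OF a] by (simp add: leg1_def)
    show "T \<otimes>\<^bsub>A1\<^esub> conv_map (conv_unit A0) (\<alpha> x) y = conv_map (conv_unit A0) (\<alpha> x) y \<otimes>\<^bsub>A1\<^esub> T"
      if "y \<in> carrier H" for y
      using that \<alpha> x by (simp add: conv_map_apply A1_commute_unit[OF T] A2_closed)
  qed
qed (use assms in auto)

text \<open>The mirror image of \<open>commute_d12\<close>: \<open>d12 (leg1 T)\<close> depends on
  the first argument only and \<open>d23 \<alpha>\<close> on the other two.\<close>

lemma commute_d23:
  assumes T: "T \<in> carrier A1" and \<alpha>: "\<alpha> \<in> carrier A2"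
  shows "d23 \<alpha> \<otimes>\<^bsub>A3\<^esub> d12 (leg1 T) = d12 (leg1 T) \<otimes>\<^bsub>A3\<^esub> d23 \<alpha>"
  unfolding d23_def
proof (rule A2.conv_unit_commute)
  fix x assume x: "x \<in> carrier H"
  have u: "conv_unit A0 (T x) \<in> carrier A1" using A0.conv_unit_closed A1_closed[OF T x] by simp
  \<comment> \<open>For a fixed first argument this factor is the constant \<open>T x\<close> times
    counits, so its commutation reduces to that of constants.\<close>
  have d: "d12 (leg1 T) x = conv_unit A1 (conv_unit A0 (T x))"
  proof (rule A2_eqI)
    show "d12 (leg1 T) x \<in> carrier A2" using x T by (auto intro: conv_carrierD)
    show "conv_unit A1 (conv_unit A0 (T x)) \<in> carrier A2" using A1.conv_unit_closed[OF u] .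
  qed (use x A1_closed[OF T x] in \<open>auto simp: d_apply legs_apply conv_unit_apply conv_apply L.m_ac\<close>)
  show "\<alpha> \<otimes>\<^bsub>A2\<^esub> d12 (leg1 T) x = d12 (leg1 T) x \<otimes>\<^bsub>A2\<^esub> \<alpha>"
    unfolding d
    by (rule A1.conv_unit_commute[OF u \<alpha>, symmetric])
      (use \<alpha> A1_closed[OF T x] in \<open>auto simp: A1_commute_unit dest: conv_carrierD\<close>)
qed (use assms in auto)

text \<open>Both sides become \<open>T(x) T(y) T(z)\<close>, times one side of the identity for
  \<open>\<alpha>\<close>, times \<open>S(xyz)\<close>. On the left, \<open>S(xy)\<close> and
  \<open>T(xy)\<close> cancel and \<open>T(z)\<close> moves in front of
  \<open>\<alpha>(x, y)\<close>. On the right, \<open>S(yz)\<close> and \<open>T(yz)\<close> cancel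
  after \<open>T(x)\<close> has passed the transform in \<open>y\<close>, \<open>z\<close>.\<close>

lemma cocycle_gauge:
  assumes T: "T \<in> carrier A1" and S: "S \<in> carrier A1" and ST: "S \<otimes>\<^bsub>A1\<^esub> T = \<one>\<^bsub>A1\<^esub>"
    and \<alpha>: "\<alpha> \<in> carrier A2" "cocycle \<alpha>"
  shows "cocycle (gauge T \<alpha> S)"
proof -
  note [simp] = T S \<alpha>(1) A2.conv.A.m_assoc A2.conv.A.m_closed A1.conv.A.m_closed
  note m = homs[THEN alg_homD(4)]
  let ?m = "monoid.mult A3"
  let ?X = "d12 (leg1 T)" and ?Y = "d12 (leg2 T)" and ?Z = "d23 (leg2 T)" and ?M = "dm23 (conv_pull S)"
  note si = simplicial_identities
  have canc1: "?m (dm12 (leg1 S)) (?m (dm12 (leg1 T)) w) = w" if w: "w \<in> carrier A3" for w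
  proof -
    have "?m (dm12 (leg1 S)) (dm12 (leg1 T)) = \<one>\<^bsub>A3\<^esub>"
      by (simp add: ST alg_homD(6)[OF leg1_hom] alg_homD(6)[OF dm12_hom]
          flip: alg_homD(4)[OF dm12_hom] alg_homD(4)[OF leg1_hom])
    then show ?thesis using w A2.conv.A.m_assoc[of "dm12 (leg1 S)" "dm12 (leg1 T)" w] by simp
  qed
  have canc2: "?m (dm23 (leg2 S)) (?m (dm23 (leg2 T)) w) = w" if w: "w \<in> carrier A3" for w
  proof -
    have "?m (dm23 (leg2 S)) (dm23 (leg2 T)) = \<one>\<^bsub>A3\<^esub>"
      by (simp add: ST alg_homD(6)[OF leg2_hom] alg_homD(6)[OF dm23_hom]
          flip: alg_homD(4)[OF dm23_hom] alg_homD(4)[OF leg2_hom])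
    then show ?thesis using w A2.conv.A.m_assoc[of "dm23 (leg2 S)" "dm23 (leg2 T)" w] by simp
  qed
  have zc: "?m (d12 \<alpha>) (?m ?Z w) = ?m ?Z (?m (d12 \<alpha>) w)" if "w \<in> carrier A3" for w
    using that commute_d12[OF T \<alpha>(1)] by (simp flip: A2.conv.A.m_assoc del: A2.conv.A.m_assoc)
  have g: "gauge T \<alpha> S \<in> carrier A2" by (simp add: gauge_def)
  \<comment> \<open>\<open>commute_d23\<close> is applied to the whole transform instead of
    \<open>\<alpha>\<close>, so that no rule for passing its single factors is required.\<close>
  have xc: "?m (d23 (gauge T \<alpha> S)) (?m ?X w) = ?m ?X (?m (d23 (gauge T \<alpha> S)) w)" if "w \<in> carrier A3" for w
    using that g commute_d23[OF T g] by (simp flip: A2.conv.A.m_assoc del: A2.conv.A.m_assoc)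
  have g12: "d12 (gauge T \<alpha> S) = ?m ?X (?m ?Y (?m (d12 \<alpha>) (dm12 (leg1 S))))"
    by (simp add: gauge_def alg_homD(4)[OF d12_hom] si)
  have gm12: "dm12 (gauge T \<alpha> S) = ?m (dm12 (leg1 T)) (?m ?Z (?m (dm12 \<alpha>) ?M))"
    by (simp add: gauge_def alg_homD(4)[OF dm12_hom] si)
  have g23: "d23 (gauge T \<alpha> S) = ?m ?Y (?m ?Z (?m (d23 \<alpha>) (dm23 (leg2 S))))"
    by (simp add: gauge_def alg_homD(4)[OF d23_hom] si)
  have gm23: "dm23 (gauge T \<alpha> S) = ?m ?X (?m (dm23 (leg2 T)) (?m (dm23 \<alpha>) ?M))"
    by (simp add: gauge_def alg_homD(4)[OF dm23_hom] si)
  have co: "?m (d12 \<alpha>) (?m (dm12 \<alpha>) w) = ?m (d23 \<alpha>) (?m (dm23 \<alpha>) w)" if "w \<in> carrier A3" for w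
    using that \<alpha>(2) by (simp add: cocycle_def flip: A2.conv.A.m_assoc del: A2.conv.A.m_assoc)
  have "?m (d12 (gauge T \<alpha> S)) (dm12 (gauge T \<alpha> S))
      = ?m ?X (?m ?Y (?m ?Z (?m (d12 \<alpha>) (?m (dm12 \<alpha>) ?M))))"
    by (simp add: g12 gm12 canc1 zc)
  also have "\<dots> = ?m ?X (?m ?Y (?m ?Z (?m (d23 \<alpha>) (?m (dm23 \<alpha>) ?M))))"
    by (simp add: co)
  also have "\<dots> = ?m ?X (?m (d23 (gauge T \<alpha> S)) (?m (dm23 (leg2 T)) (?m (dm23 \<alpha>) ?M)))"
    by (simp add: g23 canc2)
  also have "\<dots> = ?m (d23 (gauge T \<alpha> S)) (dm23 (gauge T \<alpha> S))"
    unfolding gm23 by (rule xc[symmetric]) simp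
  finally show ?thesis by (simp add: cocycle_def)
qed

end

section \<open>Evaluation at the unit of \<open>H\<close>, and rules for iterated Sweedler
  sums\<close>

context hopf_conv begin

text \<open>The unit is grouplike, so evaluation there is multiplicative. Normalization and the
  values of gauge transforms at 1 are computed with it.\<close>

lemma conv_eval_one_hom: "alg_hom k (conv A) A (\<lambda>f. f \<one>\<^bsub>H\<^esub>)"
proof -
  have "(f \<otimes>\<^bsub>conv A\<^esub> g) \<one>\<^bsub>H\<^esub> = f \<one>\<^bsub>H\<^esub> \<otimes>\<^bsub>A\<^esub> g \<one>\<^bsub>H\<^esub>"
    if "f \<in> carrier (conv A)" "g \<in> carrier (conv A)" for f g
    using that A.balanced_mult[OF conv_carrierD(2)[OF that(1)] conv_carrierD(2)[OF that(2)]]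
    by (simp add: conv_apply sweedler_one[OF A.abelian_group_axioms])
  then show ?thesis
    by (auto simp: alg_hom_def linear_map_def ring_hom_def conv_apply counit_simps conv_carrierD(3))
qed

end

context hopf begin

lemma sweedler3_closed:
  assumes "abelian_group G" "x \<in> carrier H"
    "\<And>a b c. a \<in> carrier H \<Longrightarrow> b \<in> carrier H \<Longrightarrow> c \<in> carrier H \<Longrightarrow> f a b c \<in> carrier G"
  shows "sweedler3 G H f x \<in> carrier G"
  unfolding sweedler3_def using assms by (intro sweedler_closed) auto

lemma sweedler3_cong:
  assumes "abelian_group G" "x \<in> carrier H"
    "\<And>a b c. a \<in> carrier H \<Longrightarrow> b \<in> carrier H \<Longrightarrow> c \<in> carrier H \<Longrightarrow> g a b c \<in> carrier G"
    "\<And>a b c. a \<in> carrier H \<Longrightarrow> b \<in> carrier H \<Longrightarrow> c \<in> carrier H \<Longrightarrow> f a b c = g a b c"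
  shows "sweedler3 G H f x = sweedler3 G H g x"
  unfolding sweedler3_def using assms by (intro sweedler_cong sweedler_closed) auto

lemma sweedler3_hom:
  assumes "abelian_group G" "abelian_group G'" "addhom G G' h" "x \<in> carrier H"
    "\<And>a b c. a \<in> carrier H \<Longrightarrow> b \<in> carrier H \<Longrightarrow> c \<in> carrier H \<Longrightarrow> f a b c \<in> carrier G"
  shows "h (sweedler3 G H f x) = sweedler3 G' H (\<lambda>a b c. h (f a b c)) x"
proof -
  have "h (sweedler3 G H f x) = sw G' (\<lambda>a x'. h (sw G (\<lambda>b c. f a b c) x')) x"
    unfolding sweedler3_def using assms by (intro sweedler_hom sweedler_closed) auto
  also have "\<dots> = sweedler3 G' H (\<lambda>a b c. h (f a b c)) x"
    unfolding sweedler3_def using assms addhom_closed[OF assms(3)]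
    by (intro sweedler_cong sweedler_hom sweedler_closed) auto
  finally show ?thesis .
qed

lemma sweedler_hom2:
  assumes "abelian_group G" "abelian_group G'" "addhom G G' h" "x \<in> carrier H" "y \<in> carrier H"
    "\<And>a b c d. a \<in> carrier H \<Longrightarrow> b \<in> carrier H \<Longrightarrow> c \<in> carrier H \<Longrightarrow> d \<in> carrier H \<Longrightarrow>
       f a b c d \<in> carrier G"
  shows "h (sw G (\<lambda>a b. sw G (f a b) y) x) = sw G' (\<lambda>a b. sw G' (\<lambda>c d. h (f a b c d)) y) x"
proof -
  have "h (sw G (\<lambda>a b. sw G (f a b) y) x) = sw G' (\<lambda>a b. h (sw G (f a b) y)) x"
    using assms by (intro sweedler_hom sweedler_closed) auto
  also have "\<dots> = sw G' (\<lambda>a b. sw G' (\<lambda>c d. h (f a b c d)) y) x"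
    using assms addhom_closed[OF assms(3)]
    by (intro sweedler_cong sweedler_hom sweedler_closed) auto
  finally show ?thesis .
qed

lemma sweedler_cong2:
  assumes "abelian_group G" "x \<in> carrier H" "y \<in> carrier H"
    "\<And>a b c d. a \<in> carrier H \<Longrightarrow> b \<in> carrier H \<Longrightarrow> c \<in> carrier H \<Longrightarrow> d \<in> carrier H \<Longrightarrow>
       g a b c d \<in> carrier G"
    "\<And>a b c d. a \<in> carrier H \<Longrightarrow> b \<in> carrier H \<Longrightarrow> c \<in> carrier H \<Longrightarrow> d \<in> carrier H \<Longrightarrow>
       f a b c d = g a b c d"
  shows "sw G (\<lambda>a b. sw G (f a b) y) x = sw G (\<lambda>a b. sw G (g a b) y) x"
  using assms by (intro sweedler_cong sweedler_closed) auto

end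

section \<open>Dictionary between bilinear maps on \<open>H\<close> and elements of the convolution
  algebra on \<open>H \<otimes> H\<close>\<close>

context hopf_values begin

lemma sw_A0: "sw A0 = sw L"
  by (rule sweedler_cong_add[OF same_add_A0])

lemma L_ab: "abelian_group L" ..

text \<open>Cocycles are arbitrary functions off the carrier, while elements of the convolution
  algebra are extensional; this truncation is the passage from the former to the latter.\<close>

definition ext2 :: "('h \<Rightarrow> 'h \<Rightarrow> 'l) \<Rightarrow> 'h \<Rightarrow> 'h \<Rightarrow> 'l" where
  "ext2 \<alpha> = (\<lambda>x\<in>carrier H. \<lambda>y\<in>carrier H. \<alpha> x y)"

lemma ext2_apply: "x \<in> carrier H \<Longrightarrow> y \<in> carrier H \<Longrightarrow> ext2 \<alpha> x y = \<alpha> x y"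
  by (simp add: ext2_def)

lemma bilinearD:
  assumes "bilinear_map k H H A0 \<alpha>" "x \<in> carrier H" "y \<in> carrier H"
  shows "\<alpha> x y \<in> carrier L"
    "x' \<in> carrier H \<Longrightarrow> \<alpha> (x \<oplus>\<^bsub>H\<^esub> x') y = \<alpha> x y \<oplus>\<^bsub>L\<^esub> \<alpha> x' y"
    "y' \<in> carrier H \<Longrightarrow> \<alpha> x (y \<oplus>\<^bsub>H\<^esub> y') = \<alpha> x y \<oplus>\<^bsub>L\<^esub> \<alpha> x y'"
    "r \<in> carrier k \<Longrightarrow> \<alpha> (r \<odot>\<^bsub>H\<^esub> x) y = \<rho> r \<otimes>\<^bsub>L\<^esub> \<alpha> x y"
    "r \<in> carrier k \<Longrightarrow> \<alpha> x (r \<odot>\<^bsub>H\<^esub> y) = \<rho> r \<otimes>\<^bsub>L\<^esub> \<alpha> x y"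
  using assms by (auto simp: bilinear_map_def linear_map_def)

lemma ext2_closed:
  assumes "bilinear_map k H H A0 \<alpha>" shows "ext2 \<alpha> \<in> carrier A2"
proof -
  note b = bilinearD[OF assms]
  have 1: "(\<lambda>y\<in>carrier H. \<alpha> x y) \<in> carrier A1" if "x \<in> carrier H" for x
    using assms that by (intro conv_restrict) (auto simp: bilinear_map_def)
  have "linear_map k H A1 (\<lambda>x. \<lambda>y\<in>carrier H. \<alpha> x y)"
  proof (rule linear_mapI)
    show "(\<lambda>y\<in>carrier H. \<alpha> (x \<oplus>\<^bsub>H\<^esub> x') y) = (\<lambda>y\<in>carrier H. \<alpha> x y) \<oplus>\<^bsub>A1\<^esub> (\<lambda>y\<in>carrier H. \<alpha> x' y)"
      if "x \<in> carrier H" "x' \<in> carrier H" for x x'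
      using that by (intro conv_eqI[of _ A0] A0.conv_add_closed 1) (auto simp: conv_apply b)
    show "(\<lambda>y\<in>carrier H. \<alpha> (r \<odot>\<^bsub>H\<^esub> x) y) = r \<odot>\<^bsub>A1\<^esub> (\<lambda>y\<in>carrier H. \<alpha> x y)"
      if "r \<in> carrier k" "x \<in> carrier H" for r x
      using that by (intro conv_eqI[of _ A0] A0.conv_smult_closed 1) (auto simp: conv_apply b)
  qed (rule 1)
  from conv_restrict[OF this] show ?thesis by (simp add: ext2_def)
qed

lemma A2_bilinear:
  assumes F: "F \<in> carrier A2" and eq: "\<And>x y. x \<in> carrier H \<Longrightarrow> y \<in> carrier H \<Longrightarrow> \<alpha> x y = F x y"
  shows "bilinear_map k H H A0 \<alpha>"
proof -
  note l = linear_mapD[OF conv_carrierD(2)[OF F]]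
  have "linear_map k H A0 (\<lambda>y. F x y)" if "x \<in> carrier H" for x
    using conv_carrierD(2)[OF l(1)[OF that]] .
  moreover have "linear_map k H A0 (\<lambda>x. F x y)" if "y \<in> carrier H" for y
    using that A2_closed[OF F] by (intro linear_mapI) (auto simp: l conv_apply)
  ultimately show ?thesis using eq unfolding bilinear_map_def linear_map_def by (auto simp: Pi_iff)
qed

lemma A2_mult:
  assumes "F \<in> carrier A2" "G \<in> carrier A2" "x \<in> carrier H" "y \<in> carrier H"
  shows "(F \<otimes>\<^bsub>A2\<^esub> G) x y = sw L (\<lambda>a b. sw L (\<lambda>c d. F a c \<otimes>\<^bsub>L\<^esub> G b d) y) x"
  by (simp add: conv_eval_mult[OF A0_algebra assms] sw_A0)

lemma A2_one: "x \<in> carrier H \<Longrightarrow> y \<in> carrier H \<Longrightarrow> \<one>\<^bsub>A2\<^esub> x y = \<rho> (\<epsilon> x \<otimes>\<^bsub>k\<^esub> \<epsilon> y)"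
  by (simp add: conv_apply)

lemma conv2_eq:
  assumes "F \<in> carrier A2" "G \<in> carrier A2" "x \<in> carrier H" "y \<in> carrier H"
    "\<And>x y. x \<in> carrier H \<Longrightarrow> y \<in> carrier H \<Longrightarrow> \<alpha> x y = F x y"
    "\<And>x y. x \<in> carrier H \<Longrightarrow> y \<in> carrier H \<Longrightarrow> \<alpha>' x y = G x y"
  shows "conv2 H L \<alpha> \<alpha>' x y = (F \<otimes>\<^bsub>A2\<^esub> G) x y"
  unfolding conv2_def A2_mult[OF assms(1-4)] using assms A2_closed
  by (intro sweedler_cong2 L_ab) auto

text \<open>Each side of \<open>cocycle\<close> is a convolution in three arguments, but the
  Sweedler identity sums over two only: an argument that enters one factor through a counit
  contributes no sum.\<close>

lemma two_cocycle_iff: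
  assumes F: "F \<in> carrier A2" and eq: "\<And>x y. x \<in> carrier H \<Longrightarrow> y \<in> carrier H \<Longrightarrow> \<alpha> x y = F x y"
  shows "two_cocycle k H L \<rho> \<alpha> \<longleftrightarrow> cocycle F"
proof -
  have l: "(d12 F \<otimes>\<^bsub>A3\<^esub> dm12 F) x y z =
      sw L (\<lambda>x1 x2. sw L (\<lambda>y1 y2. \<alpha> x1 y1 \<otimes>\<^bsub>L\<^esub> \<alpha> (x2 \<otimes>\<^bsub>H\<^esub> y2) z) y) x"
    if xyz: "x \<in> carrier H" "y \<in> carrier H" "z \<in> carrier H" for x y z
  proof -
    \<comment> \<open>In the third argument the left factor is a constant times the counit, so the
      innermost convolution collapses.\<close>
    have u: "d12 F a c = conv_unit A0 (F a c)" if "a \<in> carrier H" "c \<in> carrier H" for a c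
      using that by (simp add: d12_def conv_map_apply)
    have cl: "d12 F a c \<in> carrier A1" "dm12 F a c \<in> carrier A1" if "a \<in> carrier H" "c \<in> carrier H" for a c
      using that F by (auto intro!: conv_carrierD(3)[of _ A1] conv_carrierD(3)[of _ A2])
    have "(d12 F \<otimes>\<^bsub>A3\<^esub> dm12 F) x y z
        = (sw A1 (\<lambda>a b. sw A1 (\<lambda>c d. d12 F a c \<otimes>\<^bsub>A1\<^esub> dm12 F b d) y) x) z"
      using F xyz by (simp add: conv_eval_mult[OF A0.conv_algebra])
    also have "\<dots> = sw A0 (\<lambda>a b. sw A0 (\<lambda>c d. (d12 F a c \<otimes>\<^bsub>A1\<^esub> dm12 F b d) z) y) x"
      using xyz cl by (intro sweedler_hom2[of A1 A0 "\<lambda>f. f z"] conv_eval_addhom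
          A0.A.abelian_group_axioms A0.conv.abelian_group_axioms) (auto simp: A0.conv_closed)
    also have "\<dots> = sw L (\<lambda>x1 x2. sw L (\<lambda>y1 y2. \<alpha> x1 y1 \<otimes>\<^bsub>L\<^esub> \<alpha> (x2 \<otimes>\<^bsub>H\<^esub> y2) z) y) x"
      unfolding sw_A0 using xyz cl A2_closed[OF F]
      by (intro sweedler_cong2 L_ab) (auto simp: eq u A0.conv_unit_mult d_apply)
    finally show ?thesis .
  qed
  have r: "(d23 F \<otimes>\<^bsub>A3\<^esub> dm23 F) x y z =
      sw L (\<lambda>y1 y2. sw L (\<lambda>z1 z2. \<alpha> y1 z1 \<otimes>\<^bsub>L\<^esub> \<alpha> x (y2 \<otimes>\<^bsub>H\<^esub> z2)) z) y"
    if xyz: "x \<in> carrier H" "y \<in> carrier H" "z \<in> carrier H" for x y z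
  proof -
    have "(d23 F \<otimes>\<^bsub>A3\<^esub> dm23 F) x y z = (F \<otimes>\<^bsub>A2\<^esub> dm23 F x) y z"
      using F xyz by (simp add: d23_def A2.conv_unit_mult)
    also have "\<dots> = sw L (\<lambda>y1 y2. sw L (\<lambda>z1 z2. F y1 z1 \<otimes>\<^bsub>L\<^esub> dm23 F x y2 z2) z) y"
      using F xyz by (intro A2_mult) (auto intro!: conv_carrierD(3)[of _ A2])
    also have "\<dots> = sw L (\<lambda>y1 y2. sw L (\<lambda>z1 z2. \<alpha> y1 z1 \<otimes>\<^bsub>L\<^esub> \<alpha> x (y2 \<otimes>\<^bsub>H\<^esub> z2)) z) y"
      using xyz A2_closed[OF F] by (intro sweedler_cong2 L_ab) (auto simp: eq d_apply)
    finally show ?thesis .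
  qed
  have "cocycle F \<longleftrightarrow> (\<forall>x\<in>carrier H. \<forall>y\<in>carrier H. \<forall>z\<in>carrier H.
     (d12 F \<otimes>\<^bsub>A3\<^esub> dm12 F) x y z = (d23 F \<otimes>\<^bsub>A3\<^esub> dm23 F) x y z)"
    unfolding cocycle_def using F A3_eqI[of "d12 F \<otimes>\<^bsub>A3\<^esub> dm12 F" "d23 F \<otimes>\<^bsub>A3\<^esub> dm23 F"]
    by (auto simp: A2.conv_closed)
  then show ?thesis
    using A2_bilinear[OF F eq] by (simp add: two_cocycle_def l r)
qed

text \<open>The legs live in different arguments, so no Sweedler sum survives, and commutativity of
  \<open>L\<close> makes their order immaterial.\<close>

lemma leg12_apply:
  assumes "T \<in> carrier A1" "x \<in> carrier H" "y \<in> carrier H"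
  shows "(leg1 T \<otimes>\<^bsub>A2\<^esub> leg2 T) x y = T x \<otimes>\<^bsub>L\<^esub> T y" "(leg2 T \<otimes>\<^bsub>A2\<^esub> leg1 T) x y = T x \<otimes>\<^bsub>L\<^esub> T y"
proof -
  have l: "leg1 T \<in> carrier A2" "leg1 T x \<in> carrier A1" "leg1 T x = conv_unit A0 (T x)"
    using assms legs_closed(1)[OF assms(1)] conv_carrierD(3)[OF legs_closed(1)[OF assms(1)] assms(2)]
    by (simp_all add: leg1_def conv_map_apply)
  show "(leg1 T \<otimes>\<^bsub>A2\<^esub> leg2 T) x y = T x \<otimes>\<^bsub>L\<^esub> T y"
    unfolding leg2_def using assms l A0.conv_unit_mult(1)[of "T x" T y]
    by (simp add: A1.conv_unit_mult A1_closed)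
  show "(leg2 T \<otimes>\<^bsub>A2\<^esub> leg1 T) x y = T x \<otimes>\<^bsub>L\<^esub> T y"
    unfolding leg2_def using assms l A0.conv_unit_mult(2)[of "T x" T y]
    by (simp add: A1.conv_unit_mult A1_closed L.m_comm)
qed

text \<open>Brings a triple product into the nested form in which \<open>sigma\<close> and
  \<open>sigma_inv\<close> are defined.\<close>

lemma A2_mult3:
  assumes P: "P \<in> carrier A2" and Q: "Q \<in> carrier A2" and R: "R \<in> carrier A2"
    and x: "x \<in> carrier H" and y: "y \<in> carrier H"
  shows "(P \<otimes>\<^bsub>A2\<^esub> (Q \<otimes>\<^bsub>A2\<^esub> R)) x y = sweedler3 L H (\<lambda>x1 x2 x3. sweedler3 L H (\<lambda>y1 y2 y3.
       P x1 y1 \<otimes>\<^bsub>L\<^esub> (Q x2 y2 \<otimes>\<^bsub>L\<^esub> R x3 y3)) y) x"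
proof -
  note cl = A2_closed[OF P] A2_closed[OF Q] A2_closed[OF R]
  note mult_hom = A0.A.addhom_mult_left[unfolded addhom_cong_add[OF same_add_A0 same_add_A0], simplified]
  let ?f = "\<lambda>x1 y1 x2 x3 y2 y3. P x1 y1 \<otimes>\<^bsub>L\<^esub> (Q x2 y2 \<otimes>\<^bsub>L\<^esub> R x3 y3)"
  have "(P \<otimes>\<^bsub>A2\<^esub> (Q \<otimes>\<^bsub>A2\<^esub> R)) x y
      = sw L (\<lambda>x1 x'. sw L (\<lambda>y1 y'. P x1 y1 \<otimes>\<^bsub>L\<^esub> (Q \<otimes>\<^bsub>A2\<^esub> R) x' y') y) x"
    using P Q R x y by (intro A2_mult A1.conv_closed)
  also have "\<dots> = sw L (\<lambda>x1 x'. sw L (\<lambda>y1 y'. sw L (\<lambda>x2 x3. sw L (\<lambda>y2 y3. ?f x1 y1 x2 x3 y2 y3) y') x') y) x"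
  proof (intro sweedler_cong2 L_ab x y)
    fix a b c d assume h: "a \<in> carrier H" "b \<in> carrier H" "c \<in> carrier H" "d \<in> carrier H"
    show "sw L (\<lambda>x2 x3. sw L (\<lambda>y2 y3. ?f a c x2 x3 y2 y3) d) b \<in> carrier L"
      using h cl by (intro sweedler_closed L_ab) auto
    show "P a c \<otimes>\<^bsub>L\<^esub> (Q \<otimes>\<^bsub>A2\<^esub> R) b d = sw L (\<lambda>x2 x3. sw L (\<lambda>y2 y3. ?f a c x2 x3 y2 y3) d) b"
      unfolding A2_mult[OF Q R h(2,4)] using h cl
      by (intro sweedler_hom2[OF L_ab L_ab mult_hom]) auto
  qed
  \<comment> \<open>The second splitting of \<open>x\<close> is moved outside the first splitting of
    \<open>y\<close>, so that all sums over \<open>x\<close> come first.\<close>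
  also have "\<dots> = sw L (\<lambda>x1 x'. sw L (\<lambda>x2 x3. sw L (\<lambda>y1 y'. sw L (\<lambda>y2 y3. ?f x1 y1 x2 x3 y2 y3) y') y) x') x"
    using x y cl by (intro sweedler_cong[OF L_ab x] sweedler_swap L_ab sweedler_closed) auto
  finally show ?thesis by (simp add: sweedler3_def)
qed

lemma gauge_closed [simp]:
  "T \<in> carrier A1 \<Longrightarrow> S \<in> carrier A1 \<Longrightarrow> \<alpha> \<in> carrier A2 \<Longrightarrow> gauge T \<alpha> S \<in> carrier A2"
  by (simp add: gauge_def A1.conv_closed)

text \<open>The factors of \<open>gauge\<close> are inverted in reverse order, the two legs
  included; this makes it a two-sided inverse by mere cancellation.\<close>

definition "gauge_inv T \<alpha>' S = conv_pull T \<otimes>\<^bsub>A2\<^esub> (\<alpha>' \<otimes>\<^bsub>A2\<^esub> (leg2 S \<otimes>\<^bsub>A2\<^esub> leg1 S))"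

lemma gauge_inv_closed [simp]:
  "T \<in> carrier A1 \<Longrightarrow> S \<in> carrier A1 \<Longrightarrow> \<alpha>' \<in> carrier A2 \<Longrightarrow> gauge_inv T \<alpha>' S \<in> carrier A2"
  by (simp add: gauge_inv_def A1.conv_closed)

lemma gauge_apply:
  assumes "T \<in> carrier A1" "S \<in> carrier A1" "\<alpha> \<in> carrier A2" "x \<in> carrier H" "y \<in> carrier H"
  shows "gauge T \<alpha> S x y = sweedler3 L H (\<lambda>x1 x2 x3. sweedler3 L H (\<lambda>y1 y2 y3.
       T x1 \<otimes>\<^bsub>L\<^esub> T y1 \<otimes>\<^bsub>L\<^esub> \<alpha> x2 y2 \<otimes>\<^bsub>L\<^esub> S (x3 \<otimes>\<^bsub>H\<^esub> y3)) y) x"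
proof -
  have "leg1 T \<otimes>\<^bsub>A2\<^esub> leg2 T \<in> carrier A2" using assms by (simp add: A1.conv_closed)
  then show ?thesis
    unfolding gauge_def using assms
    by (subst A2_mult3) (auto simp: leg12_apply legs_apply L.m_assoc A1_closed A2_closed
        intro!: sweedler3_cong sweedler3_closed L_ab)
qed

lemma gauge_inv_apply:
  assumes "T \<in> carrier A1" "S \<in> carrier A1" "\<alpha>' \<in> carrier A2" "x \<in> carrier H" "y \<in> carrier H"
  shows "gauge_inv T \<alpha>' S x y = sweedler3 L H (\<lambda>x1 x2 x3. sweedler3 L H (\<lambda>y1 y2 y3.
       T (x1 \<otimes>\<^bsub>H\<^esub> y1) \<otimes>\<^bsub>L\<^esub> \<alpha>' x2 y2 \<otimes>\<^bsub>L\<^esub> S x3 \<otimes>\<^bsub>L\<^esub> S y3) y) x"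
proof -
  have "leg2 S \<otimes>\<^bsub>A2\<^esub> leg1 S \<in> carrier A2" using assms by (simp add: A1.conv_closed)
  then show ?thesis
    unfolding gauge_inv_def using assms
    by (subst A2_mult3) (auto simp: leg12_apply legs_apply L.m_assoc A1_closed A2_closed
        intro!: sweedler3_cong sweedler3_closed L_ab)
qed

end

locale gauge_pair = hopf_values +
  fixes T S
  assumes T [simp]: "T \<in> carrier A1" and S [simp]: "S \<in> carrier A1"
    and ST: "S \<otimes>\<^bsub>A1\<^esub> T = \<one>\<^bsub>A1\<^esub>" and TS: "T \<otimes>\<^bsub>A1\<^esub> S = \<one>\<^bsub>A1\<^esub>"
begin

lemma leg_inverse:
  assumes "\<phi> \<in> {leg1, leg2, conv_pull}" "w \<in> carrier A2"
  shows "\<phi> S \<otimes>\<^bsub>A2\<^esub> (\<phi> T \<otimes>\<^bsub>A2\<^esub> w) = w" "\<phi> T \<otimes>\<^bsub>A2\<^esub> (\<phi> S \<otimes>\<^bsub>A2\<^esub> w) = w"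
    "\<phi> S \<otimes>\<^bsub>A2\<^esub> \<phi> T = \<one>\<^bsub>A2\<^esub>" "\<phi> T \<otimes>\<^bsub>A2\<^esub> \<phi> S = \<one>\<^bsub>A2\<^esub>"
proof -
  have h: "alg_hom k A1 A2 \<phi>" using assms leg1_hom leg2_hom pull_hom by auto
  note c = alg_homD(2)[OF h T] alg_homD(2)[OF h S]
  show 1: "\<phi> S \<otimes>\<^bsub>A2\<^esub> \<phi> T = \<one>\<^bsub>A2\<^esub>" using alg_homD(4,6)[OF h] ST S T by metis
  show 2: "\<phi> T \<otimes>\<^bsub>A2\<^esub> \<phi> S = \<one>\<^bsub>A2\<^esub>" using alg_homD(4,6)[OF h] TS S T by metis
  show "\<phi> S \<otimes>\<^bsub>A2\<^esub> (\<phi> T \<otimes>\<^bsub>A2\<^esub> w) = w" "\<phi> T \<otimes>\<^bsub>A2\<^esub> (\<phi> S \<otimes>\<^bsub>A2\<^esub> w) = w"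
    using assms(2) c 1 2 by (simp_all flip: A1.conv_assoc)
qed

text \<open>The coboundary relation
  \<open>\<beta>(x1, y1) T(x2 y2) = T(x1) T(y1) \<alpha>(x2, y2)\<close> for the transform
  \<open>\<beta>\<close>. In this form, free of \<open>S\<close>, it enters the proof that the
  induced linear map is multiplicative.\<close>

lemma gauge_pull:
  assumes "\<alpha> \<in> carrier A2"
  shows "gauge T \<alpha> S \<otimes>\<^bsub>A2\<^esub> conv_pull T = leg1 T \<otimes>\<^bsub>A2\<^esub> leg2 T \<otimes>\<^bsub>A2\<^esub> \<alpha>"
  using assms by (simp add: gauge_def A1.conv_assoc A1.conv_closed leg_inverse)

lemma gauge_inverse:
  assumes "\<alpha> \<in> carrier A2" "\<alpha>' \<in> carrier A2" "\<alpha> \<otimes>\<^bsub>A2\<^esub> \<alpha>' = \<one>\<^bsub>A2\<^esub>" "\<alpha>' \<otimes>\<^bsub>A2\<^esub> \<alpha> = \<one>\<^bsub>A2\<^esub>"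
  shows "gauge T \<alpha> S \<otimes>\<^bsub>A2\<^esub> gauge_inv T \<alpha>' S = \<one>\<^bsub>A2\<^esub>"
    "gauge_inv T \<alpha>' S \<otimes>\<^bsub>A2\<^esub> gauge T \<alpha> S = \<one>\<^bsub>A2\<^esub>"
proof -
  have a: "\<alpha> \<otimes>\<^bsub>A2\<^esub> (\<alpha>' \<otimes>\<^bsub>A2\<^esub> w) = w" "\<alpha>' \<otimes>\<^bsub>A2\<^esub> (\<alpha> \<otimes>\<^bsub>A2\<^esub> w) = w" if "w \<in> carrier A2" for w
    using that assms by (simp_all flip: A1.conv_assoc)
  show "gauge T \<alpha> S \<otimes>\<^bsub>A2\<^esub> gauge_inv T \<alpha>' S = \<one>\<^bsub>A2\<^esub>"
    "gauge_inv T \<alpha>' S \<otimes>\<^bsub>A2\<^esub> gauge T \<alpha> S = \<one>\<^bsub>A2\<^esub>"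
    using assms(1,2) by (simp_all add: gauge_def gauge_inv_def A1.conv_assoc A1.conv_closed leg_inverse a)
qed

text \<open>Setting one argument to 1 is an algebra morphism from \<open>A2\<close> to
  \<open>A1\<close>. Under it one leg becomes \<open>T\<close>, the other becomes the unit because
  \<open>T\<close> is 1 at 1, \<open>\<alpha>\<close> becomes the unit by normalization, and
  \<open>T\<close> cancels against \<open>S\<close>.\<close>

lemma gauge_normalized:
  assumes \<alpha>: "\<alpha> \<in> carrier A2" and n: "\<And>x. x \<in> carrier H \<Longrightarrow> \<alpha> x \<one>\<^bsub>H\<^esub> = \<rho> (\<epsilon> x)"
    "\<And>x. x \<in> carrier H \<Longrightarrow> \<alpha> \<one>\<^bsub>H\<^esub> x = \<rho> (\<epsilon> x)"
    and T1: "T \<one>\<^bsub>H\<^esub> = \<one>\<^bsub>L\<^esub>" and x: "x \<in> carrier H"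
  shows "gauge T \<alpha> S x \<one>\<^bsub>H\<^esub> = \<rho> (\<epsilon> x)" "gauge T \<alpha> S \<one>\<^bsub>H\<^esub> x = \<rho> (\<epsilon> x)"
proof -
  let ?r = "conv_map (\<lambda>f. f \<one>\<^bsub>H\<^esub>)" and ?l = "\<lambda>F. F \<one>\<^bsub>H\<^esub>"
  have hr: "alg_hom k A2 A1 ?r"
    by (intro conv_map_hom A0.conv_eval_one_hom A0_algebra A0.conv_algebra)
  have hl: "alg_hom k A2 A1 ?l" by (rule A1.conv_eval_one_hom)
  note cl = alg_homD(2)[OF hl legs_closed(1)[OF T]] alg_homD(2)[OF hl legs_closed(2)[OF T]]
    alg_homD(2)[OF hl \<alpha>] alg_homD(2)[OF hl legs_closed(3)[OF S]]
  have e: "?r (leg1 T) = T" "?r (leg2 T) = \<one>\<^bsub>A1\<^esub>" "?r \<alpha> = \<one>\<^bsub>A1\<^esub>" "?r (conv_pull S) = S"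
    "?l (leg1 T) = \<one>\<^bsub>A1\<^esub>" "?l (leg2 T) = T" "?l \<alpha> = \<one>\<^bsub>A1\<^esub>" "?l (conv_pull S) = S"
    using \<alpha> T1 n
    by (auto intro!: conv_eqI[of _ A0] alg_homD(2)[OF hr] A0.conv_one_closed
        simp: cl conv_map_apply legs_apply conv_apply counit_simps A1_closed)
  have "?r (gauge T \<alpha> S) = \<one>\<^bsub>A1\<^esub>" "?l (gauge T \<alpha> S) = \<one>\<^bsub>A1\<^esub>"
    using \<alpha> by (simp_all add: gauge_def alg_homD(4)[OF hr] alg_homD(4)[OF hl, unfolded] e A1.conv_closed TS
        A0.conv_one_mult)
  then show "gauge T \<alpha> S x \<one>\<^bsub>H\<^esub> = \<rho> (\<epsilon> x)" "gauge T \<alpha> S \<one>\<^bsub>H\<^esub> x = \<rho> (\<epsilon> x)"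
    using x by (auto simp: conv_map_apply conv_apply dest!: fun_cong[where x = x])
qed

end

section \<open>Tensor products of algebras\<close>

text \<open>What it takes to multiply pure tensors. Twisted algebras satisfy it directly, without a
  preceding proof of associativity or of the unit laws.\<close>

definition bilinear_mult :: "('r, 'x) ring_scheme \<Rightarrow> ('r, 'a, 'm) module_scheme \<Rightarrow> bool" where
  "bilinear_mult R A \<longleftrightarrow>
     (\<forall>x\<in>carrier A. addhom A A (\<lambda>y. x \<otimes>\<^bsub>A\<^esub> y)) \<and>
     (\<forall>y\<in>carrier A. addhom A A (\<lambda>x. x \<otimes>\<^bsub>A\<^esub> y)) \<and>
     (\<forall>r\<in>carrier R. \<forall>x\<in>carrier A. \<forall>y\<in>carrier A.
        (r \<odot>\<^bsub>A\<^esub> x) \<otimes>\<^bsub>A\<^esub> y = r \<odot>\<^bsub>A\<^esub> (x \<otimes>\<^bsub>A\<^esub> y) \<and>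
        x \<otimes>\<^bsub>A\<^esub> (r \<odot>\<^bsub>A\<^esub> y) = r \<odot>\<^bsub>A\<^esub> (x \<otimes>\<^bsub>A\<^esub> y))"

lemma bilinear_multD:
  assumes "bilinear_mult R A" "x \<in> carrier A" "y \<in> carrier A"
  shows "x \<otimes>\<^bsub>A\<^esub> y \<in> carrier A"
    "z \<in> carrier A \<Longrightarrow> x \<otimes>\<^bsub>A\<^esub> (y \<oplus>\<^bsub>A\<^esub> z) = x \<otimes>\<^bsub>A\<^esub> y \<oplus>\<^bsub>A\<^esub> x \<otimes>\<^bsub>A\<^esub> z"
    "z \<in> carrier A \<Longrightarrow> (x \<oplus>\<^bsub>A\<^esub> z) \<otimes>\<^bsub>A\<^esub> y = x \<otimes>\<^bsub>A\<^esub> y \<oplus>\<^bsub>A\<^esub> z \<otimes>\<^bsub>A\<^esub> y"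
    "r \<in> carrier R \<Longrightarrow> (r \<odot>\<^bsub>A\<^esub> x) \<otimes>\<^bsub>A\<^esub> y = r \<odot>\<^bsub>A\<^esub> (x \<otimes>\<^bsub>A\<^esub> y)"
    "r \<in> carrier R \<Longrightarrow> x \<otimes>\<^bsub>A\<^esub> (r \<odot>\<^bsub>A\<^esub> y) = r \<odot>\<^bsub>A\<^esub> (x \<otimes>\<^bsub>A\<^esub> y)"
  using assms by (auto simp: bilinear_mult_def addhom_def Pi_iff)

locale tensor_mult = tensor_product R A B
  for R :: "('r, 'x) ring_scheme" and A :: "('r, 'a, 'm) module_scheme"
    and B :: "('r, 'b, 'n) module_scheme" +
  assumes bilinear_A: "bilinear_mult R A" and bilinear_B: "bilinear_mult R B"
begin

lemmas mult_A [simp] = bilinear_multD[OF bilinear_A]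
lemmas mult_B [simp] = bilinear_multD[OF bilinear_B]
lemmas [simp] = smult_closed_M smult_closed_N M.a_closed N.a_closed

abbreviation "TT \<equiv> tensor R A B"
abbreviation "\<tau> \<equiv> pure_tensor R A B"

lemma tau_simps:
  "a \<in> carrier A \<Longrightarrow> b \<in> carrier B \<Longrightarrow> \<tau> a b \<in> carrier TT"
  "a \<in> carrier A \<Longrightarrow> a' \<in> carrier A \<Longrightarrow> b \<in> carrier B \<Longrightarrow>
     \<tau> (a \<oplus>\<^bsub>A\<^esub> a') b = \<tau> a b \<oplus>\<^bsub>TT\<^esub> \<tau> a' b"
  "a \<in> carrier A \<Longrightarrow> b \<in> carrier B \<Longrightarrow> b' \<in> carrier B \<Longrightarrow>
     \<tau> a (b \<oplus>\<^bsub>B\<^esub> b') = \<tau> a b \<oplus>\<^bsub>TT\<^esub> \<tau> a b'"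
  "r \<in> carrier R \<Longrightarrow> a \<in> carrier A \<Longrightarrow> b \<in> carrier B \<Longrightarrow>
     \<tau> (r \<odot>\<^bsub>A\<^esub> a) b = \<tau> a (r \<odot>\<^bsub>B\<^esub> b)"
  using balancedD[OF pure_balanced] by auto

lemma TT_ab: "abelian_group TT" by (rule tensor_abelian)

sublocale TT: plain_group TT by (rule plain_group.intro) (rule tensor_abelian)

lemma balanced_translate:
  assumes "a \<in> carrier A" "b \<in> carrier B"
  shows "balanced R A B TT (\<lambda>a' b'. \<tau> (a \<otimes>\<^bsub>A\<^esub> a') (b \<otimes>\<^bsub>B\<^esub> b'))"
proof (rule balancedI)
  show "\<tau> (a \<otimes>\<^bsub>A\<^esub> (r \<odot>\<^bsub>A\<^esub> x)) (b \<otimes>\<^bsub>B\<^esub> y) = \<tau> (a \<otimes>\<^bsub>A\<^esub> x) (b \<otimes>\<^bsub>B\<^esub> (r \<odot>\<^bsub>B\<^esub> y))"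
    if "r \<in> carrier R" "x \<in> carrier A" "y \<in> carrier B" for r x y
    using assms that by (simp add: mult_A(4,5) mult_B(4,5) tau_simps)
qed (use assms in \<open>auto simp: tau_simps mult_A(2) mult_B(2)\<close>)

text \<open>Left multiplication by the pure tensor of \<open>a\<close> and \<open>b\<close>, the
  inner of the two lifts in the product. Its balancedness in \<open>a\<close>, \<open>b\<close>
  makes the outer lift well defined.\<close>

definition "translate a b U = lift2 TT (\<lambda>a' b'. \<tau> (a \<otimes>\<^bsub>A\<^esub> a') (b \<otimes>\<^bsub>B\<^esub> b')) U"

lemma translate_addhom: "a \<in> carrier A \<Longrightarrow> b \<in> carrier B \<Longrightarrow> addhom TT TT (translate a b)"
  unfolding translate_def[abs_def] by (rule lift2_hom(1)[OF TT_ab balanced_translate])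

lemma translate_pure:
  "a \<in> carrier A \<Longrightarrow> b \<in> carrier B \<Longrightarrow> a' \<in> carrier A \<Longrightarrow> b' \<in> carrier B \<Longrightarrow>
     translate a b (\<tau> a' b') = \<tau> (a \<otimes>\<^bsub>A\<^esub> a') (b \<otimes>\<^bsub>B\<^esub> b')"
  unfolding translate_def by (rule lift2_hom(2)[OF TT_ab balanced_translate])

lemma addhom_plus:
  "addhom TT TT f \<Longrightarrow> addhom TT TT g \<Longrightarrow> addhom TT TT (\<lambda>x. f x \<oplus>\<^bsub>TT\<^esub> g x)"
  by (rule addhomI) (auto simp: addhom_closed addhom_add TT.a_ac)

lemma translate_balanced:
  assumes U: "U \<in> carrier TT"
  shows "balanced R A B TT (\<lambda>a b. translate a b U)"
proof (rule balancedI)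
  show "translate (a \<oplus>\<^bsub>A\<^esub> a') b U = translate a b U \<oplus>\<^bsub>TT\<^esub> translate a' b U"
    if "a \<in> carrier A" "a' \<in> carrier A" "b \<in> carrier B" for a a' b
    using that
    by (intro tensor_ext[OF TT_ab translate_addhom addhom_plus[OF translate_addhom translate_addhom] _ U])
      (auto simp: translate_pure tau_simps mult_A(3))
  show "translate a (b \<oplus>\<^bsub>B\<^esub> b') U = translate a b U \<oplus>\<^bsub>TT\<^esub> translate a b' U"
    if "a \<in> carrier A" "b \<in> carrier B" "b' \<in> carrier B" for a b b'
    using that
    by (intro tensor_ext[OF TT_ab translate_addhom addhom_plus[OF translate_addhom translate_addhom] _ U])
      (auto simp: translate_pure tau_simps mult_B(3))
  show "translate (r \<odot>\<^bsub>A\<^esub> a) b U = translate a (r \<odot>\<^bsub>B\<^esub> b) U"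
    if "r \<in> carrier R" "a \<in> carrier A" "b \<in> carrier B" for r a b
    using that
    by (intro tensor_ext[OF TT_ab translate_addhom translate_addhom _ U])
      (auto simp: translate_pure tau_simps mult_A(4,5) mult_B(4,5))
qed (use U addhom_closed[OF translate_addhom] in auto)

lemma TT_mult: "T \<otimes>\<^bsub>TT\<^esub> U = lift2 TT (\<lambda>a b. translate a b U) T"
  by (simp add: tensor_mult translate_def)

lemma mult_pure_left:
  "a \<in> carrier A \<Longrightarrow> b \<in> carrier B \<Longrightarrow> U \<in> carrier TT \<Longrightarrow> \<tau> a b \<otimes>\<^bsub>TT\<^esub> U = translate a b U"
  unfolding TT_mult by (rule lift2_hom(2)[OF TT_ab translate_balanced])

lemma mult_pure:
  "a \<in> carrier A \<Longrightarrow> b \<in> carrier B \<Longrightarrow> a' \<in> carrier A \<Longrightarrow> b' \<in> carrier B \<Longrightarrow>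
     \<tau> a b \<otimes>\<^bsub>TT\<^esub> \<tau> a' b' = \<tau> (a \<otimes>\<^bsub>A\<^esub> a') (b \<otimes>\<^bsub>B\<^esub> b')"
  by (simp add: mult_pure_left tau_simps translate_pure)

lemma mult_addhom_left: "U \<in> carrier TT \<Longrightarrow> addhom TT TT (\<lambda>T. T \<otimes>\<^bsub>TT\<^esub> U)"
  unfolding TT_mult by (rule lift2_hom(1)[OF TT_ab translate_balanced])

lemma mult_closed: "T \<in> carrier TT \<Longrightarrow> U \<in> carrier TT \<Longrightarrow> T \<otimes>\<^bsub>TT\<^esub> U \<in> carrier TT"
  using addhom_closed[OF mult_addhom_left] .

lemma mult_addhom_right:
  assumes T: "T \<in> carrier TT" shows "addhom TT TT (\<lambda>U. T \<otimes>\<^bsub>TT\<^esub> U)"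
proof (rule addhomI)
  fix U V assume UV: "U \<in> carrier TT" "V \<in> carrier TT"
  show "T \<otimes>\<^bsub>TT\<^esub> (U \<oplus>\<^bsub>TT\<^esub> V) = T \<otimes>\<^bsub>TT\<^esub> U \<oplus>\<^bsub>TT\<^esub> T \<otimes>\<^bsub>TT\<^esub> V"
    using UV
    by (intro tensor_ext[OF TT_ab mult_addhom_left addhom_plus[OF mult_addhom_left mult_addhom_left] _ T])
      (auto simp: mult_pure_left addhom_add[OF translate_addhom])
qed (use T mult_closed in auto)

end

locale tensor_algebra = A: algebra_over R A + B: algebra_over R B
  for R :: "('r, 'x) ring_scheme" and A :: "('r, 'a, 'm) module_scheme"
    and B :: "('r, 'b, 'n) module_scheme"
begin

sublocale R: cring R by (rule A.scalars)

sublocale tensor_product R A B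
  by unfold_locales (intro premoduleI A.module_axioms B.module_axioms)+

sublocale tensor_mult R A B
  by unfold_locales (auto simp: bilinear_mult_def A.smult_mult B.smult_mult
      A.addhom_mult_left A.addhom_mult_right B.addhom_mult_left B.addhom_mult_right)

lemma smult_balanced:
  "r \<in> carrier R \<Longrightarrow> balanced R A B TT (\<lambda>a b. \<tau> (r \<odot>\<^bsub>A\<^esub> a) b)"
  by (rule balancedI)
    (auto simp: tau_simps A.smult_r_distr R.m_comm simp flip: A.smult_assoc1 B.smult_assoc1)

lemma smult_addhom: "r \<in> carrier R \<Longrightarrow> addhom TT TT (\<lambda>T. r \<odot>\<^bsub>TT\<^esub> T)"
  unfolding tensor_smult by (rule lift2_hom(1)[OF TT_ab smult_balanced])

lemma smult_pure:
  "r \<in> carrier R \<Longrightarrow> a \<in> carrier A \<Longrightarrow> b \<in> carrier B \<Longrightarrow> r \<odot>\<^bsub>TT\<^esub> \<tau> a b = \<tau> (r \<odot>\<^bsub>A\<^esub> a) b"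
  unfolding tensor_smult by (rule lift2_hom(2)[OF TT_ab smult_balanced])

text \<open>Both sides of every law are additive in each tensor, so they can be compared on pure
  tensors, one argument at a time.\<close>

lemma TT_algebra: "assoc_algebra R TT"
proof -
  note sc = addhom_closed[OF smult_addhom]
  note comp = addhom_comp[of TT TT _ TT]
  have assoc: "(T \<otimes>\<^bsub>TT\<^esub> U) \<otimes>\<^bsub>TT\<^esub> V = T \<otimes>\<^bsub>TT\<^esub> (U \<otimes>\<^bsub>TT\<^esub> V)"
    if T: "T \<in> carrier TT" and U: "U \<in> carrier TT" and V: "V \<in> carrier TT" for T U V
  proof (rule tensor_ext[OF TT_ab _ _ _ T, of "\<lambda>T. (T \<otimes>\<^bsub>TT\<^esub> U) \<otimes>\<^bsub>TT\<^esub> V"])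
    show "addhom TT TT (\<lambda>T. (T \<otimes>\<^bsub>TT\<^esub> U) \<otimes>\<^bsub>TT\<^esub> V)"
      by (rule addhom_comp[OF mult_addhom_left[OF U] mult_addhom_left[OF V]])
    show "addhom TT TT (\<lambda>T. T \<otimes>\<^bsub>TT\<^esub> (U \<otimes>\<^bsub>TT\<^esub> V))" using U V by (intro mult_addhom_left mult_closed)
    fix a b assume ab: "a \<in> carrier A" "b \<in> carrier B"
    note t = tau_simps(1)[OF ab]
    show "(\<tau> a b \<otimes>\<^bsub>TT\<^esub> U) \<otimes>\<^bsub>TT\<^esub> V = \<tau> a b \<otimes>\<^bsub>TT\<^esub> (U \<otimes>\<^bsub>TT\<^esub> V)"
    proof (rule tensor_ext[OF TT_ab _ _ _ U, of "\<lambda>U. (\<tau> a b \<otimes>\<^bsub>TT\<^esub> U) \<otimes>\<^bsub>TT\<^esub> V"])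
      show "addhom TT TT (\<lambda>U. (\<tau> a b \<otimes>\<^bsub>TT\<^esub> U) \<otimes>\<^bsub>TT\<^esub> V)"
        by (rule addhom_comp[OF mult_addhom_right[OF t] mult_addhom_left[OF V]])
      show "addhom TT TT (\<lambda>U. \<tau> a b \<otimes>\<^bsub>TT\<^esub> (U \<otimes>\<^bsub>TT\<^esub> V))"
        by (rule addhom_comp[OF mult_addhom_left[OF V] mult_addhom_right[OF t]])
      fix c d assume cd: "c \<in> carrier A" "d \<in> carrier B"
      note t' = tau_simps(1)[OF cd]
      show "(\<tau> a b \<otimes>\<^bsub>TT\<^esub> \<tau> c d) \<otimes>\<^bsub>TT\<^esub> V = \<tau> a b \<otimes>\<^bsub>TT\<^esub> (\<tau> c d \<otimes>\<^bsub>TT\<^esub> V)"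
        by (rule tensor_ext[OF TT_ab mult_addhom_right[OF mult_closed[OF t t']]
            addhom_comp[OF mult_addhom_right[OF t'] mult_addhom_right[OF t]] _ V])
          (use ab cd in \<open>simp add: mult_pure tau_simps A.A.m_assoc B.A.m_assoc\<close>)
    qed
  qed
  have id: "addhom TT TT (\<lambda>T. T)" by (rule addhomI) auto
  have one: "\<tau> \<one>\<^bsub>A\<^esub> \<one>\<^bsub>B\<^esub> \<in> carrier TT" by (simp add: tau_simps)
  have "\<one>\<^bsub>TT\<^esub> \<otimes>\<^bsub>TT\<^esub> T = T" if "T \<in> carrier TT" for T
    unfolding tensor_one
    by (rule tensor_ext[OF TT_ab mult_addhom_right[OF one] id _ that]) (simp add: mult_pure)
  moreover have "T \<otimes>\<^bsub>TT\<^esub> \<one>\<^bsub>TT\<^esub> = T" if "T \<in> carrier TT" for T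
    unfolding tensor_one
    by (rule tensor_ext[OF TT_ab mult_addhom_left[OF one] id _ that]) (simp add: mult_pure)
  moreover have "\<one>\<^bsub>TT\<^esub> \<in> carrier TT" by (simp add: tensor_one tau_simps)
  ultimately have "ring TT"
    using assoc mult_closed addhom_add[OF mult_addhom_left] addhom_add[OF mult_addhom_right]
    by (intro ringI TT_ab monoidI) auto
  moreover have "module R TT"
  proof (intro moduleI A.scalars TT_ab sc)
    show "(r \<oplus>\<^bsub>R\<^esub> s) \<odot>\<^bsub>TT\<^esub> T = r \<odot>\<^bsub>TT\<^esub> T \<oplus>\<^bsub>TT\<^esub> s \<odot>\<^bsub>TT\<^esub> T"
      if "r \<in> carrier R" "s \<in> carrier R" "T \<in> carrier TT" for r s T
      using that by (intro tensor_ext[OF TT_ab smult_addhom addhom_plus[OF smult_addhom smult_addhom] _ that(3)])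
        (auto simp: smult_pure A.smult_l_distr tau_simps)
    show "r \<odot>\<^bsub>TT\<^esub> (T \<oplus>\<^bsub>TT\<^esub> U) = r \<odot>\<^bsub>TT\<^esub> T \<oplus>\<^bsub>TT\<^esub> r \<odot>\<^bsub>TT\<^esub> U"
      if "r \<in> carrier R" "T \<in> carrier TT" "U \<in> carrier TT" for r T U
      using addhom_add[OF smult_addhom] that by blast
    show "(r \<otimes>\<^bsub>R\<^esub> s) \<odot>\<^bsub>TT\<^esub> T = r \<odot>\<^bsub>TT\<^esub> (s \<odot>\<^bsub>TT\<^esub> T)"
      if "r \<in> carrier R" "s \<in> carrier R" "T \<in> carrier TT" for r s T
      using that
      by (intro tensor_ext[OF TT_ab smult_addhom addhom_comp[OF smult_addhom smult_addhom] _ that(3)])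
        (auto simp: smult_pure A.smult_assoc1)
    show "\<one>\<^bsub>R\<^esub> \<odot>\<^bsub>TT\<^esub> T = T" if "T \<in> carrier TT" for T
      by (rule tensor_ext[OF TT_ab smult_addhom[OF R.one_closed] id _ that]) (simp add: smult_pure)
  qed
  moreover have "(r \<odot>\<^bsub>TT\<^esub> T) \<otimes>\<^bsub>TT\<^esub> U = r \<odot>\<^bsub>TT\<^esub> (T \<otimes>\<^bsub>TT\<^esub> U)"
    if r: "r \<in> carrier R" and T: "T \<in> carrier TT" and U: "U \<in> carrier TT" for r T U
  proof (rule tensor_ext[OF TT_ab addhom_comp[OF smult_addhom[OF r] mult_addhom_left[OF U]]
        addhom_comp[OF mult_addhom_left[OF U] smult_addhom[OF r]] _ T])
    fix a b assume ab: "a \<in> carrier A" "b \<in> carrier B"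
    note t = tau_simps(1)[OF ab]
    show "(r \<odot>\<^bsub>TT\<^esub> \<tau> a b) \<otimes>\<^bsub>TT\<^esub> U = r \<odot>\<^bsub>TT\<^esub> (\<tau> a b \<otimes>\<^bsub>TT\<^esub> U)"
      by (rule tensor_ext[OF TT_ab mult_addhom_right[OF sc[OF r t]]
        addhom_comp[OF mult_addhom_right[OF t] smult_addhom[OF r]] _ U])
        (use ab r in \<open>auto simp: smult_pure mult_pure A.smult_mult\<close>)
  qed
  moreover have "T \<otimes>\<^bsub>TT\<^esub> (r \<odot>\<^bsub>TT\<^esub> U) = r \<odot>\<^bsub>TT\<^esub> (T \<otimes>\<^bsub>TT\<^esub> U)"
    if r: "r \<in> carrier R" and T: "T \<in> carrier TT" and U: "U \<in> carrier TT" for r T U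
  proof (rule tensor_ext[OF TT_ab mult_addhom_left[OF sc[OF r U]]
        addhom_comp[OF mult_addhom_left[OF U] smult_addhom[OF r]] _ T])
    fix a b assume ab: "a \<in> carrier A" "b \<in> carrier B"
    note t = tau_simps(1)[OF ab]
    show "\<tau> a b \<otimes>\<^bsub>TT\<^esub> (r \<odot>\<^bsub>TT\<^esub> U) = r \<odot>\<^bsub>TT\<^esub> (\<tau> a b \<otimes>\<^bsub>TT\<^esub> U)"
      by (rule tensor_ext[OF TT_ab addhom_comp[OF smult_addhom[OF r] mult_addhom_right[OF t]]
        addhom_comp[OF mult_addhom_right[OF t] smult_addhom[OF r]] _ U])
        (use ab r in \<open>auto simp: smult_pure mult_pure A.smult_mult\<close>)
  qed
  ultimately show ?thesis by (auto simp: assoc_algebra_def)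
qed

sublocale TT: algebra_over R TT by unfold_locales (rule TT_algebra)

end

section \<open>Twisted algebras\<close>

lemma restrict_scalars_simps:
  "carrier (restrict_scalars \<phi> M) = carrier M" "add (restrict_scalars \<phi> M) = add M"
  "\<zero>\<^bsub>restrict_scalars \<phi> M\<^esub> = \<zero>\<^bsub>M\<^esub>" "r \<odot>\<^bsub>restrict_scalars \<phi> M\<^esub> x = \<phi> r \<odot>\<^bsub>M\<^esub> x"
  by (simp_all add: restrict_scalars_def)

context hopf_values begin

sublocale TL: tensor_algebra k A0 H
  by (intro tensor_algebra.intro A0.A.algebra_over_axioms H.algebra_over_axioms)

abbreviation "V \<equiv> tensor k A0 H"
abbreviation "tau \<equiv> pure_tensor k A0 H"

sublocale Vc: hopf_conv k H V by (rule hopf_convI[OF TL.TT_algebra])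

abbreviation "V1 \<equiv> conv V"
abbreviation "V2 \<equiv> conv V1"

sublocale Vc2: hopf_conv k H V1 by (rule hopf_convI[OF Vc.conv_algebra])

lemmas V_ab = TL.TT_ab

lemma tau_simps:
  "a \<in> carrier L \<Longrightarrow> b \<in> carrier H \<Longrightarrow> tau a b \<in> carrier V"
  "a \<in> carrier L \<Longrightarrow> a' \<in> carrier L \<Longrightarrow> b \<in> carrier H \<Longrightarrow>
     tau (a \<oplus>\<^bsub>L\<^esub> a') b = tau a b \<oplus>\<^bsub>V\<^esub> tau a' b"
  "a \<in> carrier L \<Longrightarrow> b \<in> carrier H \<Longrightarrow> b' \<in> carrier H \<Longrightarrow>
     tau a (b \<oplus>\<^bsub>H\<^esub> b') = tau a b \<oplus>\<^bsub>V\<^esub> tau a b'"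
  "r \<in> carrier k \<Longrightarrow> a \<in> carrier L \<Longrightarrow> b \<in> carrier H \<Longrightarrow>
     tau a (r \<odot>\<^bsub>H\<^esub> b) = tau (\<rho> r \<otimes>\<^bsub>L\<^esub> a) b"
  "r \<in> carrier k \<Longrightarrow> a \<in> carrier L \<Longrightarrow> b \<in> carrier H \<Longrightarrow>
     r \<odot>\<^bsub>V\<^esub> tau a b = tau (\<rho> r \<otimes>\<^bsub>L\<^esub> a) b"
  "a \<in> carrier L \<Longrightarrow> b \<in> carrier H \<Longrightarrow> a' \<in> carrier L \<Longrightarrow> b' \<in> carrier H \<Longrightarrow>
     tau a b \<otimes>\<^bsub>V\<^esub> tau a' b' = tau (a \<otimes>\<^bsub>L\<^esub> a') (b \<otimes>\<^bsub>H\<^esub> b')"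
  using TL.tau_simps[simplified] TL.smult_pure[simplified] TL.mult_pure[simplified] by metis+

text \<open>Left multiplication by \<open>scal l\<close> in the untwisted algebra
  \<open>L \<otimes> H\<close> serves as the \<open>L\<close>-action on the common carrier of all
  twisted algebras. It spares a second scalar structure beside that of \<open>k\<close>.\<close>

definition scal :: "'l \<Rightarrow> ('l, 'h) tensor" where "scal l = tau l \<one>\<^bsub>H\<^esub>"

lemma scal_closed [simp]: "l \<in> carrier L \<Longrightarrow> scal l \<in> carrier V"
  by (simp add: scal_def tau_simps)

lemma scal_pure [simp]:
  "l \<in> carrier L \<Longrightarrow> b \<in> carrier L \<Longrightarrow> x \<in> carrier H \<Longrightarrow>
     scal l \<otimes>\<^bsub>V\<^esub> tau b x = tau (l \<otimes>\<^bsub>L\<^esub> b) x"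
  by (simp add: scal_def tau_simps)

lemma scal_hom: "alg_hom k A0 V scal"
  unfolding alg_hom_def linear_map_def ring_hom_def
  by (auto simp: scal_def tau_simps TL.tensor_one)

lemma scal_mult: "a \<in> carrier L \<Longrightarrow> b \<in> carrier L \<Longrightarrow> scal (a \<otimes>\<^bsub>L\<^esub> b) = scal a \<otimes>\<^bsub>V\<^esub> scal b"
  using alg_homD(4)[OF scal_hom] by simp

lemma scal_scal:
  assumes "a \<in> carrier L" "b \<in> carrier L" "w \<in> carrier V"
  shows "scal a \<otimes>\<^bsub>V\<^esub> (scal b \<otimes>\<^bsub>V\<^esub> w) = scal (a \<otimes>\<^bsub>L\<^esub> b) \<otimes>\<^bsub>V\<^esub> w"
  using assms by (simp add: scal_mult TL.TT.A.m_assoc)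

lemma smult_scal:
  assumes r: "r \<in> carrier k" and w: "w \<in> carrier V" shows "r \<odot>\<^bsub>V\<^esub> w = scal (\<rho> r) \<otimes>\<^bsub>V\<^esub> w"
proof -
  have "(r \<odot>\<^bsub>V\<^esub> \<one>\<^bsub>V\<^esub>) \<otimes>\<^bsub>V\<^esub> w = r \<odot>\<^bsub>V\<^esub> w" using r w by (simp add: TL.TT.smult_mult)
  moreover have "r \<odot>\<^bsub>V\<^esub> \<one>\<^bsub>V\<^esub> = scal (\<rho> r)" using r by (simp add: TL.tensor_one tau_simps scal_def)
  ultimately show ?thesis by simp
qed

text \<open>The \<open>L\<close>-linear extension to \<open>L \<otimes> H\<close> of a
  \<open>k\<close>-linear map \<open>g\<close> on \<open>H\<close>. The twisted product and the
  gauge isomorphisms are both written with it.\<close>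

definition "llift g = lift2 V (\<lambda>b x. scal b \<otimes>\<^bsub>V\<^esub> g x)"

lemma llift_balanced:
  assumes g: "g \<in> carrier V1" shows "balanced k A0 H V (\<lambda>b x. scal b \<otimes>\<^bsub>V\<^esub> g x)"
proof (rule balancedI)
  note g' = linear_mapD[OF conv_carrierD(2)[OF g]]
  show "scal (r \<odot>\<^bsub>A0\<^esub> b) \<otimes>\<^bsub>V\<^esub> g x = scal b \<otimes>\<^bsub>V\<^esub> g (r \<odot>\<^bsub>H\<^esub> x)"
    if "r \<in> carrier k" "b \<in> carrier A0" "x \<in> carrier H" for r b x
    using that by (simp add: g' smult_scal scal_scal L.m_comm)
  show "scal (b \<oplus>\<^bsub>A0\<^esub> b') \<otimes>\<^bsub>V\<^esub> g x = scal b \<otimes>\<^bsub>V\<^esub> g x \<oplus>\<^bsub>V\<^esub> scal b' \<otimes>\<^bsub>V\<^esub> g x"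
    if "b \<in> carrier A0" "b' \<in> carrier A0" "x \<in> carrier H" for b b' x
    using that alg_homD(3)[OF scal_hom, of b b'] by (simp add: g' TL.TT.A.l_distr)
  show "scal b \<otimes>\<^bsub>V\<^esub> g (x \<oplus>\<^bsub>H\<^esub> x') = scal b \<otimes>\<^bsub>V\<^esub> g x \<oplus>\<^bsub>V\<^esub> scal b \<otimes>\<^bsub>V\<^esub> g x'"
    if "b \<in> carrier A0" "x \<in> carrier H" "x' \<in> carrier H" for b x x'
    using that by (simp add: g' TL.TT.A.r_distr)
qed (use conv_carrierD(3)[OF g] in auto)

lemma llift_addhom: "g \<in> carrier V1 \<Longrightarrow> addhom V V (llift g)"
  unfolding llift_def by (rule TL.lift2_hom(1)[OF V_ab llift_balanced])

lemma llift_pure: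
  "g \<in> carrier V1 \<Longrightarrow> b \<in> carrier L \<Longrightarrow> x \<in> carrier H \<Longrightarrow> llift g (tau b x) = scal b \<otimes>\<^bsub>V\<^esub> g x"
  unfolding llift_def using TL.lift2_hom(2)[OF V_ab llift_balanced] by simp

lemma llift_closed: "g \<in> carrier V1 \<Longrightarrow> w \<in> carrier V \<Longrightarrow> llift g w \<in> carrier V"
  by (rule addhom_closed[OF llift_addhom])

lemma llift_scal:
  assumes g: "g \<in> carrier V1" and l: "l \<in> carrier L" and w: "w \<in> carrier V"
  shows "llift g (scal l \<otimes>\<^bsub>V\<^esub> w) = scal l \<otimes>\<^bsub>V\<^esub> llift g w"
  by (rule TL.tensor_ext[OF V_ab addhom_comp[OF TL.mult_addhom_right llift_addhom[OF g]]
        addhom_comp[OF llift_addhom[OF g] TL.mult_addhom_right] _ w])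
    (use l g in \<open>auto simp: llift_pure scal_scal conv_carrierD(3)\<close>)

lemma llift_smult:
  "g \<in> carrier V1 \<Longrightarrow> r \<in> carrier k \<Longrightarrow> w \<in> carrier V \<Longrightarrow> llift g (r \<odot>\<^bsub>V\<^esub> w) = r \<odot>\<^bsub>V\<^esub> llift g w"
  by (simp add: smult_scal llift_scal llift_closed)

lemma llift_linear: "g \<in> carrier V1 \<Longrightarrow> linear_map k V V (llift g)"
  by (intro linear_mapI) (auto simp: llift_closed addhom_add[OF llift_addhom] llift_smult)

lemma addhom_plus_V: "addhom V V f \<Longrightarrow> addhom V V g \<Longrightarrow> addhom V V (\<lambda>x. f x \<oplus>\<^bsub>V\<^esub> g x)"
  by (rule TL.addhom_plus)

text \<open>In the twisted product the extended map varies with the left factor; linearity in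
  \<open>g\<close> makes that dependence linear.\<close>

lemma llift_linear_arg:
  assumes w: "w \<in> carrier V" shows "linear_map k V1 V (\<lambda>g. llift g w)"
proof (rule linear_mapI)
  show "llift (g \<oplus>\<^bsub>V1\<^esub> h) w = llift g w \<oplus>\<^bsub>V\<^esub> llift h w"
    if gh: "g \<in> carrier V1" "h \<in> carrier V1" for g h
    by (rule TL.tensor_ext[OF V_ab llift_addhom[OF Vc.conv_add_closed[OF gh]]
          addhom_plus_V[OF llift_addhom[OF gh(1)] llift_addhom[OF gh(2)]] _ w])
      (use gh in \<open>auto simp: llift_pure Vc.conv_add_closed conv_apply TL.TT.A.r_distr conv_carrierD(3)\<close>)
  show "llift (r \<odot>\<^bsub>V1\<^esub> g) w = r \<odot>\<^bsub>V\<^esub> llift g w" if r: "r \<in> carrier k" and g: "g \<in> carrier V1" for r g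
    by (rule TL.tensor_ext[OF V_ab llift_addhom[OF Vc.conv_smult_closed[OF r g]]
          addhom_comp[OF llift_addhom[OF g] TL.smult_addhom[OF r]] _ w])
      (use r g in \<open>auto simp: llift_pure Vc.conv_smult_closed conv_apply TL.TT.smult_mult conv_carrierD(3)\<close>)
qed (use w llift_closed in auto)

definition "incl = (\<lambda>x\<in>carrier H. tau \<one>\<^bsub>L\<^esub> x)"
text \<open>Embeds the convolution algebras with values in \<open>L\<close> into those with values
  in \<open>L \<otimes> H\<close>, so that scalar functions and elements of \<open>H\<close> can be
  multiplied in one algebra.\<close>

definition "emb = conv_map scal"
definition "emb2 = conv_map (conv_map scal)"

lemma incl_closed [simp]: "incl \<in> carrier V1"
  unfolding incl_def by (rule conv_restrict, rule linear_mapI) (auto simp: tau_simps)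

lemma incl_apply: "x \<in> carrier H \<Longrightarrow> incl x = tau \<one>\<^bsub>L\<^esub> x"
  by (simp add: incl_def)

lemma emb_hom: "alg_hom k A1 V1 emb"
  unfolding emb_def by (intro conv_map_hom scal_hom A0_algebra TL.TT_algebra)
lemma emb2_hom: "alg_hom k A2 V2 emb2"
  unfolding emb2_def
  by (intro conv_map_hom scal_hom A0_algebra TL.TT_algebra A0.conv_algebra Vc.conv_algebra)

lemma emb_closed [simp]: "T \<in> carrier A1 \<Longrightarrow> emb T \<in> carrier V1" "F \<in> carrier A2 \<Longrightarrow> emb2 F \<in> carrier V2"
  using alg_homD(2)[OF emb_hom] alg_homD(2)[OF emb2_hom] by auto

lemma emb_apply:
  "x \<in> carrier H \<Longrightarrow> emb T x = scal (T x)"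
  "x \<in> carrier H \<Longrightarrow> y \<in> carrier H \<Longrightarrow> emb2 F x y = scal (F x y)"
  by (simp_all add: emb_def emb2_def conv_map_apply)

lemma V2_closed: "Z \<in> carrier V2 \<Longrightarrow> x \<in> carrier H \<Longrightarrow> y \<in> carrier H \<Longrightarrow> Z x y \<in> carrier V"
  using conv_carrierD(3)[of Z V1 x] conv_carrierD(3)[of "Z x" V y] by simp

lemma V2_eqI:
  assumes "F \<in> carrier V2" "G \<in> carrier V2"
    "\<And>x y. x \<in> carrier H \<Longrightarrow> y \<in> carrier H \<Longrightarrow> F x y = G x y"
  shows "F = G"
  using assms by (intro conv_eqI[of F V1 G] conv_eqI[of "F _" V "G _"]) (auto dest: conv_carrierD)

lemma emb_mult_apply:
  assumes T: "T \<in> carrier A1" and h: "h \<in> carrier V1" and x: "x \<in> carrier H"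
  shows "(emb T \<otimes>\<^bsub>V1\<^esub> h) x = sw V (\<lambda>a b. scal (T a) \<otimes>\<^bsub>V\<^esub> h b) x"
  unfolding conv_apply[OF x] using T h x
  by (intro sweedler_cong V_ab) (auto simp: emb_apply A1_closed conv_carrierD(3))

lemma emb2_mult_apply:
  assumes F: "F \<in> carrier A2" and Z: "Z \<in> carrier V2" and x: "x \<in> carrier H" and y: "y \<in> carrier H"
  shows "(emb2 F \<otimes>\<^bsub>V2\<^esub> Z) x y = sw V (\<lambda>a b. sw V (\<lambda>c d. scal (F a c) \<otimes>\<^bsub>V\<^esub> Z b d) y) x"
  unfolding conv_eval_mult[OF TL.TT_algebra emb_closed(2)[OF F] Z x y] using F Z x y
  by (intro sweedler_cong2 V_ab) (auto simp: emb_apply A2_closed V2_closed)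

text \<open>An \<open>L\<close>-linear map commutes with left convolution by scalar-valued
  functions.\<close>

lemma llift_emb:
  assumes g: "g \<in> carrier V1" and T: "T \<in> carrier A1" and h: "h \<in> carrier V1" and x: "x \<in> carrier H"
  shows "llift g ((emb T \<otimes>\<^bsub>V1\<^esub> h) x) = (emb T \<otimes>\<^bsub>V1\<^esub> conv_map (llift g) h) x"
proof -
  have c: "conv_map (llift g) h \<in> carrier V1"
    using conv_restrict[OF linear_map_comp[OF conv_carrierD(2)[OF h] llift_linear[OF g]]]
    by (simp add: conv_map_def)
  have "llift g ((emb T \<otimes>\<^bsub>V1\<^esub> h) x) = sw V (\<lambda>a b. llift g (scal (T a) \<otimes>\<^bsub>V\<^esub> h b)) x"
    unfolding emb_mult_apply[OF T h x] using T h x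
    by (intro sweedler_hom V_ab llift_addhom g) (auto simp: A1_closed conv_carrierD(3))
  also have "\<dots> = (emb T \<otimes>\<^bsub>V1\<^esub> conv_map (llift g) h) x"
    unfolding emb_mult_apply[OF T c x] using T h x g
    by (intro sweedler_cong V_ab)
      (auto simp: A1_closed conv_carrierD(3) conv_map_apply llift_scal llift_closed)
  finally show ?thesis .
qed

lemma conv_map_incl: "g \<in> carrier V1 \<Longrightarrow> conv_map (llift g) incl = g"
  using conv_restrict[OF linear_map_comp[OF conv_carrierD(2)[OF incl_closed] llift_linear]]
  by (intro conv_eqI[of _ V])
    (auto simp: conv_map_apply incl_apply llift_pure conv_carrierD(3) conv_map_def[symmetric]
       TL.tensor_one[symmetric, simplified] scal_def)

lemma pull_emb: "T \<in> carrier A1 \<Longrightarrow> conv_pull (emb T) = emb2 (conv_pull T)"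
  by (rule V2_eqI) (auto intro!: Vc.conv_pull_closed simp: conv_pull_apply emb_apply)

text \<open>The twisted product of \<open>1 \<otimes> x\<close> and \<open>1 \<otimes> y\<close>, as
  a function of \<open>x\<close> and \<open>y\<close> in \<open>V2\<close>.\<close>

definition "kernel_of F = emb2 F \<otimes>\<^bsub>V2\<^esub> conv_pull incl"

lemma pull_incl [simp]: "conv_pull incl \<in> carrier V2"
  by (rule Vc.conv_pull_closed) simp

lemma kernel_closed [simp]: "F \<in> carrier A2 \<Longrightarrow> kernel_of F \<in> carrier V2"
  by (simp add: kernel_of_def Vc2.conv_closed)

lemma kernel_slice [simp]: "F \<in> carrier A2 \<Longrightarrow> x \<in> carrier H \<Longrightarrow> kernel_of F x \<in> carrier V1"
  by (auto intro: conv_carrierD(3)[of _ V1])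

lemma kernel_apply:
  assumes F: "F \<in> carrier A2" and x: "x \<in> carrier H" and y: "y \<in> carrier H"
  shows "kernel_of F x y = sw V (\<lambda>a b. sw V (\<lambda>c d. tau (F a c) (b \<otimes>\<^bsub>H\<^esub> d)) y) x"
  unfolding kernel_of_def emb2_mult_apply[OF F pull_incl x y] using F x y
  by (intro sweedler_cong2 V_ab) (auto simp: A2_closed conv_pull_apply incl_apply tau_simps)

text \<open>Turns the application of an \<open>L\<close>-linear map to a twisted product into a
  convolution product, where the gauge relation can be used.\<close>

lemma llift_kernel:
  assumes g: "g \<in> carrier V1" and F: "F \<in> carrier A2" and x: "x \<in> carrier H" and y: "y \<in> carrier H"
  shows "llift g (kernel_of F x y) = (emb2 F \<otimes>\<^bsub>V2\<^esub> conv_pull g) x y"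
proof -
  have "llift g (kernel_of F x y) = sw V (\<lambda>a b. sw V (\<lambda>c d. llift g (tau (F a c) (b \<otimes>\<^bsub>H\<^esub> d))) y) x"
    unfolding kernel_apply[OF F x y] using F x y
    by (intro sweedler_hom2 V_ab llift_addhom g) (auto simp: A2_closed tau_simps)
  also have "\<dots> = (emb2 F \<otimes>\<^bsub>V2\<^esub> conv_pull g) x y"
    unfolding emb2_mult_apply[OF F Vc.conv_pull_closed[OF g] x y] using F x y g
    by (intro sweedler_cong2 V_ab)
      (auto simp: A2_closed conv_pull_apply llift_pure conv_carrierD(3))
  finally show ?thesis .
qed

text \<open>The product of the twisted algebra, written with the convolution kernel
  \<open>(x, y) \<mapsto> \<Sum> F(x\<^sub>1, y\<^sub>1) \<otimes> x\<^sub>2 y\<^sub>2\<close>.\<close>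

definition "tmult F T U = llift (\<lambda>x\<in>carrier H. llift (kernel_of F x) U) T"

lemma tmult_arg:
  assumes F: "F \<in> carrier A2" and U: "U \<in> carrier V"
  shows "(\<lambda>x\<in>carrier H. llift (kernel_of F x) U) \<in> carrier V1"
  by (rule conv_restrict)
    (rule linear_map_comp[OF conv_carrierD(2)[OF kernel_closed[OF F]] llift_linear_arg[OF U]])

lemma tmult_addhom_left: "F \<in> carrier A2 \<Longrightarrow> U \<in> carrier V \<Longrightarrow> addhom V V (\<lambda>T. tmult F T U)"
  unfolding tmult_def by (rule llift_addhom[OF tmult_arg])

lemma tmult_pure_left:
  "F \<in> carrier A2 \<Longrightarrow> b \<in> carrier L \<Longrightarrow> x \<in> carrier H \<Longrightarrow> U \<in> carrier V \<Longrightarrow>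
     tmult F (tau b x) U = scal b \<otimes>\<^bsub>V\<^esub> llift (kernel_of F x) U"
  by (simp add: tmult_def llift_pure tmult_arg)

lemma tmult_closed: "F \<in> carrier A2 \<Longrightarrow> T \<in> carrier V \<Longrightarrow> U \<in> carrier V \<Longrightarrow> tmult F T U \<in> carrier V"
  using addhom_closed[OF tmult_addhom_left] .

lemma tmult_addhom_right:
  assumes F: "F \<in> carrier A2" and T: "T \<in> carrier V" shows "addhom V V (\<lambda>U. tmult F T U)"
proof (rule addhomI)
  fix U W assume UW: "U \<in> carrier V" "W \<in> carrier V"
  show "tmult F T (U \<oplus>\<^bsub>V\<^esub> W) = tmult F T U \<oplus>\<^bsub>V\<^esub> tmult F T W"
  proof (rule TL.tensor_ext[OF V_ab tmult_addhom_left[OF F]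
        addhom_plus_V[OF tmult_addhom_left[OF F UW(1)] tmult_addhom_left[OF F UW(2)]] _ T])
    show "U \<oplus>\<^bsub>V\<^esub> W \<in> carrier V" using UW by simp
    fix b x assume "b \<in> carrier A0" "x \<in> carrier H"
    with UW F show "tmult F (tau b x) (U \<oplus>\<^bsub>V\<^esub> W) = tmult F (tau b x) U \<oplus>\<^bsub>V\<^esub> tmult F (tau b x) W"
      by (simp add: tmult_pure_left addhom_add[OF llift_addhom] llift_closed TL.TT.A.r_distr)
  qed
qed (use F T tmult_closed in auto)

lemma tmult_scal_left:
  "F \<in> carrier A2 \<Longrightarrow> l \<in> carrier L \<Longrightarrow> T \<in> carrier V \<Longrightarrow> U \<in> carrier V \<Longrightarrow>
     tmult F (scal l \<otimes>\<^bsub>V\<^esub> T) U = scal l \<otimes>\<^bsub>V\<^esub> tmult F T U"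
  unfolding tmult_def by (rule llift_scal[OF tmult_arg])

lemma tmult_scal_right:
  assumes F: "F \<in> carrier A2" and l: "l \<in> carrier L" and T: "T \<in> carrier V" and U: "U \<in> carrier V"
  shows "tmult F T (scal l \<otimes>\<^bsub>V\<^esub> U) = scal l \<otimes>\<^bsub>V\<^esub> tmult F T U"
proof (rule TL.tensor_ext[OF V_ab tmult_addhom_left[OF F]
      addhom_comp[OF tmult_addhom_left[OF F U] TL.mult_addhom_right] _ T])
  show "scal l \<otimes>\<^bsub>V\<^esub> U \<in> carrier V" "scal l \<in> carrier V" using l U by auto
  fix b x assume "b \<in> carrier A0" "x \<in> carrier H"
  with F l U show "tmult F (tau b x) (scal l \<otimes>\<^bsub>V\<^esub> U) = scal l \<otimes>\<^bsub>V\<^esub> tmult F (tau b x) U"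
    by (simp add: tmult_pure_left llift_scal scal_scal llift_closed L.m_comm)
qed

lemma tmult_incl:
  "F \<in> carrier A2 \<Longrightarrow> x \<in> carrier H \<Longrightarrow> y \<in> carrier H \<Longrightarrow> tmult F (incl x) (incl y) = kernel_of F x y"
  by (simp add: incl_apply tmult_pure_left tau_simps llift_pure V2_closed conv_carrierD(3)
     TL.tensor_one[symmetric, simplified] scal_def)

lemma pure_scal_incl: "b \<in> carrier L \<Longrightarrow> x \<in> carrier H \<Longrightarrow> tau b x = scal b \<otimes>\<^bsub>V\<^esub> incl x"
  by (simp add: incl_apply)

lemma twisted_simps:
  "carrier (twisted k H L \<rho> \<beta> u) = carrier V"
  "add (twisted k H L \<rho> \<beta> u) = add V"
  "\<zero>\<^bsub>twisted k H L \<rho> \<beta> u\<^esub> = \<zero>\<^bsub>V\<^esub>"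
  "\<one>\<^bsub>twisted k H L \<rho> \<beta> u\<^esub> = tau u \<one>\<^bsub>H\<^esub>"
  "monoid.mult (twisted k H L \<rho> \<beta> u) = monoid.mult (twisted_algebra k H L \<rho> \<beta> u)"
  "smult (twisted k H L \<rho> \<beta> u) = smult (twisted_algebra k H L \<rho> \<beta> u)"
  by (simp_all add: twisted_def twisted_algebra_def with_coact_def Let_def)

lemma twisted_smult:
  assumes r: "r \<in> carrier L" and w: "w \<in> carrier V"
  shows "r \<odot>\<^bsub>twisted k H L \<rho> \<beta> u\<^esub> w = scal r \<otimes>\<^bsub>V\<^esub> w"
proof -
  have b: "balanced k A0 H V (\<lambda>b x. tau (r \<otimes>\<^bsub>L\<^esub> b) x)"
    using r by (intro balancedI) (auto simp: tau_simps L.r_distr L.m_ac)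
  have "lift2 V (\<lambda>b x. tau (r \<otimes>\<^bsub>L\<^esub> b) x) w = scal r \<otimes>\<^bsub>V\<^esub> w"
    by (rule TL.tensor_ext[OF V_ab TL.lift2_hom(1)[OF V_ab b] TL.mult_addhom_right _ w])
      (use r in \<open>auto simp: TL.lift2_hom(2)[OF V_ab b]\<close>)
  then show ?thesis by (simp add: twisted_simps twisted_algebra_def Let_def)
qed

text \<open>The integrands of the defining double lift are not known beforehand to be balanced, so
  they are compared with those of \<open>tmult\<close> termwise on the chosen
  representatives.\<close>

lemma twisted_mult:
  assumes F: "F \<in> carrier A2" and eq: "\<And>x y. x \<in> carrier H \<Longrightarrow> y \<in> carrier H \<Longrightarrow> \<beta> x y = F x y"
    and T: "T \<in> carrier V" and U: "U \<in> carrier V"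
  shows "T \<otimes>\<^bsub>twisted k H L \<rho> \<beta> u\<^esub> U = tmult F T U"
proof -
  let ?s = "\<lambda>b x c y. sw V (\<lambda>x1 x2. sw V (\<lambda>y1 y2.
      tau (b \<otimes>\<^bsub>L\<^esub> c \<otimes>\<^bsub>L\<^esub> \<beta> x1 y1) (x2 \<otimes>\<^bsub>H\<^esub> y2)) y) x"
  have s: "?s b x c y = scal b \<otimes>\<^bsub>V\<^esub> (scal c \<otimes>\<^bsub>V\<^esub> kernel_of F x y)"
    if h: "b \<in> carrier L" "x \<in> carrier H" "c \<in> carrier L" "y \<in> carrier H" for b x c y
  proof -
    have "scal b \<otimes>\<^bsub>V\<^esub> (scal c \<otimes>\<^bsub>V\<^esub> kernel_of F x y) = scal (b \<otimes>\<^bsub>L\<^esub> c) \<otimes>\<^bsub>V\<^esub> kernel_of F x y"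
      using h F by (simp add: scal_scal V2_closed)
    also have "\<dots> = sw V (\<lambda>x1 x2. sw V (\<lambda>y1 y2. scal (b \<otimes>\<^bsub>L\<^esub> c) \<otimes>\<^bsub>V\<^esub> tau (F x1 y1) (x2 \<otimes>\<^bsub>H\<^esub> y2)) y) x"
      unfolding kernel_apply[OF F h(2,4)] using F h
      by (intro sweedler_hom2 V_ab TL.mult_addhom_right) (auto simp: A2_closed tau_simps)
    also have "\<dots> = ?s b x c y"
      using h F by (intro sweedler_cong2 V_ab) (auto simp: A2_closed tau_simps eq)
    finally show ?thesis by simp
  qed
  have "lift2 V (\<lambda>b x. lift2 V (\<lambda>c y. ?s b x c y) U) T
      = lift2 V (\<lambda>b x. scal b \<otimes>\<^bsub>V\<^esub> (\<lambda>x\<in>carrier H. llift (kernel_of F x) U) x) T"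
  proof (rule TL.lift2_cong[OF V_ab T])
    fix b x assume "b \<in> carrier A0" "x \<in> carrier H"
    then have h: "b \<in> carrier L" "x \<in> carrier H" by auto
    show "scal b \<otimes>\<^bsub>V\<^esub> (\<lambda>x\<in>carrier H. llift (kernel_of F x) U) x \<in> carrier V"
      using h F U by (simp add: llift_closed)
    have "lift2 V (\<lambda>c y. ?s b x c y) U = lift2 V (\<lambda>c y. scal b \<otimes>\<^bsub>V\<^esub> (scal c \<otimes>\<^bsub>V\<^esub> kernel_of F x y)) U"
      using h F by (intro TL.lift2_cong[OF V_ab U]) (auto simp: s V2_closed)
    also have "\<dots> = scal b \<otimes>\<^bsub>V\<^esub> llift (kernel_of F x) U"
      unfolding llift_def using h F
      by (intro TL.hom_lift2[OF V_ab V_ab TL.mult_addhom_right U, symmetric]) (auto simp: V2_closed)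
    finally show "lift2 V (\<lambda>c y. ?s b x c y) U
        = scal b \<otimes>\<^bsub>V\<^esub> (\<lambda>x\<in>carrier H. llift (kernel_of F x) U) x"
      using h by simp
  qed
  then show ?thesis by (simp add: twisted_simps twisted_algebra_def Let_def tmult_def llift_def)
qed

subsection \<open>The coaction\<close>

text \<open>The codomain of the coaction. The parameters are kept because the definition of the
  coaction mentions the whole twisted record, whose product and unit depend on them.\<close>

definition "VH \<beta> u = tensor k (restrict_scalars \<rho> (twisted k H L \<rho> \<beta> u)) H"
definition "tauH \<beta> u = pure_tensor k (restrict_scalars \<rho> (twisted k H L \<rho> \<beta> u)) H"

lemma twisted_ab: "abelian_group (twisted k H L \<rho> \<beta> u)"
proof -
  have "same_add V (twisted k H L \<rho> \<beta> u)" by (simp add: same_add_def twisted_simps)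
  then show ?thesis using abelian_group_cong_add V_ab by blast
qed

lemma twisted_premodule: "premodule k (restrict_scalars \<rho> (twisted k H L \<rho> \<beta> u))"
proof -
  have "same_add V (restrict_scalars \<rho> (twisted k H L \<rho> \<beta> u))"
    by (simp add: same_add_def twisted_simps restrict_scalars_simps)
  then have "abelian_group (restrict_scalars \<rho> (twisted k H L \<rho> \<beta> u))"
    using abelian_group_cong_add V_ab by blast
  then show ?thesis by (auto simp: premodule_def restrict_scalars_simps twisted_simps(1) twisted_smult)
qed

lemma VH_tensor: "tensor_product k (restrict_scalars \<rho> (twisted k H L \<rho> \<beta> u)) H"
  by (intro tensor_product.intro twisted_premodule premodule_H)

lemma VH_ab: "abelian_group (VH \<beta> u)"
  unfolding VH_def by (rule tensor_product.tensor_abelian[OF VH_tensor])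

text \<open>Restated over the plain space \<open>V\<close>: by \<open>smult_scal\<close>, the action
  of \<open>k\<close> on the twisted record through \<open>\<rho>\<close> is the one that
  \<open>V\<close> carries already.\<close>

lemma tauH_balanced: "balanced k V H (VH \<beta> u) (tauH \<beta> u)"
proof -
  interpret W: tensor_product k "restrict_scalars \<rho> (twisted k H L \<rho> \<beta> u)" H by (rule VH_tensor)
  show ?thesis
    using balancedD[OF W.pure_balanced] unfolding VH_def tauH_def
    by (intro balancedI) (auto simp: restrict_scalars_simps twisted_simps(1,2) twisted_smult smult_scal)
qed

lemmas tauH_simps = balancedD[OF tauH_balanced]

lemma VH_lift:
  assumes G: "abelian_group G" and f: "balanced k V H G f"
  shows "addhom (VH \<beta> u) G (lift2 G f)"
    and "w \<in> carrier V \<Longrightarrow> x \<in> carrier H \<Longrightarrow> lift2 G f (tauH \<beta> u w x) = f w x"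
proof -
  interpret W: tensor_product k "restrict_scalars \<rho> (twisted k H L \<rho> \<beta> u)" H by (rule VH_tensor)
  have f': "balanced k (restrict_scalars \<rho> (twisted k H L \<rho> \<beta> u)) H G f"
    using balancedD[OF f]
    by (intro balancedI) (auto simp: restrict_scalars_simps twisted_simps(1,2) twisted_smult simp flip: smult_scal)
  show "addhom (VH \<beta> u) G (lift2 G f)" unfolding VH_def by (rule W.lift2_hom(1)[OF G f'])
  show "w \<in> carrier V \<Longrightarrow> x \<in> carrier H \<Longrightarrow> lift2 G f (tauH \<beta> u w x) = f w x"
    unfolding tauH_def using W.lift2_hom(2)[OF G f'] by (simp add: restrict_scalars_simps twisted_simps)
qed

lemma coact_addhom: "addhom V (VH \<beta> u) (coact (twisted k H L \<rho> \<beta> u))"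
  and coact_pure: "b \<in> carrier L \<Longrightarrow> x \<in> carrier H \<Longrightarrow> coact (twisted k H L \<rho> \<beta> u) (tau b x)
    = sw (VH \<beta> u) (\<lambda>x1 x2. tauH \<beta> u (tau b x1) x2) x"
proof -
  let ?W = "VH \<beta> u" and ?A = "restrict_scalars \<rho> (twisted k H L \<rho> \<beta> u)"
    and ?A' = "restrict_scalars \<rho> (twisted_algebra k H L \<rho> \<beta> u)"
  \<comment> \<open>The coaction is defined over the algebra to which it has not yet been attached;
    \<open>restrict_scalars\<close> erases the difference.\<close>
  have A: "?A' = ?A"
    by (simp add: restrict_scalars_def twisted_def with_coact_def Let_def)
  have c: "coact (twisted k H L \<rho> \<beta> u) = lift2 ?W (\<lambda>b x. sw ?W (\<lambda>x1 x2. tauH \<beta> u (tau b x1) x2) x)"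
    unfolding VH_def tauH_def A[symmetric] by (simp add: twisted_def with_coact_def Let_def)
  have inner: "balanced k H H ?W (\<lambda>x1 x2. tauH \<beta> u (tau b x1) x2)" if "b \<in> carrier L" for b
    using that by (intro balancedI) (auto simp: tau_simps tauH_simps simp flip: tau_simps(5))
  have b: "balanced k A0 H ?W (\<lambda>b x. sw ?W (\<lambda>x1 x2. tauH \<beta> u (tau b x1) x2) x)"
  proof (rule balancedI)
    show "sw ?W (\<lambda>x1 x2. tauH \<beta> u (tau (b \<oplus>\<^bsub>A0\<^esub> b') x1) x2) x
        = sw ?W (\<lambda>x1 x2. tauH \<beta> u (tau b x1) x2) x \<oplus>\<^bsub>?W\<^esub> sw ?W (\<lambda>x1 x2. tauH \<beta> u (tau b' x1) x2) x"
      if "b \<in> carrier A0" "b' \<in> carrier A0" "x \<in> carrier H" for b b' x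
    proof -
      interpret W: abelian_group ?W by (rule VH_ab)
      have "sw ?W (\<lambda>x1 x2. tauH \<beta> u (tau (b \<oplus>\<^bsub>A0\<^esub> b') x1) x2) x
          = sw ?W (\<lambda>x1 x2. tauH \<beta> u (tau b x1) x2 \<oplus>\<^bsub>?W\<^esub> tauH \<beta> u (tau b' x1) x2) x"
        using that by (intro sweedler_cong[OF VH_ab]) (simp_all add: tau_simps tauH_simps)
      then show ?thesis
        using that by (subst (asm) sweedler_add[OF VH_ab]) (simp_all add: tau_simps tauH_simps)
    qed
    show "sw ?W (\<lambda>x1 x2. tauH \<beta> u (tau b x1) x2) (x \<oplus>\<^bsub>H\<^esub> x')
        = sw ?W (\<lambda>x1 x2. tauH \<beta> u (tau b x1) x2) x \<oplus>\<^bsub>?W\<^esub> sw ?W (\<lambda>x1 x2. tauH \<beta> u (tau b x1) x2) x'"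
      if "b \<in> carrier A0" "x \<in> carrier H" "x' \<in> carrier H" for b x x'
      using that by (intro addhom_add[OF sweedler_addhom[OF VH_ab inner]]) auto
    show "sw ?W (\<lambda>x1 x2. tauH \<beta> u (tau (r \<odot>\<^bsub>A0\<^esub> b) x1) x2) x
        = sw ?W (\<lambda>x1 x2. tauH \<beta> u (tau b x1) x2) (r \<odot>\<^bsub>H\<^esub> x)"
      if "r \<in> carrier k" "b \<in> carrier A0" "x \<in> carrier H" for r b x
    proof -
      have "sw ?W (\<lambda>x1 x2. tauH \<beta> u (tau (r \<odot>\<^bsub>A0\<^esub> b) x1) x2) x
          = sw ?W (\<lambda>x1 x2. tauH \<beta> u (tau b (r \<odot>\<^bsub>H\<^esub> x1)) x2) x"
        using that by (intro sweedler_cong[OF VH_ab]) (simp_all add: tau_simps tauH_simps)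
      then show ?thesis using that by (simp add: sweedler_smult[OF VH_ab inner])
    qed
  qed (auto simp: tau_simps tauH_simps intro!: sweedler_closed[OF VH_ab])
  show "addhom V (VH \<beta> u) (coact (twisted k H L \<rho> \<beta> u))"
    unfolding c by (rule TL.lift2_hom(1)[OF VH_ab b])
  show "coact (twisted k H L \<rho> \<beta> u) (tau b x) = sw ?W (\<lambda>x1 x2. tauH \<beta> u (tau b x1) x2) x"
    if "b \<in> carrier L" "x \<in> carrier H"
    unfolding c using TL.lift2_hom(2)[OF VH_ab b] that by simp
qed

text \<open>The \<open>L\<close>-linear map
  \<open>b \<otimes> x \<mapsto> \<Sum> b T(x1) \<otimes> x2\<close>, the usual isomorphism attached
  to a convolution-invertible \<open>T\<close>.\<close>

definition "gmap T = llift (emb T \<otimes>\<^bsub>V1\<^esub> incl)"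

lemma g_closed [simp]: "T \<in> carrier A1 \<Longrightarrow> emb T \<otimes>\<^bsub>V1\<^esub> incl \<in> carrier V1"
  by (simp add: Vc.conv_closed)

text \<open>Composition reverses convolution: \<open>gmap S\<close> after \<open>gmap T\<close> is
  the map attached to the convolution product of \<open>T\<close> and \<open>S\<close>, in this
  order.\<close>

lemma gmap_gmap:
  assumes "T \<in> carrier A1" "S \<in> carrier A1" "T \<otimes>\<^bsub>A1\<^esub> S = \<one>\<^bsub>A1\<^esub>" "w \<in> carrier V"
  shows "gmap S (gmap T w) = w"
proof (rule TL.tensor_ext[OF V_ab _ _ _ assms(4), of "\<lambda>w. gmap S (gmap T w)" "\<lambda>w. w"])
  show "addhom V V (\<lambda>w. gmap S (gmap T w))"
    unfolding gmap_def using assms by (intro addhom_comp[OF llift_addhom llift_addhom] g_closed)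
  fix b x assume "b \<in> carrier A0" "x \<in> carrier H"
  then have h: "b \<in> carrier L" "x \<in> carrier H" by auto
  have "gmap S (gmap T (tau b x)) = scal b \<otimes>\<^bsub>V\<^esub> llift (emb S \<otimes>\<^bsub>V1\<^esub> incl) ((emb T \<otimes>\<^bsub>V1\<^esub> incl) x)"
    unfolding gmap_def using assms h by (simp add: llift_pure llift_scal conv_carrierD(3)[of _ V])
  also have "llift (emb S \<otimes>\<^bsub>V1\<^esub> incl) ((emb T \<otimes>\<^bsub>V1\<^esub> incl) x) = (emb T \<otimes>\<^bsub>V1\<^esub> (emb S \<otimes>\<^bsub>V1\<^esub> incl)) x"
    using assms h by (simp add: llift_emb conv_map_incl)
  also have "\<dots> = incl x"
    using assms by (simp flip: Vc.conv_assoc alg_homD(4)[OF emb_hom] add: alg_homD(6)[OF emb_hom] Vc.conv_one_mult)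
  finally show "gmap S (gmap T (tau b x)) = tau b x" using h by (simp add: pure_scal_incl)
qed (rule addhomI; simp)

end

subsection \<open>The isomorphism defined by a gauge transformation\<close>

context gauge_pair begin

text \<open>By \<open>L\<close>-linearity only the products of \<open>1 \<otimes> x\<close> and
  \<open>1 \<otimes> y\<close> matter. There the left side is the convolution of \<open>F\<close>,
  \<open>T(xy)\<close> and \<open>xy\<close>, the right side that of \<open>T(x) T(y)\<close>,
  \<open>G\<close> and \<open>xy\<close>, and \<open>FG\<close> equates them.\<close>

lemma gmap_mult:
  assumes F: "F \<in> carrier A2" and G: "G \<in> carrier A2"
    and FG: "F \<otimes>\<^bsub>A2\<^esub> conv_pull T = leg1 T \<otimes>\<^bsub>A2\<^esub> leg2 T \<otimes>\<^bsub>A2\<^esub> G"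
    and P: "P \<in> carrier V" and U: "U \<in> carrier V"
  shows "gmap T (tmult F P U) = tmult G (gmap T P) (gmap T U)"
proof -
  let ?g = "emb T \<otimes>\<^bsub>V1\<^esub> incl"
  have g: "?g \<in> carrier V1" by simp
  have lc: "leg1 T \<otimes>\<^bsub>A2\<^esub> leg2 T \<in> carrier A2" by (simp add: A1.conv_closed)
  have gx: "?g x \<in> carrier V" if "x \<in> carrier H" for x using that g by (rule conv_carrierD(3)[rotated])
  have gh: "addhom V V (gmap T)" unfolding gmap_def by (rule llift_addhom[OF g])
  have key: "llift ?g (kernel_of F x y) = tmult G (?g x) (?g y)"
    if x: "x \<in> carrier H" and y: "y \<in> carrier H" for x y
  proof -
    have "llift ?g (kernel_of F x y) = (emb2 F \<otimes>\<^bsub>V2\<^esub> conv_pull ?g) x y"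
      by (rule llift_kernel[OF g F x y])
    also have "conv_pull ?g = emb2 (conv_pull T) \<otimes>\<^bsub>V2\<^esub> conv_pull incl"
      by (simp add: alg_homD(4)[OF Vc.conv_pull_hom] pull_emb)
    also have "emb2 F \<otimes>\<^bsub>V2\<^esub> (emb2 (conv_pull T) \<otimes>\<^bsub>V2\<^esub> conv_pull incl)
        = emb2 (leg1 T \<otimes>\<^bsub>A2\<^esub> leg2 T) \<otimes>\<^bsub>V2\<^esub> kernel_of G"
      unfolding kernel_of_def using F G lc
      by (simp flip: Vc2.conv_assoc alg_homD(4)[OF emb2_hom] add: FG)
    also have "\<dots> x y = sw V (\<lambda>a b. sw V (\<lambda>c d.
        scal ((leg1 T \<otimes>\<^bsub>A2\<^esub> leg2 T) a c) \<otimes>\<^bsub>V\<^esub> kernel_of G b d) y) x"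
      by (rule emb2_mult_apply[OF lc kernel_closed[OF G] x y])
    \<comment> \<open>The twisted product is \<open>L\<close>-bilinear, so the scalar
      \<open>T a\<close> times \<open>T c\<close> can be distributed over its two factors; the
      double sum then separates.\<close>
    also have "\<dots> = sw V (\<lambda>a b. sw V (\<lambda>c d. tmult G (scal (T a) \<otimes>\<^bsub>V\<^esub> incl b) (scal (T c) \<otimes>\<^bsub>V\<^esub> incl d)) y) x"
      using x y G
      by (intro sweedler_cong2 V_ab)
        (auto simp: leg12_apply tmult_scal_left tmult_scal_right tmult_incl tmult_closed A1_closed
          V2_closed scal_scal L.m_comm conv_carrierD(3)[OF incl_closed])
    also have "\<dots> = sw V (\<lambda>a b. tmult G (scal (T a) \<otimes>\<^bsub>V\<^esub> incl b) (?g y)) x"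
    proof (intro sweedler_cong V_ab x)
      fix a b assume ab: "a \<in> carrier H" "b \<in> carrier H"
      then have m: "scal (T a) \<otimes>\<^bsub>V\<^esub> incl b \<in> carrier V"
        by (simp add: A1_closed conv_carrierD(3)[OF incl_closed])
      then show "tmult G (scal (T a) \<otimes>\<^bsub>V\<^esub> incl b) (?g y) \<in> carrier V"
        using G gx[OF y] by (simp add: tmult_closed)
      show "sw V (\<lambda>c d. tmult G (scal (T a) \<otimes>\<^bsub>V\<^esub> incl b) (scal (T c) \<otimes>\<^bsub>V\<^esub> incl d)) y
          = tmult G (scal (T a) \<otimes>\<^bsub>V\<^esub> incl b) (?g y)"
        unfolding emb_mult_apply[OF T incl_closed y]
        by (rule sweedler_hom[OF V_ab V_ab tmult_addhom_right[OF G m] y, symmetric])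
          (simp add: A1_closed conv_carrierD(3)[OF incl_closed])
    qed
    also have "\<dots> = tmult G (?g x) (?g y)"
      unfolding emb_mult_apply[OF T incl_closed x] using x y G gx
      by (intro sweedler_hom[OF V_ab V_ab tmult_addhom_left, symmetric])
        (auto simp: A1_closed conv_carrierD(3)[OF incl_closed])
    finally show ?thesis .
  qed
  show ?thesis
  proof (rule TL.tensor_ext[OF V_ab addhom_comp[OF tmult_addhom_left[OF F U] gh]
        addhom_comp[OF gh tmult_addhom_left[OF G addhom_closed[OF gh U]]] _ P])
    fix b x assume "b \<in> carrier A0" "x \<in> carrier H"
    then have bx: "b \<in> carrier L" "x \<in> carrier H" "tau b x \<in> carrier V" by (auto simp: tau_simps)
    show "gmap T (tmult F (tau b x) U) = tmult G (gmap T (tau b x)) (gmap T U)"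
    proof (rule TL.tensor_ext[OF V_ab addhom_comp[OF tmult_addhom_right[OF F bx(3)] gh]
          addhom_comp[OF gh tmult_addhom_right[OF G addhom_closed[OF gh bx(3)]]] _ U])
      fix c y assume "c \<in> carrier A0" "y \<in> carrier H"
      then have cy: "c \<in> carrier L" "y \<in> carrier H" by auto
      show "gmap T (tmult F (tau b x) (tau c y)) = tmult G (gmap T (tau b x)) (gmap T (tau c y))"
        using bx cy F G g gx
        by (simp add: gmap_def tmult_pure_left llift_pure tau_simps llift_scal key V2_closed
            tmult_scal_left tmult_scal_right tmult_closed scal_scal L.m_comm)
    qed
  qed
qed

lemma trilinear_tauH:
  assumes b: "b \<in> carrier L"
  shows "trilinear (VH \<beta> u) (\<lambda>p q r. tauH \<beta> u (tau (b \<otimes>\<^bsub>L\<^esub> T p) q) r)"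
proof -
  note l = linear_mapD[OF conv_carrierD(2)[OF T], simplified]
  have 1: "tau (b \<otimes>\<^bsub>L\<^esub> (\<rho> s \<otimes>\<^bsub>L\<^esub> T p)) q = s \<odot>\<^bsub>V\<^esub> tau (b \<otimes>\<^bsub>L\<^esub> T p) q"
    "tau (\<rho> s \<otimes>\<^bsub>L\<^esub> (b \<otimes>\<^bsub>L\<^esub> T p)) q = s \<odot>\<^bsub>V\<^esub> tau (b \<otimes>\<^bsub>L\<^esub> T p) q"
    if "s \<in> carrier k" "p \<in> carrier H" "q \<in> carrier H" for s p q
    using that b by (auto simp: tau_simps l L.m_lcomm)
  show ?thesis
    unfolding trilinear_def using b
    by (intro conjI ballI balancedI)
      (auto simp: l tauH_simps tau_simps(1,2,3,4) L.r_distr 1)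
qed

text \<open>\<open>T\<close> consumes the leftmost Sweedler component while the coaction splits off
  the rightmost; coassociativity lets the two operations change places.\<close>

lemma gmap_coact:
  assumes w: "w \<in> carrier V"
  shows "coact (twisted k H L \<rho> \<alpha> u') (gmap T w) =
    lift2 (VH \<alpha> u') (\<lambda>a0 a1. tauH \<alpha> u' (gmap T a0) a1) (coact (twisted k H L \<rho> \<beta> u) w)"
proof -
  let ?g = "emb T \<otimes>\<^bsub>V1\<^esub> incl" and ?W = "VH \<alpha> u'" and ?t = "tauH \<alpha> u'"
  have g: "?g \<in> carrier V1" by simp
  have gh: "addhom V V (gmap T)" unfolding gmap_def by (rule llift_addhom[OF g])
  have bal: "balanced k V H ?W (\<lambda>a0 a1. ?t (gmap T a0) a1)"
    using addhom_closed[OF gh] addhom_add[OF gh] llift_smult[OF g]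
    by (intro balancedI) (auto simp: tauH_simps gmap_def)
  have gp: "gmap T (tau b x) = sw V (\<lambda>p q. tau (b \<otimes>\<^bsub>L\<^esub> T p) q) x"
    if h: "b \<in> carrier L" "x \<in> carrier H" for b x
  proof -
    have "gmap T (tau b x) = scal b \<otimes>\<^bsub>V\<^esub> sw V (\<lambda>p q. scal (T p) \<otimes>\<^bsub>V\<^esub> incl q) x"
      using h by (simp add: gmap_def llift_pure emb_mult_apply)
    also have "\<dots> = sw V (\<lambda>p q. scal b \<otimes>\<^bsub>V\<^esub> (scal (T p) \<otimes>\<^bsub>V\<^esub> incl q)) x"
      using h by (intro sweedler_hom[OF V_ab V_ab TL.mult_addhom_right])
        (auto simp: A1_closed conv_carrierD(3)[OF incl_closed])
    also have "\<dots> = sw V (\<lambda>p q. tau (b \<otimes>\<^bsub>L\<^esub> T p) q) x"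
      using h by (intro sweedler_cong V_ab) (auto simp: A1_closed incl_apply tau_simps)
    finally show ?thesis .
  qed
  show ?thesis
  proof (rule TL.tensor_ext[OF VH_ab addhom_comp[OF gh coact_addhom]
      addhom_comp[OF coact_addhom VH_lift(1)[OF VH_ab bal]] _ w])
    fix b x assume "b \<in> carrier A0" "x \<in> carrier H"
    then have h: "b \<in> carrier L" "x \<in> carrier H" by auto
    have "coact (twisted k H L \<rho> \<alpha> u') (gmap T (tau b x))
        = sw ?W (\<lambda>p q. coact (twisted k H L \<rho> \<alpha> u') (tau (b \<otimes>\<^bsub>L\<^esub> T p) q)) x"
      unfolding gp[OF h] using h
      by (intro sweedler_hom[OF V_ab VH_ab coact_addhom]) (auto simp: A1_closed tau_simps)
    also have "\<dots> = sw ?W (\<lambda>p q. sw ?W (\<lambda>c d. ?t (tau (b \<otimes>\<^bsub>L\<^esub> T p) c) d) q) x"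
      using h by (intro sweedler_cong VH_ab)
        (auto simp: A1_closed tau_simps tauH_simps coact_pure intro!: sweedler_closed[OF VH_ab])
    also have "\<dots> = sw ?W (\<lambda>p q. sw ?W (\<lambda>c d. ?t (tau (b \<otimes>\<^bsub>L\<^esub> T c) d) q) p) x"
      by (rule coassoc[OF VH_ab trilinear_tauH[OF h(1)] h(2), symmetric])
    also have "\<dots> = sw ?W (\<lambda>p q. ?t (gmap T (tau b p)) q) x"
    proof (intro sweedler_cong VH_ab h)
      fix p q assume pq: "p \<in> carrier H" "q \<in> carrier H"
      show "?t (gmap T (tau b p)) q \<in> carrier ?W"
        using pq h addhom_closed[OF gh] by (simp add: tauH_simps tau_simps)
      have "addhom V ?W (\<lambda>v. ?t v q)" using pq by (intro addhomI) (auto simp: tauH_simps)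
      then show "sw ?W (\<lambda>c d. ?t (tau (b \<otimes>\<^bsub>L\<^esub> T c) d) q) p = ?t (gmap T (tau b p)) q"
        unfolding gp[OF h(1) pq(1)] using pq h
        by (intro sweedler_hom[OF V_ab VH_ab, symmetric]) (auto simp: A1_closed tau_simps)
    qed
    also have "\<dots> = sw ?W (\<lambda>p q. lift2 ?W (\<lambda>a0 a1. ?t (gmap T a0) a1) (tauH \<beta> u (tau b p) q)) x"
      using h addhom_closed[OF gh] by (intro sweedler_cong VH_ab)
        (auto simp: VH_lift(2)[OF VH_ab bal] tau_simps tauH_simps)
    also have "\<dots> = lift2 ?W (\<lambda>a0 a1. ?t (gmap T a0) a1) (coact (twisted k H L \<rho> \<beta> u) (tau b x))"
      unfolding coact_pure[OF h] using h
      by (intro sweedler_hom[OF VH_ab VH_ab VH_lift(1)[OF VH_ab bal], symmetric]) (auto simp: tauH_simps tau_simps)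
    finally show "coact (twisted k H L \<rho> \<alpha> u') (gmap T (tau b x)) =
      lift2 ?W (\<lambda>a0 a1. ?t (gmap T a0) a1) (coact (twisted k H L \<rho> \<beta> u) (tau b x))" .
  qed
qed

text \<open>The map sends \<open>u \<otimes> 1\<close> to \<open>u T(1) \<otimes> 1\<close>, hence
  the unit \<open>u'\<close> of the target. Keeping both units general covers the passage from an
  unnormalized to a normalized cocycle.\<close>

theorem gauge_iso:
  assumes F: "F \<in> carrier A2" and G: "G \<in> carrier A2"
    and FG: "F \<otimes>\<^bsub>A2\<^esub> conv_pull T = leg1 T \<otimes>\<^bsub>A2\<^esub> leg2 T \<otimes>\<^bsub>A2\<^esub> G"
    and \<beta>: "\<And>x y. x \<in> carrier H \<Longrightarrow> y \<in> carrier H \<Longrightarrow> \<beta> x y = F x y"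
    and \<alpha>: "\<And>x y. x \<in> carrier H \<Longrightarrow> y \<in> carrier H \<Longrightarrow> \<alpha> x y = G x y"
    and u: "u \<in> carrier L" "u' = u \<otimes>\<^bsub>L\<^esub> T \<one>\<^bsub>H\<^esub>"
  shows "comod_alg_iso k H L \<rho> (twisted k H L \<rho> \<beta> u) (twisted k H L \<rho> \<alpha> u') (gmap T)"
proof -
  let ?g = "emb T \<otimes>\<^bsub>V1\<^esub> incl" and ?A = "twisted k H L \<rho> \<beta> u" and ?B = "twisted k H L \<rho> \<alpha> u'"
  have g: "?g \<in> carrier V1" by simp
  have gh: "addhom V V (gmap T)" unfolding gmap_def by (rule llift_addhom[OF g])
  have "gmap S ` carrier V \<subseteq> carrier V"
    unfolding gmap_def using llift_closed by auto
  then have "bij_betw (gmap T) (carrier V) (carrier V)"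
    using addhom_closed[OF gh] gmap_gmap[OF T S TS] gmap_gmap[OF S T ST]
    by (intro bij_betw_byWitness[where f' = "gmap S"]) auto
  moreover have "gmap T (tau u \<one>\<^bsub>H\<^esub>) = tau u' \<one>\<^bsub>H\<^esub>"
    using u A1_closed[OF T H.A.one_closed] alg_homD(4)[OF Vc.conv_eval_one_hom, of "emb T" incl]
    by (simp add: gmap_def llift_pure emb_apply incl_apply)
  ultimately have "gmap T \<in> ring_iso ?A ?B"
    using addhom_add[OF gh] addhom_closed[OF gh] gmap_mult[OF F G FG]
    by (simp add: ring_iso_def ring_hom_def twisted_simps(1-4) twisted_mult[OF F \<beta>] twisted_mult[OF G \<alpha>] Pi_iff)
  moreover have "linear_map L ?A ?B (gmap T)"
    using addhom_add[OF gh] addhom_closed[OF gh] llift_scal[OF g]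
    by (intro linear_mapI) (auto simp: twisted_simps(1,2) twisted_smult gmap_def)
  ultimately show ?thesis
    using gmap_coact[of _ \<alpha> u' \<beta> u]
    by (auto simp: comod_alg_iso_def Let_def twisted_simps(1) VH_def tauH_def)
qed

end

section \<open>Isomorphisms of comodule algebras\<close>

context hopf begin

abbreviation "coact_space \<rho> A \<equiv> tensor k (restrict_scalars \<rho> A) H"
abbreviation "coact_pure \<rho> A \<equiv> pure_tensor k (restrict_scalars \<rho> A) H"

lemmas [simp] = restrict_scalars_simps

text \<open>What it takes for \<open>f \<otimes> id\<close> to act on values of the coaction: a
  tensor product with well-formed relators, and a coaction with values in it.\<close>

definition comod_ok :: "('k \<Rightarrow> 'r) \<Rightarrow> ('r, 'a, 'h) comod_alg \<Rightarrow> bool" where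
  "comod_ok \<rho> A \<longleftrightarrow> premodule k (restrict_scalars \<rho> A) \<and>
     (\<forall>a\<in>carrier A. coact A a \<in> carrier (coact_space \<rho> A))"

lemma comod_ok_tensor: "comod_ok \<rho> A \<Longrightarrow> tensor_product k (restrict_scalars \<rho> A) H"
  by (simp add: comod_ok_def tensor_product_def premodule_H)

lemma comod_map_balanced:
  assumes B: "comod_ok \<rho> B" and f: "linear_map L A B f"
    and \<rho>: "\<And>r. r \<in> carrier k \<Longrightarrow> \<rho> r \<in> carrier L" "\<And>r. r \<in> carrier k \<Longrightarrow> \<rho>' r = \<rho> r"
  shows "balanced k (restrict_scalars \<rho>' A) H (coact_space \<rho> B) (\<lambda>a0 a1. coact_pure \<rho> B (f a0) a1)"
proof -
  interpret B: tensor_product k "restrict_scalars \<rho> B" H by (rule comod_ok_tensor[OF B])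
  show ?thesis
    using balancedD[OF B.pure_balanced] \<rho> by (intro balancedI) (auto simp: linear_mapD[OF f])
qed

lemma comod_alg_iso_trans:
  assumes A: "comod_ok \<rho>' A" and B: "comod_ok \<rho> B" and D: "comod_ok \<rho> D"
    and \<rho>: "\<And>r. r \<in> carrier k \<Longrightarrow> \<rho> r \<in> carrier L" "\<And>r. r \<in> carrier k \<Longrightarrow> \<rho>' r = \<rho> r"
    and f: "comod_alg_iso k H L \<rho> A B f" and g: "comod_alg_iso k H L \<rho> B D g"
  shows "comod_alg_iso k H L \<rho> A D (g \<circ> f)"
proof -
  interpret A: tensor_product k "restrict_scalars \<rho>' A" H by (rule comod_ok_tensor[OF A])
  interpret B: tensor_product k "restrict_scalars \<rho> B" H by (rule comod_ok_tensor[OF B])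
  interpret D: tensor_product k "restrict_scalars \<rho> D" H by (rule comod_ok_tensor[OF D])
  have fl: "linear_map L A B f" and gl: "linear_map L B D g"
    using f g by (auto simp: comod_alg_iso_def Let_def)
  have gfl: "linear_map L A D (\<lambda>x. g (f x))" by (rule linear_map_comp[OF fl gl])
  note fb = comod_map_balanced[OF B fl \<rho>] and gb = comod_map_balanced[OF D gl \<rho>(1) refl]
    and gfb = comod_map_balanced[OF D gfl \<rho>]
  have "coact D (g (f a)) = lift2 (coact_space \<rho> D) (\<lambda>a0 a1. coact_pure \<rho> D (g (f a0)) a1) (coact A a)"
    if a: "a \<in> carrier A" for a
  proof -
    have "coact D (g (f a)) = lift2 (coact_space \<rho> D) (\<lambda>b0 b1. coact_pure \<rho> D (g b0) b1)
        (lift2 (coact_space \<rho> B) (\<lambda>a0 a1. coact_pure \<rho> B (f a0) a1) (coact A a))"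
      using f g linear_mapD(1)[OF fl a] a by (simp add: comod_alg_iso_def Let_def)
    also have "\<dots> = lift2 (coact_space \<rho> D) (\<lambda>a0 a1. coact_pure \<rho> D (g (f a0)) a1) (coact A a)"
      by (rule A.tensor_ext[OF D.tensor_abelian addhom_comp[OF A.lift2_hom(1)[OF B.tensor_abelian fb]
          B.lift2_hom(1)[OF D.tensor_abelian gb]] A.lift2_hom(1)[OF D.tensor_abelian gfb]])
        (use a A in \<open>auto simp: comod_ok_def A.lift2_hom(2)[OF B.tensor_abelian fb] linear_mapD[OF fl]
          B.lift2_hom(2)[OF D.tensor_abelian gb] A.lift2_hom(2)[OF D.tensor_abelian gfb]\<close>)
    finally show ?thesis .
  qed
  moreover have "g \<circ> f \<in> ring_iso A D"
    using f g ring_iso_set_trans by (auto simp: comod_alg_iso_def Let_def)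
  ultimately show ?thesis using gfl by (simp add: comod_alg_iso_def Let_def comp_def)
qed

lemma comod_alg_iso_sym:
  assumes A: "comod_ok \<rho> A" and B: "comod_ok \<rho> B"
    and \<rho>: "\<And>r. r \<in> carrier k \<Longrightarrow> \<rho> r \<in> carrier L"
    and f: "comod_alg_iso k H L \<rho> A B f"
    and cl: "\<one>\<^bsub>A\<^esub> \<in> carrier A" "\<And>x y. x \<in> carrier A \<Longrightarrow> y \<in> carrier A \<Longrightarrow> x \<otimes>\<^bsub>A\<^esub> y \<in> carrier A"
      "\<And>r x. r \<in> carrier L \<Longrightarrow> x \<in> carrier A \<Longrightarrow> r \<odot>\<^bsub>A\<^esub> x \<in> carrier A"
  shows "comod_alg_iso k H L \<rho> B A (inv_into (carrier A) f)"
proof -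
  interpret A: tensor_product k "restrict_scalars \<rho> A" H by (rule comod_ok_tensor[OF A])
  interpret B: tensor_product k "restrict_scalars \<rho> B" H by (rule comod_ok_tensor[OF B])
  let ?g = "inv_into (carrier A) f"
  have fl: "linear_map L A B f" and bij: "bij_betw f (carrier A) (carrier B)"
    and fr: "f \<in> ring_hom A B"
    using f by (auto simp: comod_alg_iso_def Let_def ring_iso_def)
  have gf: "?g (f x) = x" if "x \<in> carrier A" for x
    using bij that by (simp add: bij_betw_inv_into_left)
  have ex: "\<exists>x\<in>carrier A. y = f x" if "y \<in> carrier B" for y
    using bij that by (auto simp: bij_betw_def)
  note fr' = ring_hom_memE[OF fr]
  have ac: "x \<oplus>\<^bsub>A\<^esub> y \<in> carrier A" if "x \<in> carrier A" "y \<in> carrier A" for x y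
    using A.M.a_closed that by simp
  have g1: "?g b \<in> carrier A" if "b \<in> carrier B" for b
    using ex[OF that] gf by auto
  have g2: "?g (b \<oplus>\<^bsub>B\<^esub> c) = ?g b \<oplus>\<^bsub>A\<^esub> ?g c" if "b \<in> carrier B" "c \<in> carrier B" for b c
    using ex[OF that(1)] ex[OF that(2)] by (auto simp: gf ac simp flip: linear_mapD(2)[OF fl])
  have g3: "?g (b \<otimes>\<^bsub>B\<^esub> c) = ?g b \<otimes>\<^bsub>A\<^esub> ?g c" if "b \<in> carrier B" "c \<in> carrier B" for b c
    using ex[OF that(1)] ex[OF that(2)] by (auto simp: gf cl simp flip: fr'(2))
  have g4: "?g (r \<odot>\<^bsub>B\<^esub> b) = r \<odot>\<^bsub>A\<^esub> ?g b" if "r \<in> carrier L" "b \<in> carrier B" for r b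
    using ex[OF that(2)] that(1) by (auto simp: gf cl simp flip: linear_mapD(3)[OF fl])
  have g5: "?g \<one>\<^bsub>B\<^esub> = \<one>\<^bsub>A\<^esub>"
    using gf[OF cl(1)] fr'(4) by simp
  have gl: "linear_map L B A ?g" by (rule linear_mapI) (auto simp: g1 g2 g4)
  have gr: "?g \<in> ring_iso B A"
    using bij_betw_inv_into[OF bij] by (auto simp: ring_iso_def ring_hom_def g1 g2 g3 g5)
  note fb = comod_map_balanced[OF B fl \<rho> refl] and gb = comod_map_balanced[OF A gl \<rho> refl]
  have "coact A (?g b) = lift2 (coact_space \<rho> A) (\<lambda>a0 a1. coact_pure \<rho> A (?g a0) a1) (coact B b)"
    if b: "b \<in> carrier B" for b
  proof -
    obtain a where a: "a \<in> carrier A" "b = f a" using ex[OF b] by auto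
    have "lift2 (coact_space \<rho> A) (\<lambda>a0 a1. coact_pure \<rho> A (?g a0) a1) (coact B b)
        = lift2 (coact_space \<rho> A) (\<lambda>a0 a1. coact_pure \<rho> A (?g a0) a1)
          (lift2 (coact_space \<rho> B) (\<lambda>a0 a1. coact_pure \<rho> B (f a0) a1) (coact A a))"
      using f a by (simp add: comod_alg_iso_def Let_def)
    also have "\<dots> = coact A a"
      by (rule A.tensor_ext[OF A.tensor_abelian addhom_comp[OF A.lift2_hom(1)[OF B.tensor_abelian fb]
          B.lift2_hom(1)[OF A.tensor_abelian gb]], of "\<lambda>x. x"])
        (use a A in \<open>auto simp: comod_ok_def A.lift2_hom(2)[OF B.tensor_abelian fb] linear_mapD[OF fl]
          B.lift2_hom(2)[OF A.tensor_abelian gb] gf addhom_def\<close>)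
    finally show ?thesis using a gf by simp
  qed
  with gl gr show ?thesis by (simp add: comod_alg_iso_def Let_def)
qed

end

context hopf_values begin

lemma twisted_ok: "comod_ok \<rho> (twisted k H L \<rho> \<beta> u)"
  using twisted_premodule addhom_closed[OF coact_addhom]
  by (simp add: comod_ok_def twisted_simps VH_def)

text \<open>Bilinearity over the ring of values; base change needs it to multiply pure tensors
  \<open>s \<otimes> a\<close>.\<close>

lemma twisted_closed:
  assumes F: "F \<in> carrier A2" and eq: "\<And>x y. x \<in> carrier H \<Longrightarrow> y \<in> carrier H \<Longrightarrow> \<beta> x y = F x y"
  shows "bilinear_mult L (twisted k H L \<rho> \<beta> u)"
proof -
  let ?A = "twisted k H L \<rho> \<beta> u"
  have "addhom V V (\<lambda>y. x \<otimes>\<^bsub>?A\<^esub> y)" "addhom V V (\<lambda>y. y \<otimes>\<^bsub>?A\<^esub> x)" if "x \<in> carrier V" for x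
    using that tmult_addhom_left[OF F that] tmult_addhom_right[OF F that]
    by (auto simp: addhom_def twisted_mult[OF F eq] Pi_iff)
  moreover have "addhom ?A ?A = addhom V V"
    by (rule addhom_cong_add) (simp_all add: same_add_def twisted_simps)
  ultimately show ?thesis
    by (simp add: bilinear_mult_def twisted_simps(1) twisted_smult twisted_mult[OF F eq]
        tmult_closed[OF F] tmult_scal_left[OF F] tmult_scal_right[OF F])
qed

lemma twisted_premodule_L: "premodule L (twisted k H L \<rho> \<beta> u)"
  using twisted_ab by (simp add: premodule_def twisted_simps(1) twisted_smult)

end

section \<open>Base change of twisted algebras\<close>

text \<open>Cocycles are carried twice, as the functions that occur in the records and as the
  extensional elements \<open>F\<close>, \<open>G\<close> used in computations. Cocycle and unit of
  the target are the images under \<open>\<phi>\<close>.\<close>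

locale hopf_base_change = R: hopf_values k H R \<rho> + S: hopf_values k H S \<rho>'
  for k :: "('k, 'm) ring_scheme" and H :: "('k, 'h, 'n) hopf_scheme"
    and R :: "('r, 'o) ring_scheme" and \<rho> and S :: "('s, 'p) ring_scheme" and \<rho>' +
  fixes \<phi> :: "'r \<Rightarrow> 's" and \<alpha> u F \<alpha>' u' G
  assumes \<phi>_hom: "\<phi> \<in> ring_hom R S"
    and \<phi>_\<rho>: "\<And>c. c \<in> carrier k \<Longrightarrow> \<phi> (\<rho> c) = \<rho>' c"
    and F: "F \<in> carrier R.A2" and \<alpha>_F: "\<And>x y. x \<in> carrier H \<Longrightarrow> y \<in> carrier H \<Longrightarrow> \<alpha> x y = F x y"
    and G: "G \<in> carrier S.A2" and \<alpha>'_G: "\<And>x y. x \<in> carrier H \<Longrightarrow> y \<in> carrier H \<Longrightarrow> \<alpha>' x y = G x y"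
    and \<phi>_F: "\<And>x y. x \<in> carrier H \<Longrightarrow> y \<in> carrier H \<Longrightarrow> \<phi> (F x y) = G x y"
    and u: "u \<in> carrier R" "\<phi> u = u'"
begin

abbreviation "A \<equiv> twisted k H R \<rho> \<alpha> u"
abbreviation "B \<equiv> twisted k H S \<rho>' \<alpha>' u'"
abbreviation "S\<phi> \<equiv> as_algebra \<phi> S"

lemma \<phi>_simps [simp]:
  "r \<in> carrier R \<Longrightarrow> \<phi> r \<in> carrier S"
  "r \<in> carrier R \<Longrightarrow> r' \<in> carrier R \<Longrightarrow> \<phi> (r \<otimes>\<^bsub>R\<^esub> r') = \<phi> r \<otimes>\<^bsub>S\<^esub> \<phi> r'"
  "r \<in> carrier R \<Longrightarrow> r' \<in> carrier R \<Longrightarrow> \<phi> (r \<oplus>\<^bsub>R\<^esub> r') = \<phi> r \<oplus>\<^bsub>S\<^esub> \<phi> r'"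
  "\<phi> \<one>\<^bsub>R\<^esub> = \<one>\<^bsub>S\<^esub>"
  using \<phi>_hom by (auto simp: ring_hom_def)

lemma S\<phi>_simps [simp]:
  "carrier S\<phi> = carrier S" "x \<otimes>\<^bsub>S\<phi>\<^esub> y = x \<otimes>\<^bsub>S\<^esub> y" "x \<oplus>\<^bsub>S\<phi>\<^esub> y = x \<oplus>\<^bsub>S\<^esub> y"
  "\<one>\<^bsub>S\<phi>\<^esub> = \<one>\<^bsub>S\<^esub>" "\<zero>\<^bsub>S\<phi>\<^esub> = \<zero>\<^bsub>S\<^esub>" "r \<odot>\<^bsub>S\<phi>\<^esub> x = \<phi> r \<otimes>\<^bsub>S\<^esub> x"
  by (simp_all add: as_algebra_def)

lemma S\<phi>_ab: "abelian_group S\<phi>"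
proof -
  have "same_add S S\<phi>" by (simp add: same_add_def as_algebra_def)
  then show ?thesis using abelian_group_cong_add S.L_ab by blast
qed

lemma S\<phi>_premodule: "premodule R S\<phi>"
  using S\<phi>_ab by (simp add: premodule_def)

sublocale W: tensor_mult R S\<phi> A
proof (intro tensor_mult.intro tensor_product.intro tensor_mult_axioms.intro)
  show "bilinear_mult R S\<phi>"
    by (auto simp: bilinear_mult_def addhom_def S.L.l_distr S.L.r_distr S.L.m_ac)
qed (rule S\<phi>_premodule R.twisted_premodule_L R.twisted_closed[OF F \<alpha>_F])+

abbreviation "WW \<equiv> tensor R S\<phi> A"
abbreviation "tauW \<equiv> pure_tensor R S\<phi> A"

lemma A_simps [simp]:
  "carrier A = carrier R.V" "x \<oplus>\<^bsub>A\<^esub> y = x \<oplus>\<^bsub>R.V\<^esub> y" "\<one>\<^bsub>A\<^esub> = R.tau u \<one>\<^bsub>H\<^esub>"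
  "r \<in> carrier R \<Longrightarrow> w \<in> carrier R.V \<Longrightarrow> r \<odot>\<^bsub>A\<^esub> w = R.scal r \<otimes>\<^bsub>R.V\<^esub> w"
  "w \<in> carrier R.V \<Longrightarrow> v \<in> carrier R.V \<Longrightarrow> w \<otimes>\<^bsub>A\<^esub> v = R.tmult F w v"
  by (simp_all add: R.twisted_simps(1,2,4) R.twisted_smult R.twisted_mult[OF F \<alpha>_F])

lemma B_simps:
  "carrier B = carrier S.V" "x \<oplus>\<^bsub>B\<^esub> y = x \<oplus>\<^bsub>S.V\<^esub> y" "\<one>\<^bsub>B\<^esub> = S.tau u' \<one>\<^bsub>H\<^esub>"
  "r \<in> carrier S \<Longrightarrow> w \<in> carrier S.V \<Longrightarrow> r \<odot>\<^bsub>B\<^esub> w = S.scal r \<otimes>\<^bsub>S.V\<^esub> w"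
  "w \<in> carrier S.V \<Longrightarrow> v \<in> carrier S.V \<Longrightarrow> w \<otimes>\<^bsub>B\<^esub> v = S.tmult G w v"
  by (simp_all add: S.twisted_simps(1,2,4) S.twisted_smult S.twisted_mult[OF G \<alpha>'_G])

lemma tauW_simps:
  "s \<in> carrier S \<Longrightarrow> a \<in> carrier R.V \<Longrightarrow> tauW s a \<in> carrier WW"
  "s \<in> carrier S \<Longrightarrow> s' \<in> carrier S \<Longrightarrow> a \<in> carrier R.V \<Longrightarrow>
     tauW (s \<oplus>\<^bsub>S\<^esub> s') a = tauW s a \<oplus>\<^bsub>WW\<^esub> tauW s' a"
  "s \<in> carrier S \<Longrightarrow> a \<in> carrier R.V \<Longrightarrow> b \<in> carrier R.V \<Longrightarrow>
     tauW s (a \<oplus>\<^bsub>R.V\<^esub> b) = tauW s a \<oplus>\<^bsub>WW\<^esub> tauW s b"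
  "r \<in> carrier R \<Longrightarrow> s \<in> carrier S \<Longrightarrow> a \<in> carrier R.V \<Longrightarrow>
     tauW s (R.scal r \<otimes>\<^bsub>R.V\<^esub> a) = tauW (\<phi> r \<otimes>\<^bsub>S\<^esub> s) a"
  using W.tau_simps[simplified] by (auto simp del: R.scal_pure)

text \<open>The map \<open>\<phi> \<otimes> id\<close> on \<open>R \<otimes> H\<close>; the base
  change isomorphism is its \<open>S\<close>-linear extension.\<close>

definition "\<psi> = lift2 S.V (\<lambda>r x. S.tau (\<phi> r) x)"

lemma \<psi>_balanced: "balanced k R.A0 H S.V (\<lambda>r x. S.tau (\<phi> r) x)"
  by (rule balancedI) (auto simp: S.tau_simps \<phi>_\<rho>)

lemma \<psi>_addhom: "addhom R.V S.V \<psi>"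
  unfolding \<psi>_def by (rule R.TL.lift2_hom(1)[OF S.V_ab \<psi>_balanced])

lemma \<psi>_pure: "r \<in> carrier R \<Longrightarrow> x \<in> carrier H \<Longrightarrow> \<psi> (R.tau r x) = S.tau (\<phi> r) x"
  unfolding \<psi>_def using R.TL.lift2_hom(2)[OF S.V_ab \<psi>_balanced] by simp

lemma \<psi>_closed: "w \<in> carrier R.V \<Longrightarrow> \<psi> w \<in> carrier S.V"
  by (rule addhom_closed[OF \<psi>_addhom])

lemma \<psi>_scal:
  assumes r: "r \<in> carrier R" and w: "w \<in> carrier R.V"
  shows "\<psi> (R.scal r \<otimes>\<^bsub>R.V\<^esub> w) = S.scal (\<phi> r) \<otimes>\<^bsub>S.V\<^esub> \<psi> w"
  by (rule R.TL.tensor_ext[OF S.V_ab addhom_comp[OF R.TL.mult_addhom_right \<psi>_addhom]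
        addhom_comp[OF \<psi>_addhom S.TL.mult_addhom_right] _ w])
    (use r in \<open>auto simp: \<psi>_pure\<close>)

lemma \<psi>_kernel:
  assumes x: "x \<in> carrier H" and y: "y \<in> carrier H"
  shows "\<psi> (R.kernel_of F x y) = S.kernel_of G x y"
proof -
  have "\<psi> (R.kernel_of F x y) = R.sw S.V (\<lambda>a b. R.sw S.V (\<lambda>c d. \<psi> (R.tau (F a c) (b \<otimes>\<^bsub>H\<^esub> d))) y) x"
    unfolding R.kernel_apply[OF F x y] using x y R.A2_closed[OF F]
    by (intro R.sweedler_hom2[OF R.V_ab S.V_ab \<psi>_addhom]) (auto simp: R.tau_simps)
  also have "\<dots> = S.kernel_of G x y"
    unfolding S.kernel_apply[OF G x y] using x y R.A2_closed[OF F] S.A2_closed[OF G]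
    by (intro R.sweedler_cong2[OF S.V_ab]) (auto simp: S.tau_simps \<psi>_pure \<phi>_F)
  finally show ?thesis .
qed

text \<open>Since \<open>\<phi>\<close> carries \<open>F\<close> to \<open>G\<close>, the map
  respects the products of elements \<open>1 \<otimes> x\<close>; semilinearity does the
  rest.\<close>

lemma \<psi>_mult:
  assumes w: "w \<in> carrier R.V" and v: "v \<in> carrier R.V"
  shows "\<psi> (R.tmult F w v) = S.tmult G (\<psi> w) (\<psi> v)"
proof (rule R.TL.tensor_ext[OF S.V_ab addhom_comp[OF R.tmult_addhom_left[OF F v] \<psi>_addhom]
      addhom_comp[OF \<psi>_addhom S.tmult_addhom_left[OF G \<psi>_closed[OF v]]] _ w])
  fix b x assume "b \<in> carrier R.A0" "x \<in> carrier H"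
  then have bx: "b \<in> carrier R" "x \<in> carrier H" "R.tau b x \<in> carrier R.V" by (auto simp: R.tau_simps)
  show "\<psi> (R.tmult F (R.tau b x) v) = S.tmult G (\<psi> (R.tau b x)) (\<psi> v)"
  proof (rule R.TL.tensor_ext[OF S.V_ab addhom_comp[OF R.tmult_addhom_right[OF F bx(3)] \<psi>_addhom]
        addhom_comp[OF \<psi>_addhom S.tmult_addhom_right[OF G \<psi>_closed[OF bx(3)]]] _ v])
    fix c y assume "c \<in> carrier R.A0" "y \<in> carrier H"
    then have cy: "c \<in> carrier R" "y \<in> carrier H" by auto
    show "\<psi> (R.tmult F (R.tau b x) (R.tau c y)) = S.tmult G (\<psi> (R.tau b x)) (\<psi> (R.tau c y))"
      using bx cy F G
      by (simp add: R.tmult_pure_left S.tmult_pure_left R.llift_pure S.llift_pure R.tau_simps S.tau_simps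
          \<psi>_scal \<psi>_kernel \<psi>_pure R.V2_closed)
  qed
qed

text \<open>The standard isomorphism \<open>S \<otimes>\<^sub>R (R \<otimes> H) \<rightarrow> S
  \<otimes> H\<close>; its inverse is \<open>\<Phi>\<close> below.\<close>

definition "\<Psi> = lift2 S.V (\<lambda>s a. S.scal s \<otimes>\<^bsub>S.V\<^esub> \<psi> a)"

lemma S_scal_add: "s \<in> carrier S \<Longrightarrow> s' \<in> carrier S \<Longrightarrow> S.scal (s \<oplus>\<^bsub>S\<^esub> s') = S.scal s \<oplus>\<^bsub>S.V\<^esub> S.scal s'"
  using alg_homD(3)[OF S.scal_hom] by simp

lemma \<Psi>_balanced: "balanced R S\<phi> A S.V (\<lambda>s a. S.scal s \<otimes>\<^bsub>S.V\<^esub> \<psi> a)"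
  by (rule balancedI)
    (auto simp: \<psi>_closed \<psi>_scal S.scal_scal S.L.m_comm addhom_add[OF \<psi>_addhom] S_scal_add
      S.TL.TT.A.l_distr S.TL.TT.A.r_distr)

lemma \<Psi>_addhom: "addhom WW S.V \<Psi>"
  unfolding \<Psi>_def by (rule W.lift2_hom(1)[OF S.V_ab \<Psi>_balanced])

lemma \<Psi>_pure: "s \<in> carrier S \<Longrightarrow> a \<in> carrier R.V \<Longrightarrow> \<Psi> (tauW s a) = S.scal s \<otimes>\<^bsub>S.V\<^esub> \<psi> a"
  unfolding \<Psi>_def using W.lift2_hom(2)[OF S.V_ab \<Psi>_balanced] by simp

lemma \<Psi>_closed: "w \<in> carrier WW \<Longrightarrow> \<Psi> w \<in> carrier S.V"
  by (rule addhom_closed[OF \<Psi>_addhom])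

definition "\<Phi> = lift2 WW (\<lambda>s x. tauW s (R.tau \<one>\<^bsub>R\<^esub> x))"

lemma \<Phi>_balanced: "balanced k S.A0 H WW (\<lambda>s x. tauW s (R.tau \<one>\<^bsub>R\<^esub> x))"
proof (rule balancedI)
  show "tauW (r \<odot>\<^bsub>S.A0\<^esub> s) (R.tau \<one>\<^bsub>R\<^esub> x) = tauW s (R.tau \<one>\<^bsub>R\<^esub> (r \<odot>\<^bsub>H\<^esub> x))"
    if "r \<in> carrier k" "s \<in> carrier S.A0" "x \<in> carrier H" for r s x
    using that tauW_simps(4)[of "\<rho> r" s "R.tau \<one>\<^bsub>R\<^esub> x"] by (simp add: R.tau_simps \<phi>_\<rho>)
qed (auto simp: tauW_simps R.tau_simps)

lemma \<Phi>_addhom: "addhom S.V WW \<Phi>"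
  unfolding \<Phi>_def by (rule S.TL.lift2_hom(1)[OF W.tensor_abelian \<Phi>_balanced])

lemma \<Phi>_pure: "s \<in> carrier S \<Longrightarrow> x \<in> carrier H \<Longrightarrow> \<Phi> (S.tau s x) = tauW s (R.tau \<one>\<^bsub>R\<^esub> x)"
  unfolding \<Phi>_def using S.TL.lift2_hom(2)[OF W.tensor_abelian \<Phi>_balanced] by simp

lemma tauW_addhom: "s \<in> carrier S \<Longrightarrow> addhom R.V WW (\<lambda>a. tauW s a)"
  by (rule addhomI) (auto simp: tauW_simps)

text \<open>Additively, \<open>S \<otimes>\<^sub>R (R \<otimes> H)\<close> is generated by the
  tensors whose inner factor is pure as well.\<close>

lemma WW_ext:
  assumes "abelian_group E" "addhom WW E h" "addhom WW E h'"
    "\<And>s r x. s \<in> carrier S \<Longrightarrow> r \<in> carrier R \<Longrightarrow> x \<in> carrier H \<Longrightarrow>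
       h (tauW s (R.tau r x)) = h' (tauW s (R.tau r x))"
    and w: "w \<in> carrier WW"
  shows "h w = h' w"
proof (rule W.tensor_ext[OF assms(1-3) _ w])
  fix s a assume "s \<in> carrier S\<phi>" "a \<in> carrier A"
  then have sa: "s \<in> carrier S" "a \<in> carrier R.V" by auto
  show "h (tauW s a) = h' (tauW s a)"
    by (rule R.TL.tensor_ext[OF assms(1) addhom_comp[OF tauW_addhom[OF sa(1)] assms(2)]
          addhom_comp[OF tauW_addhom[OF sa(1)] assms(3)] _ sa(2)])
      (use sa assms(4) in auto)
qed

lemma \<Phi>_\<Psi>: "w \<in> carrier WW \<Longrightarrow> \<Phi> (\<Psi> w) = w"
proof (rule WW_ext[OF W.tensor_abelian addhom_comp[OF \<Psi>_addhom \<Phi>_addhom], of "\<lambda>w. w"])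
  show "\<Phi> (\<Psi> (tauW s (R.tau r x))) = tauW s (R.tau r x)"
    if "s \<in> carrier S" "r \<in> carrier R" "x \<in> carrier H" for s r x
    using that tauW_simps(4)[of r s "R.tau \<one>\<^bsub>R\<^esub> x"]
    by (simp add: \<Psi>_pure \<psi>_pure \<Phi>_pure R.tau_simps S.L.m_comm)
qed (auto intro: addhomI)

lemma \<Psi>_\<Phi>: "w \<in> carrier S.V \<Longrightarrow> \<Psi> (\<Phi> w) = w"
proof (rule S.TL.tensor_ext[OF S.V_ab addhom_comp[OF \<Phi>_addhom \<Psi>_addhom], of "\<lambda>w. w"])
  show "\<Psi> (\<Phi> (S.tau s x)) = S.tau s x" if "s \<in> carrier S.A0" "x \<in> carrier H" for s x
    using that by (simp add: \<Psi>_pure \<psi>_pure \<Phi>_pure R.tau_simps)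
qed (auto intro: addhomI)

lemma \<Psi>_mult:
  assumes w: "w \<in> carrier WW" and v: "v \<in> carrier WW"
  shows "\<Psi> (w \<otimes>\<^bsub>WW\<^esub> v) = S.tmult G (\<Psi> w) (\<Psi> v)"
proof (rule W.tensor_ext[OF S.V_ab addhom_comp[OF W.mult_addhom_left[OF v] \<Psi>_addhom]
      addhom_comp[OF \<Psi>_addhom S.tmult_addhom_left[OF G \<Psi>_closed[OF v]]] _ w])
  fix s a assume "s \<in> carrier S\<phi>" "a \<in> carrier A"
  then have sa: "s \<in> carrier S" "a \<in> carrier R.V" "tauW s a \<in> carrier WW" by (auto simp: tauW_simps)
  show "\<Psi> (tauW s a \<otimes>\<^bsub>WW\<^esub> v) = S.tmult G (\<Psi> (tauW s a)) (\<Psi> v)"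
  proof (rule W.tensor_ext[OF S.V_ab addhom_comp[OF W.mult_addhom_right[OF sa(3)] \<Psi>_addhom]
        addhom_comp[OF \<Psi>_addhom S.tmult_addhom_right[OF G \<Psi>_closed[OF sa(3)]]] _ v])
    fix s' a' assume "s' \<in> carrier S\<phi>" "a' \<in> carrier A"
    then have sa': "s' \<in> carrier S" "a' \<in> carrier R.V" by auto
    show "\<Psi> (tauW s a \<otimes>\<^bsub>WW\<^esub> tauW s' a') = S.tmult G (\<Psi> (tauW s a)) (\<Psi> (tauW s' a'))"
      using sa sa' F G
      by (simp add: W.mult_pure \<Psi>_pure R.tmult_closed \<psi>_mult S.tmult_scal_left S.tmult_scal_right
          \<psi>_closed S.scal_scal S.tmult_closed S.L.m_comm)
  qed
qed

text \<open>The base-changed algebra before its coaction is attached. The coaction is defined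
  through this record, and \<open>restrict_D\<close> identifies the two after forgetting.\<close>

definition "D = base_change_algebra R S \<phi> A"
abbreviation "BC \<equiv> base_change k H R \<rho> S \<phi> A"

lemma BC_simps:
  "carrier BC = carrier WW" "add BC = add WW" "\<zero>\<^bsub>BC\<^esub> = \<zero>\<^bsub>WW\<^esub>" "monoid.mult BC = monoid.mult WW"
  "\<one>\<^bsub>BC\<^esub> = tauW \<one>\<^bsub>S\<^esub> (R.tau u \<one>\<^bsub>H\<^esub>)"
  "smult BC = (\<lambda>s. lift2 WW (\<lambda>s' a. tauW (s \<otimes>\<^bsub>S\<^esub> s') a))"
  by (simp_all add: base_change_def base_change_algebra_def with_coact_def Let_def W.tensor_one)

lemma smult_balanced:
  "s \<in> carrier S \<Longrightarrow> balanced R S\<phi> A WW (\<lambda>s' a. tauW (s \<otimes>\<^bsub>S\<^esub> s') a)"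
  by (rule balancedI) (auto simp: tauW_simps S.L.r_distr S.L.m_ac)

lemma BC_smult_addhom: "s \<in> carrier S \<Longrightarrow> addhom WW WW (\<lambda>w. s \<odot>\<^bsub>BC\<^esub> w)"
  unfolding BC_simps by (rule W.lift2_hom(1)[OF W.tensor_abelian smult_balanced])

lemma BC_smult_pure:
  "s \<in> carrier S \<Longrightarrow> s' \<in> carrier S \<Longrightarrow> a \<in> carrier R.V \<Longrightarrow>
     s \<odot>\<^bsub>BC\<^esub> tauW s' a = tauW (s \<otimes>\<^bsub>S\<^esub> s') a"
  unfolding BC_simps using W.lift2_hom(2)[OF W.tensor_abelian smult_balanced] by simp

lemma BC_smult_closed: "s \<in> carrier S \<Longrightarrow> w \<in> carrier WW \<Longrightarrow> s \<odot>\<^bsub>BC\<^esub> w \<in> carrier WW"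
  by (rule addhom_closed[OF BC_smult_addhom])

lemma \<Psi>_smult:
  assumes s: "s \<in> carrier S" and w: "w \<in> carrier WW"
  shows "\<Psi> (s \<odot>\<^bsub>BC\<^esub> w) = S.scal s \<otimes>\<^bsub>S.V\<^esub> \<Psi> w"
  by (rule W.tensor_ext[OF S.V_ab addhom_comp[OF BC_smult_addhom[OF s] \<Psi>_addhom]
        addhom_comp[OF \<Psi>_addhom S.TL.mult_addhom_right] _ w])
    (use s in \<open>auto simp: BC_smult_pure \<Psi>_pure S.scal_scal \<psi>_closed\<close>)

lemma BC_ab: "abelian_group BC"
proof -
  have "same_add WW BC" by (simp add: same_add_def BC_simps)
  then show ?thesis using abelian_group_cong_add W.tensor_abelian by blast
qed

abbreviation "\<rho>\<phi> \<equiv> \<phi> \<circ> \<rho>"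

lemma restrict_D: "restrict_scalars \<rho>\<phi> D = restrict_scalars \<rho>\<phi> BC"
  by (simp add: restrict_scalars_def D_def base_change_def with_coact_def Let_def)

lemma BC_premodule: "premodule k (restrict_scalars \<rho>\<phi> BC)"
proof -
  have "same_add BC (restrict_scalars \<rho>\<phi> BC)" by (simp add: same_add_def)
  then show ?thesis
    using abelian_group_cong_add BC_ab by (auto simp: premodule_def BC_simps(1) BC_smult_closed)
qed

sublocale W2: tensor_product k "restrict_scalars \<rho>\<phi> BC" H
  by (intro tensor_product.intro BC_premodule R.premodule_H)

abbreviation "WH \<equiv> R.coact_space \<rho>\<phi> BC"
abbreviation "tauWH \<equiv> R.coact_pure \<rho>\<phi> BC"

lemma tauWH_simps:
  "w \<in> carrier WW \<Longrightarrow> x \<in> carrier H \<Longrightarrow> tauWH w x \<in> carrier WH"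
  "w \<in> carrier WW \<Longrightarrow> w' \<in> carrier WW \<Longrightarrow> x \<in> carrier H \<Longrightarrow>
     tauWH (w \<oplus>\<^bsub>WW\<^esub> w') x = tauWH w x \<oplus>\<^bsub>WH\<^esub> tauWH w' x"
  "w \<in> carrier WW \<Longrightarrow> x \<in> carrier H \<Longrightarrow> x' \<in> carrier H \<Longrightarrow>
     tauWH w (x \<oplus>\<^bsub>H\<^esub> x') = tauWH w x \<oplus>\<^bsub>WH\<^esub> tauWH w x'"
  "r \<in> carrier k \<Longrightarrow> w \<in> carrier WW \<Longrightarrow> x \<in> carrier H \<Longrightarrow>
     tauWH w (r \<odot>\<^bsub>H\<^esub> x) = tauWH (\<phi> (\<rho> r) \<odot>\<^bsub>BC\<^esub> w) x"
  using balancedD[OF W2.pure_balanced] by (auto simp: BC_simps(1,2))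

text \<open>The coaction on \<open>s \<otimes> a\<close>, isolated so that its balancedness over
  \<open>R\<close> can be checked.\<close>

definition "\<delta> s a = lift2 WH (\<lambda>a0 a1. tauWH (tauW s a0) a1) (coact A a)"

lemma coact_BC: "coact BC = lift2 WH \<delta>"
proof -
  have "coact BC = lift2 (R.coact_space \<rho>\<phi> D) (\<lambda>s a. lift2 (R.coact_space \<rho>\<phi> D)
      (\<lambda>a0 a1. R.coact_pure \<rho>\<phi> D (tauW s a0) a1) (coact A a))"
    by (simp add: base_change_def with_coact_def Let_def D_def)
  then show ?thesis unfolding restrict_D \<delta>_def[abs_def] .
qed

lemma inner_balanced: "s \<in> carrier S \<Longrightarrow> balanced k R.V H WH (\<lambda>a0 a1. tauWH (tauW s a0) a1)"
  by (rule balancedI)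
    (auto simp: tauWH_simps tauW_simps BC_smult_pure R.smult_scal \<phi>_\<rho>)

lemma \<delta>_addhom: "s \<in> carrier S \<Longrightarrow> addhom R.V WH (\<delta> s)"
  unfolding \<delta>_def[abs_def]
  by (rule addhom_comp[OF R.coact_addhom R.VH_lift(1)[OF W2.tensor_abelian inner_balanced]])

lemma \<delta>_pure:
  assumes s: "s \<in> carrier S" and h: "r \<in> carrier R" "x \<in> carrier H"
  shows "\<delta> s (R.tau r x) = R.sw WH (\<lambda>x1 x2. tauWH (tauW s (R.tau r x1)) x2) x"
proof -
  note l = R.VH_lift[OF W2.tensor_abelian inner_balanced[OF s]]
  have "\<delta> s (R.tau r x) = R.sw WH (\<lambda>x1 x2. lift2 WH (\<lambda>a0 a1. tauWH (tauW s a0) a1)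
      (R.tauH \<alpha> u (R.tau r x1) x2)) x"
    unfolding \<delta>_def R.coact_pure[OF h] using h
    by (intro R.sweedler_hom[OF R.VH_ab W2.tensor_abelian l(1)]) (auto simp: R.tauH_simps R.tau_simps)
  also have "\<dots> = R.sw WH (\<lambda>x1 x2. tauWH (tauW s (R.tau r x1)) x2) x"
    using h s by (intro R.sweedler_cong[OF W2.tensor_abelian])
      (auto simp: l(2) R.tau_simps tauW_simps tauWH_simps)
  finally show ?thesis .
qed

text \<open>On \<open>a = r \<otimes> x\<close> the coaction of a twisted algebra leaves
  \<open>r\<close> in place, so moving a scalar of \<open>R\<close> across the tensor sign can be
  done inside the first tensor factor.\<close>

lemma \<delta>_balanced: "balanced R S\<phi> A WH \<delta>"
proof (rule balancedI)
  interpret WH: abelian_group WH by (rule W2.tensor_abelian)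
  have plus: "addhom R.V WH (\<lambda>a. f a \<oplus>\<^bsub>WH\<^esub> g a)" if "addhom R.V WH f" "addhom R.V WH g" for f g
    using that by (intro addhomI) (auto simp: addhom_closed addhom_add WH.a_ac)
  show "\<delta> (s \<oplus>\<^bsub>S\<phi>\<^esub> s') a = \<delta> s a \<oplus>\<^bsub>WH\<^esub> \<delta> s' a"
    if "s \<in> carrier S\<phi>" "s' \<in> carrier S\<phi>" "a \<in> carrier A" for s s' a
  proof -
    have h: "s \<in> carrier S" "s' \<in> carrier S" "s \<oplus>\<^bsub>S\<^esub> s' \<in> carrier S" "a \<in> carrier R.V" using that by auto
    have "\<delta> (s \<oplus>\<^bsub>S\<^esub> s') a = \<delta> s a \<oplus>\<^bsub>WH\<^esub> \<delta> s' a"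
    proof (rule R.TL.tensor_ext[OF W2.tensor_abelian \<delta>_addhom[OF h(3)]
        plus[OF \<delta>_addhom[OF h(1)] \<delta>_addhom[OF h(2)]] _ h(4)])
      fix r x assume "r \<in> carrier R.A0" "x \<in> carrier H"
      then have rx: "r \<in> carrier R" "x \<in> carrier H" by auto
      have "\<delta> (s \<oplus>\<^bsub>S\<^esub> s') (R.tau r x) = R.sw WH (\<lambda>x1 x2. tauWH (tauW s (R.tau r x1)) x2 \<oplus>\<^bsub>WH\<^esub>
          tauWH (tauW s' (R.tau r x1)) x2) x"
        unfolding \<delta>_pure[OF h(3) rx] using rx h
        by (intro R.sweedler_cong[OF W2.tensor_abelian]) (simp_all add: tauW_simps tauWH_simps R.tau_simps)
      also have "\<dots> = \<delta> s (R.tau r x) \<oplus>\<^bsub>WH\<^esub> \<delta> s' (R.tau r x)"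
        unfolding \<delta>_pure[OF h(1) rx] \<delta>_pure[OF h(2) rx] using rx h
        by (intro R.sweedler_add[OF W2.tensor_abelian]) (simp_all add: tauW_simps tauWH_simps R.tau_simps)
      finally show "\<delta> (s \<oplus>\<^bsub>S\<^esub> s') (R.tau r x) = \<delta> s (R.tau r x) \<oplus>\<^bsub>WH\<^esub> \<delta> s' (R.tau r x)" .
    qed
    then show ?thesis by simp
  qed
  show "\<delta> (q \<odot>\<^bsub>S\<phi>\<^esub> s) a = \<delta> s (q \<odot>\<^bsub>A\<^esub> a)"
    if "q \<in> carrier R" "s \<in> carrier S\<phi>" "a \<in> carrier A" for q s a
  proof -
    have h: "s \<in> carrier S" "\<phi> q \<otimes>\<^bsub>S\<^esub> s \<in> carrier S" "a \<in> carrier R.V" using that by auto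
    have "\<delta> (\<phi> q \<otimes>\<^bsub>S\<^esub> s) a = \<delta> s (R.scal q \<otimes>\<^bsub>R.V\<^esub> a)"
    proof (rule R.TL.tensor_ext[OF W2.tensor_abelian \<delta>_addhom[OF h(2)]
        addhom_comp[OF R.TL.mult_addhom_right \<delta>_addhom[OF h(1)]] _ h(3)])
      fix r x assume "r \<in> carrier R.A0" "x \<in> carrier H"
      then have rx: "r \<in> carrier R" "x \<in> carrier H" by auto
      have qr: "q \<otimes>\<^bsub>R\<^esub> r \<in> carrier R" using that rx by simp
      have e: "tauW s (R.tau (q \<otimes>\<^bsub>R\<^esub> r) y) = tauW (\<phi> q \<otimes>\<^bsub>S\<^esub> s) (R.tau r y)" if "y \<in> carrier H" for y
        using tauW_simps(4)[of q s "R.tau r y"] that \<open>q \<in> carrier R\<close> h rx by (simp add: R.tau_simps)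
      have "\<delta> s (R.tau (q \<otimes>\<^bsub>R\<^esub> r) x) = \<delta> (\<phi> q \<otimes>\<^bsub>S\<^esub> s) (R.tau r x)"
        unfolding \<delta>_pure[OF h(2) rx] \<delta>_pure[OF h(1) qr rx(2)] using rx h that(1)
        by (intro R.sweedler_cong[OF W2.tensor_abelian]) (simp_all add: tauW_simps tauWH_simps R.tau_simps e)
      then show "\<delta> (\<phi> q \<otimes>\<^bsub>S\<^esub> s) (R.tau r x) = \<delta> s (R.scal q \<otimes>\<^bsub>R.V\<^esub> R.tau r x)"
        using rx that by simp
    qed (use that in simp)
    then show ?thesis using that by simp
  qed
qed (auto simp: addhom_closed[OF \<delta>_addhom] addhom_add[OF \<delta>_addhom])

lemma coact_BC_addhom: "addhom WW WH (coact BC)"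
  unfolding coact_BC by (rule W.lift2_hom(1)[OF W2.tensor_abelian \<delta>_balanced])

lemma coact_BC_pure:
  "s \<in> carrier S \<Longrightarrow> a \<in> carrier R.V \<Longrightarrow> coact BC (tauW s a) = \<delta> s a"
  unfolding coact_BC using W.lift2_hom(2)[OF W2.tensor_abelian \<delta>_balanced] by simp

lemma BC_ok: "R.comod_ok \<rho>\<phi> BC"
  using BC_premodule addhom_closed[OF coact_BC_addhom] by (simp add: R.comod_ok_def BC_simps(1))

lemma BC_closed:
  "\<one>\<^bsub>BC\<^esub> \<in> carrier BC" "x \<in> carrier BC \<Longrightarrow> y \<in> carrier BC \<Longrightarrow> x \<otimes>\<^bsub>BC\<^esub> y \<in> carrier BC"
  "r \<in> carrier S \<Longrightarrow> x \<in> carrier BC \<Longrightarrow> r \<odot>\<^bsub>BC\<^esub> x \<in> carrier BC"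
  using BC_smult_closed W.mult_closed u by (auto simp: BC_simps(1,4,5) tauW_simps R.tau_simps)

lemma \<Psi>_coact:
  assumes w: "w \<in> carrier WW"
  shows "coact B (\<Psi> w) = lift2 (S.VH \<alpha>' u') (\<lambda>a0 a1. S.tauH \<alpha>' u' (\<Psi> a0) a1) (coact BC w)"
proof -
  let ?Z = "S.VH \<alpha>' u'"
  have b: "balanced k (restrict_scalars \<rho>\<phi> BC) H ?Z (\<lambda>a0 a1. S.tauH \<alpha>' u' (\<Psi> a0) a1)"
    by (rule balancedI)
      (auto simp: BC_simps(1,2) \<Psi>_closed S.tauH_simps addhom_add[OF \<Psi>_addhom] \<Psi>_smult \<phi>_\<rho>
        simp flip: S.smult_scal)
  note l = W2.lift2_hom[OF S.VH_ab b]
  show ?thesis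
  proof (rule WW_ext[OF S.VH_ab addhom_comp[OF \<Psi>_addhom S.coact_addhom]
        addhom_comp[OF coact_BC_addhom l(1)] _ w])
    fix s r x assume h: "s \<in> carrier S" "r \<in> carrier R" "x \<in> carrier H"
    have "lift2 ?Z (\<lambda>a0 a1. S.tauH \<alpha>' u' (\<Psi> a0) a1) (coact BC (tauW s (R.tau r x)))
        = R.sw ?Z (\<lambda>x1 x2. lift2 ?Z (\<lambda>a0 a1. S.tauH \<alpha>' u' (\<Psi> a0) a1)
            (tauWH (tauW s (R.tau r x1)) x2)) x"
      using h
      by (simp add: coact_BC_pure R.tau_simps \<delta>_pure)
        (intro R.sweedler_hom[OF W2.tensor_abelian S.VH_ab l(1)]; simp add: tauWH_simps tauW_simps R.tau_simps)
    also have "\<dots> = R.sw ?Z (\<lambda>x1 x2. S.tauH \<alpha>' u' (S.tau (s \<otimes>\<^bsub>S\<^esub> \<phi> r) x1) x2) x"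
      using h by (intro R.sweedler_cong[OF S.VH_ab])
        (simp_all add: l(2) BC_simps(1) tauW_simps R.tau_simps S.tau_simps S.tauH_simps \<Psi>_pure \<psi>_pure)
    also have "\<dots> = coact B (\<Psi> (tauW s (R.tau r x)))"
      using h by (simp add: \<Psi>_pure R.tau_simps \<psi>_pure S.coact_pure)
    finally show "coact B (\<Psi> (tauW s (R.tau r x)))
        = lift2 ?Z (\<lambda>a0 a1. S.tauH \<alpha>' u' (\<Psi> a0) a1) (coact BC (tauW s (R.tau r x)))" ..
  qed
qed

text \<open>Base change of a twisted algebra is the twisted algebra of the pushed-forward cocycle.
  This is used for \<open>lam\<close> as well as for the extensions to \<open>L\<close>.\<close>

theorem base_change_iso: "comod_alg_iso k H S \<rho>' BC B \<Psi>"
proof -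
  have "bij_betw \<Psi> (carrier WW) (carrier S.V)"
    using \<Psi>_closed addhom_closed[OF \<Phi>_addhom] \<Phi>_\<Psi> \<Psi>_\<Phi>
    by (intro bij_betw_byWitness[where f' = \<Phi>]) auto
  moreover have "\<Psi> (tauW \<one>\<^bsub>S\<^esub> (R.tau u \<one>\<^bsub>H\<^esub>)) = S.tau u' \<one>\<^bsub>H\<^esub>"
    using u by (auto simp: \<Psi>_pure \<psi>_pure R.tau_simps)
  ultimately have "\<Psi> \<in> ring_iso BC B"
    using \<Psi>_closed addhom_add[OF \<Psi>_addhom] \<Psi>_mult
    by (auto simp: ring_iso_def ring_hom_def BC_simps(1,2,4,5) B_simps)
  moreover have "linear_map S BC B \<Psi>"
    using \<Psi>_closed addhom_add[OF \<Psi>_addhom] \<Psi>_smult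
    by (intro linear_mapI) (auto simp: BC_simps(1,2) B_simps)
  ultimately show ?thesis
    using \<Psi>_coact by (simp add: comod_alg_iso_def Let_def BC_simps(1) S.VH_def S.tauH_def)
qed

end

section \<open>The symmetric algebra\<close>

locale symmetric = k: cring k + V: abelian_group V
  for k :: "('k, 'm) ring_scheme" and V :: "('k, 'v, 'n) module_scheme" +
  assumes smult_closed: "r \<in> carrier k \<Longrightarrow> x \<in> carrier V \<Longrightarrow> r \<odot>\<^bsub>V\<^esub> x \<in> carrier V"
begin

definition "mrels =
       {frag_of (c \<oplus>\<^bsub>k\<^esub> d, M) - frag_of (c, M) - frag_of (d, M) | c d M.
           c \<in> carrier k \<and> d \<in> carrier k \<and> set_mset M \<subseteq> carrier V} \<union>
        {frag_of (c, add_mset (v \<oplus>\<^bsub>V\<^esub> w) M) - frag_of (c, add_mset v M) - frag_of (c, add_mset w M)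
           | c v w M.
           c \<in> carrier k \<and> v \<in> carrier V \<and> w \<in> carrier V \<and> set_mset M \<subseteq> carrier V} \<union>
        {frag_of (c, add_mset (d \<odot>\<^bsub>V\<^esub> v) M) - frag_of (c \<otimes>\<^bsub>k\<^esub> d, add_mset v M) | c d v M.
           c \<in> carrier k \<and> d \<in> carrier k \<and> v \<in> carrier V \<and> set_mset M \<subseteq> carrier V}"

abbreviation "gens \<equiv> sym_gens k V"

lemma gens_iff [simp]: "(c, M) \<in> gens \<longleftrightarrow> c \<in> carrier k \<and> set_mset M \<subseteq> carrier V"
  by (simp add: sym_gens_def)

sublocale frag: frag_quotient gens mrels
proof
  have d: "p - q \<in> carrier (free_Abelian_group gens)"
    if "p \<in> carrier (free_Abelian_group gens)" "q \<in> carrier (free_Abelian_group gens)"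
    for p q :: "('k \<times> 'v multiset) \<Rightarrow>\<^sub>0 int"
    using that Poly_Mapping.keys_diff[of p q] by auto
  show "mrels \<subseteq> carrier (free_Abelian_group gens)"
    unfolding mrels_def
    by (auto intro!: d simp: smult_closed simp del: carrier_free_Abelian_group_iff)
qed

abbreviation "SV \<equiv> symmetric_algebra k V"
abbreviation "W \<equiv> sym_space k V"
abbreviation "\<mu> \<equiv> sym_monomial k V"

lemma W_qspace: "W = qspace gens mrels"
  by (simp add: sym_space_def qspace_def sym_rels_def mrels_def)

lemma mono_qgen: "\<mu> c M = qgen gens mrels (c, M)"
  by (simp add: sym_monomial_def qgen_def sym_rels_def mrels_def)

lemma W_ab: "abelian_group W"
  unfolding W_qspace by (rule frag.V_abelian)

lemma mono_closed: "c \<in> carrier k \<Longrightarrow> set_mset M \<subseteq> carrier V \<Longrightarrow> \<mu> c M \<in> carrier W"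
  by (simp add: mono_qgen W_qspace frag.qgen_closed)

text \<open>The maps on generators that kill the relators of the symmetric algebra; symmetry in the
  vectors is built into the multisets.\<close>

definition multilinear :: "('g, 'o) ring_scheme \<Rightarrow> ('k \<Rightarrow> 'v multiset \<Rightarrow> 'g) \<Rightarrow> bool" where
  "multilinear G f \<longleftrightarrow>
    (\<forall>c\<in>carrier k. \<forall>M. set_mset M \<subseteq> carrier V \<longrightarrow> f c M \<in> carrier G \<and>
      (\<forall>d\<in>carrier k. f (c \<oplus>\<^bsub>k\<^esub> d) M = f c M \<oplus>\<^bsub>G\<^esub> f d M) \<and>
      (\<forall>v\<in>carrier V. \<forall>w\<in>carrier V. f c (add_mset (v \<oplus>\<^bsub>V\<^esub> w) M) = f c (add_mset v M) \<oplus>\<^bsub>G\<^esub> f c (add_mset w M)) \<and>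
      (\<forall>v\<in>carrier V. \<forall>d\<in>carrier k. f c (add_mset (d \<odot>\<^bsub>V\<^esub> v) M) = f (c \<otimes>\<^bsub>k\<^esub> d) (add_mset v M)))"

lemma mono_multilinear: "multilinear W \<mu>"
  unfolding multilinear_def
proof (intro ballI allI impI conjI)
  fix c M assume c: "c \<in> carrier k" "set_mset M \<subseteq> carrier V"
  show "\<mu> c M \<in> carrier W" using c by (rule mono_closed)
  show "\<mu> (c \<oplus>\<^bsub>k\<^esub> d) M = \<mu> c M \<oplus>\<^bsub>W\<^esub> \<mu> d M" if "d \<in> carrier k" for d
    unfolding mono_qgen W_qspace
    by (rule frag.qgen_add) (use c that in \<open>auto simp: mrels_def\<close>)
  show "\<mu> c (add_mset (v \<oplus>\<^bsub>V\<^esub> w) M) = \<mu> c (add_mset v M) \<oplus>\<^bsub>W\<^esub> \<mu> c (add_mset w M)"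
    if "v \<in> carrier V" "w \<in> carrier V" for v w
    unfolding mono_qgen W_qspace
    by (rule frag.qgen_add) (use c that in \<open>auto simp: mrels_def\<close>)
  show "\<mu> c (add_mset (d \<odot>\<^bsub>V\<^esub> v) M) = \<mu> (c \<otimes>\<^bsub>k\<^esub> d) (add_mset v M)"
    if "v \<in> carrier V" "d \<in> carrier k" for v d
    unfolding mono_qgen
    by (rule frag.qgen_eq) (use c that smult_closed in \<open>auto simp: mrels_def\<close>)
qed

lemma multilinearD:
  assumes "multilinear G f" "c \<in> carrier k" "set_mset M \<subseteq> carrier V"
  shows "f c M \<in> carrier G"
    "d \<in> carrier k \<Longrightarrow> f (c \<oplus>\<^bsub>k\<^esub> d) M = f c M \<oplus>\<^bsub>G\<^esub> f d M"
    "v \<in> carrier V \<Longrightarrow> w \<in> carrier V \<Longrightarrow>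
       f c (add_mset (v \<oplus>\<^bsub>V\<^esub> w) M) = f c (add_mset v M) \<oplus>\<^bsub>G\<^esub> f c (add_mset w M)"
    "v \<in> carrier V \<Longrightarrow> d \<in> carrier k \<Longrightarrow>
       f c (add_mset (d \<odot>\<^bsub>V\<^esub> v) M) = f (c \<otimes>\<^bsub>k\<^esub> d) (add_mset v M)"
  using assms unfolding multilinear_def by blast+

lemma lift2_mono:
  assumes G: "abelian_group G" and f: "multilinear G f"
    and c: "c \<in> carrier k" "set_mset M \<subseteq> carrier V"
  shows "lift2 G f (\<mu> c M) = f c M"
proof -
  interpret G: abelian_group G by fact
  let ?f = "\<lambda>(a, b). f a b"
  note r = multilinearD[OF f]
  have f': "?f \<in> gens \<rightarrow> carrier G" using r(1) by auto
  have of: "fragsum G ?f (frag_of (a, b)) = f a b" if "a \<in> carrier k" "set_mset b \<subseteq> carrier V" for a b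
    using that r(1) by (simp add: fragsum_of[OF G])
  have d: "fragsum G ?f (frag_of x - frag_of y) = ?f x \<ominus>\<^bsub>G\<^esub> ?f y" if "x \<in> gens" "y \<in> gens" for x y
    using that by (subst fragsum_diff[OF G f']) (auto simp: of sym_gens_def)
  have d3: "fragsum G ?f (frag_of x - frag_of y - frag_of z) = (?f x \<ominus>\<^bsub>G\<^esub> ?f y) \<ominus>\<^bsub>G\<^esub> ?f z"
    if "x \<in> gens" "y \<in> gens" "z \<in> gens" for x y z
    using that Poly_Mapping.keys_diff[of "frag_of x" "frag_of y"]
    by (subst fragsum_diff[OF G f']) (auto simp: of d sym_gens_def)
  have z: "(a \<oplus>\<^bsub>G\<^esub> b \<ominus>\<^bsub>G\<^esub> a) \<ominus>\<^bsub>G\<^esub> b = \<zero>\<^bsub>G\<^esub>" if "a \<in> carrier G" "b \<in> carrier G" for a b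
    using that G.add_minus_cancel'[of b a] by (simp add: G.a_comm) (simp add: G.minus_eq G.r_neg)
  have kill: "fragsum G ?f p = \<zero>\<^bsub>G\<^esub>" if "p \<in> mrels" for p
    using that unfolding mrels_def
  proof (elim UnE CollectE exE conjE; hypsubst)
    show "fragsum G ?f (frag_of (c \<oplus>\<^bsub>k\<^esub> d, M) - frag_of (c, M) - frag_of (d, M)) = \<zero>\<^bsub>G\<^esub>"
      if "c \<in> carrier k" "d \<in> carrier k" "set_mset M \<subseteq> carrier V" for c d M
      using that by (subst d3) (simp_all add: r(1,2) z)
    show "fragsum G ?f (frag_of (c, add_mset (v \<oplus>\<^bsub>V\<^esub> w) M) - frag_of (c, add_mset v M)
        - frag_of (c, add_mset w M)) = \<zero>\<^bsub>G\<^esub>"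
      if "c \<in> carrier k" "v \<in> carrier V" "w \<in> carrier V" "set_mset M \<subseteq> carrier V" for c v w M
      using that by (subst d3) (simp_all add: r(1,3) z)
    show "fragsum G ?f (frag_of (c, add_mset (d \<odot>\<^bsub>V\<^esub> v) M) - frag_of (c \<otimes>\<^bsub>k\<^esub> d, add_mset v M)) = \<zero>\<^bsub>G\<^esub>"
      if "c \<in> carrier k" "d \<in> carrier k" "v \<in> carrier V" "set_mset M \<subseteq> carrier V" for c d v M
      using that smult_closed by (subst d) (simp_all add: r(1,4) G.minus_eq G.r_neg)
  qed
  show ?thesis
    using frag.lift_hom(2)[OF G f' kill, of "(c, M)"] c by (simp add: lift2_fragsum mono_qgen)
qed

lemma mono_translate:
  assumes c: "c \<in> carrier k" "set_mset M \<subseteq> carrier V"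
  shows "multilinear W (\<lambda>d N. \<mu> (c \<otimes>\<^bsub>k\<^esub> d) (M + N))" "multilinear W (\<lambda>d N. \<mu> (d \<otimes>\<^bsub>k\<^esub> c) (N + M))"
  unfolding multilinear_def using c
  by (auto simp: multilinearD[OF mono_multilinear] k.r_distr k.l_distr k.m_ac union_commute smult_closed)

text \<open>The integrand of the outer lift in the product of the symmetric algebra is known to
  agree with a multilinear map only on the carriers; that makes it multilinear itself.\<close>

lemma lift2_cong_mono:
  assumes G: "abelian_group G" and f: "multilinear G f"
    and eq: "\<And>c M. c \<in> carrier k \<Longrightarrow> set_mset M \<subseteq> carrier V \<Longrightarrow> g c M = f c M"
  shows "multilinear G g"
  unfolding multilinear_def using multilinearD[OF f] eq smult_closed by auto

lemma mono_mult:
  assumes c: "c \<in> carrier k" "set_mset M \<subseteq> carrier V" and d: "d \<in> carrier k" "set_mset N \<subseteq> carrier V"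
  shows "\<mu> c M \<otimes>\<^bsub>SV\<^esub> \<mu> d N = \<mu> (c \<otimes>\<^bsub>k\<^esub> d) (M + N)"
proof -
  let ?f = "\<lambda>c M. lift2 W (\<lambda>d N. \<mu> (c \<otimes>\<^bsub>k\<^esub> d) (M + N)) (\<mu> d N)"
  have e: "?f c M = \<mu> (c \<otimes>\<^bsub>k\<^esub> d) (M + N)" if "c \<in> carrier k" "set_mset M \<subseteq> carrier V" for c M
    using that d by (simp add: lift2_mono[OF W_ab mono_translate(1)])
  have "multilinear W ?f"
    by (rule lift2_cong_mono[OF W_ab mono_translate(2)[OF d] e])
  from lift2_mono[OF W_ab this c] show ?thesis
    by (simp add: symmetric_algebra_def Let_def e[OF c])
qed

lemma SV_simps: "carrier SV = carrier W" "add SV = add W" "\<one>\<^bsub>SV\<^esub> = \<mu> \<one>\<^bsub>k\<^esub> {#}"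
  by (simp_all add: symmetric_algebra_def Let_def)

end

section \<open>The scalars and the linear map \<open>t\<close> in a ring that receives the symmetric
  algebra\<close>

locale symmetric_hom = symmetric k H + Q: ring Q
  for k :: "('k, 'm) ring_scheme" and H :: "('k, 'h, 'n) hopf_scheme" and Q :: "('q, 'o) ring_scheme" +
  fixes \<iota>
  assumes \<iota>: "\<iota> \<in> ring_hom (symmetric_algebra k H) Q"
begin

abbreviation "ts \<equiv> t_scalar k H \<iota>"
abbreviation "tg \<equiv> t_gen k H \<iota>"

lemma \<iota>_simps:
  "x \<in> carrier W \<Longrightarrow> \<iota> x \<in> carrier Q"
  "x \<in> carrier W \<Longrightarrow> y \<in> carrier W \<Longrightarrow> \<iota> (x \<oplus>\<^bsub>W\<^esub> y) = \<iota> x \<oplus>\<^bsub>Q\<^esub> \<iota> y"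
  "x \<in> carrier W \<Longrightarrow> y \<in> carrier W \<Longrightarrow> \<iota> (x \<otimes>\<^bsub>SV\<^esub> y) = \<iota> x \<otimes>\<^bsub>Q\<^esub> \<iota> y"
  "\<iota> (\<mu> \<one>\<^bsub>k\<^esub> {#}) = \<one>\<^bsub>Q\<^esub>"
  using \<iota> by (auto simp: ring_hom_def SV_simps)

lemma ts_hom: "ts \<in> ring_hom k Q"
  unfolding ring_hom_def t_scalar_def using mono_mult[of _ "{#}" _ "{#}"]
  by (auto simp: \<iota>_simps mono_closed multilinearD(2)[OF mono_multilinear] simp flip: \<iota>_simps(3))

lemma tg_linear: "linear_map k H (as_algebra ts Q) tg"
proof (rule linear_mapI)
  show "tg (x \<oplus>\<^bsub>H\<^esub> y) = tg x \<oplus>\<^bsub>as_algebra ts Q\<^esub> tg y" if "x \<in> carrier H" "y \<in> carrier H" for x y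
    using that multilinearD(3)[OF mono_multilinear, of "\<one>\<^bsub>k\<^esub>" "{#}" x y]
    by (simp add: t_gen_def as_algebra_def \<iota>_simps mono_closed)
  show "tg (r \<odot>\<^bsub>H\<^esub> x) = r \<odot>\<^bsub>as_algebra ts Q\<^esub> tg x" if "r \<in> carrier k" "x \<in> carrier H" for r x
    using that multilinearD(4)[OF mono_multilinear, of "\<one>\<^bsub>k\<^esub>" "{#}" x r] mono_mult[of r "{#}" "\<one>\<^bsub>k\<^esub>" "{#x#}"]
    by (simp add: t_gen_def t_scalar_def as_algebra_def mono_closed flip: \<iota>_simps(3))
qed (simp add: t_gen_def as_algebra_def \<iota>_simps mono_closed)

end

section \<open>Extending ring homomorphisms along integral extensions\<close>

text \<open>A partial homomorphism from \<open>Q\<close> to \<open>M\<close> is represented by its graph, a subring of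
  \<open>Q \<times> M\<close> that meets \<open>0 \<times> M\<close> trivially.\<close>

locale ring_pair = Q: cring Q + M: "domain" M
  for Q :: "('q, 'm) ring_scheme" and M :: "('l, 'n) ring_scheme"
begin

abbreviation "PR \<equiv> RDirProd Q M"

lemma PR_simps [simp]:
  "carrier PR = carrier Q \<times> carrier M"
  "x \<otimes>\<^bsub>PR\<^esub> y = (fst x \<otimes>\<^bsub>Q\<^esub> fst y, snd x \<otimes>\<^bsub>M\<^esub> snd y)"
  "x \<oplus>\<^bsub>PR\<^esub> y = (fst x \<oplus>\<^bsub>Q\<^esub> fst y, snd x \<oplus>\<^bsub>M\<^esub> snd y)"
  "\<one>\<^bsub>PR\<^esub> = (\<one>\<^bsub>Q\<^esub>, \<one>\<^bsub>M\<^esub>)" "\<zero>\<^bsub>PR\<^esub> = (\<zero>\<^bsub>Q\<^esub>, \<zero>\<^bsub>M\<^esub>)"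
  by (auto simp: RDirProd_def DirProd_def monoid.defs split: prod.splits)

sublocale PR: ring PR
  by (rule RDirProd_ring) unfold_locales

lemma PR_minus [simp]:
  assumes "x \<in> carrier PR" shows "\<ominus>\<^bsub>PR\<^esub> x = (\<ominus>\<^bsub>Q\<^esub> fst x, \<ominus>\<^bsub>M\<^esub> snd x)"
  by (rule PR.minus_equality) (use assms in \<open>auto simp: Q.l_neg M.l_neg\<close>)

definition "graph G \<longleftrightarrow> subring G PR \<and> (\<forall>y. (\<zero>\<^bsub>Q\<^esub>, y) \<in> G \<longrightarrow> y = \<zero>\<^bsub>M\<^esub>)"

lemma graphD:
  assumes "graph G"
  shows "G \<subseteq> carrier Q \<times> carrier M" "(\<one>\<^bsub>Q\<^esub>, \<one>\<^bsub>M\<^esub>) \<in> G" "(\<zero>\<^bsub>Q\<^esub>, \<zero>\<^bsub>M\<^esub>) \<in> G"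
    "g \<in> G \<Longrightarrow> h \<in> G \<Longrightarrow> (fst g \<otimes>\<^bsub>Q\<^esub> fst h, snd g \<otimes>\<^bsub>M\<^esub> snd h) \<in> G"
    "g \<in> G \<Longrightarrow> h \<in> G \<Longrightarrow> (fst g \<oplus>\<^bsub>Q\<^esub> fst h, snd g \<oplus>\<^bsub>M\<^esub> snd h) \<in> G"
    "g \<in> G \<Longrightarrow> (\<ominus>\<^bsub>Q\<^esub> fst g, \<ominus>\<^bsub>M\<^esub> snd g) \<in> G"
    "(\<zero>\<^bsub>Q\<^esub>, y) \<in> G \<Longrightarrow> y = \<zero>\<^bsub>M\<^esub>"
    "g \<in> G \<Longrightarrow> fst g \<in> carrier Q" "g \<in> G \<Longrightarrow> snd g \<in> carrier M"
proof -
  have s: "subring G PR" using assms by (simp add: graph_def)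
  note e = subringE[OF s]
  show "G \<subseteq> carrier Q \<times> carrier M" "(\<one>\<^bsub>Q\<^esub>, \<one>\<^bsub>M\<^esub>) \<in> G" "(\<zero>\<^bsub>Q\<^esub>, \<zero>\<^bsub>M\<^esub>) \<in> G"
    using e(1-3) by simp_all
  show "g \<in> G \<Longrightarrow> h \<in> G \<Longrightarrow> (fst g \<otimes>\<^bsub>Q\<^esub> fst h, snd g \<otimes>\<^bsub>M\<^esub> snd h) \<in> G"
    "g \<in> G \<Longrightarrow> h \<in> G \<Longrightarrow> (fst g \<oplus>\<^bsub>Q\<^esub> fst h, snd g \<oplus>\<^bsub>M\<^esub> snd h) \<in> G"
    using e(6,7) by auto
  show "(\<ominus>\<^bsub>Q\<^esub> fst g, \<ominus>\<^bsub>M\<^esub> snd g) \<in> G" if "g \<in> G"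
    using e(5)[OF that] PR_minus[OF subsetD[OF e(1) that]] by simp
  show "(\<zero>\<^bsub>Q\<^esub>, y) \<in> G \<Longrightarrow> y = \<zero>\<^bsub>M\<^esub>" using assms by (simp add: graph_def)
  show "g \<in> G \<Longrightarrow> fst g \<in> carrier Q" "g \<in> G \<Longrightarrow> snd g \<in> carrier M"
    using e(1) by auto
qed

lemma graph_fun:
  assumes G: "graph G" and "(x, y) \<in> G" "(x, z) \<in> G" shows "y = z"
proof -
  note g = graphD[OF G]
  have c: "x \<in> carrier Q" "y \<in> carrier M" "z \<in> carrier M" using g(1) assms by auto
  have "(\<zero>\<^bsub>Q\<^esub>, y \<oplus>\<^bsub>M\<^esub> \<ominus>\<^bsub>M\<^esub> z) \<in> G"
    using g(5)[OF assms(2) g(6)[OF assms(3)]] c by (simp add: Q.r_neg)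
  then have "y \<ominus>\<^bsub>M\<^esub> z = \<zero>\<^bsub>M\<^esub>" using g(7) by (simp add: M.minus_eq)
  then show ?thesis using c by simp
qed

end

section \<open>Kernel, elimination of generators, and polynomials over a partial
  homomorphism\<close>

locale graph_step = ring_pair +
  fixes G assumes G: "graph G"
begin

lemmas g = graphD[OF G]

text \<open>The kernel of the partial homomorphism, an ideal of its domain.\<close>

definition "ideal_P = {p. \<exists>h\<in>G. fst h = p \<and> snd h = \<zero>\<^bsub>M\<^esub>}"

lemma ideal_P:
  "p \<in> ideal_P \<Longrightarrow> p \<in> carrier Q"
  "\<zero>\<^bsub>Q\<^esub> \<in> ideal_P"
  "p \<in> ideal_P \<Longrightarrow> q \<in> ideal_P \<Longrightarrow> p \<oplus>\<^bsub>Q\<^esub> q \<in> ideal_P"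
  "p \<in> ideal_P \<Longrightarrow> \<ominus>\<^bsub>Q\<^esub> p \<in> ideal_P"
  "h \<in> G \<Longrightarrow> p \<in> ideal_P \<Longrightarrow> fst h \<otimes>\<^bsub>Q\<^esub> p \<in> ideal_P"
proof -
  show "p \<in> ideal_P \<Longrightarrow> p \<in> carrier Q" "\<zero>\<^bsub>Q\<^esub> \<in> ideal_P"
    using g(3,8) by (auto simp: ideal_P_def intro!: bexI[of _ "(\<zero>\<^bsub>Q\<^esub>, \<zero>\<^bsub>M\<^esub>)"])
  show "p \<oplus>\<^bsub>Q\<^esub> q \<in> ideal_P" if pq: "p \<in> ideal_P" "q \<in> ideal_P"
  proof -
    obtain h h' where "h \<in> G" "fst h = p" "snd h = \<zero>\<^bsub>M\<^esub>" "h' \<in> G" "fst h' = q" "snd h' = \<zero>\<^bsub>M\<^esub>"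
      using pq by (auto simp: ideal_P_def)
    then show ?thesis using g(5)[of h h'] by (auto simp: ideal_P_def intro!: bexI[of _ "(p \<oplus>\<^bsub>Q\<^esub> q, \<zero>\<^bsub>M\<^esub>)"])
  qed
  show "\<ominus>\<^bsub>Q\<^esub> p \<in> ideal_P" if p: "p \<in> ideal_P"
  proof -
    obtain h where "h \<in> G" "fst h = p" "snd h = \<zero>\<^bsub>M\<^esub>" using p by (auto simp: ideal_P_def)
    then show ?thesis using g(6)[of h] by (auto simp: ideal_P_def intro!: bexI[of _ "(\<ominus>\<^bsub>Q\<^esub> p, \<zero>\<^bsub>M\<^esub>)"])
  qed
  show "fst h \<otimes>\<^bsub>Q\<^esub> p \<in> ideal_P" if h: "h \<in> G" and p: "p \<in> ideal_P"
  proof -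
    obtain h' where "h' \<in> G" "fst h' = p" "snd h' = \<zero>\<^bsub>M\<^esub>" using p by (auto simp: ideal_P_def)
    then show ?thesis using g(4)[OF h, of h'] g(9)[OF h]
      by (auto simp: ideal_P_def intro!: bexI[of _ "(fst h \<otimes>\<^bsub>Q\<^esub> p, \<zero>\<^bsub>M\<^esub>)"])
  qed
qed

text \<open>The module generated by \<open>e 0\<close>, ..., \<open>e (n - 1)\<close>, multiplied by
  the kernel ideal: all coefficients are in \<open>ideal_P\<close>.\<close>

definition "pspan e n = {finsum Q (\<lambda>i. p i \<otimes>\<^bsub>Q\<^esub> e i) {..<n} | p. p \<in> {..<n::nat} \<rightarrow> ideal_P}"

lemma pspan_add:
  assumes e: "e \<in> {..<n} \<rightarrow> carrier Q" and "v \<in> pspan e n" "w \<in> pspan e n"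
  shows "v \<oplus>\<^bsub>Q\<^esub> w \<in> pspan e n"
proof -
  obtain p q where p: "p \<in> {..<n} \<rightarrow> ideal_P" "v = finsum Q (\<lambda>i. p i \<otimes>\<^bsub>Q\<^esub> e i) {..<n}"
    and q: "q \<in> {..<n} \<rightarrow> ideal_P" "w = finsum Q (\<lambda>i. q i \<otimes>\<^bsub>Q\<^esub> e i) {..<n}"
    using assms(2,3) by (auto simp: pspan_def)
  have "v \<oplus>\<^bsub>Q\<^esub> w = finsum Q (\<lambda>i. p i \<otimes>\<^bsub>Q\<^esub> e i \<oplus>\<^bsub>Q\<^esub> q i \<otimes>\<^bsub>Q\<^esub> e i) {..<n}"
    unfolding p(2) q(2) using p(1) q(1) e ideal_P(1)
    by (intro Q.finsum_addf[symmetric]) (auto simp: Pi_iff)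
  also have "\<dots> = finsum Q (\<lambda>i. (p i \<oplus>\<^bsub>Q\<^esub> q i) \<otimes>\<^bsub>Q\<^esub> e i) {..<n}"
    using p(1) q(1) e ideal_P(1) by (intro Q.finsum_cong') (auto simp: Pi_iff Q.l_distr)
  finally show ?thesis
    unfolding pspan_def using p(1) q(1) ideal_P(3) by (auto intro!: exI[of _ "\<lambda>i. p i \<oplus>\<^bsub>Q\<^esub> q i"] simp: Pi_iff)
qed

lemma pspan_unit:
  assumes e: "e \<in> {..<n} \<rightarrow> carrier Q" and c: "c \<in> ideal_P" and j: "j < n"
  shows "c \<otimes>\<^bsub>Q\<^esub> e j \<in> pspan e n"
proof -
  let ?p = "\<lambda>i. if i = j then c else \<zero>\<^bsub>Q\<^esub>"
  have "finsum Q (\<lambda>i. ?p i \<otimes>\<^bsub>Q\<^esub> e i) {..<n} = finsum Q (\<lambda>i. if j = i then c \<otimes>\<^bsub>Q\<^esub> e i else \<zero>\<^bsub>Q\<^esub>) {..<n}"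
    using e ideal_P(1)[OF c] by (intro Q.finsum_cong') (auto simp: Pi_iff)
  also have "\<dots> = c \<otimes>\<^bsub>Q\<^esub> e j"
    using e j ideal_P(1)[OF c] by (intro Q.finsum_singleton) (auto simp: Pi_iff)
  finally show ?thesis
    unfolding pspan_def using c ideal_P(2) by (auto intro!: exI[of _ ?p])
qed

lemma pspan_closed: "e \<in> {..<n} \<rightarrow> carrier Q \<Longrightarrow> v \<in> pspan e n \<Longrightarrow> v \<in> carrier Q"
  using ideal_P(1) by (auto simp: pspan_def Pi_iff intro!: Q.finsum_closed)

lemma pspan_zero:
  assumes e: "e \<in> {..<n} \<rightarrow> carrier Q" shows "\<zero>\<^bsub>Q\<^esub> \<in> pspan e n"
proof -
  have "finsum Q (\<lambda>i. \<zero>\<^bsub>Q\<^esub> \<otimes>\<^bsub>Q\<^esub> e i) {..<n} = finsum Q (\<lambda>i. \<zero>\<^bsub>Q\<^esub>) {..<n}"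
    using e by (intro Q.finsum_cong') (auto simp: Pi_iff)
  also have "\<dots> = \<zero>\<^bsub>Q\<^esub>" by (rule Q.finsum_zero)
  finally show ?thesis
    unfolding pspan_def using ideal_P(2) by (auto intro!: exI[of _ "\<lambda>i. \<zero>\<^bsub>Q\<^esub>"])
qed

lemma pspan_sum:
  assumes e: "e \<in> {..<n} \<rightarrow> carrier Q" and f: "\<And>i. i \<in> I \<Longrightarrow> f i \<in> pspan e n"
  shows "finsum Q f I \<in> pspan e n"
  using f
proof (induction I rule: infinite_finite_induct)
  case (insert i I)
  then have "finsum Q f (insert i I) = f i \<oplus>\<^bsub>Q\<^esub> finsum Q f I"
    using pspan_closed[OF e] by (intro Q.finsum_insert) auto
  then show ?case using insert pspan_add[OF e] by auto
qed (auto simp: pspan_zero[OF e] Q.finsum_infinite)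

text \<open>A substitute for the determinant argument in Nakayama's lemma: the generators are
  eliminated one at a time.\<close>

lemma nakayama:
  assumes "e \<in> {..<n} \<rightarrow> carrier Q" "s \<in> G" "snd s \<noteq> \<zero>\<^bsub>M\<^esub>"
    "\<And>j. j < n \<Longrightarrow> fst s \<otimes>\<^bsub>Q\<^esub> e j \<in> pspan e n"
  shows "\<exists>t\<in>G. snd t \<noteq> \<zero>\<^bsub>M\<^esub> \<and> (\<forall>j<n. fst t \<otimes>\<^bsub>Q\<^esub> e j = \<zero>\<^bsub>Q\<^esub>)"
  using assms
proof (induction n arbitrary: s)
  case (Suc n)
  note cl = g(8)[OF Suc.prems(2)] g(9)[OF Suc.prems(2)]
  have e: "e \<in> {..<n} \<rightarrow> carrier Q" "e n \<in> carrier Q" using Suc.prems(1) by auto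
  have split: "\<exists>q c. q \<in> {..<n} \<rightarrow> ideal_P \<and> c \<in> ideal_P \<and>
      v = finsum Q (\<lambda>i. q i \<otimes>\<^bsub>Q\<^esub> e i) {..<n} \<oplus>\<^bsub>Q\<^esub> c \<otimes>\<^bsub>Q\<^esub> e n" if v: "v \<in> pspan e (Suc n)" for v
  proof -
    obtain p where p: "p \<in> {..<Suc n} \<rightarrow> ideal_P" "v = finsum Q (\<lambda>i. p i \<otimes>\<^bsub>Q\<^esub> e i) {..<Suc n}"
      using v unfolding pspan_def by blast
    have "v = p n \<otimes>\<^bsub>Q\<^esub> e n \<oplus>\<^bsub>Q\<^esub> finsum Q (\<lambda>i. p i \<otimes>\<^bsub>Q\<^esub> e i) {..<n}"
      unfolding p(2) lessThan_Suc using p(1) e ideal_P(1)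
      by (intro Q.finsum_insert) (auto simp: Pi_iff)
    moreover have "finsum Q (\<lambda>i. p i \<otimes>\<^bsub>Q\<^esub> e i) {..<n} \<in> carrier Q" "p n \<in> carrier Q"
      using p(1) e ideal_P(1) by (auto simp: Pi_iff intro!: Q.finsum_closed)
    ultimately show ?thesis using p(1) e
      by (intro exI[of _ p] exI[of _ "p n"]) (auto simp: Q.a_comm)
  qed
  obtain p c where p: "p \<in> {..<n} \<rightarrow> ideal_P" and c: "c \<in> ideal_P"
    and pe: "fst s \<otimes>\<^bsub>Q\<^esub> e n = finsum Q (\<lambda>i. p i \<otimes>\<^bsub>Q\<^esub> e i) {..<n} \<oplus>\<^bsub>Q\<^esub> c \<otimes>\<^bsub>Q\<^esub> e n"
    using split[OF Suc.prems(4)[of n]] by auto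
  obtain h where h: "h \<in> G" "fst h = c" "snd h = \<zero>\<^bsub>M\<^esub>" using c by (auto simp: ideal_P_def)
  \<comment> \<open>Subtracting the coefficient \<open>c\<close> of \<open>e n\<close> does not
    change the value, because \<open>c\<close> lies in the kernel; \<open>t\<close> then carries
    \<open>e n\<close> into the span of the remaining generators.\<close>
  define t where "t = (fst s \<ominus>\<^bsub>Q\<^esub> c, snd s)"
  have t: "t \<in> G" "snd t \<noteq> \<zero>\<^bsub>M\<^esub>"
    using g(5)[OF Suc.prems(2) g(6)[OF h(1)]] cl Suc.prems(3) by (auto simp: t_def h Q.minus_eq)
  have tc: "fst t \<in> carrier Q" using g(8)[OF t(1)] .
  have pc: "finsum Q (\<lambda>i. p i \<otimes>\<^bsub>Q\<^esub> e i) {..<n} \<in> carrier Q"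
    using p e ideal_P(1) by (auto simp: Pi_iff intro!: Q.finsum_closed)
  have te: "fst t \<otimes>\<^bsub>Q\<^esub> e n = finsum Q (\<lambda>i. p i \<otimes>\<^bsub>Q\<^esub> e i) {..<n}"
  proof -
    have "fst t \<otimes>\<^bsub>Q\<^esub> e n = fst s \<otimes>\<^bsub>Q\<^esub> e n \<ominus>\<^bsub>Q\<^esub> c \<otimes>\<^bsub>Q\<^esub> e n"
      using cl e ideal_P(1)[OF c] by (simp add: t_def Q.minus_eq Q.l_distr Q.l_minus)
    then show ?thesis
      unfolding pe using pc e ideal_P(1)[OF c] by (simp add: Q.minus_eq Q.a_assoc Q.r_neg)
  qed
  \<comment> \<open>The further factor \<open>t\<close> rewrites every remaining occurrence of
    \<open>e n\<close>, so the induction hypothesis applies to \<open>n\<close> generators. The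
    value stays nonzero since \<open>M\<close> is a domain.\<close>
  define s' where "s' = (fst t \<otimes>\<^bsub>Q\<^esub> fst s, snd t \<otimes>\<^bsub>M\<^esub> snd s)"
  have s': "s' \<in> G" "snd s' \<noteq> \<zero>\<^bsub>M\<^esub>"
    using g(4)[OF t(1) Suc.prems(2)] t(2) Suc.prems(3) g(9)[OF t(1)] cl M.integral
    by (auto simp: s'_def)
  have "fst s' \<otimes>\<^bsub>Q\<^esub> e j \<in> pspan e n" if j: "j < n" for j
  proof -
    obtain q d where q: "q \<in> {..<n} \<rightarrow> ideal_P" and d: "d \<in> ideal_P"
      and qe: "fst s \<otimes>\<^bsub>Q\<^esub> e j = finsum Q (\<lambda>i. q i \<otimes>\<^bsub>Q\<^esub> e i) {..<n} \<oplus>\<^bsub>Q\<^esub> d \<otimes>\<^bsub>Q\<^esub> e n"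
      using split[OF Suc.prems(4)[of j]] j by auto
    have qc: "finsum Q (\<lambda>i. q i \<otimes>\<^bsub>Q\<^esub> e i) {..<n} \<in> carrier Q"
      using q e ideal_P(1) by (auto simp: Pi_iff intro!: Q.finsum_closed)
    have dc: "d \<in> carrier Q" using ideal_P(1)[OF d] .
    have ej: "e j \<in> carrier Q" using e j by auto
    have "fst s' \<otimes>\<^bsub>Q\<^esub> e j = fst t \<otimes>\<^bsub>Q\<^esub> (fst s \<otimes>\<^bsub>Q\<^esub> e j)"
      using tc cl ej by (simp add: s'_def Q.m_assoc)
    also have "\<dots> = fst t \<otimes>\<^bsub>Q\<^esub> finsum Q (\<lambda>i. q i \<otimes>\<^bsub>Q\<^esub> e i) {..<n} \<oplus>\<^bsub>Q\<^esub> d \<otimes>\<^bsub>Q\<^esub> (fst t \<otimes>\<^bsub>Q\<^esub> e n)"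
      unfolding qe using tc qc dc e by (simp add: Q.r_distr Q.m_lcomm)
    also have "fst t \<otimes>\<^bsub>Q\<^esub> finsum Q (\<lambda>i. q i \<otimes>\<^bsub>Q\<^esub> e i) {..<n}
        = finsum Q (\<lambda>i. fst t \<otimes>\<^bsub>Q\<^esub> (q i \<otimes>\<^bsub>Q\<^esub> e i)) {..<n}"
      using q e ideal_P(1) tc by (intro Q.finsum_rdistr) (auto simp: Pi_iff)
    also have "\<dots> = finsum Q (\<lambda>i. (fst t \<otimes>\<^bsub>Q\<^esub> q i) \<otimes>\<^bsub>Q\<^esub> e i) {..<n}"
      using q e ideal_P(1) tc by (intro Q.finsum_cong') (auto simp: Pi_iff Q.m_assoc)
    also have "d \<otimes>\<^bsub>Q\<^esub> (fst t \<otimes>\<^bsub>Q\<^esub> e n) = finsum Q (\<lambda>i. d \<otimes>\<^bsub>Q\<^esub> (p i \<otimes>\<^bsub>Q\<^esub> e i)) {..<n}"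
      unfolding te using p e ideal_P(1) dc by (intro Q.finsum_rdistr) (auto simp: Pi_iff)
    finally have eq: "fst s' \<otimes>\<^bsub>Q\<^esub> e j = finsum Q (\<lambda>i. (fst t \<otimes>\<^bsub>Q\<^esub> q i) \<otimes>\<^bsub>Q\<^esub> e i) {..<n} \<oplus>\<^bsub>Q\<^esub>
        finsum Q (\<lambda>i. d \<otimes>\<^bsub>Q\<^esub> (p i \<otimes>\<^bsub>Q\<^esub> e i)) {..<n}" .
    obtain h' where h': "h' \<in> G" "fst h' = d" using d by (auto simp: ideal_P_def)
    have "finsum Q (\<lambda>i. (fst t \<otimes>\<^bsub>Q\<^esub> q i) \<otimes>\<^bsub>Q\<^esub> e i) {..<n} \<in> pspan e n"
      unfolding pspan_def using q ideal_P(5)[OF t(1)] by (auto simp: Pi_iff intro!: exI[of _ "\<lambda>i. fst t \<otimes>\<^bsub>Q\<^esub> q i"])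
    moreover have "finsum Q (\<lambda>i. d \<otimes>\<^bsub>Q\<^esub> (p i \<otimes>\<^bsub>Q\<^esub> e i)) {..<n} \<in> pspan e n"
    proof (rule pspan_sum[OF e(1)])
      fix i assume i: "i \<in> {..<n}"
      have "d \<otimes>\<^bsub>Q\<^esub> p i \<in> ideal_P" using ideal_P(5)[OF h'(1), of "p i"] h' p i by auto
      then have "(d \<otimes>\<^bsub>Q\<^esub> p i) \<otimes>\<^bsub>Q\<^esub> e i \<in> pspan e n" using i by (intro pspan_unit[OF e(1)]) auto
      then show "d \<otimes>\<^bsub>Q\<^esub> (p i \<otimes>\<^bsub>Q\<^esub> e i) \<in> pspan e n"
        using i p e dc ideal_P(1) by (simp add: Q.m_assoc Pi_iff)
    qed
    ultimately show ?thesis unfolding eq by (rule pspan_add[OF e(1)])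
  qed
  from Suc.IH[OF e(1) s' this] obtain r where r: "r \<in> G" "snd r \<noteq> \<zero>\<^bsub>M\<^esub>"
    "\<And>j. j < n \<Longrightarrow> fst r \<otimes>\<^bsub>Q\<^esub> e j = \<zero>\<^bsub>Q\<^esub>" by auto
  have rc: "fst r \<in> carrier Q" using g(8)[OF r(1)] .
  \<comment> \<open>\<open>r\<close> annihilates the first \<open>n\<close> generators and
    \<open>t\<close> sends \<open>e n\<close> to a combination of them, so the product annihilates
    all generators.\<close>
  define r' where "r' = (fst r \<otimes>\<^bsub>Q\<^esub> fst t, snd r \<otimes>\<^bsub>M\<^esub> snd t)"
  have "r' \<in> G" "snd r' \<noteq> \<zero>\<^bsub>M\<^esub>"
    using g(4)[OF r(1) t(1)] r(2) t(2) g(9)[OF r(1)] g(9)[OF t(1)] M.integral by (auto simp: r'_def)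
  moreover have "fst r' \<otimes>\<^bsub>Q\<^esub> e j = \<zero>\<^bsub>Q\<^esub>" if "j < Suc n" for j
  proof (cases "j = n")
    case False
    then have j: "j < n" "e j \<in> carrier Q" using that e by auto
    have "fst r' \<otimes>\<^bsub>Q\<^esub> e j = fst t \<otimes>\<^bsub>Q\<^esub> (fst r \<otimes>\<^bsub>Q\<^esub> e j)"
      using rc tc j by (simp add: r'_def Q.m_ac)
    then show ?thesis using r(3)[OF j(1)] tc by simp
  next
    case True
    have "fst r' \<otimes>\<^bsub>Q\<^esub> e n = fst r \<otimes>\<^bsub>Q\<^esub> finsum Q (\<lambda>i. p i \<otimes>\<^bsub>Q\<^esub> e i) {..<n}"
      using rc tc e by (simp add: r'_def Q.m_assoc te)
    also have "\<dots> = finsum Q (\<lambda>i. fst r \<otimes>\<^bsub>Q\<^esub> (p i \<otimes>\<^bsub>Q\<^esub> e i)) {..<n}"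
      using p e ideal_P(1) rc by (intro Q.finsum_rdistr) (auto simp: Pi_iff)
    also have "\<dots> = finsum Q (\<lambda>i. \<zero>\<^bsub>Q\<^esub>) {..<n}"
    proof (intro Q.finsum_cong')
      fix i assume i: "i \<in> {..<n}"
      then have "p i \<in> carrier Q" "e i \<in> carrier Q" using p e ideal_P(1) by auto
      then have "fst r \<otimes>\<^bsub>Q\<^esub> (p i \<otimes>\<^bsub>Q\<^esub> e i) = p i \<otimes>\<^bsub>Q\<^esub> (fst r \<otimes>\<^bsub>Q\<^esub> e i)" using rc by (simp add: Q.m_lcomm)
      then show "fst r \<otimes>\<^bsub>Q\<^esub> (p i \<otimes>\<^bsub>Q\<^esub> e i) = \<zero>\<^bsub>Q\<^esub>"
        using r(3)[of i] i \<open>p i \<in> carrier Q\<close> by simp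
    qed auto
    finally show ?thesis using True by (simp add: Q.finsum_zero)
  qed
  ultimately show ?case by blast
qed auto

abbreviation "RG \<equiv> PR\<lparr>carrier := G\<rparr>"
abbreviation "U \<equiv> UP RG"

lemma RG_cring: "cring RG"
proof -
  have "ring RG" using PR.subring_is_ring G by (simp add: graph_def)
  then interpret ring RG .
  show ?thesis
    by unfold_locales (use g(8,9) in \<open>auto simp: Q.m_comm M.m_comm\<close>)
qed

text \<open>A polynomial over the graph carries two coefficients per degree: \<open>fst\<close>
  leads to evaluation in \<open>Q\<close>, \<open>snd\<close> to the reduction along the partial
  homomorphism and evaluation in \<open>M\<close>.\<close>

sublocale E1: UP_pre_univ_prop RG Q fst U
proof -
  interpret RG: cring RG by (rule RG_cring)
  have "fst \<in> ring_hom RG Q" using g(8) by (auto simp: ring_hom_def)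
  then show "UP_pre_univ_prop RG Q fst"
    by (intro UP_pre_univ_prop.intro ring_hom_cringI UP_cring.intro RG_cring Q.is_cring)
qed auto

sublocale E2: UP_pre_univ_prop RG M snd U
proof -
  have "snd \<in> ring_hom RG M" using g(9) by (auto simp: ring_hom_def)
  then show "UP_pre_univ_prop RG M snd"
    by (intro UP_pre_univ_prop.intro ring_hom_cringI UP_cring.intro RG_cring M.is_cring)
qed auto

definition "ev1 x = UnivPoly.eval RG Q fst x"
definition "ev2 y = UnivPoly.eval RG M snd y"
abbreviation "cf \<equiv> up_ring.coeff U"

lemma ev1_hom: "x \<in> carrier Q \<Longrightarrow> ev1 x \<in> ring_hom U Q"
  and ev2_hom: "y \<in> carrier M \<Longrightarrow> ev2 y \<in> ring_hom U M"
  by (simp_all add: ev1_def ev2_def E1.eval_ring_hom E2.eval_ring_hom)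

lemma cf_closed [simp]: "f \<in> carrier U \<Longrightarrow> cf f i \<in> G"
  using E1.coeff_closed[of f i] by simp

text \<open>Reconciles the bound given by the formal degree with any other bound beyond which the
  terms vanish.\<close>

lemma finsum_cut:
  assumes "abelian_group E" "\<And>i. h i \<in> carrier E" "\<And>i. i > n \<Longrightarrow> h i = \<zero>\<^bsub>E\<^esub>" "\<And>i. i > d \<Longrightarrow> h i = \<zero>\<^bsub>E\<^esub>"
  shows "finsum E h {..d::nat} = finsum E h {..n}"
proof -
  interpret abelian_group E by fact
  have "finsum E h {..d} = finsum E h {..max d n}"
    using assms(2-) by (intro add.finprod_mono_neutral_cong_left) auto
  also have "\<dots> = finsum E h {..n}"
    using assms(2-) by (intro add.finprod_mono_neutral_cong_right) auto
  finally show ?thesis .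
qed

lemma ev1_bound:
  assumes f: "f \<in> carrier U" and x: "x \<in> carrier Q" and z: "\<And>i. i > n \<Longrightarrow> fst (cf f i) = \<zero>\<^bsub>Q\<^esub>"
  shows "ev1 x f = finsum Q (\<lambda>i. fst (cf f i) \<otimes>\<^bsub>Q\<^esub> x [^]\<^bsub>Q\<^esub> i) {..n}"
  unfolding ev1_def E1.eval_on_carrier[OF f]
  by (rule finsum_cut) (use f x z g(8) E1.deg_aboveD[of f] in \<open>auto simp: Q.abelian_group_axioms\<close>)

text \<open>The bound concerns the reduced coefficients alone: the degree of a polynomial over the
  graph may drop on passing to \<open>M\<close>.\<close>

lemma ev2_bound:
  assumes f: "f \<in> carrier U" and y: "y \<in> carrier M" and z: "\<And>i. i > n \<Longrightarrow> snd (cf f i) = \<zero>\<^bsub>M\<^esub>"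
  shows "ev2 y f = finsum M (\<lambda>i. snd (cf f i) \<otimes>\<^bsub>M\<^esub> y [^]\<^bsub>M\<^esub> i) {..n}"
  unfolding ev2_def E1.eval_on_carrier[OF f]
  by (rule finsum_cut) (use f y z g(9) E1.deg_aboveD[of f] in \<open>auto simp: M.abelian_group_axioms\<close>)

lemma carrier_U: "carrier U = up RG"
  unfolding UP_def by simp

lemma cf_up: "f \<in> up RG \<Longrightarrow> cf f i = f i"
  unfolding UP_def by simp

lemma poly_of_seq:
  assumes c: "\<And>i. c i \<in> G"
  obtains f where "f \<in> carrier U" "\<And>i. cf f i = (if i \<le> n then c i else (\<zero>\<^bsub>Q\<^esub>, \<zero>\<^bsub>M\<^esub>))"
proof
  let ?f = "\<lambda>i. if i \<le> (n::nat) then c i else (\<zero>\<^bsub>Q\<^esub>, \<zero>\<^bsub>M\<^esub>)"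
  have f: "?f \<in> up RG"
    using c g(3) by (intro mem_upI exI[of _ n]) (auto intro!: bound.intro)
  then show "?f \<in> carrier U" unfolding carrier_U .
  show "cf ?f i = (if i \<le> n then c i else (\<zero>\<^bsub>Q\<^esub>, \<zero>\<^bsub>M\<^esub>))" for i
    by (rule cf_up[OF f])
qed

lemma cf_monom_mult:
  assumes "c \<in> G" "f \<in> carrier U" "i \<ge> d"
  shows "cf (up_ring.monom U c d \<otimes>\<^bsub>U\<^esub> f) i = c \<otimes>\<^bsub>PR\<^esub> cf f (i - d)"
  using E1.coeff_monom_mult[of c f d "i - d"] assms by simp

section \<open>Adjoining an element \<open>x\<close> that satisfies a monic relation over the
  graph\<close>

context
  fixes x m c
  assumes x: "x \<in> carrier Q" and c: "\<And>i. c i \<in> G" and cm: "c m = (\<one>\<^bsub>Q\<^esub>, \<one>\<^bsub>M\<^esub>)"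
    and rel: "finsum Q (\<lambda>i. fst (c i) \<otimes>\<^bsub>Q\<^esub> x [^]\<^bsub>Q\<^esub> i) {..m::nat} = \<zero>\<^bsub>Q\<^esub>"
begin

abbreviation "xpow \<equiv> \<lambda>i::nat. x [^]\<^bsub>Q\<^esub> i"

lemma pow_closed: "xpow \<in> I \<rightarrow> carrier Q" "xpow i \<in> carrier Q"
  using x by auto

lemma Q_nontrivial: "\<one>\<^bsub>Q\<^esub> \<noteq> \<zero>\<^bsub>Q\<^esub>"
  using g(7)[of "\<one>\<^bsub>M\<^esub>"] g(2) M.one_not_zero by metis

lemma m_pos: "m > 0"
proof (rule ccontr)
  assume "\<not> m > 0"
  then have "\<one>\<^bsub>Q\<^esub> = \<zero>\<^bsub>Q\<^esub>" using rel x cm by simp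
  then show False using Q_nontrivial by simp
qed

lemma pow_m: "xpow m = finsum Q (\<lambda>i. fst (\<ominus>\<^bsub>PR\<^esub> c i) \<otimes>\<^bsub>Q\<^esub> xpow i) {..<m}"
proof -
  let ?h = "\<lambda>i. fst (c i) \<otimes>\<^bsub>Q\<^esub> xpow i"
  have h: "?h i \<in> carrier Q" for i using g(8)[OF c] x by simp
  have "finsum Q ?h {..m} = ?h m \<oplus>\<^bsub>Q\<^esub> finsum Q ?h {..<m}"
    unfolding lessThan_Suc_atMost[symmetric] lessThan_Suc using h by (intro Q.finsum_insert) auto
  then have z: "xpow m \<oplus>\<^bsub>Q\<^esub> finsum Q ?h {..<m} = \<zero>\<^bsub>Q\<^esub>" using rel cm x by simp
  have s: "finsum Q ?h {..<m} \<in> carrier Q" using h by (auto intro!: Q.finsum_closed)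
  have "\<ominus>\<^bsub>Q\<^esub> finsum Q ?h {..<m} = xpow m" using Q.minus_equality[OF z s] x by simp
  moreover have "\<ominus>\<^bsub>Q\<^esub> finsum Q ?h {..<m} = finsum Q (\<lambda>i. \<ominus>\<^bsub>Q\<^esub> ?h i) {..<m}"
  proof -
    have "finsum Q (\<lambda>i. \<ominus>\<^bsub>Q\<^esub> ?h i) {..<m} \<oplus>\<^bsub>Q\<^esub> finsum Q ?h {..<m} = finsum Q (\<lambda>i. \<ominus>\<^bsub>Q\<^esub> ?h i \<oplus>\<^bsub>Q\<^esub> ?h i) {..<m}"
      using h by (intro Q.finsum_addf[symmetric]) auto
    also have "\<dots> = \<zero>\<^bsub>Q\<^esub>" using h by (simp add: Q.l_neg Q.finsum_zero)
    finally show ?thesis using h s by (intro Q.minus_equality) (auto intro!: Q.finsum_closed)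
  qed
  moreover have "finsum Q (\<lambda>i. \<ominus>\<^bsub>Q\<^esub> ?h i) {..<m} = finsum Q (\<lambda>i. fst (\<ominus>\<^bsub>PR\<^esub> c i) \<otimes>\<^bsub>Q\<^esub> xpow i) {..<m}"
    using g(8,9)[OF c] x by (intro Q.finsum_cong') (auto simp: Q.l_minus mem_Times_iff)
  ultimately show ?thesis by simp
qed

text \<open>Strong induction on \<open>n\<close>: the monic relation replaces a high power by lower
  ones, and multiplication by its coefficients keeps \<open>p\<close> in the ideal.\<close>

lemma pow_reduce: "p \<in> ideal_P \<Longrightarrow> p \<otimes>\<^bsub>Q\<^esub> xpow n \<in> pspan xpow m"
proof (induction n arbitrary: p rule: less_induct)
  case (less n)
  show ?case
  proof (cases "n < m")
    case True
    then show ?thesis by (intro pspan_unit pow_closed less.prems)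
  next
    case False
    have pc: "p \<in> carrier Q" using ideal_P(1)[OF less.prems] .
    have mc: "\<ominus>\<^bsub>PR\<^esub> c i \<in> G" for i using g(6)[OF c[of i]] g(8,9)[OF c[of i]] by (simp add: mem_Times_iff)
    have "xpow n = xpow (n - m) \<otimes>\<^bsub>Q\<^esub> xpow m" using x False by (simp add: Q.nat_pow_mult)
    then have "p \<otimes>\<^bsub>Q\<^esub> xpow n = (p \<otimes>\<^bsub>Q\<^esub> xpow (n - m)) \<otimes>\<^bsub>Q\<^esub> finsum Q (\<lambda>i. fst (\<ominus>\<^bsub>PR\<^esub> c i) \<otimes>\<^bsub>Q\<^esub> xpow i) {..<m}"
      using pc x by (simp add: pow_m[symmetric] Q.m_assoc)
    also have "\<dots> = finsum Q (\<lambda>i. (p \<otimes>\<^bsub>Q\<^esub> xpow (n - m)) \<otimes>\<^bsub>Q\<^esub> (fst (\<ominus>\<^bsub>PR\<^esub> c i) \<otimes>\<^bsub>Q\<^esub> xpow i)) {..<m}"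
      using pc x g(8)[OF mc] by (intro Q.finsum_rdistr) auto
    also have "\<dots> \<in> pspan xpow m"
    proof (rule pspan_sum[OF pow_closed(1)])
      fix i assume i: "i \<in> {..<m}"
      have "(p \<otimes>\<^bsub>Q\<^esub> xpow (n - m)) \<otimes>\<^bsub>Q\<^esub> (fst (\<ominus>\<^bsub>PR\<^esub> c i) \<otimes>\<^bsub>Q\<^esub> xpow i)
          = (fst (\<ominus>\<^bsub>PR\<^esub> c i) \<otimes>\<^bsub>Q\<^esub> p) \<otimes>\<^bsub>Q\<^esub> (xpow (n - m) \<otimes>\<^bsub>Q\<^esub> xpow i)"
        using pc x g(8)[OF mc[of i]] by (simp add: Q.m_ac)
      also have "xpow (n - m) \<otimes>\<^bsub>Q\<^esub> xpow i = xpow (n - m + i)" using x by (simp add: Q.nat_pow_mult)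
      also have "(fst (\<ominus>\<^bsub>PR\<^esub> c i) \<otimes>\<^bsub>Q\<^esub> p) \<otimes>\<^bsub>Q\<^esub> xpow (n - m + i) \<in> pspan xpow m"
        using i False by (intro less.IH ideal_P(5) mc less.prems) auto
      finally show "(p \<otimes>\<^bsub>Q\<^esub> xpow (n - m)) \<otimes>\<^bsub>Q\<^esub> (fst (\<ominus>\<^bsub>PR\<^esub> c i) \<otimes>\<^bsub>Q\<^esub> xpow i) \<in> pspan xpow m" .
    qed
    finally show ?thesis .
  qed
qed

text \<open>This is where integrality enters: the statement amounts to lying-over for \<open>G \<subseteq> G[x]\<close>.\<close>

lemma constant_relation:
  assumes f: "f \<in> carrier U" "ev1 x f = \<zero>\<^bsub>Q\<^esub>" and z: "\<And>i. i > 0 \<Longrightarrow> snd (cf f i) = \<zero>\<^bsub>M\<^esub>"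
  shows "snd (cf f 0) = \<zero>\<^bsub>M\<^esub>"
proof (rule ccontr)
  assume nz: "snd (cf f 0) \<noteq> \<zero>\<^bsub>M\<^esub>"
  note cfc = g(8)[OF cf_closed[OF f(1)]]
  \<comment> \<open>The relation \<open>f(x) = 0\<close> writes the constant coefficient as a
    combination of positive powers with coefficients in the kernel; multiplied by any power of
    \<open>x\<close> it still lies in the kernel span.\<close>
  have "fst (cf f 0) \<otimes>\<^bsub>Q\<^esub> xpow j \<in> pspan xpow m" for j
  proof -
    let ?d = "deg RG f"
    let ?h = "\<lambda>i. fst (cf f i) \<otimes>\<^bsub>Q\<^esub> xpow i"
    have h: "?h i \<in> carrier Q" for i using cfc x by simp
    have "ev1 x f = finsum Q ?h {..?d}"
      by (rule ev1_bound[OF f(1) x]) (use E1.deg_aboveD[of f] f in simp)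
    also have "{..?d} = insert 0 {1..?d}" by auto
    also have "finsum Q ?h (insert 0 {1..?d}) = ?h 0 \<oplus>\<^bsub>Q\<^esub> finsum Q ?h {1..?d}"
      using h cfc by (intro Q.finsum_insert) auto
    finally have zz: "fst (cf f 0) \<oplus>\<^bsub>Q\<^esub> finsum Q ?h {1..?d} = \<zero>\<^bsub>Q\<^esub>"
      using f(2) cfc by simp
    have P: "fst (cf f i) \<in> ideal_P" if "i \<in> {1..?d}" for i
      using z[of i] that cf_closed[OF f(1)] by (auto simp: ideal_P_def)
    have s: "finsum Q ?h {1..?d} \<in> carrier Q" using h by (auto intro!: Q.finsum_closed)
    have "fst (cf f 0) = \<ominus>\<^bsub>Q\<^esub> finsum Q ?h {1..?d}" using Q.minus_equality[OF zz s] cfc by simp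
    then have "fst (cf f 0) \<otimes>\<^bsub>Q\<^esub> xpow j = finsum Q ?h {1..?d} \<otimes>\<^bsub>Q\<^esub> (\<ominus>\<^bsub>Q\<^esub> xpow j)"
      using s x by (simp add: Q.l_minus Q.r_minus)
    also have "\<dots> = finsum Q (\<lambda>i. ?h i \<otimes>\<^bsub>Q\<^esub> (\<ominus>\<^bsub>Q\<^esub> xpow j)) {1..?d}"
      using h x by (intro Q.finsum_ldistr) auto
    also have "\<dots> \<in> pspan xpow m"
    proof (rule pspan_sum[OF pow_closed(1)])
      fix i assume i: "i \<in> {1..?d}"
      have "?h i \<otimes>\<^bsub>Q\<^esub> (\<ominus>\<^bsub>Q\<^esub> xpow j) = (\<ominus>\<^bsub>Q\<^esub> fst (cf f i)) \<otimes>\<^bsub>Q\<^esub> (xpow i \<otimes>\<^bsub>Q\<^esub> xpow j)"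
        using cfc x by (simp add: Q.l_minus Q.r_minus Q.m_assoc)
      also have "xpow i \<otimes>\<^bsub>Q\<^esub> xpow j = xpow (i + j)" using x by (simp add: Q.nat_pow_mult)
      also have "(\<ominus>\<^bsub>Q\<^esub> fst (cf f i)) \<otimes>\<^bsub>Q\<^esub> xpow (i + j) \<in> pspan xpow m"
        by (intro pow_reduce ideal_P(4) P i)
      finally show "?h i \<otimes>\<^bsub>Q\<^esub> (\<ominus>\<^bsub>Q\<^esub> xpow j) \<in> pspan xpow m" .
    qed
    finally show ?thesis .
  qed
  then obtain t where t: "t \<in> G" "snd t \<noteq> \<zero>\<^bsub>M\<^esub>" "\<And>j. j < m \<Longrightarrow> fst t \<otimes>\<^bsub>Q\<^esub> xpow j = \<zero>\<^bsub>Q\<^esub>"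
    using nakayama[OF pow_closed(1) cf_closed[OF f(1)] nz] by blast
  \<comment> \<open>The generator of index 0, present because \<open>m > 0\<close>, is the power
    \<open>xpow 0\<close>, that is 1. Being annihilated it forces \<open>t\<close> to have first
    component zero, and a nonzero value at zero contradicts the graph property.\<close>
  have "fst t = \<zero>\<^bsub>Q\<^esub>" using t(3)[OF m_pos] g(8)[OF t(1)] by simp
  then show False using g(7)[of "snd t"] t by (metis prod.collapse)
qed

text \<open>The relations \<open>f(x) = 0\<close>, reduced to \<open>M\<close>, contain no nonzero
  constant. A root \<open>y\<close> of a reduced relation of least degree is a root of all of them
  by pseudodivision, \<open>M\<close> being a domain; hence \<open>f(x) \<mapsto> f(y)\<close>, with
  \<open>f\<close> reduced on the right, is well defined.\<close>

lemma extend_graph: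
  assumes roots: "\<And>n c. n > 0 \<Longrightarrow> c \<in> UNIV \<rightarrow> carrier M \<Longrightarrow> c n \<noteq> \<zero>\<^bsub>M\<^esub> \<Longrightarrow>
    \<exists>y\<in>carrier M. finsum M (\<lambda>i. c i \<otimes>\<^bsub>M\<^esub> y [^]\<^bsub>M\<^esub> i) {..n::nat} = \<zero>\<^bsub>M\<^esub>"
  shows "\<exists>G' y. graph G' \<and> G \<subseteq> G' \<and> (x, y) \<in> G'"
proof -
  \<comment> \<open>\<open>N n\<close> says that some relation for \<open>x\<close> has a reduction
    of degree exactly \<open>n\<close>.\<close>
  define N where "N n \<longleftrightarrow> (\<exists>f\<in>carrier U. ev1 x f = \<zero>\<^bsub>Q\<^esub> \<and> snd (cf f n) \<noteq> \<zero>\<^bsub>M\<^esub> \<and>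
    (\<forall>i>n. snd (cf f i) = \<zero>\<^bsub>M\<^esub>))" for n
  \<comment> \<open>The monic relation reduces to a monic polynomial, so a relation with nonzero
    reduction exists.\<close>
  have "N m"
  proof -
    obtain f where f: "f \<in> carrier U" "\<And>i. cf f i = (if i \<le> m then c i else (\<zero>\<^bsub>Q\<^esub>, \<zero>\<^bsub>M\<^esub>))"
      using poly_of_seq[of c m] c by blast
    have "ev1 x f = finsum Q (\<lambda>i. fst (cf f i) \<otimes>\<^bsub>Q\<^esub> xpow i) {..m}"
      by (rule ev1_bound[OF f(1) x]) (simp add: f(2))
    also have "\<dots> = finsum Q (\<lambda>i. fst (c i) \<otimes>\<^bsub>Q\<^esub> xpow i) {..m}"
      using g(8)[OF c] x by (intro Q.finsum_cong') (auto simp: f(2))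
    finally show ?thesis unfolding N_def using f rel cm by (intro bexI[of _ f]) auto
  qed
  define n where "n = (LEAST n. N n)"
  have Nn: "N n" and minimal: "\<And>d. d < n \<Longrightarrow> \<not> N d"
    unfolding n_def using \<open>N m\<close> by (auto intro: LeastI dest: not_less_Least)
  obtain f0 where f0: "f0 \<in> carrier U" "ev1 x f0 = \<zero>\<^bsub>Q\<^esub>" "snd (cf f0 n) \<noteq> \<zero>\<^bsub>M\<^esub>"
    "\<And>i. i > n \<Longrightarrow> snd (cf f0 i) = \<zero>\<^bsub>M\<^esub>"
    using Nn unfolding N_def by blast
  have npos: "n > 0"
  proof (rule ccontr)
    assume "\<not> n > 0" then show False using constant_relation[OF f0(1,2)] f0(3,4) by auto
  qed
  obtain y where y: "y \<in> carrier M" "finsum M (\<lambda>i. snd (cf f0 i) \<otimes>\<^bsub>M\<^esub> y [^]\<^bsub>M\<^esub> i) {..n} = \<zero>\<^bsub>M\<^esub>"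
    using roots[OF npos, of "\<lambda>i. snd (cf f0 i)"] f0 g(9)[OF cf_closed[OF f0(1)]] by auto
  have f0y: "ev2 y f0 = \<zero>\<^bsub>M\<^esub>" using ev2_bound[OF f0(1) y(1) f0(4)] y(2) by simp
  note h1 = ring_hom_memE[OF ev1_hom[OF x]] and h2 = ring_hom_memE[OF ev2_hom[OF y(1)]]
  have neg1: "ev1 x (\<ominus>\<^bsub>U\<^esub> f) = \<ominus>\<^bsub>Q\<^esub> ev1 x f" and neg2: "ev2 y (\<ominus>\<^bsub>U\<^esub> f) = \<ominus>\<^bsub>M\<^esub> ev2 y f"
    if "f \<in> carrier U" for f
    using that ring_hom_cring.hom_a_inv[OF ring_hom_cringI[OF E1.UP_cring Q.is_cring ev1_hom[OF x]]]
      ring_hom_cring.hom_a_inv[OF ring_hom_cringI[OF E1.UP_cring M.is_cring ev2_hom[OF y(1)]]]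
    by auto
  \<comment> \<open>Induction on a bound \<open>d\<close> from which on the reduced coefficients
    vanish; for \<open>d = 0\<close> the reduction is zero.\<close>
  have all: "ev2 y f = \<zero>\<^bsub>M\<^esub>"
    if "f \<in> carrier U" "ev1 x f = \<zero>\<^bsub>Q\<^esub>" "\<And>i. i \<ge> d \<Longrightarrow> snd (cf f i) = \<zero>\<^bsub>M\<^esub>" for f d
    using that
  proof (induction d arbitrary: f)
    case 0
    have "ev2 y f = finsum M (\<lambda>i. snd (cf f i) \<otimes>\<^bsub>M\<^esub> y [^]\<^bsub>M\<^esub> i) {..0}"
      by (rule ev2_bound[OF 0(1) y(1)]) (simp add: 0(3))
    then show ?case using 0(3)[of 0] y(1) by simp
  next
    case (Suc d)
    note cfc = g(9)[OF cf_closed[OF Suc.prems(1)]] and cf0 = g(9)[OF cf_closed[OF f0(1)]]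
    show ?case
    proof (cases "d < n")
      case True
      \<comment> \<open>A nonzero coefficient here would give a reduced relation of degree
        \<open>d\<close> below the least degree \<open>n\<close>.\<close>
      have "snd (cf f d) = \<zero>\<^bsub>M\<^esub>"
        using minimal[OF True] Suc.prems unfolding N_def by (auto simp: Suc_le_eq)
      then have "snd (cf f i) = \<zero>\<^bsub>M\<^esub>" if "i \<ge> d" for i
        using Suc.prems(3)[of i] that by (cases "i = d") auto
      then show ?thesis by (rule Suc.IH[OF Suc.prems(1,2)])
    next
      case False
      \<comment> \<open>Each polynomial is multiplied by the top coefficient of the other, since
        division is not possible over the graph; the reduced coefficients in degree \<open>d\<close>
        cancel in the difference.\<close>
      let ?p = "up_ring.monom U (cf f0 n) 0 \<otimes>\<^bsub>U\<^esub> f" and ?q = "up_ring.monom U (cf f d) (d - n) \<otimes>\<^bsub>U\<^esub> f0"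
      have mc: "up_ring.monom U (cf f0 n) 0 \<in> carrier U" "up_ring.monom U (cf f d) (d - n) \<in> carrier U"
        using f0(1) Suc.prems(1) by (auto intro!: E1.monom_closed)
      have pq: "?p \<in> carrier U" "?q \<in> carrier U" "\<ominus>\<^bsub>U\<^esub> ?q \<in> carrier U"
        using mc f0(1) Suc.prems(1) by (auto intro!: E1.UP_mult_closed E1.UP_a_inv_closed)
      let ?f = "?p \<oplus>\<^bsub>U\<^esub> \<ominus>\<^bsub>U\<^esub> ?q"
      have fc: "?f \<in> carrier U" using pq by (intro E1.UP_a_closed)
      have "ev1 x ?f = \<zero>\<^bsub>Q\<^esub>"
        using pq mc f0 Suc.prems h1(1)[OF mc(1)] h1(1)[OF mc(2)] by (simp add: h1(2,3) neg1)
      moreover have "snd (cf ?f i) = \<zero>\<^bsub>M\<^esub>" if i: "i \<ge> d" for i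
      proof -
        have ci: "cf (\<ominus>\<^bsub>U\<^esub> ?q) i = \<ominus>\<^bsub>RG\<^esub> cf ?q i" using E1.coeff_a_inv[OF pq(2)] by simp
        have gi: "cf ?q i \<in> G" using pq(2) by simp
        have "\<ominus>\<^bsub>RG\<^esub> cf ?q i = \<ominus>\<^bsub>PR\<^esub> cf ?q i"
          by (rule E1.R.minus_equality)
            (use gi g(6)[OF gi] g(8,9)[OF gi] in \<open>auto simp: mem_Times_iff Q.l_neg M.l_neg\<close>)
        then have "snd (cf ?f i) = snd (cf ?p i) \<oplus>\<^bsub>M\<^esub> \<ominus>\<^bsub>M\<^esub> snd (cf ?q i)"
          using E1.coeff_add[OF pq(1,3)] ci g(8,9)[OF gi] by (simp add: mem_Times_iff)
        also have "cf ?p i = cf f0 n \<otimes>\<^bsub>PR\<^esub> cf f i"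
          using cf_monom_mult[OF cf_closed[OF f0(1)] Suc.prems(1), of 0 i n] by simp
        also have "cf ?q i = cf f d \<otimes>\<^bsub>PR\<^esub> cf f0 (i - (d - n))"
          using i by (intro cf_monom_mult cf_closed Suc.prems f0) auto
        finally have e: "snd (cf ?f i) = snd (cf f0 n) \<otimes>\<^bsub>M\<^esub> snd (cf f i) \<oplus>\<^bsub>M\<^esub>
            \<ominus>\<^bsub>M\<^esub> (snd (cf f d) \<otimes>\<^bsub>M\<^esub> snd (cf f0 (i - (d - n))))" by simp
        show ?thesis
        proof (cases "i = d")
          case True
          then have "i - (d - n) = n" using False by auto
          then show ?thesis unfolding e using True cfc cf0 by (simp add: M.m_comm M.r_neg)
        next
          case f: False
          then have "snd (cf f i) = \<zero>\<^bsub>M\<^esub>" "snd (cf f0 (i - (d - n))) = \<zero>\<^bsub>M\<^esub>"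
            using i False Suc.prems(3)[of i] by (auto intro!: f0(4))
          then show ?thesis unfolding e using cfc cf0 by simp
        qed
      qed
      ultimately have "ev2 y ?f = \<zero>\<^bsub>M\<^esub>" by (rule Suc.IH[OF fc])
      moreover have "ev2 y ?f = snd (cf f0 n) \<otimes>\<^bsub>M\<^esub> ev2 y f"
        using pq mc f0(1) f0y Suc.prems(1) h2(1)[OF mc(1)] h2(1)[OF mc(2)] h2(1)[OF Suc.prems(1)]
          E2.eval_const[OF y(1), of "cf f0 n"] cf0
        by (simp add: h2(2,3) neg2 ev2_def[symmetric])
      ultimately show ?thesis
        using f0(3) cf0 h2(1)[OF Suc.prems(1)] M.integral by auto
    qed
  qed
  \<comment> \<open>The graph of \<open>f(x) \<mapsto> f(y)\<close> on the subring generated by the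
    old domain and \<open>x\<close>.\<close>
  define G' where "G' = (\<lambda>f. (ev1 x f, ev2 y f)) ` carrier U"
  have "graph G'"
    unfolding graph_def
  proof (intro conjI allI impI PR.subringI)
    show "G' \<subseteq> carrier PR" using h1(1) h2(1) by (auto simp: G'_def)
    show "\<one>\<^bsub>PR\<^esub> \<in> G'" using h1(4) h2(4) E1.UP_one_closed by (force simp: G'_def)
    show "\<ominus>\<^bsub>PR\<^esub> h \<in> G'" if h: "h \<in> G'" for h
    proof -
      obtain f where f: "f \<in> carrier U" "h = (ev1 x f, ev2 y f)" using h by (auto simp: G'_def)
      then have "\<ominus>\<^bsub>PR\<^esub> h = (ev1 x (\<ominus>\<^bsub>U\<^esub> f), ev2 y (\<ominus>\<^bsub>U\<^esub> f))" using h1(1) h2(1) by (simp add: neg1 neg2)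
      then show ?thesis using E1.UP_a_inv_closed[OF f(1)] by (auto simp: G'_def)
    qed
    fix h h' assume "h \<in> G'" "h' \<in> G'"
    then obtain f f' where f: "f \<in> carrier U" "h = (ev1 x f, ev2 y f)" "f' \<in> carrier U" "h' = (ev1 x f', ev2 y f')"
      by (auto simp: G'_def)
    then have "h \<otimes>\<^bsub>PR\<^esub> h' = (ev1 x (f \<otimes>\<^bsub>U\<^esub> f'), ev2 y (f \<otimes>\<^bsub>U\<^esub> f'))"
      "h \<oplus>\<^bsub>PR\<^esub> h' = (ev1 x (f \<oplus>\<^bsub>U\<^esub> f'), ev2 y (f \<oplus>\<^bsub>U\<^esub> f'))" by (simp_all add: h1 h2)
    then show "h \<otimes>\<^bsub>PR\<^esub> h' \<in> G'" "h \<oplus>\<^bsub>PR\<^esub> h' \<in> G'"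
      using E1.UP_mult_closed[OF f(1,3)] E1.UP_a_closed[OF f(1,3)] by (auto simp: G'_def)
  next
    fix z assume "(\<zero>\<^bsub>Q\<^esub>, z) \<in> G'"
    then obtain f where f: "f \<in> carrier U" "ev1 x f = \<zero>\<^bsub>Q\<^esub>" "z = ev2 y f" by (auto simp: G'_def)
    have "snd (cf f i) = \<zero>\<^bsub>M\<^esub>" if "i \<ge> Suc (deg RG f)" for i
      using E1.deg_aboveD[of f i] f(1) that by simp
    from all[OF f(1,2) this] show "z = \<zero>\<^bsub>M\<^esub>" using f by simp
  qed
  moreover have "G \<subseteq> G'"
  proof
    fix h assume h: "h \<in> G"
    have "up_ring.monom U h 0 \<in> carrier U" using E1.monom_closed[of h 0] h by simp
    moreover have "(ev1 x (up_ring.monom U h 0), ev2 y (up_ring.monom U h 0)) = h"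
      using E1.eval_const[OF x, of h] E2.eval_const[OF y(1), of h] h by (simp add: ev1_def ev2_def)
    ultimately show "h \<in> G'"
      using imageI[of "up_ring.monom U h 0" "carrier U" "\<lambda>f. (ev1 x f, ev2 y f)"] by (simp only: G'_def)
  qed
  moreover have "(x, y) \<in> G'"
  proof -
    have "up_ring.monom U \<one>\<^bsub>RG\<^esub> 1 \<in> carrier U" using E1.monom_closed[of "\<one>\<^bsub>RG\<^esub>" 1] g(2) by simp
    moreover have "ev1 x (up_ring.monom U \<one>\<^bsub>RG\<^esub> 1) = x" "ev2 y (up_ring.monom U \<one>\<^bsub>RG\<^esub> 1) = y"
      using E1.eval_monom1[OF x] E2.eval_monom1[OF y(1)] by (simp_all add: ev1_def ev2_def)
    ultimately show ?thesis
      using imageI[of "up_ring.monom U \<one>\<^bsub>RG\<^esub> 1" "carrier U" "\<lambda>f. (ev1 x f, ev2 y f)"]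
      by (simp only: G'_def)
  qed
  ultimately show ?thesis by blast
qed

end

end

section \<open>Maximal partial homomorphisms by Zorn's lemma\<close>

context ring_pair begin

lemma graph_of_hom:
  assumes B: "subring B Q" and lam: "lam \<in> ring_hom (Q\<lparr>carrier := B\<rparr>) M"
  shows "graph ((\<lambda>b. (b, lam b)) ` B)"
proof -
  note b = subringE[OF B] and l = ring_hom_memE[OF lam, simplified]
  have z: "lam \<zero>\<^bsub>Q\<^esub> = \<zero>\<^bsub>M\<^esub>"
    using l(3)[OF b(2) b(2)] l(1)[OF b(2)] by (simp add: M.add.r_cancel_one')
  have neg: "lam (\<ominus>\<^bsub>Q\<^esub> x) = \<ominus>\<^bsub>M\<^esub> lam x" if x: "x \<in> B" for x
    using l(3)[OF b(5)[OF x] x] l(1)[OF x] l(1)[OF b(5)[OF x]] x b(1) z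
    by (intro M.minus_equality[symmetric]) (auto simp: Q.l_neg)
  show ?thesis
    unfolding graph_def
  proof (intro conjI allI impI PR.subringI)
    show "(\<lambda>b. (b, lam b)) ` B \<subseteq> carrier PR" using b(1) l(1) by auto
    show "\<one>\<^bsub>PR\<^esub> \<in> (\<lambda>b. (b, lam b)) ` B" using b(3) l(4) by auto
    show "\<ominus>\<^bsub>PR\<^esub> h \<in> (\<lambda>b. (b, lam b)) ` B" if "h \<in> (\<lambda>b. (b, lam b)) ` B" for h
    proof -
      obtain x where x: "x \<in> B" "h = (x, lam x)" using \<open>h \<in> _\<close> by auto
      have "h \<in> carrier PR" using x b(1) l(1) by auto
      then show ?thesis
        using x neg[OF x(1)] b(5)[OF x(1)] by (auto intro!: image_eqI[of _ _ "\<ominus>\<^bsub>Q\<^esub> x"])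
    qed
    fix h h' assume "h \<in> (\<lambda>b. (b, lam b)) ` B" "h' \<in> (\<lambda>b. (b, lam b)) ` B"
    then show "h \<otimes>\<^bsub>PR\<^esub> h' \<in> (\<lambda>b. (b, lam b)) ` B" "h \<oplus>\<^bsub>PR\<^esub> h' \<in> (\<lambda>b. (b, lam b)) ` B"
      using b(6,7) by (auto simp: l(2,3))
  next
    fix y assume "(\<zero>\<^bsub>Q\<^esub>, y) \<in> (\<lambda>b. (b, lam b)) ` B"
    then show "y = \<zero>\<^bsub>M\<^esub>" using z by auto
  qed
qed

lemma graph_Union:
  assumes "\<C> \<noteq> {}" and chain: "subset.chain {G. graph G} \<C>"
  shows "graph (\<Union>\<C>)"
proof -
  have g: "graph G" if "G \<in> \<C>" for G using chain that by (auto simp: subset.chain_def)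
  note s = g[unfolded graph_def, THEN conjunct1]
  have pair: "\<exists>G\<in>\<C>. h \<in> G \<and> h' \<in> G" if hh: "h \<in> \<Union>\<C>" "h' \<in> \<Union>\<C>" for h h'
  proof -
    obtain G1 G2 where G12: "G1 \<in> \<C>" "h \<in> G1" "G2 \<in> \<C>" "h' \<in> G2" using hh by blast
    then have "G1 \<subseteq> G2 \<or> G2 \<subseteq> G1" using chain by (auto simp: subset.chain_def)
    then show ?thesis using G12 by blast
  qed
  show ?thesis
    unfolding graph_def
  proof (intro conjI allI impI PR.subringI)
    show "\<Union>\<C> \<subseteq> carrier PR" using subringE(1)[OF s] by blast
    show "\<one>\<^bsub>PR\<^esub> \<in> \<Union>\<C>" using subringE(3)[OF s] assms(1) by blast
    show "\<ominus>\<^bsub>PR\<^esub> h \<in> \<Union>\<C>" if "h \<in> \<Union>\<C>" for h using subringE(5)[OF s] that by blast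
    fix h h' assume "h \<in> \<Union>\<C>" "h' \<in> \<Union>\<C>"
    then obtain G where "G \<in> \<C>" "h \<in> G" "h' \<in> G" using pair by blast
    then show "h \<otimes>\<^bsub>PR\<^esub> h' \<in> \<Union>\<C>" "h \<oplus>\<^bsub>PR\<^esub> h' \<in> \<Union>\<C>"
      using subringE(6)[OF s, of G h h'] subringE(7)[OF s, of G h h'] by blast+
  next
    fix y assume "(\<zero>\<^bsub>Q\<^esub>, y) \<in> \<Union>\<C>"
    then show "y = \<zero>\<^bsub>M\<^esub>" using g by (auto simp: graph_def)
  qed
qed

text \<open>Converts a coefficient list over \<open>B\<close>, leading coefficient first, into a
  sequence over the graph indexed by exponents.\<close>

lemma integral_relation:
  assumes G: "graph G" and B: "B \<subseteq> fst ` G" and BQ: "subring B Q"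
    and x: "x \<in> carrier Q" "integral_over Q B x"
  obtains m :: nat and c where "\<And>i. c i \<in> G" "c m = (\<one>\<^bsub>Q\<^esub>, \<one>\<^bsub>M\<^esub>)"
    "finsum Q (\<lambda>i. fst (c i) \<otimes>\<^bsub>Q\<^esub> x [^]\<^bsub>Q\<^esub> i) {..m} = \<zero>\<^bsub>Q\<^esub>"
proof -
  note g = graphD[OF G]
  obtain p where p: "polynomial\<^bsub>Q\<^esub> B p" "p \<noteq> []" "hd p = \<one>\<^bsub>Q\<^esub>" "Q.eval p x = \<zero>\<^bsub>Q\<^esub>"
    using x(2) by (auto simp: integral_over_def)
  \<comment> \<open>Prepending an entry fills index \<open>length p\<close>, the next exponent. The
    sequence has to lie in the graph at every index, hence the pair of units as default for the
    empty list.\<close>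
  have seq: "\<exists>c. (\<forall>i. c i \<in> G) \<and> Q.eval p x = finsum Q (\<lambda>i. fst (c i) \<otimes>\<^bsub>Q\<^esub> x [^]\<^bsub>Q\<^esub> i) {..<length p}"
    if "set p \<subseteq> B" for p
    using that
  proof (induction p)
    case Nil
    then show ?case using g(2) by (auto intro!: exI[of _ "\<lambda>_. (\<one>\<^bsub>Q\<^esub>, \<one>\<^bsub>M\<^esub>)"])
  next
    case (Cons a p)
    then obtain c where c: "\<And>i. c i \<in> G"
      "Q.eval p x = finsum Q (\<lambda>i. fst (c i) \<otimes>\<^bsub>Q\<^esub> x [^]\<^bsub>Q\<^esub> i) {..<length p}" by auto
    obtain h where h: "h \<in> G" "fst h = a" using Cons.prems B by auto
    let ?c = "c(length p := h)"
    have cl: "fst (?c i) \<otimes>\<^bsub>Q\<^esub> x [^]\<^bsub>Q\<^esub> i \<in> carrier Q" "fst (c i) \<otimes>\<^bsub>Q\<^esub> x [^]\<^bsub>Q\<^esub> i \<in> carrier Q" for i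
      using g(8)[OF c(1)[of i]] g(8)[OF h(1)] x(1) by auto
    have "finsum Q (\<lambda>i. fst (?c i) \<otimes>\<^bsub>Q\<^esub> x [^]\<^bsub>Q\<^esub> i) {..<Suc (length p)}
        = fst h \<otimes>\<^bsub>Q\<^esub> x [^]\<^bsub>Q\<^esub> length p \<oplus>\<^bsub>Q\<^esub> finsum Q (\<lambda>i. fst (?c i) \<otimes>\<^bsub>Q\<^esub> x [^]\<^bsub>Q\<^esub> i) {..<length p}"
      unfolding lessThan_Suc using cl g(8)[OF h(1)] x(1) by (subst Q.finsum_insert) auto
    also have "finsum Q (\<lambda>i. fst (?c i) \<otimes>\<^bsub>Q\<^esub> x [^]\<^bsub>Q\<^esub> i) {..<length p} = Q.eval p x"
      unfolding c(2) using cl by (intro Q.finsum_cong') auto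
    finally show ?case using c(1) h by (intro exI[of _ ?c]) auto
  qed
  have pB: "set p \<subseteq> B" using p(1,2) by (auto simp: polynomial_def)
  obtain q where q: "p = \<one>\<^bsub>Q\<^esub> # q" using p(2,3) by (cases p) auto
  obtain c where c: "\<And>i. c i \<in> G"
    "Q.eval q x = finsum Q (\<lambda>i. fst (c i) \<otimes>\<^bsub>Q\<^esub> x [^]\<^bsub>Q\<^esub> i) {..<length q}"
    using seq[of q] pB q by auto
  let ?c = "c(length q := (\<one>\<^bsub>Q\<^esub>, \<one>\<^bsub>M\<^esub>))"
  have cl: "fst (?c i) \<otimes>\<^bsub>Q\<^esub> x [^]\<^bsub>Q\<^esub> i \<in> carrier Q" "fst (c i) \<otimes>\<^bsub>Q\<^esub> x [^]\<^bsub>Q\<^esub> i \<in> carrier Q" for i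
    using g(8)[OF c(1)[of i]] x(1) by auto
  have "finsum Q (\<lambda>i. fst (?c i) \<otimes>\<^bsub>Q\<^esub> x [^]\<^bsub>Q\<^esub> i) {..length q}
      = x [^]\<^bsub>Q\<^esub> length q \<oplus>\<^bsub>Q\<^esub> finsum Q (\<lambda>i. fst (?c i) \<otimes>\<^bsub>Q\<^esub> x [^]\<^bsub>Q\<^esub> i) {..<length q}"
    unfolding lessThan_Suc_atMost[symmetric] lessThan_Suc using cl x(1) by (subst Q.finsum_insert) auto
  also have "finsum Q (\<lambda>i. fst (?c i) \<otimes>\<^bsub>Q\<^esub> x [^]\<^bsub>Q\<^esub> i) {..<length q} = Q.eval q x"
    unfolding c(2) using cl by (intro Q.finsum_cong') auto
  also have "x [^]\<^bsub>Q\<^esub> length q \<oplus>\<^bsub>Q\<^esub> Q.eval q x = \<zero>\<^bsub>Q\<^esub>" using p(4) q x(1) by simp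
  finally show thesis using c(1) g(2) by (intro that[of ?c "length q"]) auto
qed

text \<open>A maximal graph above that of \<open>lam\<close> has all integral elements in its
  domain, since \<open>extend_graph\<close> would otherwise enlarge it. The root hypothesis is
  algebraic closedness in terms of coefficient sequences.\<close>

theorem extend_hom_integral:
  assumes B: "subring B Q" and lam: "lam \<in> ring_hom (Q\<lparr>carrier := B\<rparr>) M"
    and roots: "\<And>n c. n > 0 \<Longrightarrow> c \<in> UNIV \<rightarrow> carrier M \<Longrightarrow> c n \<noteq> \<zero>\<^bsub>M\<^esub> \<Longrightarrow>
      \<exists>y\<in>carrier M. finsum M (\<lambda>i. c i \<otimes>\<^bsub>M\<^esub> y [^]\<^bsub>M\<^esub> i) {..n::nat} = \<zero>\<^bsub>M\<^esub>"
  obtains G where "graph G" "\<And>b. b \<in> B \<Longrightarrow> (b, lam b) \<in> G"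
    "\<And>x. x \<in> carrier Q \<Longrightarrow> integral_over Q B x \<Longrightarrow> \<exists>y. (x, y) \<in> G"
proof -
  let ?G0 = "(\<lambda>b. (b, lam b)) ` B"
  let ?A = "{G. graph G \<and> ?G0 \<subseteq> G}"
  have "\<exists>G\<in>?A. \<forall>G'\<in>?A. G \<subseteq> G' \<longrightarrow> G' = G"
  proof (rule subset_Zorn_nonempty)
    show "?A \<noteq> {}" using graph_of_hom[OF B lam] by blast
    fix \<C> assume C: "\<C> \<noteq> {}" "subset.chain ?A \<C>"
    then have "subset.chain {G. graph G} \<C>" by (auto simp: subset.chain_def)
    then have "graph (\<Union>\<C>)" by (rule graph_Union[OF C(1)])
    moreover have "?G0 \<subseteq> \<Union>\<C>"
    proof -
      obtain G where "G \<in> \<C>" using C(1) by blast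
      moreover from this have "?G0 \<subseteq> G" using C(2) unfolding subset.chain_def by blast
      ultimately show ?thesis by blast
    qed
    ultimately show "\<Union>\<C> \<in> ?A" by blast
  qed
  then obtain G where GA: "G \<in> ?A" and mx: "\<forall>G'\<in>?A. G \<subseteq> G' \<longrightarrow> G' = G" by (elim bexE)
  have G: "graph G" "?G0 \<subseteq> G" using GA by simp_all
  have maximal: "G' = G" if "graph G'" "G \<subseteq> G'" for G'
  proof -
    have "?G0 \<subseteq> G'" using G(2) that(2) by (rule subset_trans)
    then show ?thesis using mx that by simp
  qed
  interpret step: graph_step Q M G by unfold_locales (rule G(1))
  show thesis
  proof (rule that[OF G(1)])
    show "(b, lam b) \<in> G" if "b \<in> B" for b using G(2) that by auto
    fix x assume x: "x \<in> carrier Q" "integral_over Q B x"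
    have BG: "B \<subseteq> fst ` G" using G(2) by force
    obtain m :: nat and c where "\<And>i. c i \<in> G" "c m = (\<one>\<^bsub>Q\<^esub>, \<one>\<^bsub>M\<^esub>)"
      "finsum Q (\<lambda>i. fst (c i) \<otimes>\<^bsub>Q\<^esub> x [^]\<^bsub>Q\<^esub> i) {..m} = \<zero>\<^bsub>Q\<^esub>"
      using integral_relation[OF G(1) BG B x] by blast
    from step.extend_graph[OF x(1) this roots] obtain G' y where "graph G'" "G \<subseteq> G'" "(x, y) \<in> G'"
      by blast
    then show "\<exists>y. (x, y) \<in> G" using maximal[of G'] by blast
  qed
qed

end

section \<open>Algebraic closures inside a type of lists\<close>

text \<open>Reversal matches the sequence indexed by exponents with lists that start at the leading
  coefficient; the polynomial splits and has positive degree, so it has a root.\<close>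

lemma (in algebraically_closed) ex_root:
  assumes n: "n > 0" and c: "c \<in> UNIV \<rightarrow> carrier L" "c n \<noteq> \<zero>"
  shows "\<exists>y\<in>carrier L. finsum L (\<lambda>i. c i \<otimes> y [^] i) {..n::nat} = \<zero>"
proof -
  define p where "p = map c (rev [0..<Suc n])"
  have ev: "eval (map c (rev [0..<m])) y = finsum L (\<lambda>i. c i \<otimes> y [^] i) {..<m}"
    if "y \<in> carrier L" for m and y
  proof (induction m)
    case (Suc m)
    have "finsum L (\<lambda>i. c i \<otimes> y [^] i) {..<Suc m} = c m \<otimes> y [^] m \<oplus> finsum L (\<lambda>i. c i \<otimes> y [^] i) {..<m}"
      unfolding lessThan_Suc using c that by (intro finsum_insert) auto
    then show ?case using Suc by simp
  qed simp
  have "p \<in> carrier (poly_ring L)"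
    using c by (auto simp: p_def univ_poly_carrier[symmetric] polynomial_def)
  then have "size (roots p) = degree p" and r: "\<And>x. x \<in># roots p \<longleftrightarrow> is_root p x"
    using roots_over_carrier roots_mem_iff_is_root by (auto simp: splitted_def)
  then have "roots p \<noteq> {#}" using n by (auto simp: p_def)
  then obtain y where "is_root p y" using r by blast
  then show ?thesis
    using ev[of y "Suc n"] by (auto simp: is_root_def p_def lessThan_Suc_atMost)
qed

text \<open>The run of entries with \<open>a\<close> is a unary count, closed by the first entry
  with \<open>b\<close>; so \<open>n\<close> can be read off before \<open>p\<close>.\<close>

lemma inj_list_encoding:
  fixes a b :: 'a and h :: 'h
  assumes "a \<noteq> b"
  shows "inj (\<lambda>(p, n). replicate n (a, h) @ (b, h) # map (\<lambda>x. (x, h)) p)"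
proof (rule injI, clarify)
  fix p n q m
  assume eq: "replicate n (a, h) @ (b, h) # map (\<lambda>x. (x, h)) p = replicate m (a, h) @ (b, h) # map (\<lambda>x. (x, h)) q"
  have tw: "takeWhile (\<lambda>z. z = (a, h)) (replicate n (a, h) @ (b, h) # r) = replicate n (a, h)" for n r
    using assms by (induction n) auto
  have nm: "n = m" using arg_cong[OF eq, of "\<lambda>z. length (takeWhile (\<lambda>z. z = (a, h)) z)"] by (simp add: tw)
  then have "map (\<lambda>x. (x, h)) p = map (\<lambda>x. (x, h)) q" using eq by simp
  then have "map fst (map (\<lambda>x. (x, h)) p) = map fst (map (\<lambda>x. (x, h)) q)" by simp
  then show "p = q \<and> n = m" using nm by (simp add: comp_def)
qed

text \<open>An element of the closure is encoded by a polynomial that it annihilates, together with its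
  number among the roots of that polynomial.\<close>

lemma (in field) closure_encoding:
  obtains M :: "(('a list \<times> nat) multiset \<Rightarrow> 'a) ring" and e :: "_ \<Rightarrow> ('a \<times> 'h) list"
  where "algebraically_closed M" "indexed_const \<in> ring_hom R M" "inj_on e (carrier M)"
proof -
  obtain M :: "(('a list \<times> nat) multiset \<Rightarrow> 'a) ring"
    where M: "algebraic_closure M (indexed_const ` carrier R)" "indexed_const \<in> ring_hom R M"
    using exists_closure by blast
  interpret M: algebraic_closure M "indexed_const ` carrier R" by (rule M(1))
  \<comment> \<open>Every element is algebraic over the copy of the base field, so an annihilating
    polynomial can be pulled back to a list over the original type.\<close>
  have ex: "\<exists>p. map indexed_const p \<in> carrier (poly_ring M) \<and> map indexed_const p \<noteq> [] \<and>
      M.eval (map indexed_const p) x = \<zero>\<^bsub>M\<^esub>" if x: "x \<in> carrier M" for x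
  proof -
    obtain P where P: "P \<in> carrier ((indexed_const ` carrier R)[X]\<^bsub>M\<^esub>)" "P \<noteq> []" "M.eval P x = \<zero>\<^bsub>M\<^esub>"
      using M.algebraicE[OF M.subring_axioms x M.algebraic_extension[OF x]] by blast
    have "set P \<subseteq> indexed_const ` carrier R" and Pc: "P \<in> carrier (poly_ring M)"
      using P(1,2) M.subset by (auto simp: univ_poly_carrier[symmetric] polynomial_def)
    then obtain p where "P = map indexed_const p"
      by (metis (no_types, lifting) ex_map_conv image_iff subset_iff)
    then show ?thesis using P Pc by blast
  qed
  then obtain pp where pp: "\<And>x. x \<in> carrier M \<Longrightarrow> map indexed_const (pp x) \<in> carrier (poly_ring M) \<and>
      map indexed_const (pp x) \<noteq> [] \<and> M.eval (map indexed_const (pp x)) x = \<zero>\<^bsub>M\<^esub>"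
    by metis
  have fin: "finite {x. M.is_root P x}" if "P \<in> carrier (poly_ring M)" for P
    using M.finite_number_of_roots[OF that] .
  have "\<exists>num :: _ \<Rightarrow> nat. inj_on num {x. M.is_root P x}" if "P \<in> carrier (poly_ring M)" for P
    using finite_imp_inj_to_nat_seg[OF fin[OF that]] by blast
  then obtain num :: "_ \<Rightarrow> _ \<Rightarrow> nat" where num:
    "\<And>P. P \<in> carrier (poly_ring M) \<Longrightarrow> inj_on (num P) {x. M.is_root P x}"
    by metis
  \<comment> \<open>Zero counts and one delimits. The second components carry no information; they
    adapt the list to the type demanded of extension fields.\<close>
  define enc :: "'a list \<times> nat \<Rightarrow> ('a \<times> 'h) list" where
    "enc = (\<lambda>(p, n). replicate n (\<zero>, undefined) @ (\<one>, undefined) # map (\<lambda>x. (x, undefined)) p)"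
  have enc: "inj enc" unfolding enc_def by (rule inj_list_encoding) simp
  define e where "e x = enc (pp x, num (map indexed_const (pp x)) x)" for x
  have "inj_on e (carrier M)"
  proof (rule inj_onI)
    fix x y assume xy: "x \<in> carrier M" "y \<in> carrier M" "e x = e y"
    then have eq: "pp x = pp y" "num (map indexed_const (pp x)) x = num (map indexed_const (pp x)) y"
      using enc by (auto simp: e_def dest!: injD)
    have "M.is_root (map indexed_const (pp x)) x" "M.is_root (map indexed_const (pp x)) y"
      using pp[OF xy(1)] pp[OF xy(2)] xy(1,2) eq(1) by (simp_all add: M.is_root_def)
    then show "x = y" using num[of "map indexed_const (pp x)"] pp[OF xy(1)] eq(2) by (auto dest: inj_onD)
  qed
  moreover have "algebraically_closed M" ..
  ultimately show thesis using that M(2) by blast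
qed

text \<open>An algebraic closure receives the maximal extension of \<open>lam\<close>, and is then
  renamed along the injection \<open>e\<close> into lists, the type over which
  \<open>twisted_is_form\<close> quantifies.\<close>

theorem integral_extension:
  fixes K :: "'l ring" and Q :: "('q, 'm) ring_scheme"
  assumes K: "field K" and Q: "cring Q" and B: "subring B Q"
    and lam: "lam \<in> ring_hom (Q\<lparr>carrier := B\<rparr>) K"
  obtains L :: "('l \<times> 'h) list ring" and j D Lam where
    "field L" "j \<in> ring_hom K L" "subring D Q" "B \<subseteq> D" "Lam \<in> ring_hom (Q\<lparr>carrier := D\<rparr>) L"
    "\<And>b. b \<in> B \<Longrightarrow> Lam b = j (lam b)"
    "\<And>x. x \<in> carrier Q \<Longrightarrow> integral_over Q B x \<Longrightarrow> x \<in> D"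
proof -
  interpret K: field K by fact
  interpret Q: cring Q by fact
  obtain M :: "(('l list \<times> nat) multiset \<Rightarrow> 'l) ring" and e :: "_ \<Rightarrow> ('l \<times> 'h) list"
    where M: "algebraically_closed M" and c: "K.indexed_const \<in> ring_hom K M" and e: "inj_on e (carrier M)"
    by (rule K.closure_encoding)
  interpret M: algebraically_closed M by fact
  interpret P: ring_pair Q M ..
  have hom: "(\<lambda>b. K.indexed_const (lam b)) \<in> ring_hom (Q\<lparr>carrier := B\<rparr>) M"
    using ring_hom_trans[OF lam c] by (simp add: comp_def)
  obtain G where G: "P.graph G" and GB: "\<And>b. b \<in> B \<Longrightarrow> (b, K.indexed_const (lam b)) \<in> G"
    and GI: "\<And>x. x \<in> carrier Q \<Longrightarrow> integral_over Q B x \<Longrightarrow> \<exists>y. (x, y) \<in> G"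
    using P.extend_hom_integral[OF B hom M.ex_root] by blast
  note g = P.graphD[OF G] and fu = P.graph_fun[OF G]
  define D where "D = fst ` G"
  define y where "y x = (THE z. (x, z) \<in> G)" for x
  have y: "y x = z" if "(x, z) \<in> G" for x z
    unfolding y_def using that fu by blast
  have yG: "(x, y x) \<in> G" if "x \<in> D" for x
    using that y by (auto simp: D_def)
  have yc: "y x \<in> carrier M" if "x \<in> D" for x using g(9)[OF yG[OF that]] by simp
  have DG: "x \<in> D" if "(x, z) \<in> G" for x z using that by (force simp: D_def)
  have D: "subring D Q"
  proof (rule Q.subringI)
    show "D \<subseteq> carrier Q" using g(8) by (auto simp: D_def)
    show "\<one>\<^bsub>Q\<^esub> \<in> D" using DG[OF g(2)] .
    show "\<ominus>\<^bsub>Q\<^esub> h \<in> D" if "h \<in> D" for h using DG[OF g(6)[OF yG[OF that]]] by simp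
    show "h1 \<otimes>\<^bsub>Q\<^esub> h2 \<in> D" if "h1 \<in> D" "h2 \<in> D" for h1 h2
      using DG[OF g(4)[OF yG[OF that(1)] yG[OF that(2)]]] by simp
    show "h1 \<oplus>\<^bsub>Q\<^esub> h2 \<in> D" if "h1 \<in> D" "h2 \<in> D" for h1 h2
      using DG[OF g(5)[OF yG[OF that(1)] yG[OF that(2)]]] by simp
  qed
  have "y \<in> ring_hom (Q\<lparr>carrier := D\<rparr>) M"
  proof (rule ring_hom_memI)
    show "y (x \<otimes>\<^bsub>Q\<lparr>carrier := D\<rparr>\<^esub> z) = y x \<otimes>\<^bsub>M\<^esub> y z"
      if "x \<in> carrier (Q\<lparr>carrier := D\<rparr>)" "z \<in> carrier (Q\<lparr>carrier := D\<rparr>)" for x z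
      using that y[OF g(4)[OF yG[of x] yG[of z], simplified]] by simp
    show "y (x \<oplus>\<^bsub>Q\<lparr>carrier := D\<rparr>\<^esub> z) = y x \<oplus>\<^bsub>M\<^esub> y z"
      if "x \<in> carrier (Q\<lparr>carrier := D\<rparr>)" "z \<in> carrier (Q\<lparr>carrier := D\<rparr>)" for x z
      using that y[OF g(5)[OF yG[of x] yG[of z], simplified]] by simp
  qed (use yc y[OF g(2)] in auto)
  moreover have ee: "e \<in> ring_hom M (image_ring e M)"
    using inj_imp_image_ring_iso[OF e] by (simp add: ring_iso_def)
  ultimately have "e \<circ> y \<in> ring_hom (Q\<lparr>carrier := D\<rparr>) (image_ring e M)" by (rule ring_hom_trans)
  moreover have "field (image_ring e M)" by (rule M.inj_imp_image_ring_is_field[OF e])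
  moreover have "B \<subseteq> D" using GB DG by blast
  moreover have "x \<in> D" if "x \<in> carrier Q" "integral_over Q B x" for x
    using GI[OF that] DG by blast
  ultimately show thesis
    using that[of "image_ring e M" "e \<circ> K.indexed_const" D "e \<circ> y"] ring_hom_trans[OF c ee] D y[OF GB]
    by (auto simp: comp_def)
qed

section \<open>Change of the ring of values\<close>

lemma (in hopf) conv_map_inj:
  assumes "inj_on \<phi> (carrier A)"
  shows "inj_on (conv_map \<phi>) (carrier (conv A))"
proof (rule inj_onI)
  fix f g assume fg: "f \<in> carrier (conv A)" "g \<in> carrier (conv A)" "conv_map \<phi> f = conv_map \<phi> g"
  have "f x = g x" if "x \<in> carrier H" for x
    using fun_cong[OF fg(3), of x] that fg(1,2)
    by (intro inj_onD[OF assms]) (auto simp: conv_map_apply conv_carrierD(3))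
  then show "f = g" by (rule conv_eqI[OF fg(1,2)])
qed

text \<open>A morphism of rings of values over \<open>k\<close>. Pushing forward commutes with all
  constructions of the gauge calculus; for injective \<open>\<phi>\<close>, identities can also be
  pulled back.\<close>

locale hopf_values_hom = R: hopf_values k H R \<rho> + S: hopf_values k H S \<rho>'
  for k :: "('k, 'm) ring_scheme" and H :: "('k, 'h, 'n) hopf_scheme"
    and R :: "('r, 'o) ring_scheme" and \<rho> and S :: "('s, 'p) ring_scheme" and \<rho>' +
  fixes \<phi> :: "'r \<Rightarrow> 's"
  assumes \<phi>_hom: "\<phi> \<in> ring_hom R S"
    and \<phi>_\<rho>: "\<And>c. c \<in> carrier k \<Longrightarrow> \<phi> (\<rho> c) = \<rho>' c"
begin

abbreviation "push \<equiv> R.conv_map \<phi>"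
abbreviation "push2 \<equiv> R.conv_map push"
abbreviation "push3 \<equiv> R.conv_map push2"

lemma \<phi>_simps:
  "r \<in> carrier R \<Longrightarrow> \<phi> r \<in> carrier S"
  "r \<in> carrier R \<Longrightarrow> s \<in> carrier R \<Longrightarrow> \<phi> (r \<otimes>\<^bsub>R\<^esub> s) = \<phi> r \<otimes>\<^bsub>S\<^esub> \<phi> s"
  "r \<in> carrier R \<Longrightarrow> s \<in> carrier R \<Longrightarrow> \<phi> (r \<oplus>\<^bsub>R\<^esub> s) = \<phi> r \<oplus>\<^bsub>S\<^esub> \<phi> s"
  "\<phi> \<one>\<^bsub>R\<^esub> = \<one>\<^bsub>S\<^esub>"
  using \<phi>_hom by (auto simp: ring_hom_def)

lemma push_hom: "alg_hom k R.A1 S.A1 push" "alg_hom k R.A2 S.A2 push2" "alg_hom k R.A3 S.A3 push3"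
proof -
  have "alg_hom k R.A0 S.A0 \<phi>"
    by (auto simp: alg_hom_def linear_map_def ring_hom_def \<phi>_simps \<phi>_\<rho>)
  note 1 = R.conv_map_hom[OF R.A0_algebra S.A0_algebra this]
  note 2 = R.conv_map_hom[OF R.A0.conv_algebra S.A0.conv_algebra 1]
  note 3 = R.conv_map_hom[OF R.A1.conv_algebra S.A1.conv_algebra 2]
  show "alg_hom k R.A1 S.A1 push" "alg_hom k R.A2 S.A2 push2" "alg_hom k R.A3 S.A3 push3"
    by (rule 1 2 3)+
qed

lemmas push_closed = push_hom[THEN alg_homD(2)]

lemma push_apply:
  "x \<in> carrier H \<Longrightarrow> push f x = \<phi> (f x)"
  "x \<in> carrier H \<Longrightarrow> y \<in> carrier H \<Longrightarrow> push2 F x y = \<phi> (F x y)"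
  "x \<in> carrier H \<Longrightarrow> y \<in> carrier H \<Longrightarrow> z \<in> carrier H \<Longrightarrow> push3 E x y z = \<phi> (E x y z)"
  by (simp_all add: R.conv_map_apply)

lemma push_legs:
  assumes "f \<in> carrier R.A1"
  shows "push2 (R.leg1 f) = S.leg1 (push f)" "push2 (R.leg2 f) = S.leg2 (push f)"
    "push2 (R.conv_pull f) = R.conv_pull (push f)"
  using assms
  by (auto intro!: S.A2_eqI push_closed S.legs_closed
      simp: push_apply R.legs_apply S.legs_apply R.A1_closed \<phi>_simps \<phi>_\<rho>)

lemma push_faces:
  assumes "F \<in> carrier R.A2"
  shows "push3 (R.d12 F) = S.d12 (push2 F)" "push3 (R.d23 F) = S.d23 (push2 F)"
    "push3 (R.dm12 F) = S.dm12 (push2 F)" "push3 (R.dm23 F) = S.dm23 (push2 F)"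
  using assms
  by (auto intro!: S.A3_eqI push_closed S.legs_closed
      simp: push_apply R.d_apply S.d_apply R.A2_closed \<phi>_simps \<phi>_\<rho>)

lemma push_gauge:
  assumes "f \<in> carrier R.A1" "F \<in> carrier R.A2" "g \<in> carrier R.A1"
  shows "push2 (R.gauge f F g) = S.gauge (push f) (push2 F) (push g)"
    "push2 (R.gauge_inv f F g) = S.gauge_inv (push f) (push2 F) (push g)"
  using assms
  by (simp_all add: R.gauge_def S.gauge_def R.gauge_inv_def S.gauge_inv_def R.A1.conv_closed
      push_legs alg_homD(4)[OF push_hom(2)])

lemma gauge_pair_push:
  assumes "gauge_pair k H R \<rho> f g" shows "gauge_pair k H S \<rho>' (push f) (push g)"
proof -
  interpret gauge_pair k H R \<rho> f g by fact
  show ?thesis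
    by unfold_locales (simp_all add: push_closed ST TS alg_homD(6)[OF push_hom(1)]
        flip: alg_homD(4)[OF push_hom(1)])
qed

lemma push3_faces:
  assumes "F \<in> carrier R.A2"
  shows "push3 (R.d12 F \<otimes>\<^bsub>R.A3\<^esub> R.dm12 F) = S.d12 (push2 F) \<otimes>\<^bsub>S.A3\<^esub> S.dm12 (push2 F)"
    "push3 (R.d23 F \<otimes>\<^bsub>R.A3\<^esub> R.dm23 F) = S.d23 (push2 F) \<otimes>\<^bsub>S.A3\<^esub> S.dm23 (push2 F)"
  using assms by (simp_all add: push_faces alg_homD(4)[OF push_hom(3)])

lemma cocycle_push: "F \<in> carrier R.A2 \<Longrightarrow> R.cocycle F \<Longrightarrow> S.cocycle (push2 F)"
  unfolding R.cocycle_def S.cocycle_def by (metis push3_faces)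

lemma push_ext2: "push2 (R.ext2 \<beta>) = S.ext2 (\<lambda>x y. \<phi> (\<beta> x y))"
  by (intro ext) (simp add: R.ext2_def S.ext2_def R.conv_map_def)

text \<open>Each law of bilinearity for \<open>\<beta>\<close> can be tested after the injective map
  \<open>\<phi>\<close>, where it holds because \<open>G\<close> is bilinear.\<close>

lemma ext2_values:
  assumes G: "G \<in> carrier S.A2" and inj: "inj_on \<phi> (carrier R)"
    and \<beta>: "\<And>x y. x \<in> carrier H \<Longrightarrow> y \<in> carrier H \<Longrightarrow> \<beta> x y \<in> carrier R"
    and eq: "\<And>x y. x \<in> carrier H \<Longrightarrow> y \<in> carrier H \<Longrightarrow> \<phi> (\<beta> x y) = G x y"
  shows "R.ext2 \<beta> \<in> carrier R.A2" "push2 (R.ext2 \<beta>) = G"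
proof -
  note b = S.bilinearD[OF S.A2_bilinear[OF G eq]]
  have "bilinear_map k H H R.A0 \<beta>"
    unfolding bilinear_map_def
    by (intro conjI ballI linear_mapI; (intro inj_onD[OF inj])?)
      (simp_all add: \<beta> b \<phi>_simps \<phi>_\<rho>)
  then show c: "R.ext2 \<beta> \<in> carrier R.A2" by (rule R.ext2_closed)
  show "push2 (R.ext2 \<beta>) = G"
    by (rule S.A2_eqI[OF push_closed(2)[OF c] G]) (simp add: push_apply R.ext2_apply eq)
qed

text \<open>Injectivity survives three applications of \<open>conv_map\<close>, so an identity
  between functions of three arguments can be checked after pushing forward.\<close>

lemma cocycle_reflect:
  assumes inj: "inj_on \<phi> (carrier R)" and F: "F \<in> carrier R.A2" "S.cocycle (push2 F)"
  shows "R.cocycle F"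
  unfolding R.cocycle_def
  by (rule inj_onD[OF R.conv_map_inj[OF R.conv_map_inj[OF R.conv_map_inj]]])
    (use inj F in \<open>auto simp: push3_faces S.cocycle_def R.A2.conv_closed\<close>)

lemma inverse_reflect:
  assumes inj: "inj_on \<phi> (carrier R)" and F: "F \<in> carrier R.A2" "G \<in> carrier R.A2"
    and eq: "push2 F \<otimes>\<^bsub>S.A2\<^esub> push2 G = \<one>\<^bsub>S.A2\<^esub>"
  shows "F \<otimes>\<^bsub>R.A2\<^esub> G = \<one>\<^bsub>R.A2\<^esub>"
  by (rule inj_onD[OF R.conv_map_inj[OF R.conv_map_inj]])
    (use inj F eq in \<open>auto simp: alg_homD(4,6)[OF push_hom(2)] R.A1.conv_closed R.A1.conv_one_closed\<close>)

end

context hopf_values begin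

lemma ext2_inverse:
  assumes \<beta>: "bilinear_map k H H A0 \<beta>" and \<beta>': "conv2_inverse k H L \<rho> \<beta> \<beta>'"
  shows "ext2 \<beta> \<otimes>\<^bsub>A2\<^esub> ext2 \<beta>' = \<one>\<^bsub>A2\<^esub>" "ext2 \<beta>' \<otimes>\<^bsub>A2\<^esub> ext2 \<beta> = \<one>\<^bsub>A2\<^esub>"
proof -
  have c: "ext2 \<beta> \<in> carrier A2" "ext2 \<beta>' \<in> carrier A2"
    using \<beta> \<beta>' by (auto intro!: ext2_closed simp: conv2_inverse_def)
  have "conv2 H L \<beta> \<beta>' x y = (ext2 \<beta> \<otimes>\<^bsub>A2\<^esub> ext2 \<beta>') x y"
    "conv2 H L \<beta>' \<beta> x y = (ext2 \<beta>' \<otimes>\<^bsub>A2\<^esub> ext2 \<beta>) x y"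
    if "x \<in> carrier H" "y \<in> carrier H" for x y
    using that c by (auto intro!: conv2_eq simp: ext2_apply)
  then have "(ext2 \<beta> \<otimes>\<^bsub>A2\<^esub> ext2 \<beta>') x y = \<one>\<^bsub>A2\<^esub> x y" "(ext2 \<beta>' \<otimes>\<^bsub>A2\<^esub> ext2 \<beta>) x y = \<one>\<^bsub>A2\<^esub> x y"
    if "x \<in> carrier H" "y \<in> carrier H" for x y
    using that \<beta>' by (simp_all add: A2_one conv2_inverse_def)
  then show "ext2 \<beta> \<otimes>\<^bsub>A2\<^esub> ext2 \<beta>' = \<one>\<^bsub>A2\<^esub>" "ext2 \<beta>' \<otimes>\<^bsub>A2\<^esub> ext2 \<beta> = \<one>\<^bsub>A2\<^esub>"
    using c by (intro A2_eqI A1.conv_closed A1.conv_one_closed; simp)+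
qed

lemma conv2_inverseI:
  assumes c: "ext2 \<beta> \<in> carrier A2" "ext2 \<beta>' \<in> carrier A2"
    and eq: "ext2 \<beta> \<otimes>\<^bsub>A2\<^esub> ext2 \<beta>' = \<one>\<^bsub>A2\<^esub>" "ext2 \<beta>' \<otimes>\<^bsub>A2\<^esub> ext2 \<beta> = \<one>\<^bsub>A2\<^esub>"
  shows "conv2_inverse k H L \<rho> \<beta> \<beta>'"
proof -
  have "conv2 H L \<beta> \<beta>' x y = (ext2 \<beta> \<otimes>\<^bsub>A2\<^esub> ext2 \<beta>') x y"
    "conv2 H L \<beta>' \<beta> x y = (ext2 \<beta>' \<otimes>\<^bsub>A2\<^esub> ext2 \<beta>) x y"
    if "x \<in> carrier H" "y \<in> carrier H" for x y
    using that c by (auto intro!: conv2_eq simp: ext2_apply)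
  moreover have "bilinear_map k H H A0 \<beta>'"
    using A2_bilinear[OF c(2)] by (simp add: ext2_apply)
  ultimately show ?thesis by (simp add: conv2_inverse_def eq A2_one)
qed

text \<open>Constants are central in \<open>A1\<close>, so the factors \<open>c\<close> and
  \<open>d\<close> meet and cancel.\<close>

lemma conv_unit_scale:
  assumes "c \<in> carrier L" "d \<in> carrier L" "c \<otimes>\<^bsub>L\<^esub> d = \<one>\<^bsub>L\<^esub>" "gauge_pair k H L \<rho> T S"
  shows "gauge_pair k H L \<rho> (conv_unit A0 c \<otimes>\<^bsub>A1\<^esub> T) (conv_unit A0 d \<otimes>\<^bsub>A1\<^esub> S)"
proof -
  interpret gauge_pair k H L \<rho> T S by fact
  note u = A0.conv_unit_closed[simplified]
  have *: "(conv_unit A0 a \<otimes>\<^bsub>A1\<^esub> f) \<otimes>\<^bsub>A1\<^esub> (conv_unit A0 b \<otimes>\<^bsub>A1\<^esub> g) = f \<otimes>\<^bsub>A1\<^esub> g"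
    if "a \<in> carrier L" "b \<in> carrier L" "a \<otimes>\<^bsub>L\<^esub> b = \<one>\<^bsub>L\<^esub>" "f \<in> carrier A1" "g \<in> carrier A1" for a b f g
  proof -
    have "(conv_unit A0 a \<otimes>\<^bsub>A1\<^esub> f) \<otimes>\<^bsub>A1\<^esub> (conv_unit A0 b \<otimes>\<^bsub>A1\<^esub> g)
        = conv_unit A0 a \<otimes>\<^bsub>A1\<^esub> ((f \<otimes>\<^bsub>A1\<^esub> conv_unit A0 b) \<otimes>\<^bsub>A1\<^esub> g)"
      using that u by (simp add: A0.conv_assoc A0.conv_closed)
    also have "\<dots> = (conv_unit A0 a \<otimes>\<^bsub>A1\<^esub> conv_unit A0 b) \<otimes>\<^bsub>A1\<^esub> (f \<otimes>\<^bsub>A1\<^esub> g)"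
      using that u by (simp add: A0.conv_assoc A0.conv_closed A1_commute_unit[of f b])
    also have "conv_unit A0 a \<otimes>\<^bsub>A1\<^esub> conv_unit A0 b = \<one>\<^bsub>A1\<^esub>"
      using that alg_homD(4)[OF A0.conv_unit_hom, of a b] alg_homD(6)[OF A0.conv_unit_hom] by simp
    finally show ?thesis using that by (simp add: A0.conv_closed A0.conv_one_mult)
  qed
  show ?thesis
    by unfold_locales (use assms(1-3) u in \<open>simp_all add: * A0.conv_closed ST TS L.m_comm\<close>)
qed

text \<open>\<open>T\<close> occurs twice and \<open>S\<close> once in the transform, which leaves
  \<open>c c d = c\<close>; in the inverse the counts are exchanged and \<open>c d d = d\<close>
  remains.\<close>

lemma gauge_scale:
  assumes cd: "c \<in> carrier L" "d \<in> carrier L" "c \<otimes>\<^bsub>L\<^esub> d = \<one>\<^bsub>L\<^esub>"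
    and TS: "T \<in> carrier A1" "S \<in> carrier A1" and F: "F \<in> carrier A2" and x: "x \<in> carrier H" and y: "y \<in> carrier H"
  shows "gauge (conv_unit A0 c \<otimes>\<^bsub>A1\<^esub> T) F (conv_unit A0 d \<otimes>\<^bsub>A1\<^esub> S) x y = c \<otimes>\<^bsub>L\<^esub> gauge T F S x y"
    "gauge_inv (conv_unit A0 c \<otimes>\<^bsub>A1\<^esub> T) F (conv_unit A0 d \<otimes>\<^bsub>A1\<^esub> S) x y = d \<otimes>\<^bsub>L\<^esub> gauge_inv T F S x y"
proof -
  note u = A0.conv_unit_closed[simplified]
  have cl: "conv_unit A0 c \<otimes>\<^bsub>A1\<^esub> T \<in> carrier A1" "conv_unit A0 d \<otimes>\<^bsub>A1\<^esub> S \<in> carrier A1"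
    using cd TS u by (auto intro: A0.conv_closed)
  note mult_hom = A0.A.addhom_mult_left[unfolded addhom_cong_add[OF same_add_A0 same_add_A0], simplified]
  note scl = A0.conv_unit_mult(1)[simplified]
  note c0 = A1_closed[OF TS(1)] A1_closed[OF TS(2)] A2_closed[OF F]
  have dc: "d \<otimes>\<^bsub>L\<^esub> (c \<otimes>\<^bsub>L\<^esub> z) = z" "c \<otimes>\<^bsub>L\<^esub> (d \<otimes>\<^bsub>L\<^esub> z) = z" if "z \<in> carrier L" for z
    using that cd L.m_assoc[of d c z] L.m_assoc[of c d z] L.m_comm[of d c] by simp_all
  have pull: "a \<otimes>\<^bsub>L\<^esub> sweedler3 L H (\<lambda>x1 x2 x3. sweedler3 L H (f x1 x2 x3) y) x
      = sweedler3 L H (\<lambda>x1 x2 x3. sweedler3 L H (\<lambda>y1 y2 y3. a \<otimes>\<^bsub>L\<^esub> f x1 x2 x3 y1 y2 y3) y) x"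
    if a: "a \<in> carrier L" and f: "\<And>x1 x2 x3 y1 y2 y3. x1 \<in> carrier H \<Longrightarrow> x2 \<in> carrier H \<Longrightarrow> x3 \<in> carrier H \<Longrightarrow>
      y1 \<in> carrier H \<Longrightarrow> y2 \<in> carrier H \<Longrightarrow> y3 \<in> carrier H \<Longrightarrow> f x1 x2 x3 y1 y2 y3 \<in> carrier L" for a f
  proof -
    have "a \<otimes>\<^bsub>L\<^esub> sweedler3 L H (\<lambda>x1 x2 x3. sweedler3 L H (f x1 x2 x3) y) x
        = sweedler3 L H (\<lambda>x1 x2 x3. a \<otimes>\<^bsub>L\<^esub> sweedler3 L H (f x1 x2 x3) y) x"
      using f y by (intro sweedler3_hom[OF L_ab L_ab mult_hom[OF a] x]) (auto intro!: sweedler3_closed L_ab)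
    also have "\<dots> = sweedler3 L H (\<lambda>x1 x2 x3. sweedler3 L H (\<lambda>y1 y2 y3. a \<otimes>\<^bsub>L\<^esub> f x1 x2 x3 y1 y2 y3) y) x"
      using f y a by (intro sweedler3_cong[OF L_ab x] sweedler3_closed[OF L_ab y]
          sweedler3_hom[OF L_ab L_ab mult_hom[OF a] y]) auto
    finally show ?thesis .
  qed
  show "gauge (conv_unit A0 c \<otimes>\<^bsub>A1\<^esub> T) F (conv_unit A0 d \<otimes>\<^bsub>A1\<^esub> S) x y = c \<otimes>\<^bsub>L\<^esub> gauge T F S x y"
    unfolding gauge_apply[OF cl F x y] gauge_apply[OF TS F x y]
    by (subst pull) (use x y cd c0 in \<open>auto simp: scl TS L.m_ac dc intro!: sweedler3_cong sweedler3_closed L_ab\<close>)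
  show "gauge_inv (conv_unit A0 c \<otimes>\<^bsub>A1\<^esub> T) F (conv_unit A0 d \<otimes>\<^bsub>A1\<^esub> S) x y = d \<otimes>\<^bsub>L\<^esub> gauge_inv T F S x y"
    unfolding gauge_inv_apply[OF cl F x y] gauge_inv_apply[OF TS F x y]
    by (subst pull) (use x y cd c0 in \<open>auto simp: scl TS L.m_ac dc intro!: sweedler3_cong sweedler3_closed L_ab\<close>)
qed

text \<open>The trivial pair; rescaled by constants it yields the gauge transformations that change
  only the normalization.\<close>

lemma gauge_one:
  assumes "F \<in> carrier A2"
  shows "gauge \<one>\<^bsub>A1\<^esub> F \<one>\<^bsub>A1\<^esub> = F" "gauge_pair k H L \<rho> \<one>\<^bsub>A1\<^esub> \<one>\<^bsub>A1\<^esub>"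
proof -
  show "gauge \<one>\<^bsub>A1\<^esub> F \<one>\<^bsub>A1\<^esub> = F"
    using assms by (simp add: gauge_def alg_homD(6)[OF leg1_hom] alg_homD(6)[OF leg2_hom]
        alg_homD(6)[OF pull_hom] A1.conv_one_mult A1.conv_one_closed)
  show "gauge_pair k H L \<rho> \<one>\<^bsub>A1\<^esub> \<one>\<^bsub>A1\<^esub>"
    by unfold_locales (simp_all add: A0.conv_one_closed A0.conv_one_mult)
qed

end

section \<open>Forms from gauge transformations over an extension\<close>

text \<open>\<open>\<sigma>\<close> and \<open>\<sigma>'\<close> have values in \<open>K\<close> but
  are gauge transforms only over \<open>L\<close>. In the application they are \<open>lam\<close>
  composed with the universal cocycle and its inverse, and \<open>u\<close>, \<open>v\<close> are
  the images of \<open>t\<close> at 1 and of its inverse.\<close>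

locale gauge_descent = hopf_values_hom k H K i L \<rho> j + P: gauge_pair k H L \<rho> T T'
  for k :: "('k, 'm) ring_scheme" and H :: "('k, 'h, 'n) hopf_scheme"
    and K :: "('l, 'o) ring_scheme" and i and L :: "('s, 'p) ring_scheme" and \<rho> j T T' +
  fixes \<alpha> \<alpha>' \<sigma> \<sigma>' u v
  assumes inj: "inj_on j (carrier K)"
    and cocycle_\<alpha>: "two_cocycle k H k id \<alpha>" and normalized_\<alpha>: "normalized H id \<alpha>"
    and inverse_\<alpha>: "conv2_inverse k H k id \<alpha> \<alpha>'"
    and \<sigma>_closed: "\<And>x y. x \<in> carrier H \<Longrightarrow> y \<in> carrier H \<Longrightarrow> \<sigma> x y \<in> carrier K"
      "\<And>x y. x \<in> carrier H \<Longrightarrow> y \<in> carrier H \<Longrightarrow> \<sigma>' x y \<in> carrier K"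
    and j_\<sigma>: "\<And>x y. x \<in> carrier H \<Longrightarrow> y \<in> carrier H \<Longrightarrow>
        j (\<sigma> x y) = S.gauge T (S.ext2 (\<lambda>x y. \<rho> (\<alpha> x y))) T' x y"
      "\<And>x y. x \<in> carrier H \<Longrightarrow> y \<in> carrier H \<Longrightarrow>
        j (\<sigma>' x y) = S.gauge_inv T (S.ext2 (\<lambda>x y. \<rho> (\<alpha>' x y))) T' x y"
    and uv: "u \<in> carrier K" "v \<in> carrier K" "u \<otimes>\<^bsub>K\<^esub> v = \<one>\<^bsub>K\<^esub>" and T_one: "T \<one>\<^bsub>H\<^esub> = j u"
begin

sublocale E: hopf_values_hom k H k id L \<rho> \<rho>
  by unfold_locales (auto simp: ring_hom_def)

text \<open>Scaling by \<open>v\<close>, the inverse of \<open>u\<close>, amounts to gauging over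
  \<open>L\<close> with \<open>T\<^sub>1\<close>, whose value at 1 is 1. This normalizes the cocycle
  without leaving \<open>K\<close>.\<close>

definition "\<beta> x y = v \<otimes>\<^bsub>K\<^esub> \<sigma> x y"
definition "\<beta>' x y = u \<otimes>\<^bsub>K\<^esub> \<sigma>' x y"

abbreviation "a \<equiv> S.ext2 (\<lambda>x y. \<rho> (\<alpha> x y))"
abbreviation "a' \<equiv> S.ext2 (\<lambda>x y. \<rho> (\<alpha>' x y))"
abbreviation "T\<^sub>1 \<equiv> R.conv_unit S.A0 (j v) \<otimes>\<^bsub>S.A1\<^esub> T"
abbreviation "T\<^sub>1' \<equiv> R.conv_unit S.A0 (j u) \<otimes>\<^bsub>S.A1\<^esub> T'"

lemma vu: "v \<otimes>\<^bsub>K\<^esub> u = \<one>\<^bsub>K\<^esub>" using uv R.L.m_comm by simp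

lemma j_uv: "j u \<in> carrier L" "j v \<in> carrier L" "j v \<otimes>\<^bsub>L\<^esub> j u = \<one>\<^bsub>L\<^esub>"
  using uv vu \<phi>_simps(2)[of v u] by (simp_all add: \<phi>_simps)

sublocale P1: gauge_pair k H L \<rho> T\<^sub>1 T\<^sub>1'
  by (rule S.conv_unit_scale[OF j_uv(2,1,3)]) unfold_locales

lemma bilinear_\<alpha>: "bilinear_map k H H E.R.A0 \<alpha>" "bilinear_map k H H E.R.A0 \<alpha>'"
  using cocycle_\<alpha> inverse_\<alpha> by (auto simp: two_cocycle_def conv2_inverse_def)

lemma a_closed [simp]: "a \<in> carrier S.A2" "a' \<in> carrier S.A2"
  using E.push_closed(2)[OF E.R.ext2_closed] bilinear_\<alpha> by (simp_all add: E.push_ext2)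

lemma a_inverse: "a \<otimes>\<^bsub>S.A2\<^esub> a' = \<one>\<^bsub>S.A2\<^esub>" "a' \<otimes>\<^bsub>S.A2\<^esub> a = \<one>\<^bsub>S.A2\<^esub>"
  using E.R.ext2_inverse[OF bilinear_\<alpha>(1) inverse_\<alpha>] E.R.ext2_closed bilinear_\<alpha>
  by (simp_all add: alg_homD(6)[OF E.push_hom(2)] flip: E.push_ext2 alg_homD(4)[OF E.push_hom(2)])

lemma a_cocycle: "S.cocycle a"
  using E.cocycle_push[OF E.R.ext2_closed[OF bilinear_\<alpha>(1)]] cocycle_\<alpha>
    E.R.two_cocycle_iff[OF E.R.ext2_closed[OF bilinear_\<alpha>(1)], of \<alpha>]
  by (simp add: E.push_ext2 E.R.ext2_apply)

lemma T1_one: "T\<^sub>1 \<one>\<^bsub>H\<^esub> = \<one>\<^bsub>L\<^esub>"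
  using S.A0.conv_unit_mult(1)[of "j v" T] j_uv by (simp add: T_one)

lemma j_\<beta>:
  assumes "x \<in> carrier H" "y \<in> carrier H"
  shows "j (\<beta> x y) = S.gauge T\<^sub>1 a T\<^sub>1' x y" "j (\<beta>' x y) = S.gauge_inv T\<^sub>1 a' T\<^sub>1' x y"
  using assms uv
  by (simp_all add: \<beta>_def \<beta>'_def \<phi>_simps \<sigma>_closed j_\<sigma> S.gauge_scale[OF j_uv(2,1,3) P.T P.S])

lemma \<beta>_closed: "x \<in> carrier H \<Longrightarrow> y \<in> carrier H \<Longrightarrow> \<beta> x y \<in> carrier K"
    "x \<in> carrier H \<Longrightarrow> y \<in> carrier H \<Longrightarrow> \<beta>' x y \<in> carrier K"
  using uv by (simp_all add: \<beta>_def \<beta>'_def \<sigma>_closed)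

lemma b: "R.ext2 \<beta> \<in> carrier R.A2" "push2 (R.ext2 \<beta>) = S.gauge T\<^sub>1 a T\<^sub>1'"
  by (rule ext2_values[OF _ inj]; simp add: \<beta>_closed j_\<beta>)+

lemma b': "R.ext2 \<beta>' \<in> carrier R.A2" "push2 (R.ext2 \<beta>') = S.gauge_inv T\<^sub>1 a' T\<^sub>1'"
  by (rule ext2_values[OF _ inj]; simp add: \<beta>_closed j_\<beta>)+

lemma s: "R.ext2 \<sigma> \<in> carrier R.A2" "push2 (R.ext2 \<sigma>) = S.gauge T a T'"
  by (rule ext2_values[OF _ inj]; simp add: \<sigma>_closed j_\<sigma>)+

text \<open>Each property holds over \<open>L\<close> for the transform by \<open>T\<^sub>1\<close>
  and is reflected to \<open>K\<close> by injectivity of \<open>j\<close>.\<close>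

lemma \<beta>_normalized_invertible_cocycle: "normalized_invertible_cocycle k H K i \<beta>"
proof -
  have "R.cocycle (R.ext2 \<beta>)"
    using S.cocycle_gauge[OF P1.T P1.S P1.ST a_closed(1) a_cocycle]
    by (intro cocycle_reflect[OF inj b(1)]) (simp add: b(2))
  then have "two_cocycle k H K i \<beta>"
    using R.two_cocycle_iff[OF b(1), of \<beta>] by (simp add: R.ext2_apply)
  moreover have "normalized H i \<beta>"
    unfolding normalized_def
  proof (intro ballI conjI)
    fix x assume x: "x \<in> carrier H"
    have n: "a x \<one>\<^bsub>H\<^esub> = \<rho> (R.\<epsilon> x)" "a \<one>\<^bsub>H\<^esub> x = \<rho> (R.\<epsilon> x)" if "x \<in> carrier H" for x
      using normalized_\<alpha> that by (simp_all add: S.ext2_apply normalized_def)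
    note g = P1.gauge_normalized[OF a_closed(1) n T1_one x]
    show "\<beta> x \<one>\<^bsub>H\<^esub> = i (R.\<epsilon> x)" "\<beta> \<one>\<^bsub>H\<^esub> x = i (R.\<epsilon> x)"
      using x by (auto intro!: inj_onD[OF inj] simp: j_\<beta> g \<phi>_\<rho> \<beta>_closed)
  qed
  moreover have "conv2_inverse k H K i \<beta> \<beta>'"
    using P1.gauge_inverse[OF a_closed a_inverse]
    by (intro R.conv2_inverseI b(1) b'(1) inverse_reflect[OF inj]) (simp_all add: b(2) b'(2))
  ultimately show ?thesis by (auto simp: normalized_invertible_cocycle_def)
qed

text \<open>Over \<open>K\<close> itself, the constant \<open>u\<close> times the counit is a gauge
  transformation that turns \<open>\<beta>\<close> back into \<open>\<sigma>\<close>, as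
  \<open>u v = 1\<close>.\<close>

lemma \<sigma>_\<beta>_iso: "\<exists>f. comod_alg_iso k H K i (twisted k H K i \<sigma> v) (twisted k H K i \<beta> \<one>\<^bsub>K\<^esub>) f"
proof -
  let ?U = "R.conv_unit R.A0 u \<otimes>\<^bsub>R.A1\<^esub> \<one>\<^bsub>R.A1\<^esub>" and ?V = "R.conv_unit R.A0 v \<otimes>\<^bsub>R.A1\<^esub> \<one>\<^bsub>R.A1\<^esub>"
  interpret U: gauge_pair k H K i ?U ?V
    by (rule R.conv_unit_scale[OF uv R.gauge_one(2)[OF b(1)]])
  have "R.gauge ?U (R.ext2 \<beta>) ?V = R.ext2 \<sigma>"
  proof (rule R.A2_eqI[OF R.gauge_closed[OF U.T U.S b(1)] s(1)])
    fix x y assume xy: "x \<in> carrier H" "y \<in> carrier H"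
    show "R.gauge ?U (R.ext2 \<beta>) ?V x y = R.ext2 \<sigma> x y"
      using xy uv \<sigma>_closed(1)[OF xy] R.gauge_scale(1)[OF uv R.A0.conv_one_closed R.A0.conv_one_closed b(1) xy]
      by (simp add: R.gauge_one(1)[OF b(1)] R.ext2_apply)
        (simp add: \<beta>_def flip: R.L.m_assoc)
  qed
  then have FG: "R.ext2 \<sigma> \<otimes>\<^bsub>R.A2\<^esub> R.conv_pull ?U = R.leg1 ?U \<otimes>\<^bsub>R.A2\<^esub> R.leg2 ?U \<otimes>\<^bsub>R.A2\<^esub> R.ext2 \<beta>"
    using U.gauge_pull[OF b(1)] by simp
  \<comment> \<open>The unit \<open>v \<otimes> 1\<close> of the unnormalized algebra is sent to
    \<open>v u \<otimes> 1\<close>, the unit of the normalized one.\<close>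
  have "\<one>\<^bsub>K\<^esub> = v \<otimes>\<^bsub>K\<^esub> ?U \<one>\<^bsub>H\<^esub>"
    using uv vu R.A0.conv_unit_mult(1)[of u "\<one>\<^bsub>R.A1\<^esub>"]
    by (simp add: R.A0.conv_one_closed R.conv_apply R.counit_simps)
  from U.gauge_iso[OF s(1) b(1) FG _ _ uv(2) this] show ?thesis
    by (auto simp: R.ext2_apply)
qed

text \<open>Three isomorphisms in a row: base change leads to the twisted algebra of
  \<open>\<beta>\<close> over \<open>L\<close>, the gauge map of \<open>T\<^sub>1\<close> to that of
  \<open>\<alpha>\<close> over \<open>L\<close>, and inverse base change to the right side.\<close>

lemma \<beta>_\<alpha>_iso:
  "\<exists>f. comod_alg_iso k H L \<rho> (base_change k H K i L j (twisted k H K i \<beta> \<one>\<^bsub>K\<^esub>))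
    (base_change k H k id L \<rho> (twisted k H k id \<alpha> \<one>\<^bsub>k\<^esub>)) f"
proof -
  let ?J = "\<lambda>x y. j (\<beta> x y)" and ?A = "\<lambda>x y. \<rho> (\<alpha> x y)"
  interpret B1: hopf_base_change k H K i L \<rho> j \<beta> "\<one>\<^bsub>K\<^esub>" "R.ext2 \<beta>" ?J "\<one>\<^bsub>L\<^esub>" "S.gauge T\<^sub>1 a T\<^sub>1'"
    by unfold_locales (simp_all add: \<phi>_hom \<phi>_\<rho> b R.ext2_apply j_\<beta> \<phi>_simps)
  interpret B2: hopf_base_change k H k id L \<rho> \<rho> \<alpha> "\<one>\<^bsub>k\<^esub>" "E.R.ext2 \<alpha>" ?A "\<one>\<^bsub>L\<^esub>" a
    by unfold_locales
      (simp_all add: E.\<phi>_hom E.R.ext2_closed[OF bilinear_\<alpha>(1)] E.R.ext2_apply S.ext2_apply)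
  have \<rho>: "\<rho> r \<in> carrier L" if "r \<in> carrier k" for r using that by simp
  have \<rho>': "(j \<circ> i) r = \<rho> r" if "r \<in> carrier k" for r using that by (simp add: \<phi>_\<rho>)
  have ok2: "R.comod_ok \<rho> B2.BC" using B2.BC_ok by simp
  have "comod_alg_iso k H L \<rho> B1.B B2.B (S.gmap T\<^sub>1)"
    by (rule P1.gauge_iso[OF S.gauge_closed[OF P1.T P1.S a_closed(1)] a_closed(1) P1.gauge_pull[OF a_closed(1)]])
      (simp_all add: j_\<beta> S.ext2_apply T1_one)
  note 1 = R.comod_alg_iso_trans[OF B1.BC_ok S.twisted_ok S.twisted_ok \<rho> \<rho>' B1.base_change_iso this]
  have "comod_alg_iso k H L \<rho> B2.B B2.BC (inv_into (carrier B2.BC) B2.\<Psi>)"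
    by (rule R.comod_alg_iso_sym[OF ok2 S.twisted_ok \<rho> B2.base_change_iso B2.BC_closed])
  from R.comod_alg_iso_trans[OF B1.BC_ok S.twisted_ok ok2 \<rho> \<rho>' 1 this] show ?thesis by blast
qed

end

section \<open>The universal cocycle\<close>

locale universal_cocycle = hopf k H + symmetric_hom k H Q \<iota> + Q: cring Q
  for k :: "('k, 'm) ring_scheme" and H :: "('k, 'h, 'n) hopf_scheme"
    and Q :: "('q, 'o) ring_scheme" and \<iota> +
  fixes tinv
  assumes tinv: "is_t_inverse k H Q \<iota> tinv"
begin

sublocale V: hopf_values k H Q ts
  by unfold_locales (rule ts_hom)

abbreviation "tgr \<equiv> restrict tg (carrier H)"
abbreviation "tir \<equiv> restrict tinv (carrier H)"

lemma tinv_linear: "linear_map k H V.A0 tinv"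
  using tinv by (simp add: is_t_inverse_def)

sublocale V: gauge_pair k H Q ts tgr tir
proof
  show c: "tgr \<in> carrier V.A1" "tir \<in> carrier V.A1"
    by (intro conv_restrict tg_linear tinv_linear)+
  have "sw Q (\<lambda>a b. tir a \<otimes>\<^bsub>Q\<^esub> tgr b) x = ts (\<epsilon> x)" "sw Q (\<lambda>a b. tgr a \<otimes>\<^bsub>Q\<^esub> tir b) x = ts (\<epsilon> x)"
    if x: "x \<in> carrier H" for x
  proof -
    have "sw Q (\<lambda>a b. tir a \<otimes>\<^bsub>Q\<^esub> tgr b) x = sw Q (\<lambda>a b. tinv a \<otimes>\<^bsub>Q\<^esub> tg b) x"
      "sw Q (\<lambda>a b. tgr a \<otimes>\<^bsub>Q\<^esub> tir b) x = sw Q (\<lambda>a b. tg a \<otimes>\<^bsub>Q\<^esub> tinv b) x"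
      using x linear_mapD(1)[OF tg_linear] linear_mapD(1)[OF tinv_linear]
      by (auto intro!: sweedler_cong V.L_ab)
    then show "sw Q (\<lambda>a b. tir a \<otimes>\<^bsub>Q\<^esub> tgr b) x = ts (\<epsilon> x)" "sw Q (\<lambda>a b. tgr a \<otimes>\<^bsub>Q\<^esub> tir b) x = ts (\<epsilon> x)"
      using tinv x by (simp_all add: is_t_inverse_def)
  qed
  then show "tir \<otimes>\<^bsub>V.A1\<^esub> tgr = \<one>\<^bsub>V.A1\<^esub>" "tgr \<otimes>\<^bsub>V.A1\<^esub> tir = \<one>\<^bsub>V.A1\<^esub>"
    using c by (auto intro!: conv_eqI[of _ V.A0] V.A0.conv_closed V.A0.conv_one_closed
        simp: conv_apply V.sw_A0 simp del: restrict_apply)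
qed

lemma t_pair: "gauge_pair k H Q ts tgr tir" ..

sublocale E: hopf_values_hom k H k id Q ts ts
  by unfold_locales (auto simp: ring_hom_def)

text \<open>The definitions of \<open>sigma\<close> and \<open>sigma_inv\<close> are the Sweedler
  expansions of the abstract transforms, taken for \<open>t\<close> and its convolution
  inverse.\<close>

lemma sigma_gauge:
  assumes \<alpha>: "bilinear_map k H H E.R.A0 \<alpha>" and xy: "x \<in> carrier H" "y \<in> carrier H"
  shows "V.ext2 (\<lambda>x y. ts (\<alpha> x y)) \<in> carrier V.A2"
    "sigma k H \<alpha> Q \<iota> tinv x y = V.gauge tgr (V.ext2 (\<lambda>x y. ts (\<alpha> x y))) tir x y"
    "sigma_inv k H \<alpha> Q \<iota> tinv x y = V.gauge_inv tgr (V.ext2 (\<lambda>x y. ts (\<alpha> x y))) tir x y"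
proof -
  show a: "V.ext2 (\<lambda>x y. ts (\<alpha> x y)) \<in> carrier V.A2"
    using E.push_closed(2)[OF E.R.ext2_closed[OF \<alpha>]] by (simp add: E.push_ext2)
  note cl = linear_mapD(1)[OF tg_linear, simplified] linear_mapD(1)[OF tinv_linear, simplified]
    E.R.bilinearD(1)[OF \<alpha>]
  show "sigma k H \<alpha> Q \<iota> tinv x y = V.gauge tgr (V.ext2 (\<lambda>x y. ts (\<alpha> x y))) tir x y"
    unfolding V.gauge_apply[OF V.T V.S a xy] sigma_def using xy cl
    by (intro sweedler3_cong sweedler3_closed V.L_ab) (auto simp: V.ext2_apply)
  show "sigma_inv k H \<alpha> Q \<iota> tinv x y = V.gauge_inv tgr (V.ext2 (\<lambda>x y. ts (\<alpha> x y))) tir x y"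
    unfolding V.gauge_inv_apply[OF V.T V.S a xy] sigma_inv_def using xy cl
    by (intro sweedler3_cong sweedler3_closed V.L_ab) (auto simp: V.ext2_apply)
qed

lemma t_one: "tg \<one>\<^bsub>H\<^esub> \<otimes>\<^bsub>Q\<^esub> tinv \<one>\<^bsub>H\<^esub> = \<one>\<^bsub>Q\<^esub>"
proof -
  have "tgr \<one>\<^bsub>H\<^esub> \<otimes>\<^bsub>Q\<^esub> tir \<one>\<^bsub>H\<^esub> = \<one>\<^bsub>Q\<^esub>"
    using alg_homD(4,6)[OF V.A0.conv_eval_one_hom] V.T V.S V.TS by (metis V.A0_simps(2,4))
  then show ?thesis by simp
qed

text \<open>At the grouplike element 1 the transforms are plain products: with \<open>t\<close> and
  its inverse \<open>t'\<close> at 1, they are \<open>t t t' = t\<close> and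
  \<open>t t' t' = t'\<close>. This places both elements in the base algebra.\<close>

lemma sigma_one:
  assumes \<alpha>: "bilinear_map k H H E.R.A0 \<alpha>" and one: "\<alpha> \<one>\<^bsub>H\<^esub> \<one>\<^bsub>H\<^esub> = \<one>\<^bsub>k\<^esub>"
  shows "sigma k H \<alpha> Q \<iota> tinv \<one>\<^bsub>H\<^esub> \<one>\<^bsub>H\<^esub> = tg \<one>\<^bsub>H\<^esub>" "sigma_inv k H \<alpha> Q \<iota> tinv \<one>\<^bsub>H\<^esub> \<one>\<^bsub>H\<^esub> = tinv \<one>\<^bsub>H\<^esub>"
proof -
  let ?a = "V.ext2 (\<lambda>x y. ts (\<alpha> x y))"
  note a = sigma_gauge(1)[OF \<alpha> H.A.one_closed H.A.one_closed]
  have h: "alg_hom k V.A2 V.A0 (\<lambda>F. F \<one>\<^bsub>H\<^esub> \<one>\<^bsub>H\<^esub>)"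
    using alg_hom_comp[OF V.A1.conv_eval_one_hom V.A0.conv_eval_one_hom] .
  have c: "tg \<one>\<^bsub>H\<^esub> \<in> carrier Q" "tinv \<one>\<^bsub>H\<^esub> \<in> carrier Q"
    using linear_mapD(1)[OF tg_linear] linear_mapD(1)[OF tinv_linear] by simp_all
  then have t: "tinv \<one>\<^bsub>H\<^esub> \<otimes>\<^bsub>Q\<^esub> tg \<one>\<^bsub>H\<^esub> = \<one>\<^bsub>Q\<^esub>"
    using t_one Q.m_comm by simp
  note e = V.ext2_apply[OF H.A.one_closed H.A.one_closed]
  have "V.gauge tgr ?a tir \<one>\<^bsub>H\<^esub> \<one>\<^bsub>H\<^esub> = tg \<one>\<^bsub>H\<^esub> \<otimes>\<^bsub>Q\<^esub> tg \<one>\<^bsub>H\<^esub> \<otimes>\<^bsub>Q\<^esub> tinv \<one>\<^bsub>H\<^esub>"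
    using a c by (simp add: V.gauge_def alg_homD(4)[OF h] V.A1.conv_closed V.legs_apply
        counit_simps e one)
  moreover have "V.gauge_inv tgr ?a tir \<one>\<^bsub>H\<^esub> \<one>\<^bsub>H\<^esub> = tg \<one>\<^bsub>H\<^esub> \<otimes>\<^bsub>Q\<^esub> (tinv \<one>\<^bsub>H\<^esub> \<otimes>\<^bsub>Q\<^esub> tinv \<one>\<^bsub>H\<^esub>)"
    using a c by (simp add: V.gauge_inv_def alg_homD(4)[OF h] V.A1.conv_closed V.legs_apply
        counit_simps e one)
  moreover have "tg \<one>\<^bsub>H\<^esub> \<otimes>\<^bsub>Q\<^esub> tg \<one>\<^bsub>H\<^esub> \<otimes>\<^bsub>Q\<^esub> tinv \<one>\<^bsub>H\<^esub> = tg \<one>\<^bsub>H\<^esub>"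
    "tg \<one>\<^bsub>H\<^esub> \<otimes>\<^bsub>Q\<^esub> (tinv \<one>\<^bsub>H\<^esub> \<otimes>\<^bsub>Q\<^esub> tinv \<one>\<^bsub>H\<^esub>) = tinv \<one>\<^bsub>H\<^esub>"
    using c t by (simp_all add: Q.m_ac) (simp add: t flip: Q.m_assoc)
  ultimately show "sigma k H \<alpha> Q \<iota> tinv \<one>\<^bsub>H\<^esub> \<one>\<^bsub>H\<^esub> = tg \<one>\<^bsub>H\<^esub>"
    "sigma_inv k H \<alpha> Q \<iota> tinv \<one>\<^bsub>H\<^esub> \<one>\<^bsub>H\<^esub> = tinv \<one>\<^bsub>H\<^esub>"
    by (simp_all add: sigma_gauge[OF \<alpha>])
qed

end

text \<open>The gauge formula for the universal cocycle holds in \<open>Q\<close>, whereas the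
  extended morphism \<open>\<phi>\<close> is defined on a subring \<open>R\<close>. The formula is
  reflected to \<open>R\<close> along the inclusion \<open>\<psi>\<close> and then pushed along
  \<open>\<phi>\<close>.\<close>

locale gauge_transport = hopf_values_hom k H R \<rho>\<^sub>R L \<rho> \<phi> + I: hopf_values_hom k H R \<rho>\<^sub>R Q \<rho>\<^sub>Q \<psi> +
    V: gauge_pair k H Q \<rho>\<^sub>Q T T'
  for k :: "('k, 'm) ring_scheme" and H :: "('k, 'h, 'n) hopf_scheme"
    and R :: "('r, 'o) ring_scheme" and \<rho>\<^sub>R and L :: "('l, 'p) ring_scheme" and \<rho> \<phi>
    and Q :: "('q, 'u) ring_scheme" and \<rho>\<^sub>Q \<psi> T T' +
  fixes \<tau> \<tau>'
  assumes inj: "inj_on \<psi> (carrier R)"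
    and \<tau>: "\<And>x. x \<in> carrier H \<Longrightarrow> \<tau> x \<in> carrier R" "\<And>x. x \<in> carrier H \<Longrightarrow> \<psi> (\<tau> x) = T x"
      "\<And>x. x \<in> carrier H \<Longrightarrow> \<tau>' x \<in> carrier R" "\<And>x. x \<in> carrier H \<Longrightarrow> \<psi> (\<tau>' x) = T' x"
begin

abbreviation "\<tau>\<^sub>r \<equiv> restrict \<tau> (carrier H)"
abbreviation "\<tau>\<^sub>r' \<equiv> restrict \<tau>' (carrier H)"

sublocale G: gauge_pair k H R \<rho>\<^sub>R \<tau>\<^sub>r \<tau>\<^sub>r'
proof
  show c: "\<tau>\<^sub>r \<in> carrier R.A1" "\<tau>\<^sub>r' \<in> carrier R.A1"
    using linear_mapD[OF R.conv_carrierD(2)[OF V.T]] linear_mapD[OF R.conv_carrierD(2)[OF V.S]]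
    by (auto intro!: R.conv_restrict linear_mapI inj_onD[OF inj] simp: \<tau> I.\<phi>_simps I.\<phi>_\<rho>)
  have inj1: "inj_on I.push (carrier R.A1)" by (rule R.conv_map_inj) (simp add: inj)
  have "I.push \<tau>\<^sub>r = T" "I.push \<tau>\<^sub>r' = T'"
    by (rule R.conv_eqI[OF I.push_closed(1)[OF c(1)] V.T] R.conv_eqI[OF I.push_closed(1)[OF c(2)] V.S];
        simp add: I.push_apply \<tau>)+
  then show "\<tau>\<^sub>r' \<otimes>\<^bsub>R.A1\<^esub> \<tau>\<^sub>r = \<one>\<^bsub>R.A1\<^esub>" "\<tau>\<^sub>r \<otimes>\<^bsub>R.A1\<^esub> \<tau>\<^sub>r' = \<one>\<^bsub>R.A1\<^esub>"
    using c V.ST V.TS by (auto intro!: inj_onD[OF inj1] R.A0.conv_closed R.A0.conv_one_closed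
      simp: alg_homD(4,6)[OF I.push_hom(1)])
qed

lemma transport_pair: "gauge_pair k H L \<rho> (push \<tau>\<^sub>r) (push \<tau>\<^sub>r')"
  by (rule gauge_pair_push[OF G.gauge_pair_axioms])

lemma transport_gauge:
  assumes a: "bilinear_map k H H R.A0 a" and xy: "x \<in> carrier H" "y \<in> carrier H"
  shows "z \<in> carrier R \<Longrightarrow> \<psi> z = I.S.gauge T (I.S.ext2 (\<lambda>x y. \<psi> (a x y))) T' x y \<Longrightarrow>
      \<phi> z = S.gauge (push \<tau>\<^sub>r) (S.ext2 (\<lambda>x y. \<phi> (a x y))) (push \<tau>\<^sub>r') x y"
    "z \<in> carrier R \<Longrightarrow> \<psi> z = I.S.gauge_inv T (I.S.ext2 (\<lambda>x y. \<psi> (a x y))) T' x y \<Longrightarrow>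
      \<phi> z = S.gauge_inv (push \<tau>\<^sub>r) (S.ext2 (\<lambda>x y. \<phi> (a x y))) (push \<tau>\<^sub>r') x y"
proof -
  note c = R.ext2_closed[OF a]
  note gc = R.A2_closed[OF R.gauge_closed[OF G.T G.S c] xy] R.A2_closed[OF R.gauge_inv_closed[OF G.T G.S c] xy]
  have p: "I.push \<tau>\<^sub>r = T" "I.push \<tau>\<^sub>r' = T'"
    by (rule R.conv_eqI[OF I.push_closed(1)[OF G.T] V.T] R.conv_eqI[OF I.push_closed(1)[OF G.S] V.S];
        simp add: I.push_apply \<tau>)+
  note L = fun_cong[OF fun_cong[OF push_gauge(1)[OF G.T c G.S]], of x y, unfolded push_apply(2)[OF xy] push_ext2]
    fun_cong[OF fun_cong[OF push_gauge(2)[OF G.T c G.S]], of x y, unfolded push_apply(2)[OF xy] push_ext2]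
  note Q = fun_cong[OF fun_cong[OF I.push_gauge(1)[OF G.T c G.S]], of x y, unfolded I.push_apply(2)[OF xy] I.push_ext2 p]
    fun_cong[OF fun_cong[OF I.push_gauge(2)[OF G.T c G.S]], of x y, unfolded I.push_apply(2)[OF xy] I.push_ext2 p]
  show "\<phi> z = S.gauge (push \<tau>\<^sub>r) (S.ext2 (\<lambda>x y. \<phi> (a x y))) (push \<tau>\<^sub>r') x y"
    if "z \<in> carrier R" "\<psi> z = I.S.gauge T (I.S.ext2 (\<lambda>x y. \<psi> (a x y))) T' x y"
  proof -
    have "z = R.gauge \<tau>\<^sub>r (R.ext2 a) \<tau>\<^sub>r' x y"
      by (rule inj_onD[OF inj _ that(1) gc(1)]) (simp only: that(2) Q(1))
    then show ?thesis by (simp only: L(1))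
  qed
  show "\<phi> z = S.gauge_inv (push \<tau>\<^sub>r) (S.ext2 (\<lambda>x y. \<phi> (a x y))) (push \<tau>\<^sub>r') x y"
    if "z \<in> carrier R" "\<psi> z = I.S.gauge_inv T (I.S.ext2 (\<lambda>x y. \<psi> (a x y))) T' x y"
  proof -
    have "z = R.gauge_inv \<tau>\<^sub>r (R.ext2 a) \<tau>\<^sub>r' x y"
      by (rule inj_onD[OF inj _ that(1) gc(2)]) (simp only: that(2) Q(2))
    then show ?thesis by (simp only: L(2))
  qed
qed

end

text \<open>Evaluation of both arguments at 1 is an algebra morphism, so it sends the convolution
  inverse to the inverse of 1.\<close>

lemma (in hopf_values) inverse_one:
  assumes \<beta>: "bilinear_map k H H A0 \<beta>" "conv2_inverse k H L \<rho> \<beta> \<beta>'" and one: "\<beta> \<one>\<^bsub>H\<^esub> \<one>\<^bsub>H\<^esub> = \<one>\<^bsub>L\<^esub>"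
  shows "\<beta>' \<one>\<^bsub>H\<^esub> \<one>\<^bsub>H\<^esub> = \<one>\<^bsub>L\<^esub>"
proof -
  have \<beta>': "bilinear_map k H H A0 \<beta>'" using \<beta>(2) by (simp add: conv2_inverse_def)
  have h: "alg_hom k A2 A0 (\<lambda>F. F \<one>\<^bsub>H\<^esub> \<one>\<^bsub>H\<^esub>)"
    using alg_hom_comp[OF A1.conv_eval_one_hom A0.conv_eval_one_hom] .
  have "ext2 \<beta> \<one>\<^bsub>H\<^esub> \<one>\<^bsub>H\<^esub> \<otimes>\<^bsub>L\<^esub> ext2 \<beta>' \<one>\<^bsub>H\<^esub> \<one>\<^bsub>H\<^esub> = \<one>\<^bsub>L\<^esub>"
    using alg_homD(4)[OF h ext2_closed[OF \<beta>(1)] ext2_closed[OF \<beta>']] alg_homD(6)[OF h]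
    by (simp only: ext2_inverse(1)[OF \<beta>] A0_simps)
  then show ?thesis
    using bilinearD(1)[OF \<beta>' H.A.one_closed H.A.one_closed] by (simp add: ext2_apply one)
qed

context universal_cocycle begin

lemma sigma_bilinear:
  assumes \<alpha>: "bilinear_map k H H E.R.A0 \<alpha>"
  shows "bilinear_map k H H V.A0 (sigma k H \<alpha> Q \<iota> tinv)" "bilinear_map k H H V.A0 (sigma_inv k H \<alpha> Q \<iota> tinv)"
proof -
  have a: "V.ext2 (\<lambda>x y. ts (\<alpha> x y)) \<in> carrier V.A2"
    by (rule sigma_gauge(1)[OF \<alpha> H.A.one_closed H.A.one_closed])
  show "bilinear_map k H H V.A0 (sigma k H \<alpha> Q \<iota> tinv)"
    by (rule V.A2_bilinear[OF V.gauge_closed[OF V.T V.S a] sigma_gauge(2)[OF \<alpha>]])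
  show "bilinear_map k H H V.A0 (sigma_inv k H \<alpha> Q \<iota> tinv)"
    by (rule V.A2_bilinear[OF V.gauge_inv_closed[OF V.T V.S a] sigma_gauge(3)[OF \<alpha>]])
qed

end

lemma bilinear_map_ring_hom:
  assumes "bilinear_map k M N (as_algebra \<rho> R) f" "\<phi> \<in> ring_hom R S"
    "\<And>c. c \<in> carrier k \<Longrightarrow> \<rho> c \<in> carrier R" "\<And>c. c \<in> carrier k \<Longrightarrow> \<phi> (\<rho> c) = \<rho>' c"
  shows "bilinear_map k M N (as_algebra \<rho>' S) (\<lambda>x y. \<phi> (f x y))"
  using assms by (auto simp: bilinear_map_def linear_map_def ring_hom_def as_algebra_def Pi_iff)

lemma bilinear_map_restrict:
  assumes "bilinear_map k M N (as_algebra \<rho> R) f"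
    "\<And>x y. x \<in> carrier M \<Longrightarrow> y \<in> carrier N \<Longrightarrow> f x y \<in> B"
  shows "bilinear_map k M N (as_algebra \<rho> (R\<lparr>carrier := B\<rparr>)) f"
  using assms by (auto simp: bilinear_map_def linear_map_def as_algebra_def)

theorem theorem7p2:
  fixes k :: "'k ring" and H :: "('k, 'h) hopf" and \<alpha> :: "'h \<Rightarrow> 'h \<Rightarrow> 'k"
    and K\<^sub>H :: "'q ring" and \<iota> :: "('k, 'h multiset) tensor \<Rightarrow> 'q" and tinv :: "'h \<Rightarrow> 'q"
    and K :: "'l ring" and i :: "'k \<Rightarrow> 'l" and lam :: "'q \<Rightarrow> 'l"
  assumes "field k"
    and "hopf_algebra k H"
    and "normalized_invertible_cocycle k H k id \<alpha>"
    and "fraction_field (symmetric_algebra k H) K\<^sub>H \<iota>"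
    and "is_t_inverse k H K\<^sub>H \<iota> tinv"
    and "\<forall>x\<in>S_Theta k H K\<^sub>H \<iota> tinv.
           integral_over K\<^sub>H (carrier (B_alg k H \<alpha> K\<^sub>H \<iota> tinv)) x"
    and "field_extension k K i"
    and "lam \<in> ring_hom (B_alg k H \<alpha> K\<^sub>H \<iota> tinv) K"
    and "\<forall>c\<in>carrier k. lam (t_scalar k H \<iota> c) = i c"
  shows "is_form k H \<alpha> K i
           (base_change k H (B_alg k H \<alpha> K\<^sub>H \<iota> tinv) (t_scalar k H \<iota>) K lam
             (A_alg k H \<alpha> K\<^sub>H \<iota> tinv))"
proof -
  interpret k: field k by fact
  interpret K: field K using assms(7) by (simp add: field_extension_def)
  interpret Q: field K\<^sub>H using assms(4) by (simp add: fraction_field_def)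
  have i: "i \<in> ring_hom k K" using assms(7) by (simp add: field_extension_def)
  have hopf: "hopf k H" by (intro hopf.intro k.cring_axioms assms(2))
  have alg: "algebra_over k H" by (intro algebra_over.intro hopf.assoc_H[OF hopf])
  have one_H: "\<one>\<^bsub>H\<^esub> \<in> carrier H"
    using algebra_over.ring_A[OF alg] by (rule ring.ring_simprules)
  have U: "universal_cocycle k H K\<^sub>H \<iota> tinv"
    using hopf assms(4,5) Q.cring_axioms Q.ring_axioms k.cring_axioms
      module.axioms(2)[OF algebra_over.module_axioms[OF alg]] module.smult_closed[OF algebra_over.module_axioms[OF alg]]
    by (auto simp: universal_cocycle_def universal_cocycle_axioms_def symmetric_hom_def
        symmetric_hom_axioms_def symmetric_def symmetric_axioms_def fraction_field_def)
  have ts: "t_scalar k H \<iota> \<in> ring_hom k K\<^sub>H"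
    using U by (intro symmetric_hom.ts_hom) (simp add: universal_cocycle_def)
  have kk: "hopf_values k H k id"
    using hopf k.cring_axioms by (simp add: hopf_values_def hopf_values_axioms_def ring_hom_def)
  \<comment> \<open>The same choice as inside \<open>B_alg\<close>, so that the base algebra unfolds
    with this inverse.\<close>
  define \<alpha>' where "\<alpha>' = (SOME \<alpha>'. conv2_inverse k H k id \<alpha> \<alpha>')"
  have \<alpha>: "two_cocycle k H k id \<alpha>" "normalized H id \<alpha>" and \<alpha>': "conv2_inverse k H k id \<alpha> \<alpha>'"
    using assms(3) someI_ex[of "conv2_inverse k H k id \<alpha>"]
    by (auto simp: normalized_invertible_cocycle_def \<alpha>'_def)
  have bil: "bilinear_map k H H (as_algebra id k) \<alpha>" "bilinear_map k H H (as_algebra id k) \<alpha>'"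
    using \<alpha> \<alpha>' by (auto simp: two_cocycle_def conv2_inverse_def)
  have one: "\<alpha> \<one>\<^bsub>H\<^esub> \<one>\<^bsub>H\<^esub> = \<one>\<^bsub>k\<^esub>"
    using \<alpha>(2) by (simp add: normalized_def one_H hopf.counit_simps(4)[OF hopf])
  have one': "\<alpha>' \<one>\<^bsub>H\<^esub> \<one>\<^bsub>H\<^esub> = \<one>\<^bsub>k\<^esub>"
    by (rule hopf_values.inverse_one[OF kk bil(1) \<alpha>' one])
  let ?ts = "t_scalar k H \<iota>" and ?tg = "t_gen k H \<iota>"
    and ?\<sigma> = "sigma k H \<alpha> K\<^sub>H \<iota> tinv" and ?\<sigma>' = "sigma_inv k H \<alpha>' K\<^sub>H \<iota> tinv"
  define Y where "Y = ?ts ` carrier k \<union> ((\<lambda>(x, y). ?\<sigma> x y) ` (carrier H \<times> carrier H) \<union>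
      (\<lambda>(x, y). ?\<sigma>' x y) ` (carrier H \<times> carrier H))"
  define Bs where "Bs = generate_ring K\<^sub>H Y"
  let ?B = "K\<^sub>H\<lparr>carrier := Bs\<rparr>"
  have BA: "B_alg k H \<alpha> K\<^sub>H \<iota> tinv = ?B"
    by (simp add: B_alg_def Let_def Bs_def Y_def generated_subalgebra_def \<alpha>'_def)
  note \<sigma>_bil = universal_cocycle.sigma_bilinear(1)[OF U bil(1)] universal_cocycle.sigma_bilinear(2)[OF U bil(2)]
  have \<sigma>Q: "?\<sigma> x y \<in> carrier K\<^sub>H" "?\<sigma>' x y \<in> carrier K\<^sub>H" if "x \<in> carrier H" "y \<in> carrier H" for x y
    using \<sigma>_bil that by (auto simp: bilinear_map_def linear_map_def as_algebra_def)
  have "Y \<subseteq> carrier K\<^sub>H" using \<sigma>Q ts by (auto simp: Y_def ring_hom_def)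
  then have Bs: "subring Bs K\<^sub>H" unfolding Bs_def by (rule Q.generate_ring_is_subring)
  have YB: "Y \<subseteq> Bs" by (auto simp: Bs_def intro: generate_ring.incl)
  have \<sigma>B: "?\<sigma> x y \<in> Bs" "?\<sigma>' x y \<in> Bs" if "x \<in> carrier H" "y \<in> carrier H" for x y
    using YB that by (auto simp: Y_def)
  have tsB: "?ts c \<in> Bs" if "c \<in> carrier k" for c using YB that by (auto simp: Y_def)
  have lam: "lam \<in> ring_hom ?B K" using assms(8) by (simp add: BA)
  obtain L :: "('l \<times> 'h) list ring" and j D Lam where L: "field L" "j \<in> ring_hom K L"
    and D: "subring D K\<^sub>H" "Bs \<subseteq> D" and Lam: "Lam \<in> ring_hom (K\<^sub>H\<lparr>carrier := D\<rparr>) L"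
    and Lam_B: "\<And>b. b \<in> Bs \<Longrightarrow> Lam b = j (lam b)"
    and int: "\<And>x. x \<in> carrier K\<^sub>H \<Longrightarrow> integral_over K\<^sub>H Bs x \<Longrightarrow> x \<in> D"
    using integral_extension[OF K.field_axioms Q.cring_axioms Bs lam, where ?'h = 'h] by blast
  let ?D = "K\<^sub>H\<lparr>carrier := D\<rparr>"
  interpret L: field L by (rule L(1))
  have inj: "inj_on j (carrier K)" by (rule non_trivial_field_hom_is_inj[OF L(2) K.field_axioms L(1)])
  have tQ: "?tg h \<in> carrier K\<^sub>H" "tinv h \<in> carrier K\<^sub>H" if "h \<in> carrier H" for h
    using that linear_mapD(1)[OF universal_cocycle.tinv_linear[OF U]]
      linear_mapD(1)[OF symmetric_hom.tg_linear, of k H K\<^sub>H \<iota>] U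
    by (simp_all add: as_algebra_def universal_cocycle_def)
  \<comment> \<open>These are the generators of \<open>S_Theta\<close>; being integral over the base
    algebra, they belong to the domain \<open>D\<close> of the extension.\<close>
  have tD: "?tg h \<in> D" "tinv h \<in> D" if "h \<in> carrier H" for h
    using that assms(6) by (auto intro!: int tQ generate_ring.incl
        simp: BA S_Theta_def generated_subalgebra_def)
  have hom_sub: "?ts \<in> ring_hom k (K\<^sub>H\<lparr>carrier := E\<rparr>)" if "Bs \<subseteq> E" for E
    using ts tsB that by (auto simp: ring_hom_def)
  have cr: "cring (K\<^sub>H\<lparr>carrier := E\<rparr>)" if "subring E K\<^sub>H" for E
    using Q.subcring_iff[OF subringE(1)[OF that]] Q.subcringI'[OF that] by simp
  have ji: "j \<circ> i \<in> ring_hom k L" by (rule ring_hom_trans[OF i L(2)])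
  have vals: "hopf_values k H K i" "hopf_values k H L (j \<circ> i)" "hopf_values k H K\<^sub>H ?ts"
    "hopf_values k H ?D ?ts" "hopf_values k H ?B ?ts"
    using i ji ts hom_sub D(2) cr[OF D(1)] cr[OF Bs] hopf K.cring_axioms L.cring_axioms Q.cring_axioms
    by (simp_all add: hopf_values_def hopf_values_axioms_def)
  have DQ: "x \<in> carrier K\<^sub>H" if "x \<in> D" for x using subringE(1)[OF D(1)] that by auto
  have homs: "hopf_values_hom k H ?D ?ts L (j \<circ> i) Lam" "hopf_values_hom k H ?D ?ts K\<^sub>H ?ts id"
    "hopf_values_hom k H K i L (j \<circ> i) j"
    using vals Lam L(2) assms(9) DQ
    by (auto simp: hopf_values_hom_def hopf_values_hom_axioms_def Lam_B tsB ring_hom_def)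
  note V = universal_cocycle.t_pair[OF U]
  let ?T = "restrict ?tg (carrier H)" and ?T' = "restrict tinv (carrier H)"
  have tr: "gauge_transport k H ?D ?ts L (j \<circ> i) Lam K\<^sub>H ?ts id ?T ?T' ?tg tinv"
    using homs(1,2) V tD by (auto simp: gauge_transport_def gauge_transport_axioms_def)
  have bilD: "bilinear_map k H H (as_algebra ?ts ?D) (\<lambda>x y. ?ts (a x y))"
    if "bilinear_map k H H (as_algebra id k) a" for a
    by (rule bilinear_map_ring_hom[OF that hom_sub[OF D(2)]]) simp_all
  \<comment> \<open>Scalars lie in the base algebra, so on them \<open>Lam\<close> is
    \<open>j\<close> after \<open>lam\<close>, and \<open>lam\<close> restricts to \<open>i\<close>.
    Truncation then makes the two functions equal everywhere.\<close>
  have ext: "hopf_values.ext2 H (\<lambda>x y. Lam (?ts (a x y))) = hopf_values.ext2 H (\<lambda>x y. (j \<circ> i) (a x y))"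
    if "bilinear_map k H H (as_algebra id k) a" for a
    unfolding hopf_values.ext2_def[OF vals(2)]
    by (intro restrict_ext) (simp add: hopf_values.bilinearD(1)[OF kk that] assms(9) Lam_B tsB)
  \<comment> \<open>By \<open>sigma_one\<close>, \<open>t\<close> at 1 and its inverse lie in the
    base algebra, so \<open>lam\<close> itself is defined on them and the normalizing constants
    belong to \<open>K\<close>.\<close>
  define u where "u = lam (?tg \<one>\<^bsub>H\<^esub>)"
  define v where "v = lam (tinv \<one>\<^bsub>H\<^esub>)"
  note s1 = universal_cocycle.sigma_one(1)[OF U bil(1) one] universal_cocycle.sigma_one(2)[OF U bil(2) one']
  have tB: "?tg \<one>\<^bsub>H\<^esub> \<in> Bs" "tinv \<one>\<^bsub>H\<^esub> \<in> Bs"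
    using \<sigma>B[OF one_H one_H] by (simp_all add: s1)
  have lamK: "lam b \<in> carrier K" if "b \<in> Bs" for b using lam that by (auto simp: ring_hom_def)
  have uv: "u \<in> carrier K" "v \<in> carrier K" "u \<otimes>\<^bsub>K\<^esub> v = \<one>\<^bsub>K\<^esub>"
    using tB lamK ring_hom_mult[OF lam, of "?tg \<one>\<^bsub>H\<^esub>" "tinv \<one>\<^bsub>H\<^esub>"] ring_hom_one[OF lam]
    by (simp_all add: u_def v_def universal_cocycle.t_one[OF U])
  let ?S = "\<lambda>x y. lam (?\<sigma> x y)" and ?S' = "\<lambda>x y. lam (?\<sigma>' x y)"
  define P where "P = hopf.conv_map H Lam ?T"
  define P' where "P' = hopf.conv_map H Lam ?T'"
  note sg = universal_cocycle.sigma_gauge(2)[OF U bil(1)] universal_cocycle.sigma_gauge(3)[OF U bil(2)]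
  \<comment> \<open>On the base algebra \<open>Lam\<close> is \<open>j\<close> after
    \<open>lam\<close>; the transported formula thus exhibits the pushed cocycle as a gauge
    transform of \<open>\<alpha>\<close> over \<open>L\<close>.\<close>
  have jS: "j (?S x y) = hopf_values.gauge k H L (j \<circ> i) P (hopf_values.ext2 H (\<lambda>x y. (j \<circ> i) (\<alpha> x y))) P' x y"
    "j (?S' x y) = hopf_values.gauge_inv k H L (j \<circ> i) P (hopf_values.ext2 H (\<lambda>x y. (j \<circ> i) (\<alpha>' x y))) P' x y"
    if xy: "x \<in> carrier H" "y \<in> carrier H" for x y
    using gauge_transport.transport_gauge(1)[OF tr bilD[OF bil(1)] xy, of "?\<sigma> x y"]
      gauge_transport.transport_gauge(2)[OF tr bilD[OF bil(2)] xy, of "?\<sigma>' x y"] \<sigma>B[OF xy] D(2)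
    unfolding ext[OF bil(1)] ext[OF bil(2)] P_def P'_def
    by (auto simp: Lam_B sg[OF xy])
  have P1: "P \<one>\<^bsub>H\<^esub> = j u" using tB by (simp add: P_def hopf.conv_map_apply[OF hopf] one_H u_def Lam_B)
  have "gauge_pair k H L (j \<circ> i) P P'"
    using gauge_transport.transport_pair[OF tr] by (simp add: P_def P'_def)
  then have gd: "gauge_descent k H K i L (j \<circ> i) j P P' \<alpha> \<alpha>' ?S ?S' u v"
    unfolding gauge_descent_def gauge_descent_axioms_def
    using homs(3) inj \<alpha> \<alpha>' lamK[OF \<sigma>B(1)] lamK[OF \<sigma>B(2)] uv jS P1 by blast
  define \<beta> where "\<beta> = gauge_descent.\<beta> K ?S v"
  obtain f where f: "comod_alg_iso k H K i (twisted k H K i ?S v) (twisted k H K i \<beta> \<one>\<^bsub>K\<^esub>) f"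
    using gauge_descent.\<sigma>_\<beta>_iso[OF gd] by (auto simp: \<beta>_def)
  have bB: "bilinear_map k H H (as_algebra ?ts ?B) ?\<sigma>"
    by (rule bilinear_map_restrict[OF \<sigma>_bil(1) \<sigma>B(1)])
  have bK: "bilinear_map k H H (as_algebra i K) ?S"
    by (rule bilinear_map_ring_hom[OF bB lam]) (simp_all add: tsB assms(9))
  \<comment> \<open>Base change along \<open>lam\<close> turns the universal algebra into the
    twisted algebra of \<open>?S\<close>; its unit involves \<open>v\<close> because the universal
    algebra has unit \<open>tinv 1 \<otimes> 1\<close>.\<close>
  have bc: "hopf_base_change k H ?B ?ts K i lam ?\<sigma> (tinv \<one>\<^bsub>H\<^esub>) (hopf_values.ext2 H ?\<sigma>) ?S v
      (hopf_values.ext2 H ?S)"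
    using vals(1,5) lam hopf_values.ext2_closed[OF vals(5) bB] hopf_values.ext2_closed[OF vals(1) bK] assms(9) tB
    by (simp add: hopf_base_change_def hopf_base_change_axioms_def v_def
        hopf_values.ext2_apply[OF vals(5)] hopf_values.ext2_apply[OF vals(1)])
  have "\<exists>g. comod_alg_iso k H K i (base_change k H ?B ?ts K lam (twisted k H ?B ?ts ?\<sigma> (tinv \<one>\<^bsub>H\<^esub>)))
      (twisted k H K i \<beta> \<one>\<^bsub>K\<^esub>) g"
    by (rule exI, rule hopf.comod_alg_iso_trans[OF hopf hopf_base_change.BC_ok[OF bc] hopf_values.twisted_ok[OF vals(1)]
          hopf_values.twisted_ok[OF vals(1)] _ _ hopf_base_change.base_change_iso[OF bc] f])
      (use i assms(9) in \<open>auto simp: ring_hom_def\<close>)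
  moreover have "twisted_is_form k H \<alpha> K i \<beta>"
    unfolding twisted_is_form_def field_extension_def \<beta>_def
    using gauge_descent.\<beta>_\<alpha>_iso[OF gd] L K.field_axioms by blast
  moreover have "normalized_invertible_cocycle k H K i \<beta>"
    unfolding \<beta>_def by (rule gauge_descent.\<beta>_normalized_invertible_cocycle[OF gd])
  ultimately show ?thesis
    unfolding is_form_def A_alg_def BA by blast
qed

end
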